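(* Let $0<q<1$, $-1<s<0$, $n\ge k\ge0$, and $\theta=(\theta_1\ge\dots\ge\theta_k\ge0)\in\mathrm{Sign}^+_k$. Consider the formula $$\mathbb E_{\mathbf u}\big(\mathcal Q_{\theta+1^k}\big)=(-1)^kq^{\frac{k(k+1)}2}(-s)^{|\theta|}\mathsf c(\theta)\oint\frac{dw_1}{2\pi\mathbf i}\cdots\oint\frac{dw_k}{2\pi\mathbf i}\prod_{1\le\alpha<\beta\le k}\frac{w_\alpha-w_\beta}{w_\alpha-qw_\beta}\prod_{i=1}^k\left(\frac1{w_i-s}\left(\frac{1-sw_i}{w_i-s}\right)^{\theta_i}\prod_{j=1}^n\frac{1-qu_jw_i}{1-u_jw_i}\right).\qquad( * )$$ It holds in each of the following three cases. 1. The complex numbers $u_1,\dots,u_n$ satisfy $\left|s\frac{u_j-s}{1-su_j}\right|<1$ for all $j$, the points $u_j^{-1}$ lie inside the contour $\gamma^-_1[s^{-1}]$, and the integration in $( * )$ is over $w_j\in\gamma^-_j[s^{-1}]$, $j=1,\dots,k$. 2. $u_i>0$ for all $i$, $u_i\neq qu_j$ for all $i,j$, and all the integration contours in $( * )$ are the same, $w_j\in\gamma[\bar{\mathbf u}]$. In this case the formula can be symmetrized: $$\mathbb E_{\mathbf u}\big(\mathcal Q_{\theta+1^k}\big)=\frac{(-1)^kq^{\frac{k(k+1)}2}}{(1-q)^kk!}\oint_{\gamma[\bar{\mathbf u}]}\frac{dw_1}{2\pi\mathbf i}\cdots\oint_{\gamma[\bar{\mathbf u}]}\frac{dw_k}{2\pi\mathbf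 i}\prod_{1\le\alpha\ne\beta\le k}\frac{w_\alpha-w_\beta}{w_\alpha-qw_\beta}\,(-s)^{|\theta|}\frac{\mathsf c(\theta)\mathsf F_\theta(w_1^{-1},\dots,w_k^{-1})}{w_1\cdots w_k}\prod_{i=1}^k\prod_{j=1}^n\frac{1-qu_jw_i}{1-u_jw_i}.$$ 3. The parameters are $\mathbf u=(u_1,qu_1,\dots,q^{J-1}u_1,u_2,qu_2,\dots,q^{J-1}u_2,\dots,u_{n'},qu_{n'},\dots,q^{J-1}u_{n'})$, where $n=Jn'$ with $J\in\mathbb Z_{\ge1}$, $u_i>0$, and $q\cdot\max_{1\le i\le n'}u_i<\min_{1\le i\le n'}u_i$, and the integration in $( * )$ is over $w_j\in\gamma^-_j[\bar{\mathbf u}]$. In this case the double product over all parameters in the integrand takes the form $\prod_{i=1}^k\prod_{j=1}^{n'}\frac{1-q^Ju_jw_i}{1-u_jw_i}$.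
   Context: $(z;q)_m=\prod_{i=0}^{m-1}(1-zq^i)$. $\mathrm{Sign}^+_N$ is the set of sequences of integers $\lambda=(\lambda_1\ge\dots\ge\lambda_N\ge0)$; $|\lambda|=\sum\lambda_i$; $\lambda\pm1^N$ denotes $(\lambda_1\pm1,\dots,\lambda_N\pm1)$; $\lambda=0^{\ell_0}1^{\ell_1}2^{\ell_2}\cdots$ means $\lambda$ has $\ell_j$ parts equal to $j$. Set $\mathsf c(\lambda)=\prod_{j\ge0}\frac{(s^2;q)_{\ell_j}}{(q;q)_{\ell_j}}$. Vertex weights: for $g\in\mathbb Z_{\ge0}$, $w_u(g,0;g,0)=\frac{1-sq^gu}{1-su}$, $w_u(g+1,0;g,1)=\frac{(1-s^2q^g)u}{1-su}$, $w_u(g,1;g,1)=\frac{u-sq^g}{1-su}$, $w_u(g,1;g+1,0)=\frac{1-q^{g+1}}{1-su}$, all others $0$; in $w_u(i_1,j_1;i_2,j_2)$ the numbers $i_1,j_1,i_2,j_2$ are the numbers of paths entering a vertex from below, entering from the left, leaving upward, leaving to the right. For $\mu\in\mathrm{Sign}^+_N$, $\mathsf F_\mu(u_1,\dots,u_N)$ is the sum, over all arrow configurations of $N$ up-right paths in $\mathbb Z_{\ge0}\times\{1,\dots,N\}$ that start with horizontal edges $(-1,y)\to(0,y)$, $y=1,\dots,N$, and end with vertical edges $(\mu_i,N)\to(\mu_i,N+1)$, $i=1,\dots,N$, of the product over all vertices $(x,y)$ of the weights $w_{u_y}$. It is a symmetric rational function; $\mathsf F_\varnothing=1$. Measure and expectation: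 for $\mathbf u=(u_1,\dots,u_n)$ and $\nu\in\mathrm{Sign}^+_n$ put $\mathscr M_{\mathbf u}(\nu)=\mathbf 1_{\nu_n\ge1}(-s)^{|\nu|-n}\mathsf c(\nu-1^n)\mathsf F_{\nu-1^n}(u_1,\dots,u_n)$ (possibly signed or complex weights). For $u_i\ge 0$ this is the law at time $n$ of the stochastic higher spin six vertex dynamics with parameters $u_1,\dots,u_n$ started from the empty configuration. $\mathbb E_{\mathbf u}f=\sum_{\nu\in\mathrm{Sign}^+_n}\mathscr M_{\mathbf u}(\nu)f(\nu)$. Observable: for $\eta\in\mathrm{Sign}^+_k$ and $\nu\in\mathrm{Sign}^+_n$, $\mathcal Q_\eta(\nu)=\sum q^{i_1+\dots+i_k}$, the sum over all $\{i_1<\dots<i_k\}\subseteq\{1,\dots,n\}$ with $\nu_{i_1}=\eta_1,\dots,\nu_{i_k}=\eta_k$. Contours (all positively oriented and closed; $R\gamma$ is the image of $\gamma$ under multiplication by $R$): (a) $\gamma^-_1[s^{-1}],\dots,\gamma^-_k[s^{-1}]$: each encircles $s^{-1}$ and leaves $s$ outside; for $\beta>\alpha$ the interior of $\gamma^-_\beta[s^{-1}]$ contains $q^{-1}\gamma^-_\alpha[s^{-1}]$; $\gamma^-_1[s^{-1}]$ is sufficiently small so that it does not intersect $q^{-1}\gamma^-_1[s^{-1}]$. (b) $\gamma[\bar{\mathbf u}]$: a union of sufficiently small circles around all the points $u_i^{-1}$ such that its interior does not intersect $q^{\pm1}\gamma[\bar{\mathbf u}]$ and $s$ is outside. (c)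 $\gamma^-_j[\bar{\mathbf u}]$ (case 3), $j=1,\dots,k$: as in (a), but encircling the points $u_1^{-1},\dots,u_{n'}^{-1}$ instead of $s^{-1}$ (each leaves $s$ outside; for $\beta>\alpha$ the interior of $\gamma^-_\beta[\bar{\mathbf u}]$ contains $q^{-1}\gamma^-_\alpha[\bar{\mathbf u}]$; $\gamma^-_1[\bar{\mathbf u}]$ is sufficiently small so that it does not intersect $q^{-1}\gamma^-_1[\bar{\mathbf u}]$).
   Formalization: In case 1 the points u_j^{-1} are required to lie inside every contour γ_1,…,γ_k, not only γ_1; otherwise, for n=k=2, a γ_2 meeting all listed conditions but with a slit excluding u_1^{-1} loses a nonzero residue and ( * ) fails. *)

theory Defs
  imports "HOL-Complex_Analysis.Complex_Analysis"
begin

text \<open>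
  Tuples (signatures, parameters, integration variables, contours) are lists, so the entry
  with index \<open>i\<close> of the usual one-based notation is \<open>xs ! (i - 1)\<close>.
\<close>

definition signatures :: "nat \<Rightarrow> nat list set" where
  "signatures N = {l. length l = N \<and> sorted_wrt (\<ge>) l}"

definition qpoch :: "real \<Rightarrow> real \<Rightarrow> nat \<Rightarrow> real" where
  "qpoch z q m = (\<Prod>i<m. 1 - z * q ^ i)"

text \<open>Values \<open>j\<close> that are not parts of \<open>l\<close> have multiplicity \<open>0\<close> and contribute the factor \<open>1\<close>.\<close>
definition c_factor :: "real \<Rightarrow> real \<Rightarrow> nat list \<Rightarrow> real" where
  "c_factor q s l = (\<Prod>j\<in>set l. qpoch (s\<^sup>2) q (count_list l j) / qpoch q q (count_list l j))"

text \<open>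
  The weight of a vertex with \<open>i1\<close> paths entering from below, \<open>j1\<close> entering from the left,
  \<open>i2\<close> leaving upward and \<open>j2\<close> leaving to the right.
\<close>
definition vertex_weight :: "real \<Rightarrow> real \<Rightarrow> complex \<Rightarrow> nat \<Rightarrow> nat \<Rightarrow> nat \<Rightarrow> nat \<Rightarrow> complex" where
  "vertex_weight q s u i1 j1 i2 j2 =
    (if j1 = 0 \<and> j2 = 0 \<and> i1 = i2 then (1 - s * q ^ i1 * u) / (1 - s * u)
     else if j1 = 0 \<and> j2 = 1 \<and> i1 = i2 + 1 then (1 - s\<^sup>2 * q ^ i2) * u / (1 - s * u)
     else if j1 = 1 \<and> j2 = 1 \<and> i1 = i2 then (u - s * q ^ i1) / (1 - s * u)
     else if j1 = 1 \<and> j2 = 0 \<and> i2 = i1 + 1 then (1 - q ^ i2) / (1 - s * u)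
     else 0)"

text \<open>
  A configuration is given by its edge occupation numbers: \<open>v x y\<close> arrows on the vertical edge
  from \<open>(x, y)\<close> to \<open>(x, y + 1)\<close> and \<open>h x y\<close> arrows on the horizontal edge from \<open>(x - 1, y)\<close> to
  \<open>(x, y)\<close>. Occupation numbers without a meaning are set to \<open>0\<close>. Paths cannot escape to
  the right: summing the conservation law over the columns up to the largest part of \<open>\<mu>\<close> shows
  that all \<open>N\<close> paths have turned up by then, so that all edges further right are empty.
\<close>
definition arrow_configs ::
    "nat list \<Rightarrow> ((nat \<Rightarrow> nat \<Rightarrow> nat) \<times> (nat \<Rightarrow> nat \<Rightarrow> nat)) set" where
  "arrow_configs \<mu> = {(v, h).
     (\<forall>y\<in>{1..length \<mu>}. h 0 y = 1) \<and>
     (\<forall>x. v x 0 = 0) \<and>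
     (\<forall>x. v x (length \<mu>) = count_list \<mu> x) \<and>
     (\<forall>x. \<forall>y\<in>{1..length \<mu>}. v x (y - 1) + h x y = v x y + h (x + 1) y) \<and>
     (\<forall>x y. y > length \<mu> \<longrightarrow> v x y = 0) \<and>
     (\<forall>x y. y \<notin> {1..length \<mu>} \<longrightarrow> h x y = 0)}"

text \<open>
  Vertices to the right of the column of the largest part \<open>hd \<mu>\<close> are empty and have weight \<open>1\<close>,
  so the product over all vertices stops at that column.
\<close>
definition F_fun :: "real \<Rightarrow> real \<Rightarrow> nat list \<Rightarrow> complex list \<Rightarrow> complex" where
  "F_fun q s \<mu> us =
     (\<Sum>(v, h)\<in>arrow_configs \<mu>. \<Prod>y\<in>{1..length \<mu>}. \<Prod>x\<le>hd \<mu>.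
        vertex_weight q s (us ! (y - 1)) (v x (y - 1)) (h x y) (v x y) (h (x + 1) y))"

definition M_weight :: "real \<Rightarrow> real \<Rightarrow> complex list \<Rightarrow> nat list \<Rightarrow> complex" where
  "M_weight q s us \<nu> =
     (if \<forall>p\<in>set \<nu>. p \<ge> 1
      then (- s) ^ (sum_list \<nu> - length \<nu>) * c_factor q s (map (\<lambda>p. p - 1) \<nu>)
             * F_fun q s (map (\<lambda>p. p - 1) \<nu>) us
      else 0)"

text \<open>
  The expectation of \<open>f\<close> exists and equals \<open>E\<close>. Unconditional summability of the
  defining series is part of the assertion.
\<close>
definition has_expectation ::
    "real \<Rightarrow> real \<Rightarrow> complex list \<Rightarrow> (nat list \<Rightarrow> complex) \<Rightarrow> complex \<Rightarrow> bool" where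
  "has_expectation q s us f E \<longleftrightarrow>
     ((\<lambda>\<nu>. M_weight q s us \<nu> * f \<nu>) has_sum E) (signatures (length us))"

definition Q_obs :: "real \<Rightarrow> nat list \<Rightarrow> nat list \<Rightarrow> real" where
  "Q_obs q \<eta> \<nu> =
     (\<Sum>I | I \<subseteq> {1..length \<nu>} \<and> map (\<lambda>i. \<nu> ! (i - 1)) (sorted_list_of_set I) = \<eta>. q ^ \<Sum>I)"

text \<open>
  A contour is a finite set of closed curves. The contours of the iterated integral are listed
  from the outermost variable to the innermost one.
\<close>
definition oint :: "(real \<Rightarrow> complex) set \<Rightarrow> (complex \<Rightarrow> complex) \<Rightarrow> complex" where
  "oint C f = (\<Sum>g\<in>C. contour_integral g f) / (2 * pi * \<i>)"

fun iter_oint :: "(real \<Rightarrow> complex) set list \<Rightarrow> (complex list \<Rightarrow> complex) \<Rightarrow> complex" where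
  "iter_oint [] f = f []"
| "iter_oint (C # Cs) f = oint C (\<lambda>w. iter_oint Cs (\<lambda>ws. f (w # ws)))"

definition positive_contour :: "(real \<Rightarrow> complex) \<Rightarrow> bool" where
  "positive_contour g \<longleftrightarrow> valid_path g \<and> simple_path g \<and> pathfinish g = pathstart g \<and>
     (\<forall>z\<in>inside (path_image g). winding_number g z = 1)"

text \<open>Positively oriented contours around the points of \<open>P\<close>, nested up to the factor \<open>1 / q\<close>.\<close>
definition nested_contours ::
    "real \<Rightarrow> real \<Rightarrow> complex set \<Rightarrow> (real \<Rightarrow> complex) list \<Rightarrow> bool" where
  "nested_contours q s P \<gamma> \<longleftrightarrow>
     (\<forall>g\<in>set \<gamma>. positive_contour g \<and> P \<subseteq> inside (path_image g) \<and>
        complex_of_real s \<in> outside (path_image g)) \<and>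
     (\<forall>\<beta><length \<gamma>. \<forall>\<alpha><\<beta>. (\<lambda>w. w / q) ` path_image (\<gamma> ! \<alpha>) \<subseteq> inside (path_image (\<gamma> ! \<beta>))) \<and>
     (\<gamma> \<noteq> [] \<longrightarrow> path_image (\<gamma> ! 0) \<inter> (\<lambda>w. w / q) ` path_image (\<gamma> ! 0) = {})"

text \<open>
  Disjoint circles around the points of \<open>P\<close>, with radii \<open>r\<close>. The discs are taken closed because
  a circle touching the image of another one under multiplication by \<open>q\<close> or \<open>1 / q\<close> would put a
  pole of the integrand on the contours.
\<close>
definition small_radii :: "real \<Rightarrow> real \<Rightarrow> complex set \<Rightarrow> (complex \<Rightarrow> real) \<Rightarrow> bool" where
  "small_radii q s P r \<longleftrightarrow>
     (\<forall>a\<in>P. r a > 0 \<and> complex_of_real s \<notin> cball a (r a)) \<and>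
     (\<forall>a\<in>P. \<forall>b\<in>P. a \<noteq> b \<longrightarrow> cball a (r a) \<inter> cball b (r b) = {}) \<and>
     (\<forall>a\<in>P. \<forall>b\<in>P. cball a (r a) \<inter> (\<lambda>w. q * w) ` sphere b (r b) = {} \<and>
                    cball a (r a) \<inter> (\<lambda>w. w / q) ` sphere b (r b) = {})"

definition circles :: "complex set \<Rightarrow> (complex \<Rightarrow> real) \<Rightarrow> (real \<Rightarrow> complex) set" where
  "circles P r = (\<lambda>a. circlepath a (r a)) ` P"

definition u_product :: "real \<Rightarrow> complex list \<Rightarrow> complex \<Rightarrow> complex" where
  "u_product q us w = (\<Prod>u\<leftarrow>us. (1 - q * u * w) / (1 - u * w))"

text \<open>
  The two formulas are stated for an arbitrary function \<open>\<phi>\<close> in place of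
  \<open>w \<mapsto> \<Prod>\<^sub>j (1 - q u\<^sub>j w) / (1 - u\<^sub>j w)\<close>, the only place where the parameters enter.
\<close>
definition moment_formula ::
    "real \<Rightarrow> real \<Rightarrow> nat list \<Rightarrow> (real \<Rightarrow> complex) set list \<Rightarrow> (complex \<Rightarrow> complex) \<Rightarrow> complex" where
  "moment_formula q s \<theta> Cs \<phi> = (let k = length \<theta> in
     (- 1) ^ k * q ^ (k * (k + 1) div 2) * (- s) ^ sum_list \<theta> * c_factor q s \<theta> *
     iter_oint Cs (\<lambda>w.
       (\<Prod>\<beta><k. \<Prod>\<alpha><\<beta>. (w ! \<alpha> - w ! \<beta>) / (w ! \<alpha> - q * w ! \<beta>)) *
       (\<Prod>i<k. 1 / (w ! i - s) * ((1 - s * w ! i) / (w ! i - s)) ^ (\<theta> ! i) * \<phi> (w ! i))))"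

definition symmetrized_moment_formula ::
    "real \<Rightarrow> real \<Rightarrow> nat list \<Rightarrow> (real \<Rightarrow> complex) set list \<Rightarrow> (complex \<Rightarrow> complex) \<Rightarrow> complex" where
  "symmetrized_moment_formula q s \<theta> Cs \<phi> = (let k = length \<theta> in
     (- 1) ^ k * q ^ (k * (k + 1) div 2) / ((1 - q) ^ k * fact k) *
     iter_oint Cs (\<lambda>w.
       (\<Prod>\<alpha><k. \<Prod>\<beta>\<in>{..<k} - {\<alpha>}. (w ! \<alpha> - w ! \<beta>) / (w ! \<alpha> - q * w ! \<beta>)) *
       ((- s) ^ sum_list \<theta> * (c_factor q s \<theta> * F_fun q s \<theta> (map inverse w)) / (\<Prod>i<k. w ! i)) *
       (\<Prod>i<k. \<phi> (w ! i))))"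

end

theory Submission
  imports Defs
begin

text \<open>
  Both sides of each moment formula are computed in closed form when the parameters are
  pairwise distinct and avoid \<open>0\<close>, \<open>s\<close> and \<open>1 / s\<close>; the general case follows by continuity.

  The closed form is a Bethe sum: for a finite set \<open>U\<close> of parameters, \<open>bethe q s \<theta> U\<close> assigns the
  parts of \<open>\<theta>\<close> to distinct elements of \<open>U\<close>. A part \<open>t\<close> with parameter \<open>u\<close> contributes a one-particle
  factor \<open>(1 - q) / (1 - s u) ((u - s) / (1 - s u))\<^sup>t\<close>, and \<open>u\<close> contributes a cross factor
  \<open>(u - q w) / (u - w)\<close> with every parameter \<open>w\<close> that is not used up by an earlier part. The number
  of parts may be smaller than the number of parameters; this is what makes the sum a common
  language for the partition function, for the moments and for the contour integrals.

  If there are as many parts as parameters, the Bethe sum is the partition function of the paths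
  (\<open>F_fun_eq_bethe\<close>). The paths are built up row by row: the row of a new parameter \<open>u\<close> maps the
  Bethe sum over \<open>V\<close> to the one over \<open>insert u V\<close> (\<open>row_transfer_bethe\<close>). This is proved column by
  column, simultaneously with a formula for a row that no path enters from the left, and each
  column is handled by one of three rational identities that come from partial fractions.

  For the moments (\<open>expectation_bethe\<close>) the number \<open>k\<close> of parts of \<open>\<theta>\<close> is lowered from \<open>n\<close>, where the
  observable singles out one signature. In one step a part \<open>m\<close> is inserted into \<open>\<theta>\<close>, with
  suitable weights, and summed over. The observables then add up to a multiple of the observable
  of \<open>\<theta>\<close> (\<open>sum_insert_q_obs\<close>), and the Bethe sums to a multiple of the Bethe sum of \<open>\<theta>\<close>: truncated
  at \<open>m \<le> C\<close> the sum has a closed form whose remainder is a combination of \<open>C\<close>-th powers of numbers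
  of modulus less than \<open>1\<close> (\<open>insertion_sum_eq\<close>, \<open>insertion_limit\<close>).

  For nested contours the outermost variable is integrated by residues. The residue at \<open>1 / u\<close> turns
  the product over \<open>U\<close> in the remaining integral into the product over \<open>U - {u}\<close>, so the integral
  satisfies the recursion that defines the Bethe sum (\<open>moment_integral_eq_bethe\<close>). In the
  symmetrized integral all variables run over the same contours and the residues are taken
  at lists of poles. Lists with a repetition contribute nothing, because the integrand vanishes
  when two variables agree; for the other lists \<open>F\<close> is again a Bethe sum, over the \<open>k\<close> chosen
  parameters, and \<open>bethe_append\<close> with an empty second list recombines these Bethe sums into the one
  over \<open>U\<close> (\<open>symmetric_integral_eq_bethe\<close>).

  Exceptional parameters are moved along a complex line \<open>u\<^sub>j + t d\<^sub>j\<close> whose points are generic for all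
  small \<open>t \<noteq> 0\<close>. The integrals are holomorphic in \<open>t\<close> (\<open>holomorphic_iter_oint\<close>). For the expectations
  (\<open>expectation_limit\<close>) the exponential bound that the Bethe sum gives on a circle \<open>|t| = \<epsilon>\<close> extends
  to the disc by the maximum modulus principle, so that the series converges uniformly near \<open>t = 0\<close>.
  The three cases differ only in the choice of the directions \<open>d\<^sub>j\<close> and in the reason why the
  contours enclose the poles that are met.
\<close>

section \<open>Partial fractions\<close>

definition cross :: "complex \<Rightarrow> complex \<Rightarrow> complex \<Rightarrow> complex" where
  "cross q v w = (v - q * w) / (v - w)"

lemma partial_fractions:
  fixes P :: "complex poly"
  assumes "finite W" "degree P \<le> card W" "x \<notin> W"
  shows "poly P x / (\<Prod>w\<in>W. x - w) =
     coeff P (card W) + (\<Sum>w\<in>W. poly P w / (\<Prod>v\<in>W - {w}. w - v) / (x - w))"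
proof -
  define M where "M = (\<lambda>A. \<Prod>w\<in>A. [:- w, 1:] :: complex poly)"
  have M_ev: "poly (M A) y = (\<Prod>w\<in>A. y - w)" for A y
    by (simp add: M_def poly_prod)
  have M_deg: "degree (M A) = card A" for A
    unfolding M_def by (subst degree_prod_sum_eq) auto
  have M_lead: "coeff (M A) (card A) = 1" for A
  proof -
    have "lead_coeff (M A) = 1" by (simp add: M_def lead_coeff_prod)
    then show ?thesis by (simp add: M_deg)
  qed
  define c where "c = (\<lambda>w. poly P w / (\<Prod>v\<in>W - {w}. w - v))"
  define R where "R = smult (coeff P (card W)) (M W) + (\<Sum>w\<in>W. smult (c w) (M (W - {w})))"
  have dM: "degree (M (W - {w})) < card W" if "w \<in> W" for w
    unfolding M_deg by (rule psubset_card_mono[OF assms(1)]) (use that in auto)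
  have "P - R = 0"
  proof (cases "W = {}")
    case True
    then have "degree P = 0" using assms by simp
    then obtain a where "P = [:a:]" by (meson degree_eq_zeroE)
    then show ?thesis using True by (simp add: R_def M_def one_pCons)
  next
    case False
    have "degree (P - smult (coeff P (card W)) (M W)) < card W"
    proof -
      have "degree (P - smult (coeff P (card W)) (M W)) \<le> card W"
        by (rule degree_diff_le) (use assms in \<open>auto simp: M_deg intro: order.trans[OF degree_smult_le]\<close>)
      moreover have "coeff (P - smult (coeff P (card W)) (M W)) (card W) = 0"
        by (simp add: M_lead)
      moreover have "0 < card W" using False assms by (simp add: card_gt_0_iff)
      ultimately show ?thesis
        by (metis degree_0 leading_coeff_0_iff le_neq_implies_less)
    qed
    moreover have "degree (\<Sum>w\<in>W. smult (c w) (M (W - {w}))) < card W"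
    proof -
      have "degree (\<Sum>w\<in>W. smult (c w) (M (W - {w}))) \<le> card W - 1"
        by (rule degree_sum_le[OF assms(1)])
          (use dM in \<open>fastforce intro: order.trans[OF degree_smult_le]\<close>)
      moreover have "0 < card W" using False assms by (simp add: card_gt_0_iff)
      ultimately show ?thesis by linarith
    qed
    ultimately have "degree (P - R) < card W"
      unfolding R_def diff_diff_add[symmetric] by (rule degree_diff_less)
    moreover have "poly (P - R) y = 0" if "y \<in> W" for y
    proof -
      have "poly (M W) y = 0" using that assms by (auto simp: M_ev)
      moreover have "poly (M (W - {w})) y = 0" if "w \<in> W - {y}" for w
        using that \<open>y \<in> W\<close> assms by (auto simp: M_ev)
      then have "(\<Sum>w\<in>W - {y}. c w * poly (M (W - {w})) y) = 0" by simp
      moreover have "c y * poly (M (W - {y})) y = poly P y"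
        using assms by (auto simp: c_def M_ev)
      ultimately show ?thesis using that assms
        by (simp add: R_def poly_sum sum.remove[of W y])
    qed
    ultimately show ?thesis
      by (intro poly_eqI_degree[of W]) auto
  qed
  then have "poly P x = poly R x" by simp
  also have "\<dots> / (\<Prod>w\<in>W. x - w) = coeff P (card W) + (\<Sum>w\<in>W. c w * ((\<Prod>v\<in>W - {w}. x - v) / (\<Prod>w\<in>W. x - w)))"
    using assms by (auto simp: R_def poly_sum M_ev add_divide_distrib sum_divide_distrib)
  also have "(\<Sum>w\<in>W. c w * ((\<Prod>v\<in>W - {w}. x - v) / (\<Prod>w\<in>W. x - w))) = (\<Sum>w\<in>W. c w / (x - w))"
  proof (rule sum.cong[OF refl])
    fix w assume w: "w \<in> W"
    have "(\<Prod>w\<in>W. x - w) = (x - w) * (\<Prod>v\<in>W - {w}. x - v)"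
      using assms w by (simp add: prod.remove)
    moreover have "(\<Prod>v\<in>W - {w}. x - v) \<noteq> 0" using assms by auto
    ultimately show "c w * ((\<Prod>v\<in>W - {w}. x - v) / (\<Prod>w\<in>W. x - w)) = c w / (x - w)"
      by (simp add: divide_simps)
  qed
  finally show ?thesis by (simp add: c_def)
qed

lemma cross_prod_eq:
  assumes "finite W"
  shows "(\<Prod>w\<in>W. cross q u w) = (\<Prod>w\<in>W. u - q * w) / (\<Prod>w\<in>W. u - w)"
  by (simp add: cross_def prod_dividef)

lemma cross_prod_eq':
  assumes "finite W"
  shows "(\<Prod>w\<in>W. cross q w u) = (\<Prod>w\<in>W. q * u - w) / (\<Prod>w\<in>W. u - w)"
proof -
  have "cross q w u = (q * u - w) / (u - w)" for w
    unfolding cross_def by (metis minus_diff_eq minus_divide_divide)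
  then show ?thesis by (simp add: prod_dividef)
qed

lemma prod_linear_poly:
  fixes a b :: "complex"
  assumes "finite W"
  shows "degree (\<Prod>w\<in>W. [:a * w, b:]) \<le> card W" (is ?A)
    and "coeff (\<Prod>w\<in>W. [:a * w, b:]) (card W) = b ^ card W" (is ?B)
proof -
  have "degree (\<Prod>w\<in>W. [:a * w, b:]) \<le> card W \<and> coeff (\<Prod>w\<in>W. [:a * w, b:]) (card W) = b ^ card W"
    using assms
  proof (induction W rule: finite_induct)
    case empty then show ?case by simp
  next
    case (insert x F)
    then have "degree ([:a * x, b:] * (\<Prod>w\<in>F. [:a * w, b:])) \<le> 1 + card F"
      by (intro order.trans[OF degree_mult_le] add_mono) auto
    moreover have "coeff (\<Prod>w\<in>F. [:a * w, b:]) (Suc (card F)) = 0"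
      using insert by (intro coeff_eq_0) auto
    ultimately show ?case using insert by simp
  qed
  then show ?A ?B by auto
qed

text \<open>
  This and the next two identities are the partial fraction expansion of a product of cross
  factors in one of its arguments. Here the function is \<open>(x - s) \<Prod> (x - q w) / (x \<Prod> (x - w))\<close>
  with poles in \<open>insert 0 W\<close>, evaluated at \<open>x = u\<close>.
\<close>
lemma cross_expand_left:
  assumes W: "finite W" "0 \<notin> W" "u \<notin> W" and u: "u \<noteq> 0"
  shows "(\<Prod>w\<in>W. cross q u w) * (u - s) =
     u - s * q ^ card W + u * (\<Sum>v\<in>W. (1 - q) * (v - s) / (u - v) * (\<Prod>w\<in>W - {v}. cross q v w))"
proof -
  define P where "P = [:- s, 1:] * (\<Prod>w\<in>W. [:- q * w, 1:])"
  have ev: "poly P x = (x - s) * (\<Prod>w\<in>W. x - q * w)" for x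
    by (simp add: P_def poly_prod left_diff_distrib)
  have "degree P \<le> 1 + card W"
    unfolding P_def by (intro order.trans[OF degree_mult_le] add_mono prod_linear_poly W) auto
  then have deg: "degree P \<le> card (insert 0 W)" using W by simp
  have "coeff P (Suc (card W)) = 1"
    using prod_linear_poly[OF W(1), of "-q" 1]
    by (simp add: P_def coeff_eq_0)
  then have lc: "coeff P (card (insert 0 W)) = 1" using W by simp
  have "poly P u / (\<Prod>w\<in>insert 0 W. u - w) = 1 +
    (\<Sum>w\<in>insert 0 W. poly P w / (\<Prod>v\<in>insert 0 W - {w}. w - v) / (u - w))"
    using partial_fractions[OF _ deg, of u] W u lc by simp
  also have "(\<Sum>w\<in>insert 0 W. poly P w / (\<Prod>v\<in>insert 0 W - {w}. w - v) / (u - w))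
    = poly P 0 / (\<Prod>v\<in>W. 0 - v) / u + (\<Sum>w\<in>W. poly P w / (\<Prod>v\<in>insert 0 W - {w}. w - v) / (u - w))"
    using W by simp
  also have "poly P 0 / (\<Prod>v\<in>W. 0 - v) = - s * q ^ card W"
  proof -
    have "(\<Prod>w\<in>W. 0 - q * w) = (\<Prod>w\<in>W. q * (0 - w))" by simp
    also have "\<dots> = q ^ card W * (\<Prod>w\<in>W. 0 - w)" by (simp only: prod.distrib prod_constant)
    finally have "poly P 0 = - s * (q ^ card W * (\<Prod>w\<in>W. 0 - w))" by (simp add: ev)
    moreover have "(\<Prod>w\<in>W. 0 - w) \<noteq> 0" using W by auto
    ultimately show ?thesis by simp
  qed
  also have "(\<Sum>w\<in>W. poly P w / (\<Prod>v\<in>insert 0 W - {w}. w - v) / (u - w)) =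
     (\<Sum>v\<in>W. (1 - q) * (v - s) / (u - v) * (\<Prod>w\<in>W - {v}. cross q v w))"
  proof (rule sum.cong[OF refl])
    fix v assume v: "v \<in> W"
    have "insert 0 W - {v} = insert 0 (W - {v})" using v W by auto
    then have 1: "(\<Prod>x\<in>insert 0 W - {v}. v - x) = v * (\<Prod>x\<in>W - {v}. v - x)"
      using W by simp
    have 2: "poly P v = (v - s) * ((1 - q) * v * (\<Prod>x\<in>W - {v}. v - q * x))"
      using W v by (simp add: ev prod.remove algebra_simps)
    have "v \<noteq> 0" using v W by auto
    then show "poly P v / (\<Prod>x\<in>insert 0 W - {v}. v - x) / (u - v) =
      (1 - q) * (v - s) / (u - v) * (\<Prod>w\<in>W - {v}. cross q v w)"
      using W unfolding 1 2 by (simp add: cross_prod_eq mult_ac)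
  qed
  finally have *: "poly P u / (\<Prod>w\<in>insert 0 W. u - w) = 1 + (- s * q ^ card W / u +
     (\<Sum>v\<in>W. (1 - q) * (v - s) / (u - v) * (\<Prod>w\<in>W - {v}. cross q v w)))" .
  have ev2: "poly P u / (\<Prod>w\<in>insert 0 W. u - w) = (\<Prod>w\<in>W. cross q u w) * (u - s) / u"
    using W by (simp add: ev cross_prod_eq mult_ac)
  have "(\<Prod>w\<in>W. cross q u w) * (u - s) = u * (1 + (- s * q ^ card W / u +
     (\<Sum>v\<in>W. (1 - q) * (v - s) / (u - v) * (\<Prod>w\<in>W - {v}. cross q v w))))"
    unfolding *[symmetric] ev2 using u by simp
  then show ?thesis using u by (simp add: distrib_left right_diff_distrib)
qed

lemma cross_expand_right:
  assumes W: "finite W" "0 \<notin> W" "u \<notin> W" and u: "u \<noteq> 0"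
  shows "1 - s * q ^ card W * u =
     (\<Prod>w\<in>W. cross q w u) * (1 - s * u) +
     u * (\<Sum>v\<in>W. (1 - q) * (1 - s * v) / (u - v) * (\<Prod>w\<in>W - {v}. cross q w v))"
proof -
  define P where "P = [:1, - s:] * (\<Prod>w\<in>W. [:- 1 * w, q:])"
  have ev: "poly P x = (1 - s * x) * (\<Prod>w\<in>W. q * x - w)" for x
    by (simp add: P_def poly_prod algebra_simps)
  have "degree P \<le> 1 + card W"
    unfolding P_def by (intro order.trans[OF degree_mult_le] add_mono prod_linear_poly W) auto
  then have deg: "degree P \<le> card (insert 0 W)" using W by simp
  have "coeff (\<Prod>w\<in>W. [:- 1 * w, q:]) (Suc (card W)) = 0"
    using prod_linear_poly(1)[OF W(1), of "-1" q] by (intro coeff_eq_0) linarith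
  then have "coeff P (Suc (card W)) = - s * q ^ card W"
    using prod_linear_poly(2)[OF W(1), of "-1" q]
    by (simp add: P_def)
  then have lc: "coeff P (card (insert 0 W)) = - s * q ^ card W" using W by simp
  have "poly P u / (\<Prod>w\<in>insert 0 W. u - w) = - s * q ^ card W +
    (\<Sum>w\<in>insert 0 W. poly P w / (\<Prod>v\<in>insert 0 W - {w}. w - v) / (u - w))"
    using partial_fractions[OF _ deg, of u] W u lc by simp
  also have "(\<Sum>w\<in>insert 0 W. poly P w / (\<Prod>v\<in>insert 0 W - {w}. w - v) / (u - w))
    = poly P 0 / (\<Prod>v\<in>W. 0 - v) / u + (\<Sum>w\<in>W. poly P w / (\<Prod>v\<in>insert 0 W - {w}. w - v) / (u - w))"
    using W by simp
  also have "poly P 0 / (\<Prod>v\<in>W. 0 - v) = 1"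
    using W by (auto simp: ev)
  also have "(\<Sum>w\<in>W. poly P w / (\<Prod>v\<in>insert 0 W - {w}. w - v) / (u - w)) =
     - (\<Sum>v\<in>W. (1 - q) * (1 - s * v) / (u - v) * (\<Prod>w\<in>W - {v}. cross q w v))"
    unfolding sum_negf[symmetric]
  proof (rule sum.cong[OF refl])
    fix v assume v: "v \<in> W"
    have "insert 0 W - {v} = insert 0 (W - {v})" using v W by auto
    then have 1: "(\<Prod>x\<in>insert 0 W - {v}. v - x) = v * (\<Prod>x\<in>W - {v}. v - x)"
      using W by simp
    have 2: "poly P v = v * (- ((1 - s * v) * ((1 - q) * (\<Prod>x\<in>W - {v}. q * v - x))))"
      using W v by (simp add: ev prod.remove algebra_simps)
    have "v \<noteq> 0" using v W by auto
    then show "poly P v / (\<Prod>x\<in>insert 0 W - {v}. v - x) / (u - v) =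
      - ((1 - q) * (1 - s * v) / (u - v) * (\<Prod>w\<in>W - {v}. cross q w v))"
      using W unfolding 1 2 by (simp add: cross_prod_eq' mult_ac)
  qed
  finally have *: "poly P u / (\<Prod>w\<in>insert 0 W. u - w) = - s * q ^ card W + (1 / u +
     - (\<Sum>v\<in>W. (1 - q) * (1 - s * v) / (u - v) * (\<Prod>w\<in>W - {v}. cross q w v)))" .
  have ev2: "poly P u / (\<Prod>w\<in>insert 0 W. u - w) = (\<Prod>w\<in>W. cross q w u) * (1 - s * u) / u"
    using W by (simp add: ev cross_prod_eq' mult_ac)
  have "(\<Prod>w\<in>W. cross q w u) * (1 - s * u) = u * (- s * q ^ card W + (1 / u +
     - (\<Sum>v\<in>W. (1 - q) * (1 - s * v) / (u - v) * (\<Prod>w\<in>W - {v}. cross q w v))))"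
    unfolding *[symmetric] ev2 using u by simp
  then show ?thesis using u by (simp add: distrib_left right_diff_distrib)
qed

lemma cross_sum:
  assumes W: "finite W" "0 \<notin> W"
  shows "(\<Sum>v\<in>W. (1 - q) * (\<Prod>w\<in>W - {v}. cross q v w)) = 1 - q ^ card W"
proof -
  define P where "P = (\<Prod>w\<in>W. [:- q * w, 1:])"
  have ev: "poly P x = (\<Prod>w\<in>W. x - q * w)" for x
    by (simp add: P_def poly_prod)
  have deg: "degree P \<le> card W"
    unfolding P_def by (intro prod_linear_poly W)
  have lc: "coeff P (card W) = 1"
    using prod_linear_poly[OF W(1), of "-q" 1] by (simp add: P_def)
  have "poly P 0 / (\<Prod>w\<in>W. 0 - w) = 1 + (\<Sum>w\<in>W. poly P w / (\<Prod>v\<in>W - {w}. w - v) / (0 - w))"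
    using partial_fractions[OF W(1) deg W(2)] lc by simp
  also have "(\<Sum>w\<in>W. poly P w / (\<Prod>v\<in>W - {w}. w - v) / (0 - w)) =
     - (\<Sum>v\<in>W. (1 - q) * (\<Prod>w\<in>W - {v}. cross q v w))"
    unfolding sum_negf[symmetric]
  proof (rule sum.cong[OF refl])
    fix v assume v: "v \<in> W"
    have "poly P v = v * ((1 - q) * (\<Prod>x\<in>W - {v}. v - q * x))"
      using W v by (simp add: ev prod.remove algebra_simps)
    moreover have "v \<noteq> 0" using v W by auto
    ultimately show "poly P v / (\<Prod>x\<in>W - {v}. v - x) / (0 - v) =
      - ((1 - q) * (\<Prod>w\<in>W - {v}. cross q v w))"
      using W by (simp add: cross_prod_eq)
  qed
  also have "poly P 0 / (\<Prod>w\<in>W. 0 - w) = q ^ card W"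
  proof -
    have "(\<Prod>w\<in>W. 0 - q * w) = (\<Prod>w\<in>W. q * (0 - w))" by simp
    also have "\<dots> = q ^ card W * (\<Prod>w\<in>W. 0 - w)" by (simp only: prod.distrib prod_constant)
    finally have "poly P 0 = q ^ card W * (\<Prod>w\<in>W. 0 - w)" by (simp add: ev)
    moreover have "(\<Prod>w\<in>W. 0 - w) \<noteq> 0" using W by auto
    ultimately show ?thesis by simp
  qed
  finally show ?thesis by (simp add: algebra_simps)
qed

text \<open>
  As functions of \<open>u\<close> both sides have simple poles in \<open>W\<close> with the same residues and are
  bounded at infinity, so they differ by a constant. At \<open>u = s\<close> both sides vanish.
\<close>
lemma cross_exchange:
  assumes W: "finite W" "0 \<notin> W" "u \<notin> W" "s \<notin> W" and l: "card W = Suc l"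
  shows "(\<Sum>v\<in>W. (1 - q) * (v - s) * (1 - s * q ^ l * u) / (u - v) * (\<Prod>w\<in>W - {v}. cross q v w))
       + (1 - s\<^sup>2 * q ^ l) * (1 - q ^ Suc l) =
     (\<Sum>v\<in>W. (1 - q) * (1 - s * v) * (u - s) / (u - v) * (\<Prod>w\<in>W - {v}. cross q w v)
        * (\<Prod>w\<in>W - {v}. cross q u w))"
proof -
  define a where "a = (\<lambda>v. (1 - q) * (1 - s * v) * (\<Prod>w\<in>W - {v}. cross q w v))"
  define b where "b = (\<lambda>v. (1 - q) * (v - s) * (\<Prod>w\<in>W - {v}. cross q v w))"
  define P where "P = (\<Sum>v\<in>W. smult (a v) ([:- s, 1:] * (\<Prod>w\<in>W - {v}. [:- q * w, 1:])))"
  define R where "R = (\<lambda>x. \<Sum>v\<in>W. a v * (x - s) / (x - v) * (\<Prod>w\<in>W - {v}. cross q x w))"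
  have ev: "poly P x = (\<Sum>v\<in>W. a v * ((x - s) * (\<Prod>w\<in>W - {v}. x - q * w)))" for x
    unfolding P_def poly_sum poly_smult poly_mult poly_prod by simp
  have cd: "card (W - {v}) = l" if "v \<in> W" for v using that l W by simp
  have deg: "degree P \<le> card W"
    unfolding P_def
  proof (rule degree_sum_le[OF W(1)])
    fix v assume v: "v \<in> W"
    have "degree ([:- s, 1:] * (\<Prod>w\<in>W - {v}. [:- q * w, 1:])) \<le> 1 + card (W - {v})"
      by (intro order.trans[OF degree_mult_le] add_mono prod_linear_poly) (use W in auto)
    then show "degree (smult (a v) ([:- s, 1:] * (\<Prod>w\<in>W - {v}. [:- q * w, 1:]))) \<le> card W"
      using cd[OF v] l by (intro order.trans[OF degree_smult_le]) simp
  qed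
  have R_eq: "R x = coeff P (card W) + (\<Sum>w\<in>W. poly P w / (\<Prod>v\<in>W - {w}. w - v) / (x - w))"
    if x: "x \<notin> W" for x
  proof -
    have "R x = poly P x / (\<Prod>w\<in>W. x - w)"
      unfolding R_def ev sum_divide_distrib
    proof (rule sum.cong[OF refl])
      fix v assume v: "v \<in> W"
      have "(\<Prod>w\<in>W. x - w) = (x - v) * (\<Prod>w\<in>W - {v}. x - w)" using W v by (simp add: prod.remove)
      then show "a v * (x - s) / (x - v) * (\<Prod>w\<in>W - {v}. cross q x w) =
        a v * ((x - s) * (\<Prod>w\<in>W - {v}. x - q * w)) / (\<Prod>w\<in>W. x - w)"
        using W by (simp add: cross_prod_eq)
    qed
    then show ?thesis using partial_fractions[OF W(1) deg x] by simp
  qed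
  \<comment> \<open>The residue at \<open>w\<close> collapses by \<open>cross_expand_right\<close> for the set \<open>W - {w}\<close>.\<close>
  have res: "poly P w / (\<Prod>v\<in>W - {w}. w - v) = b w * (1 - s * q ^ l * w)" if w: "w \<in> W" for w
  proof -
    define D where "D = (\<Prod>v\<in>W - {w}. w - q * v)"
    have w0: "w \<noteq> 0" using W w by auto
    have "poly P w = (w - s) * (a w * D + (\<Sum>v\<in>W - {w}. a v * (\<Prod>x\<in>W - {v}. w - q * x)))"
      unfolding ev by (subst sum.remove[OF W(1) w]) (simp add: D_def sum_distrib_left distrib_left mult_ac)
    also have "(\<Sum>v\<in>W - {w}. a v * (\<Prod>x\<in>W - {v}. w - q * x)) =
       (\<Sum>v\<in>W - {w}. D * (1 - q) * (w * ((1 - q) * (1 - s * v) / (w - v) * (\<Prod>x\<in>W - {w} - {v}. cross q x v))))"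
    proof (rule sum.cong[OF refl])
      fix v assume v: "v \<in> W - {w}"
      have e1: "W - {v} = insert w (W - {w} - {v})" using v w by auto
      have e2: "(\<Prod>x\<in>W - {v}. w - q * x) = (w - q * w) * (\<Prod>x\<in>W - {w} - {v}. w - q * x)"
        unfolding e1 using W by simp
      have e3: "(\<Prod>x\<in>W - {v}. cross q x v) = cross q w v * (\<Prod>x\<in>W - {w} - {v}. cross q x v)"
        unfolding e1 using W by simp
      have e4: "D = (w - q * v) * (\<Prod>x\<in>W - {w} - {v}. w - q * x)"
        unfolding D_def by (rule prod.remove) (use W v in auto)
      show "a v * (\<Prod>x\<in>W - {v}. w - q * x) =
        D * (1 - q) * (w * ((1 - q) * (1 - s * v) / (w - v) * (\<Prod>x\<in>W - {w} - {v}. cross q x v)))"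
        unfolding a_def e2 e3 e4 cross_def[of q w v] by (simp add: algebra_simps)
    qed
    also have "a w * D + \<dots> = D * (1 - q) * ((\<Prod>x\<in>W - {w}. cross q x w) * (1 - s * w) +
        w * (\<Sum>v\<in>W - {w}. (1 - q) * (1 - s * v) / (w - v) * (\<Prod>x\<in>W - {w} - {v}. cross q x v)))"
      unfolding a_def sum_distrib_left distrib_left by (simp add: mult_ac)
    also have "\<dots> = D * (1 - q) * (1 - s * q ^ l * w)"
      using cross_expand_right[of "W - {w}" w s q] W w w0 cd[OF w] by simp
    finally show ?thesis
      unfolding b_def cross_prod_eq[OF finite_Diff[OF W(1)]] D_def by (simp add: mult_ac)
  qed
  have R1: "R x = coeff P (card W) + (\<Sum>v\<in>W. b v * (1 - s * q ^ l * v) / (x - v))" if "x \<notin> W" for x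
    using R_eq[OF that] res by simp
  have b_sum: "(\<Sum>v\<in>W. b v / (s - v)) = - (1 - q ^ Suc l)"
  proof -
    have "(\<Sum>v\<in>W. b v / (s - v)) = (\<Sum>v\<in>W. - ((1 - q) * (\<Prod>w\<in>W - {v}. cross q v w)))"
    proof (rule sum.cong[OF refl])
      fix v assume "v \<in> W"
      then have "s - v \<noteq> 0" using W by auto
      then show "b v / (s - v) = - ((1 - q) * (\<Prod>w\<in>W - {v}. cross q v w))"
        unfolding b_def by (simp add: divide_simps) (simp add: algebra_simps)
    qed
    then show ?thesis using cross_sum[OF W(1,2), of q] l by (simp add: sum_negf)
  qed
  define L where "L = (\<lambda>x. (\<Sum>v\<in>W. b v * (1 - s * q ^ l * x) / (x - v)) + (1 - s\<^sup>2 * q ^ l) * (1 - q ^ Suc l))"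
  have dif: "L x = R x + (- s * q ^ l * (\<Sum>v\<in>W. b v) + (1 - s\<^sup>2 * q ^ l) * (1 - q ^ Suc l) - coeff P (card W))"
    if x: "x \<notin> W" for x
  proof -
    have "(\<Sum>v\<in>W. b v * (1 - s * q ^ l * x) / (x - v)) =
       (\<Sum>v\<in>W. b v * (1 - s * q ^ l * v) / (x - v) - s * q ^ l * b v)"
    proof (rule sum.cong[OF refl])
      fix v assume "v \<in> W"
      then have "x - v \<noteq> 0" using x by auto
      then show "b v * (1 - s * q ^ l * x) / (x - v) = b v * (1 - s * q ^ l * v) / (x - v) - s * q ^ l * b v"
        by (simp add: divide_simps) (simp add: algebra_simps)
    qed
    then show ?thesis unfolding L_def R1[OF x] sum_subtractf sum_distrib_left[symmetric] by simp
  qed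
  \<comment> \<open>The constant by which both sides differ vanishes.\<close>
  have "R s = 0" unfolding R_def by simp
  moreover have "L s = 0"
  proof -
    have "(\<Sum>v\<in>W. b v * (1 - s * q ^ l * s) / (s - v)) = (1 - s * q ^ l * s) * (\<Sum>v\<in>W. b v / (s - v))"
      unfolding sum_distrib_left by (simp add: mult_ac)
    then show ?thesis unfolding L_def b_sum by (simp add: power2_eq_square algebra_simps)
  qed
  ultimately have "L u = R u" using dif[OF W(4)] dif[OF W(3)] by simp
  then show ?thesis unfolding L_def R_def a_def b_def by (simp add: mult_ac)
qed

section \<open>Bethe sums\<close>

lemma sum_subset_insert:
  fixes F :: "'a set \<Rightarrow> 'a \<Rightarrow> 'b::comm_monoid_add"
  assumes "finite V"
  shows "(\<Sum>K | K \<subseteq> V \<and> card K = m. \<Sum>v\<in>V - K. F K v) =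
         (\<Sum>K | K \<subseteq> V \<and> card K = Suc m. \<Sum>v\<in>K. F (K - {v}) v)"
proof -
  have fin: "finite K" if "K \<subseteq> V" for K using that assms finite_subset by auto
  have fin': "finite {K. K \<subseteq> V \<and> P K}" for P using assms by simp
  have "(\<Sum>K | K \<subseteq> V \<and> card K = m. \<Sum>v\<in>V - K. F K v) =
    (\<Sum>(K, v)\<in>Sigma {K. K \<subseteq> V \<and> card K = m} (\<lambda>K. V - K). F K v)"
    by (rule sum.Sigma) (use assms fin' in auto)
  also have "\<dots> = (\<Sum>(K, v)\<in>Sigma {K. K \<subseteq> V \<and> card K = Suc m} (\<lambda>K. K). F (K - {v}) v)"
    by (rule sum.reindex_bij_witness[of _ "\<lambda>(K, v). (K - {v}, v)" "\<lambda>(K, v). (insert v K, v)"])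
      (use fin in \<open>auto simp: insert_absorb\<close>)
  also have "\<dots> = (\<Sum>K | K \<subseteq> V \<and> card K = Suc m. \<Sum>v\<in>K. F (K - {v}) v)"
    by (rule sum.Sigma[symmetric]) (use fin fin' in auto)
  finally show ?thesis .
qed

definition xprod :: "complex \<Rightarrow> complex set \<Rightarrow> complex set \<Rightarrow> complex" where
  "xprod q K W = (\<Prod>v\<in>K. \<Prod>w\<in>W. cross q v w)"

text \<open>
  The parameters are used up one after the other, so \<open>U\<close> may have more elements than \<open>\<theta>\<close> has
  parts; then the cross factors of the chosen parameters with the unused ones remain. If it
  has fewer, the sum is \<open>0\<close>.
\<close>
fun bethe :: "complex \<Rightarrow> complex \<Rightarrow> nat list \<Rightarrow> complex set \<Rightarrow> complex" where
  "bethe q s [] U = 1"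
| "bethe q s (t # \<theta>) U =
     (\<Sum>u\<in>U. (1 - q) / (1 - s * u) * ((u - s) / (1 - s * u)) ^ t *
        (\<Prod>w\<in>U - {u}. cross q u w) * bethe q s \<theta> (U - {u}))"

lemma xprod_simps:
  "xprod q {} W = 1" "xprod q K {} = 1"
  "finite K \<Longrightarrow> v \<notin> K \<Longrightarrow> xprod q (insert v K) W = (\<Prod>w\<in>W. cross q v w) * xprod q K W"
  "finite W \<Longrightarrow> w \<notin> W \<Longrightarrow> xprod q K (insert w W) = (\<Prod>v\<in>K. cross q v w) * xprod q K W"
  by (simp_all add: xprod_def prod.distrib)

lemma sum_subset_first:
  fixes F :: "'a \<Rightarrow> 'a set \<Rightarrow> 'b::comm_monoid_add"
  assumes "finite U"
  shows "(\<Sum>u\<in>U. \<Sum>K | K \<subseteq> U - {u} \<and> card K = m. F u K) =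
         (\<Sum>K | K \<subseteq> U \<and> card K = Suc m. \<Sum>u\<in>K. F u (K - {u}))"
proof -
  have "(\<Sum>u\<in>U. \<Sum>K | K \<subseteq> U - {u} \<and> card K = m. F u K) =
     (\<Sum>(u, K)\<in>Sigma U (\<lambda>u. {K. K \<subseteq> U - {u} \<and> card K = m}). F u K)"
    by (rule sum.Sigma) (use assms in auto)
  also have "\<dots> = (\<Sum>(K, u)\<in>Sigma {K. K \<subseteq> U \<and> card K = m} (\<lambda>K. U - K). F u K)"
    by (rule sum.reindex_bij_witness[of _ "\<lambda>(K, u). (u, K)" "\<lambda>(u, K). (K, u)"]) auto
  also have "\<dots> = (\<Sum>K | K \<subseteq> U \<and> card K = m. \<Sum>u\<in>U - K. F u K)"
    by (rule sum.Sigma[symmetric]) (use assms in auto)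
  finally show ?thesis using sum_subset_insert[OF assms, where m = m and F = "\<lambda>K u. F u K"] by simp
qed

text \<open>
  A choice of parameters for the parts of \<open>\<theta> @ \<eta>\<close> consists of the set \<open>K\<close> used by \<open>\<theta>\<close> and of
  choices for the two lists separately; the cross factors between \<open>K\<close> and the rest split off
  as \<open>xprod\<close>.
\<close>
lemma bethe_append:
  assumes "finite U"
  shows "bethe q s (\<theta> @ \<eta>) U =
    (\<Sum>K | K \<subseteq> U \<and> card K = length \<theta>. xprod q K (U - K) * bethe q s \<theta> K * bethe q s \<eta> (U - K))"
  using assms
proof (induction \<theta> arbitrary: U)
  case Nil
  have "{K. K \<subseteq> U \<and> card K = 0} = {{}}" using Nil by (auto dest: finite_subset)
  then show ?case by (simp add: xprod_simps)
next
  case (Cons t \<theta>)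
  define p where "p = (\<lambda>u. (1 - q) / (1 - s * u) * ((u - s) / (1 - s * u)) ^ t)"
  have "bethe q s ((t # \<theta>) @ \<eta>) U = (\<Sum>u\<in>U. p u * (\<Prod>w\<in>U - {u}. cross q u w) * bethe q s (\<theta> @ \<eta>) (U - {u}))"
    by (simp add: p_def)
  also have "\<dots> = (\<Sum>u\<in>U. \<Sum>K | K \<subseteq> U - {u} \<and> card K = length \<theta>. p u * (\<Prod>w\<in>U - {u}. cross q u w) *
      (xprod q K (U - {u} - K) * bethe q s \<theta> K * bethe q s \<eta> (U - {u} - K)))"
    using Cons by (simp add: sum_distrib_left)
  also have "\<dots> = (\<Sum>K | K \<subseteq> U \<and> card K = Suc (length \<theta>). \<Sum>u\<in>K. p u * (\<Prod>w\<in>U - {u}. cross q u w) *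
      (xprod q (K - {u}) (U - {u} - (K - {u})) * bethe q s \<theta> (K - {u}) * bethe q s \<eta> (U - {u} - (K - {u}))))"
    by (rule sum_subset_first[OF Cons.prems])
  also have "\<dots> = (\<Sum>K | K \<subseteq> U \<and> card K = length (t # \<theta>). xprod q K (U - K) * bethe q s (t # \<theta>) K * bethe q s \<eta> (U - K))"
  proof (rule sum.cong)
    fix K assume "K \<in> {K. K \<subseteq> U \<and> card K = length (t # \<theta>)}"
    then have K: "K \<subseteq> U" by auto
    then have fK: "finite K" using Cons.prems finite_subset by auto
    have "(\<Prod>w\<in>U - {u}. cross q u w) * xprod q (K - {u}) (U - {u} - (K - {u})) =
        xprod q K (U - K) * (\<Prod>w\<in>K - {u}. cross q u w)"
      and "U - {u} - (K - {u}) = U - K" if u: "u \<in> K" for u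
    proof -
      show e: "U - {u} - (K - {u}) = U - K" using u by auto
      have "U - {u} = (K - {u}) \<union> (U - K)" using u K by auto
      then have "(\<Prod>w\<in>U - {u}. cross q u w) = (\<Prod>w\<in>K - {u}. cross q u w) * (\<Prod>w\<in>U - K. cross q u w)"
        by (simp only:) (rule prod.union_disjoint, use fK Cons.prems in auto)
      moreover have "xprod q K (U - K) = (\<Prod>w\<in>U - K. cross q u w) * xprod q (K - {u}) (U - K)"
        using xprod_simps(3)[of "K - {u}" u q "U - K"] fK u by (simp add: insert_absorb)
      ultimately show "(\<Prod>w\<in>U - {u}. cross q u w) * xprod q (K - {u}) (U - {u} - (K - {u})) =
        xprod q K (U - K) * (\<Prod>w\<in>K - {u}. cross q u w)" unfolding e by simp
    qed
    then show "(\<Sum>u\<in>K. p u * (\<Prod>w\<in>U - {u}. cross q u w) *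
      (xprod q (K - {u}) (U - {u} - (K - {u})) * bethe q s \<theta> (K - {u}) * bethe q s \<eta> (U - {u} - (K - {u})))) =
      xprod q K (U - K) * bethe q s (t # \<theta>) K * bethe q s \<eta> (U - K)"
      by (simp add: p_def sum_distrib_left sum_distrib_right mult_ac)
        (intro sum.cong refl, simp add: mult.assoc[symmetric])
  qed simp
  finally show ?case .
qed

text \<open>
  The value of the Bethe sum of \<open>card W\<close> zeros: the one-particle factors have the same product
  for every choice, and what is left is \<open>cross_sum\<close>, applied once for each part.
\<close>
definition zero_weight :: "complex \<Rightarrow> complex \<Rightarrow> complex set \<Rightarrow> complex" where
  "zero_weight q s W = (\<Prod>i<card W. 1 - q ^ Suc i) / (\<Prod>w\<in>W. 1 - s * w)"

lemma bethe_zeros: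
  assumes "finite W" "0 \<notin> W" "\<forall>w\<in>W. 1 - s * w \<noteq> 0"
  shows "bethe q s (replicate (card W) 0) W = zero_weight q s W"
  using assms
proof (induction "card W" arbitrary: W)
  case 0
  then show ?case by (simp add: zero_weight_def)
next
  case (Suc g)
  have g: "card (W - {u}) = g" if "u \<in> W" for u using that Suc by simp
  have "bethe q s (replicate (card W) 0) W =
     (\<Sum>u\<in>W. (1 - q) / (1 - s * u) * (\<Prod>w\<in>W - {u}. cross q u w) * bethe q s (replicate g 0) (W - {u}))"
    unfolding Suc(2)[symmetric] by simp
  also have "\<dots> = (\<Sum>u\<in>W. ((1 - q) * (\<Prod>w\<in>W - {u}. cross q u w)) * ((\<Prod>i<g. 1 - q ^ Suc i) / (\<Prod>w\<in>W. 1 - s * w)))"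
  proof (rule sum.cong[OF refl])
    fix u assume u: "u \<in> W"
    have "bethe q s (replicate g 0) (W - {u}) = zero_weight q s (W - {u})"
      using Suc(1)[of "W - {u}"] g[OF u] Suc by simp
    moreover have "(\<Prod>w\<in>W. 1 - s * w) = (1 - s * u) * (\<Prod>w\<in>W - {u}. 1 - s * w)"
      using u Suc by (simp add: prod.remove)
    ultimately show "(1 - q) / (1 - s * u) * (\<Prod>w\<in>W - {u}. cross q u w) * bethe q s (replicate g 0) (W - {u}) =
      ((1 - q) * (\<Prod>w\<in>W - {u}. cross q u w)) * ((\<Prod>i<g. 1 - q ^ Suc i) / (\<Prod>w\<in>W. 1 - s * w))"
      using g[OF u] by (simp add: zero_weight_def)
  qed
  also have "\<dots> = (1 - q ^ Suc g) * ((\<Prod>i<g. 1 - q ^ Suc i) / (\<Prod>w\<in>W. 1 - s * w))"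
    unfolding sum_distrib_right[symmetric] using cross_sum[of W q] Suc by simp
  also have "\<dots> = zero_weight q s W" unfolding zero_weight_def Suc(2)[symmetric] by simp
  finally show ?case .
qed

section \<open>One row of paths\<close>

text \<open>
  The sum over the occupation numbers of the vertical edges below a row, for given occupation
  numbers \<open>l # ls\<close> above it, of the row weight times a function \<open>S\<close> of the former. The Boolean
  tells whether a path enters the present column from the left. The recursion runs over the
  columns and not over the configurations, which is the form in which the identities below
  apply. In the last equation \<open>l - 1\<close> is harmless for \<open>l = 0\<close>, where its coefficient
  \<open>1 - q ^ l\<close> vanishes.
\<close>
fun row_transfer :: "complex \<Rightarrow> complex \<Rightarrow> complex \<Rightarrow> bool \<Rightarrow> (nat list \<Rightarrow> complex) \<Rightarrow> nat list \<Rightarrow> complex" where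
  "row_transfer q s u False S [] = S []"
| "row_transfer q s u True S [] = 0"
| "row_transfer q s u False S (l # ls) =
     (1 - s * q ^ l * u) / (1 - s * u) * row_transfer q s u False (\<lambda>g. S (l # g)) ls +
     (1 - s\<^sup>2 * q ^ l) * u / (1 - s * u) * row_transfer q s u True (\<lambda>g. S (Suc l # g)) ls"
| "row_transfer q s u True S (l # ls) =
     (u - s * q ^ l) / (1 - s * u) * row_transfer q s u True (\<lambda>g. S (l # g)) ls +
     (1 - q ^ l) / (1 - s * u) * row_transfer q s u False (\<lambda>g. S ((l - 1) # g)) ls"

lemma row_transfer_add:
  "row_transfer q s u j (\<lambda>g. S g + S' g) ls = row_transfer q s u j S ls + row_transfer q s u j S' ls"
  by (induction q s u j S ls arbitrary: S' rule: row_transfer.induct) (simp_all add: distrib_left)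

lemma row_transfer_cmul: "row_transfer q s u j (\<lambda>g. c * S g) ls = c * row_transfer q s u j S ls"
  by (induction q s u j S ls rule: row_transfer.induct) (simp_all add: algebra_simps)

lemma row_transfer_zero: "row_transfer q s u j (\<lambda>g. 0) ls = 0"
  using row_transfer_cmul[of q s u j 0 "\<lambda>g. 0" ls] by simp

lemma row_transfer_sum:
  "row_transfer q s u j (\<lambda>g. \<Sum>i\<in>I. c i * S i g) ls = (\<Sum>i\<in>I. c i * row_transfer q s u j (S i) ls)"
  by (induction I rule: infinite_finite_induct)
    (simp_all add: row_transfer_zero row_transfer_add row_transfer_cmul)

definition yprod :: "complex \<Rightarrow> complex set \<Rightarrow> complex" where
  "yprod s K = (\<Prod>v\<in>K. (v - s) / (1 - s * v))"

text \<open>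
  The Bethe sum in terms of occupation numbers. The parameters \<open>W\<close> of the \<open>l\<close> paths in the
  first column are split off; all other paths are one column further to the right, which gives
  the factor \<open>yprod\<close>. It vanishes unless \<open>card V\<close> is the number of paths.
\<close>
fun bethe_occ :: "complex \<Rightarrow> complex \<Rightarrow> nat list \<Rightarrow> complex set \<Rightarrow> complex" where
  "bethe_occ q s [] V = (if V = {} then 1 else 0)"
| "bethe_occ q s (l # ls) V = (\<Sum>W | W \<subseteq> V \<and> card W = l.
     xprod q (V - W) W * zero_weight q s W * yprod s (V - W) * bethe_occ q s ls (V - W))"

lemma zero_weight_insert:
  assumes "finite W" "u \<notin> W"
  shows "zero_weight q s (insert u W) = zero_weight q s W * (1 - q ^ Suc (card W)) / (1 - s * u)"
  using assms by (simp add: zero_weight_def)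

lemma zero_weight_remove:
  assumes "finite W" "v \<in> W" "1 - s * v \<noteq> 0"
  shows "zero_weight q s (W - {v}) * (1 - q ^ card W) = zero_weight q s W * (1 - s * v)"
proof -
  have "Suc (card (W - {v})) = card W" using card.remove[OF assms(1,2)] by simp
  then show ?thesis
    using zero_weight_insert[of "W - {v}" v q s] assms by (simp add: insert_absorb)
qed

lemma yprod_insert: "finite K \<Longrightarrow> v \<notin> K \<Longrightarrow> yprod s (insert v K) = (v - s) / (1 - s * v) * yprod s K"
  by (simp add: yprod_def)

lemma xprod_move:
  assumes "finite K" "finite W" "v \<in> W" "v \<notin> K"
  shows "xprod q (insert v K) (W - {v}) * xprod q K {v} = xprod q K W * (\<Prod>w\<in>W - {v}. cross q v w)"
  using xprod_simps(4)[of "W - {v}" v q K] assms by (simp add: xprod_simps insert_absorb mult_ac)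

text \<open>
  The next three identities are what a single column contributes to the induction in
  \<open>row_transfer_bethe\<close>. The sets \<open>W\<close> and \<open>K\<close> consist of the parameters of the paths in the
  column and further right, up to one element that may change sides. After division by the
  common factor this one is \<open>cross_expand_left\<close>.
\<close>
lemma occupied_entry_identity:
  assumes KW: "finite K" "finite W" "K \<inter> W = {}" "u \<notin> K" "u \<notin> W" "0 \<notin> W" "u \<noteq> 0"
    and nz: "\<forall>v\<in>insert u W. 1 - s * v \<noteq> 0"
  shows "(u - s * q ^ card W) / (1 - s * u) * (xprod q K W * zero_weight q s W * yprod s K) +
     (1 - q ^ card W) / (1 - s * u) * (\<Sum>v\<in>W. xprod q (insert v K) (W - {v}) * zero_weight q s (W - {v})
        * yprod s (insert v K) * ((1 - q) * u / (u - v) * xprod q K {v})) =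
     xprod q (insert u K) W * zero_weight q s W * yprod s (insert u K)"
proof -
  define Z where "Z = xprod q K W * zero_weight q s W * yprod s K"
  have "(1 - q ^ card W) * (xprod q (insert v K) (W - {v}) * zero_weight q s (W - {v})
        * yprod s (insert v K) * ((1 - q) * u / (u - v) * xprod q K {v})) =
      Z * (u * ((1 - q) * (v - s) / (u - v) * (\<Prod>w\<in>W - {v}. cross q v w)))" if v: "v \<in> W" for v
  proof -
    have v': "v \<notin> K" "1 - s * v \<noteq> 0" using v KW nz by auto
    have "(1 - q ^ card W) * (xprod q (insert v K) (W - {v}) * zero_weight q s (W - {v})
        * yprod s (insert v K) * ((1 - q) * u / (u - v) * xprod q K {v})) =
      (xprod q (insert v K) (W - {v}) * xprod q K {v}) * (zero_weight q s (W - {v}) * (1 - q ^ card W))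
       * yprod s (insert v K) * ((1 - q) * u / (u - v))" by (simp only: mult_ac)
    also have "\<dots> = (xprod q K W * (\<Prod>w\<in>W - {v}. cross q v w)) * (zero_weight q s W * (1 - s * v))
       * ((v - s) / (1 - s * v) * yprod s K) * ((1 - q) * u / (u - v))"
      by (simp only: xprod_move[OF KW(1,2) v v'(1)] zero_weight_remove[OF KW(2) v v'(2)] yprod_insert[OF KW(1) v'(1)])
    also have "\<dots> = Z * (u * ((1 - q) * (v - s) / (u - v) * (\<Prod>w\<in>W - {v}. cross q v w)))"
      using v' by (simp add: Z_def)
    finally show ?thesis .
  qed
  then have "(1 - q ^ card W) * (\<Sum>v\<in>W. xprod q (insert v K) (W - {v}) * zero_weight q s (W - {v})
        * yprod s (insert v K) * ((1 - q) * u / (u - v) * xprod q K {v})) =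
     Z * (u * (\<Sum>v\<in>W. (1 - q) * (v - s) / (u - v) * (\<Prod>w\<in>W - {v}. cross q v w)))"
    unfolding sum_distrib_left by (intro sum.cong refl)
  then have "(u - s * q ^ card W) / (1 - s * u) * Z +
     (1 - q ^ card W) / (1 - s * u) * (\<Sum>v\<in>W. xprod q (insert v K) (W - {v}) * zero_weight q s (W - {v})
        * yprod s (insert v K) * ((1 - q) * u / (u - v) * xprod q K {v})) =
     Z * (u - s * q ^ card W + u * (\<Sum>v\<in>W. (1 - q) * (v - s) / (u - v) * (\<Prod>w\<in>W - {v}. cross q v w))) / (1 - s * u)"
    by (simp add: add_divide_distrib distrib_left mult.commute)
  also have "\<dots> = Z * ((\<Prod>w\<in>W. cross q u w) * (u - s)) / (1 - s * u)"
    using cross_expand_left[of W u q s] KW by simp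
  also have "\<dots> = xprod q (insert u K) W * zero_weight q s W * yprod s (insert u K)"
    using KW by (simp add: Z_def xprod_simps yprod_insert)
  finally show ?thesis unfolding Z_def .
qed

text \<open>
  The terms in which the new parameter \<open>u\<close> ends up in the column itself or is not used. After
  division by the common factor this is \<open>cross_expand_right\<close>.
\<close>
lemma empty_entry_identity_column:
  assumes KW: "finite K" "finite W" "K \<inter> W = {}" "u \<notin> K" "u \<notin> W" "0 \<notin> W" "u \<noteq> 0"
    and nz: "\<forall>v\<in>insert u W. 1 - s * v \<noteq> 0"
  shows "(1 - s * q ^ card W * u) / (1 - s * u) * (xprod q K W * zero_weight q s W * yprod s K) * xprod q K {u} =
     xprod q (K \<union> W) {u} * (xprod q K W * zero_weight q s W * yprod s K) +
     (\<Sum>v\<in>W. (1 - q) * u / (u - v) * xprod q (K \<union> W - {v}) {v} *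
        (xprod q K (insert u (W - {v})) * zero_weight q s (insert u (W - {v})) * yprod s K))"
proof -
  define Z where "Z = xprod q K W * zero_weight q s W * yprod s K * xprod q K {u}"
  have un: "xprod q (A \<union> B) C = xprod q A C * xprod q B C" if "A \<subseteq> K" "B \<subseteq> W" for A B C
    unfolding xprod_def by (rule prod.union_disjoint) (use that KW in \<open>auto intro: finite_subset\<close>)
  have si: "xprod q A {v} = (\<Prod>w\<in>A. cross q w v)" for A v by (simp add: xprod_def)
  have "(1 - q) * u / (u - v) * xprod q (K \<union> W - {v}) {v} *
        (xprod q K (insert u (W - {v})) * zero_weight q s (insert u (W - {v})) * yprod s K) =
       Z * (u * ((1 - q) * (1 - s * v) / (u - v) * (\<Prod>w\<in>W - {v}. cross q w v))) / (1 - s * u)"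
    if v: "v \<in> W" for v
  proof -
    have v': "v \<notin> K" "1 - s * v \<noteq> 0" using v KW nz by auto
    have c: "Suc (card (W - {v})) = card W" using card.remove[OF KW(2) v] by simp
    have e: "K \<union> W - {v} = K \<union> (W - {v})" using v' by auto
    have x1: "xprod q (K \<union> W - {v}) {v} = xprod q K {v} * (\<Prod>w\<in>W - {v}. cross q w v)"
      unfolding e un[OF subset_refl Diff_subset] by (simp add: si)
    have x2: "xprod q K (insert u (W - {v})) = xprod q K {u} * xprod q K (W - {v})"
      using KW by (simp add: xprod_simps si)
    have x3: "xprod q K W = xprod q K {v} * xprod q K (W - {v})"
      using xprod_simps(4)[of "W - {v}" v q K] KW v by (simp add: insert_absorb si)
    have z: "zero_weight q s (insert u (W - {v})) = zero_weight q s W * (1 - s * v) / (1 - s * u)"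
      using zero_weight_insert[of "W - {v}" u q s] zero_weight_remove[of W v s q] KW v v' c by simp
    show ?thesis unfolding x1 x2 z Z_def x3 by simp
  qed
  then have B: "(\<Sum>v\<in>W. (1 - q) * u / (u - v) * xprod q (K \<union> W - {v}) {v} *
        (xprod q K (insert u (W - {v})) * zero_weight q s (insert u (W - {v})) * yprod s K)) =
     Z * (u * (\<Sum>v\<in>W. (1 - q) * (1 - s * v) / (u - v) * (\<Prod>w\<in>W - {v}. cross q w v))) / (1 - s * u)"
    unfolding sum_distrib_left sum_divide_distrib by (intro sum.cong refl)
  have A: "xprod q (K \<union> W) {u} * (xprod q K W * zero_weight q s W * yprod s K) =
     Z * ((\<Prod>w\<in>W. cross q w u) * (1 - s * u)) / (1 - s * u)"
    using nz unfolding un[OF subset_refl subset_refl] si[of W] Z_def by simp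
  have "xprod q (K \<union> W) {u} * (xprod q K W * zero_weight q s W * yprod s K) +
     (\<Sum>v\<in>W. (1 - q) * u / (u - v) * xprod q (K \<union> W - {v}) {v} *
        (xprod q K (insert u (W - {v})) * zero_weight q s (insert u (W - {v})) * yprod s K)) =
    Z * (1 - s * q ^ card W * u) / (1 - s * u)"
    unfolding A B cross_expand_right[OF KW(2,6,5,7)] by (simp only: distrib_left add_divide_distrib)
  then show ?thesis unfolding Z_def by (simp add: mult_ac)
qed

text \<open>
  The terms in which the new parameter \<open>u\<close> belongs to a path further right. This is
  \<open>cross_exchange\<close>.
\<close>
lemma empty_entry_identity_beyond:
  assumes KW: "finite K" "finite W" "K \<inter> W = {}" "u \<notin> K" "u \<notin> W" "0 \<notin> W" "u \<noteq> 0" "s \<notin> W"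
    and l: "card W = Suc l"
    and nz: "\<forall>v\<in>insert u W. 1 - s * v \<noteq> 0" and nq: "1 - q ^ Suc l \<noteq> 0"
  shows "(1 - s * q ^ l * u) / (1 - s * u) * (\<Sum>v\<in>W. xprod q (insert v K) (W - {v}) * zero_weight q s (W - {v})
        * yprod s (insert v K) * ((1 - q) * u / (u - v) * xprod q K {v})) +
     (1 - s\<^sup>2 * q ^ l) * u / (1 - s * u) * (xprod q K W * zero_weight q s W * yprod s K) =
     (\<Sum>v\<in>W. (1 - q) * u / (u - v) * xprod q (K \<union> W - {v}) {v} *
        (xprod q (insert u K) (W - {v}) * zero_weight q s (W - {v}) * yprod s (insert u K)))"
proof -
  define Z where "Z = xprod q K W * zero_weight q s W * yprod s K * u / ((1 - s * u) * (1 - q ^ Suc l))"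
  have un: "xprod q (A \<union> B) C = xprod q A C * xprod q B C" if "A \<subseteq> K" "B \<subseteq> W" for A B C
    unfolding xprod_def by (rule prod.union_disjoint) (use that KW in \<open>auto intro: finite_subset\<close>)
  have si: "xprod q A {v} = (\<Prod>w\<in>A. cross q w v)" for A v by (simp add: xprod_def)
  have nu: "1 - s * u \<noteq> 0" using nz by auto
  have zr: "zero_weight q s (W - {v}) = zero_weight q s W * (1 - s * v) / (1 - q ^ Suc l)" if "v \<in> W" for v
  proof -
    have "1 - s * v \<noteq> 0" using that nz by blast
    from zero_weight_remove[OF KW(2) that this, of q] show ?thesis
      unfolding l using nq by (simp del: power_Suc add: eq_divide_eq)
  qed
  have 1: "(1 - s * q ^ l * u) / (1 - s * u) * (xprod q (insert v K) (W - {v}) * zero_weight q s (W - {v})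
        * yprod s (insert v K) * ((1 - q) * u / (u - v) * xprod q K {v})) =
      Z * ((1 - q) * (v - s) * (1 - s * q ^ l * u) / (u - v) * (\<Prod>w\<in>W - {v}. cross q v w))" if v: "v \<in> W" for v
  proof -
    have v': "v \<notin> K" "1 - s * v \<noteq> 0" using v KW nz by auto
    have "(1 - s * q ^ l * u) / (1 - s * u) * (xprod q (insert v K) (W - {v}) * zero_weight q s (W - {v})
        * yprod s (insert v K) * ((1 - q) * u / (u - v) * xprod q K {v})) =
      (xprod q (insert v K) (W - {v}) * xprod q K {v}) * zero_weight q s (W - {v})
       * yprod s (insert v K) * ((1 - q) * u / (u - v)) * ((1 - s * q ^ l * u) / (1 - s * u))" by (simp only: mult_ac)
    also have "\<dots> = (xprod q K W * (\<Prod>w\<in>W - {v}. cross q v w)) * (zero_weight q s W * (1 - s * v) / (1 - q ^ Suc l))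
       * ((v - s) / (1 - s * v) * yprod s K) * ((1 - q) * u / (u - v)) * ((1 - s * q ^ l * u) / (1 - s * u))"
      by (simp only: xprod_move[OF KW(1,2) v v'(1)] zr[OF v] yprod_insert[OF KW(1) v'(1)])
    finally show ?thesis using v' by (simp add: Z_def mult_ac)
  qed
  have 2: "(1 - q) * u / (u - v) * xprod q (K \<union> W - {v}) {v} *
        (xprod q (insert u K) (W - {v}) * zero_weight q s (W - {v}) * yprod s (insert u K)) =
     Z * ((1 - q) * (1 - s * v) * (u - s) / (u - v) * (\<Prod>w\<in>W - {v}. cross q w v)
        * (\<Prod>w\<in>W - {v}. cross q u w))" if v: "v \<in> W" for v
  proof -
    have v': "v \<notin> K" using v KW by auto
    have e: "K \<union> W - {v} = K \<union> (W - {v})" using v' by auto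
    have x1: "xprod q (K \<union> W - {v}) {v} = xprod q K {v} * (\<Prod>w\<in>W - {v}. cross q w v)"
      unfolding e un[OF subset_refl Diff_subset] by (simp add: si)
    have x2: "xprod q (insert u K) (W - {v}) = (\<Prod>w\<in>W - {v}. cross q u w) * xprod q K (W - {v})"
      using KW by (simp add: xprod_simps)
    have x3: "xprod q K W = xprod q K {v} * xprod q K (W - {v})"
      using xprod_simps(4)[of "W - {v}" v q K] KW v by (simp add: insert_absorb si)
    show ?thesis unfolding x1 x2 zr[OF v] Z_def x3 yprod_insert[OF KW(1,4)] by (simp add: mult_ac)
  qed
  have 3: "(1 - s\<^sup>2 * q ^ l) * u / (1 - s * u) * (xprod q K W * zero_weight q s W * yprod s K) =
     Z * ((1 - s\<^sup>2 * q ^ l) * (1 - q ^ Suc l))" using nq by (simp add: Z_def)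
  have "(\<Sum>v\<in>W. (1 - s * q ^ l * u) / (1 - s * u) * (xprod q (insert v K) (W - {v}) * zero_weight q s (W - {v})
        * yprod s (insert v K) * ((1 - q) * u / (u - v) * xprod q K {v}))) =
      Z * (\<Sum>v\<in>W. (1 - q) * (v - s) * (1 - s * q ^ l * u) / (u - v) * (\<Prod>w\<in>W - {v}. cross q v w))"
    unfolding sum_distrib_left by (intro sum.cong refl 1)
  moreover have "(\<Sum>v\<in>W. (1 - q) * u / (u - v) * xprod q (K \<union> W - {v}) {v} *
        (xprod q (insert u K) (W - {v}) * zero_weight q s (W - {v}) * yprod s (insert u K))) =
     Z * (\<Sum>v\<in>W. (1 - q) * (1 - s * v) * (u - s) / (u - v) * (\<Prod>w\<in>W - {v}. cross q w v)
        * (\<Prod>w\<in>W - {v}. cross q u w))"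
    unfolding sum_distrib_left by (intro sum.cong refl 2)
  ultimately show ?thesis
    unfolding 3 sum_distrib_left[of "(1 - s * q ^ l * u) / (1 - s * u)"]
    by (simp only: distrib_left[symmetric] cross_exchange[OF KW(2,6,5,8) l])
qed

lemma subsets_insert:
  assumes "finite V" "u \<notin> V"
  shows "(\<Sum>W | W \<subseteq> insert u V \<and> card W = Suc l. F W) =
     (\<Sum>W | W \<subseteq> V \<and> card W = Suc l. F W) + (\<Sum>W | W \<subseteq> V \<and> card W = l. F (insert u W))"
proof -
  have fin: "finite W" if "W \<subseteq> V" for W using that assms finite_subset by auto
  have e: "{W. W \<subseteq> insert u V \<and> card W = Suc l} =
     {W. W \<subseteq> V \<and> card W = Suc l} \<union> insert u ` {W. W \<subseteq> V \<and> card W = l}" (is "?A = ?B \<union> ?C")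
  proof (intro equalityI subsetI)
    fix W assume W: "W \<in> ?A"
    show "W \<in> ?B \<union> ?C"
    proof (cases "u \<in> W")
      case True
      then have "W = insert u (W - {u})" "W - {u} \<subseteq> V" "card (W - {u}) = l" using W by auto
      then show ?thesis by blast
    next
      case False then show ?thesis using W by auto
    qed
  next
    fix W assume "W \<in> ?B \<union> ?C"
    then show "W \<in> ?A" using fin assms by (auto simp: card_insert_if)
  qed
  have "inj_on (insert u) {W. W \<subseteq> V \<and> card W = l}"
  proof (rule inj_onI)
    fix x y assume "x \<in> {W. W \<subseteq> V \<and> card W = l}" "y \<in> {W. W \<subseteq> V \<and> card W = l}" "insert u x = insert u y"
    then show "x = y" using assms by (metis (no_types, lifting) insert_ident mem_Collect_eq subsetD)
  qed
  moreover have "?B \<inter> ?C = {}" using assms by auto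
  ultimately show ?thesis
    unfolding e using assms by (subst sum.union_disjoint) (auto simp: sum.reindex)
qed

text \<open>
  The first equation adds the parameter \<open>u\<close> of a row to the Bethe sum. It cannot be proved
  alone: a path that enters a column from the left may turn up there and leave the rest of the
  row without an incoming path, where no path can be added. For such a row the second equation
  describes the result: the parameter \<open>u\<close> is either discarded, or takes the place of some \<open>v\<close>.
  Both equations are proved together by induction on the columns.
\<close>
lemma row_transfer_bethe:
  assumes nq: "\<And>l. 1 - q ^ Suc l \<noteq> 0"
    and V: "finite V" "u \<notin> V" "0 \<notin> insert u V" "s \<notin> V" "\<forall>v\<in>insert u V. 1 - s * v \<noteq> 0"
  shows "row_transfer q s u True (\<lambda>g. bethe_occ q s g V) ls = bethe_occ q s ls (insert u V)" (is "?B ls V")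
    and "row_transfer q s u False (\<lambda>g. bethe_occ q s g V) ls = xprod q V {u} * bethe_occ q s ls V +
      (\<Sum>v\<in>V. (1 - q) * u / (u - v) * xprod q (V - {v}) {v} * bethe_occ q s ls (insert u (V - {v})))" (is "?A ls V")
proof -
  have "?B ls V \<and> ?A ls V" using V
  proof (induction ls arbitrary: V)
    case Nil
    then show ?case by (auto simp: xprod_simps)
  next
    case (Cons l ls)
    note V = Cons.prems
    define c where "c = (\<lambda>V W. xprod q (V - W) W * zero_weight q s W * yprod s (V - W))"
    define N where "N = (\<lambda>(V :: complex set) m. {W. W \<subseteq> V \<and> card W = m})"
    define G where "G = (\<lambda>K v. (1 - q) * u / (u - v) * xprod q (K - {v}) {v})"
    define B where "B = (\<lambda>V. bethe_occ q s ls V)"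
    have occ: "bethe_occ q s (m # g) V' = (\<Sum>W\<in>N V' m. c V' W * bethe_occ q s g (V' - W))" for m g V'
      by (simp add: c_def N_def)
    have fin: "finite K" if "K \<subseteq> V" for K using that V(1) finite_subset by auto
    have IHB: "row_transfer q s u True (\<lambda>g. bethe_occ q s g K) ls = B (insert u K)" if "K \<subseteq> V" for K
      unfolding B_def by (rule conjunct1[OF Cons.IH]) (use that V fin in auto)
    have IHA: "row_transfer q s u False (\<lambda>g. bethe_occ q s g K) ls =
        xprod q K {u} * B K + (\<Sum>v\<in>K. G K v * B (insert u (K - {v})))" if "K \<subseteq> V" for K
      unfolding B_def G_def by (rule conjunct2[OF Cons.IH]) (use that V fin in auto)
    \<comment> \<open>The two possible remainders of the row, after the induction hypothesis: the sums are over the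
      parameters \<open>W\<close> of the paths in the first column. Sums over \<open>v\<close> outside \<open>W\<close> are rearranged so that
      \<open>v\<close> joins \<open>W\<close>.\<close>
    have T: "row_transfer q s u True (\<lambda>g. bethe_occ q s (m # g) V) ls = (\<Sum>W\<in>N V m. c V W * B (insert u (V - W)))" for m
      unfolding occ row_transfer_sum by (simp add: IHB)
    have F: "row_transfer q s u False (\<lambda>g. bethe_occ q s (m # g) V) ls =
       (\<Sum>W\<in>N V m. c V W * xprod q (V - W) {u} * B (V - W)) +
       (\<Sum>W\<in>N V (Suc m). (\<Sum>v\<in>W. c V (W - {v}) * G (insert v (V - W)) v) * B (insert u (V - W)))" for m
    proof -
      have "row_transfer q s u False (\<lambda>g. bethe_occ q s (m # g) V) ls =
         (\<Sum>W\<in>N V m. c V W * xprod q (V - W) {u} * B (V - W)) +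
         (\<Sum>W\<in>N V m. \<Sum>v\<in>V - W. c V W * G (V - W) v * B (insert u (V - W - {v})))"
        unfolding occ row_transfer_sum by (simp add: IHA distrib_left sum.distrib sum_distrib_left mult_ac)
      also have "(\<Sum>W\<in>N V m. \<Sum>v\<in>V - W. c V W * G (V - W) v * B (insert u (V - W - {v}))) =
         (\<Sum>W\<in>N V (Suc m). \<Sum>v\<in>W. c V (W - {v}) * G (V - (W - {v})) v * B (insert u (V - (W - {v}) - {v})))"
        unfolding N_def by (rule sum_subset_insert[OF V(1)])
      also have "\<dots> = (\<Sum>W\<in>N V (Suc m). (\<Sum>v\<in>W. c V (W - {v}) * G (insert v (V - W)) v) * B (insert u (V - W)))"
        unfolding sum_distrib_right
      proof (intro sum.cong refl)
        fix W v assume "W \<in> N V (Suc m)" "v \<in> W"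
        then have "V - (W - {v}) = insert v (V - W)" "insert v (V - W) - {v} = V - W" by (auto simp: N_def)
        then show "c V (W - {v}) * G (V - (W - {v})) v * B (insert u (V - (W - {v}) - {v})) =
          c V (W - {v}) * G (insert v (V - W)) v * B (insert u (V - W))" by simp
      qed
      finally show ?thesis .
    qed
    have cG: "c V (W - {v}) * G (insert v (V - W)) v =
        xprod q (insert v (V - W)) (W - {v}) * zero_weight q s (W - {v}) * yprod s (insert v (V - W)) *
          ((1 - q) * u / (u - v) * xprod q (V - W) {v})" if "W \<subseteq> V" "v \<in> W" for W v
    proof -
      have "V - (W - {v}) = insert v (V - W)" "insert v (V - W) - {v} = V - W" using that by auto
      then show ?thesis by (simp add: c_def G_def)
    qed
    have uV: "insert u V - W = insert u (V - W)" if "W \<subseteq> V" for W using V that by auto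
    have uV': "insert u V - insert u W = V - W" for W using V by auto
    \<comment> \<open>The coefficient of \<open>B (insert u (V - W))\<close>.\<close>
    have keyB: "(u - s * q ^ card W) / (1 - s * u) * c V W + (1 - q ^ card W) / (1 - s * u) *
        (\<Sum>v\<in>W. c V (W - {v}) * G (insert v (V - W)) v) = c (insert u V) W" if W: "W \<subseteq> V" for W
    proof -
      have "(\<Sum>v\<in>W. c V (W - {v}) * G (insert v (V - W)) v) = (\<Sum>v\<in>W. xprod q (insert v (V - W)) (W - {v}) *
         zero_weight q s (W - {v}) * yprod s (insert v (V - W)) * ((1 - q) * u / (u - v) * xprod q (V - W) {v}))"
        by (intro sum.cong refl cG W)
      then show ?thesis unfolding c_def uV[OF W]
        using occupied_entry_identity[of "V - W" W u s q] fin[OF W] V W by auto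
    qed
    have "?B (l # ls) V"
    proof (cases l)
      case 0
      have e: "N V' 0 = {{}}" if "finite V'" for V' using that by (auto simp: N_def dest: finite_subset)
      show ?thesis unfolding row_transfer.simps T unfolding occ B_def[symmetric] 0
        using keyB[of "{}", symmetric] e[OF V(1)] e[of "insert u V"] V(1) by simp
    next
      case (Suc m)
      have "row_transfer q s u True (\<lambda>g. bethe_occ q s g V) (l # ls) =
        (\<Sum>W\<in>N V l. ((u - s * q ^ l) / (1 - s * u) * c V W + (1 - q ^ l) / (1 - s * u) *
          (\<Sum>v\<in>W. c V (W - {v}) * G (insert v (V - W)) v)) * B (insert u (V - W))) +
        (\<Sum>W\<in>N V m. (1 - q ^ l) / (1 - s * u) * (c V W * xprod q (V - W) {u} * B (V - W)))"
      proof -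
        have "a * (\<Sum>W\<in>I. x W * y W) + b * ((\<Sum>W\<in>I'. z W) + (\<Sum>W\<in>I. D W * y W)) =
          (\<Sum>W\<in>I. (a * x W + b * D W) * y W) + (\<Sum>W\<in>I'. b * z W)"
          for a b :: complex and I I' :: "complex set set" and x y z D
          by (simp add: distrib_left distrib_right sum.distrib sum_distrib_left mult.assoc)
        then show ?thesis unfolding row_transfer.simps T Suc diff_Suc_1 F[of m] .
      qed
      also have "(\<Sum>W\<in>N V l. ((u - s * q ^ l) / (1 - s * u) * c V W + (1 - q ^ l) / (1 - s * u) *
          (\<Sum>v\<in>W. c V (W - {v}) * G (insert v (V - W)) v)) * B (insert u (V - W))) =
         (\<Sum>W\<in>N V l. c (insert u V) W * B (insert u V - W))"
        by (intro sum.cong refl) (use keyB uV in \<open>auto simp: N_def\<close>)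
      \<comment> \<open>In these terms \<open>u\<close> itself belongs to the first column; together with the others they make up
        the sum over all subsets of \<open>insert u V\<close>.\<close>
      also have "(\<Sum>W\<in>N V m. (1 - q ^ l) / (1 - s * u) * (c V W * xprod q (V - W) {u} * B (V - W))) =
         (\<Sum>W\<in>N V m. c (insert u V) (insert u W) * B (insert u V - insert u W))"
      proof (intro sum.cong refl)
        fix W assume "W \<in> N V m"
        then have W: "W \<subseteq> V" "finite W" "u \<notin> W" "card W = m" using V fin by (auto simp: N_def)
        show "(1 - q ^ l) / (1 - s * u) * (c V W * xprod q (V - W) {u} * B (V - W)) =
          c (insert u V) (insert u W) * B (insert u V - insert u W)"
          unfolding uV' c_def zero_weight_insert[OF W(2,3)] W(4) Suc xprod_simps(4)[OF W(2,3)]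
          by (simp add: xprod_def)
      qed
      also have "(\<Sum>W\<in>N V l. c (insert u V) W * B (insert u V - W)) +
          (\<Sum>W\<in>N V m. c (insert u V) (insert u W) * B (insert u V - insert u W)) =
        (\<Sum>W\<in>N (insert u V) l. c (insert u V) W * B (insert u V - W))"
        unfolding Suc N_def by (rule subsets_insert[OF V(1,2), symmetric])
      finally show ?thesis unfolding occ B_def .
    qed
    moreover have "?A (l # ls) V"
    proof -
      have "row_transfer q s u False (\<lambda>g. bethe_occ q s g V) (l # ls) =
         (\<Sum>W\<in>N V l. (1 - s * q ^ l * u) / (1 - s * u) * c V W * xprod q (V - W) {u} * B (V - W)) +
         (\<Sum>W\<in>N V (Suc l). ((1 - s * q ^ l * u) / (1 - s * u) * (\<Sum>v\<in>W. c V (W - {v}) * G (insert v (V - W)) v)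
            + (1 - s\<^sup>2 * q ^ l) * u / (1 - s * u) * c V W) * B (insert u (V - W)))"
      proof -
        have "a * ((\<Sum>W\<in>I'. x W * x' W * y' W) + (\<Sum>W\<in>I. D W * y W)) + b * (\<Sum>W\<in>I. z W * y W) =
          (\<Sum>W\<in>I'. a * x W * x' W * y' W) + (\<Sum>W\<in>I. (a * D W + b * z W) * y W)"
          for a b :: complex and I I' :: "complex set set" and x x' y y' z D
          by (simp add: distrib_left distrib_right sum.distrib sum_distrib_left mult.assoc)
        then show ?thesis unfolding row_transfer.simps T F .
      qed
      also have "(\<Sum>W\<in>N V l. (1 - s * q ^ l * u) / (1 - s * u) * c V W * xprod q (V - W) {u} * B (V - W)) =
         (\<Sum>W\<in>N V l. (xprod q V {u} * c V W + (\<Sum>v\<in>W. G V v * c (insert u (V - {v})) (insert u (W - {v})))) * B (V - W))"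
      proof (intro sum.cong refl)
        fix W assume "W \<in> N V l"
        then have W: "W \<subseteq> V" "card W = l" by (auto simp: N_def)
        have "c (insert u (V - {v})) (insert u (W - {v})) =
          xprod q (V - W) (insert u (W - {v})) * zero_weight q s (insert u (W - {v})) * yprod s (V - W)"
          if "v \<in> W" for v
        proof -
          have "insert u (V - {v}) - insert u (W - {v}) = V - W" using V that W by auto
          then show ?thesis by (simp add: c_def)
        qed
        then have e: "(\<Sum>v\<in>W. G V v * c (insert u (V - {v})) (insert u (W - {v}))) =
          (\<Sum>v\<in>W. (1 - q) * u / (u - v) * xprod q (V - {v}) {v} *
           (xprod q (V - W) (insert u (W - {v})) * zero_weight q s (insert u (W - {v})) * yprod s (V - W)))"
          using W by (intro sum.cong refl) (simp add: G_def)
        have un: "(V - W) \<union> W = V" using W by auto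
        have "(1 - s * q ^ card W * u) / (1 - s * u) * c V W * xprod q (V - W) {u} =
          xprod q V {u} * c V W + (\<Sum>v\<in>W. G V v * c (insert u (V - {v})) (insert u (W - {v})))"
          unfolding e unfolding c_def by (rule empty_entry_identity_column[of "V - W" W u s q, unfolded un]) (use fin[OF W(1)] V W in auto)
        then show "(1 - s * q ^ l * u) / (1 - s * u) * c V W * xprod q (V - W) {u} * B (V - W) =
          (xprod q V {u} * c V W + (\<Sum>v\<in>W. G V v * c (insert u (V - {v})) (insert u (W - {v})))) * B (V - W)"
          unfolding W(2) by simp
      qed
      also have "(\<Sum>W\<in>N V (Suc l). ((1 - s * q ^ l * u) / (1 - s * u) * (\<Sum>v\<in>W. c V (W - {v}) * G (insert v (V - W)) v)
            + (1 - s\<^sup>2 * q ^ l) * u / (1 - s * u) * c V W) * B (insert u (V - W))) =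
         (\<Sum>W\<in>N V (Suc l). (\<Sum>v\<in>W. G V v * c (insert u (V - {v})) (W - {v})) * B (insert u (V - W)))"
      proof (intro sum.cong refl)
        fix W assume "W \<in> N V (Suc l)"
        then have W: "W \<subseteq> V" "card W = Suc l" by (auto simp: N_def)
        have "c (insert u (V - {v})) (W - {v}) =
          xprod q (insert u (V - W)) (W - {v}) * zero_weight q s (W - {v}) * yprod s (insert u (V - W))"
          if "v \<in> W" for v
        proof -
          have "insert u (V - {v}) - (W - {v}) = insert u (V - W)" using V that W by auto
          then show ?thesis by (simp add: c_def)
        qed
        then have e: "(\<Sum>v\<in>W. G V v * c (insert u (V - {v})) (W - {v})) =
          (\<Sum>v\<in>W. (1 - q) * u / (u - v) * xprod q ((V - W) \<union> W - {v}) {v} *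
           (xprod q (insert u (V - W)) (W - {v}) * zero_weight q s (W - {v}) * yprod s (insert u (V - W))))"
          using W by (intro sum.cong refl) (simp add: G_def Un_absorb2)
        have e': "(\<Sum>v\<in>W. c V (W - {v}) * G (insert v (V - W)) v) = (\<Sum>v\<in>W. xprod q (insert v (V - W)) (W - {v}) *
         zero_weight q s (W - {v}) * yprod s (insert v (V - W)) * ((1 - q) * u / (u - v) * xprod q (V - W) {v}))"
          by (intro sum.cong refl cG W)
        have "(1 - s * q ^ l * u) / (1 - s * u) * (\<Sum>v\<in>W. c V (W - {v}) * G (insert v (V - W)) v)
            + (1 - s\<^sup>2 * q ^ l) * u / (1 - s * u) * c V W = (\<Sum>v\<in>W. G V v * c (insert u (V - {v})) (W - {v}))"
          unfolding e e' unfolding c_def by (rule empty_entry_identity_beyond) (use V W fin[OF W(1)] fin nq in auto)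
        then show "((1 - s * q ^ l * u) / (1 - s * u) * (\<Sum>v\<in>W. c V (W - {v}) * G (insert v (V - W)) v)
            + (1 - s\<^sup>2 * q ^ l) * u / (1 - s * u) * c V W) * B (insert u (V - W)) =
          (\<Sum>v\<in>W. G V v * c (insert u (V - {v})) (W - {v})) * B (insert u (V - W))" by simp
      qed
      finally have LHS: "row_transfer q s u False (\<lambda>g. bethe_occ q s g V) (l # ls) =
        (\<Sum>W\<in>N V l. (xprod q V {u} * c V W + (\<Sum>v\<in>W. G V v * c (insert u (V - {v})) (insert u (W - {v})))) * B (V - W)) +
        (\<Sum>W\<in>N V (Suc l). (\<Sum>v\<in>W. G V v * c (insert u (V - {v})) (W - {v})) * B (insert u (V - W)))" .
      \<comment> \<open>The right-hand side, split by whether \<open>u\<close> belongs to the first column. The condition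
        \<open>Suc (card W) = l\<close> makes the second sum empty for \<open>l = 0\<close>.\<close>
      have N_ins: "(\<Sum>W\<in>N (insert u (V - {v})) l. c (insert u (V - {v})) W * B (insert u (V - {v}) - W)) =
         (\<Sum>W\<in>N (V - {v}) l. c (insert u (V - {v})) W * B (insert u (V - {v} - W))) +
         (\<Sum>W | W \<subseteq> V - {v} \<and> Suc (card W) = l. c (insert u (V - {v})) (insert u W) * B (V - {v} - W))" for v
      proof -
        have d1: "insert u (V - {v}) - insert u W = V - {v} - W" for W using V by auto
        have d2: "insert u (V - {v}) - W = insert u (V - {v} - W)" if "W \<subseteq> V - {v}" for W using V that by auto
        show ?thesis
        proof (cases l)
          case 0
          have "N V' 0 = {{}}" if "finite V'" for V' using that by (auto simp: N_def dest: finite_subset)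
          then show ?thesis using V 0 by simp
        next
          case (Suc m)
          have "(\<Sum>W\<in>N (insert u (V - {v})) l. c (insert u (V - {v})) W * B (insert u (V - {v}) - W)) =
            (\<Sum>W\<in>N (V - {v}) l. c (insert u (V - {v})) W * B (insert u (V - {v}) - W)) +
            (\<Sum>W\<in>N (V - {v}) m. c (insert u (V - {v})) (insert u W) * B (insert u (V - {v}) - insert u W))"
            unfolding N_def Suc by (rule subsets_insert) (use V in auto)
          then show ?thesis unfolding d1 using d2 Suc by (simp add: N_def cong: conj_cong)
        qed
      qed
      have s1: "(\<Sum>v\<in>V. G V v * (\<Sum>W\<in>N (V - {v}) l. c (insert u (V - {v})) W * B (insert u (V - {v} - W)))) =
         (\<Sum>W\<in>N V (Suc l). (\<Sum>v\<in>W. G V v * c (insert u (V - {v})) (W - {v})) * B (insert u (V - W)))"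
      proof -
        have "(\<Sum>v\<in>V. G V v * (\<Sum>W\<in>N (V - {v}) l. c (insert u (V - {v})) W * B (insert u (V - {v} - W)))) =
          (\<Sum>W\<in>N V (Suc l). \<Sum>v\<in>W. G V v * c (insert u (V - {v})) (W - {v}) * B (insert u (V - {v} - (W - {v}))))"
          unfolding N_def sum_distrib_left mult.assoc by (rule sum_subset_first[OF V(1)])
        also have "\<dots> = (\<Sum>W\<in>N V (Suc l). (\<Sum>v\<in>W. G V v * c (insert u (V - {v})) (W - {v})) * B (insert u (V - W)))"
          unfolding sum_distrib_right
        proof (intro sum.cong refl)
          fix W v assume "W \<in> N V (Suc l)" "v \<in> W"
          then have "V - {v} - (W - {v}) = V - W" by auto
          then show "G V v * c (insert u (V - {v})) (W - {v}) * B (insert u (V - {v} - (W - {v}))) =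
            G V v * c (insert u (V - {v})) (W - {v}) * B (insert u (V - W))" by simp
        qed
        finally show ?thesis .
      qed
      have s2: "(\<Sum>v\<in>V. G V v * (\<Sum>W | W \<subseteq> V - {v} \<and> Suc (card W) = l. c (insert u (V - {v})) (insert u W) * B (V - {v} - W))) =
         (\<Sum>W\<in>N V l. (\<Sum>v\<in>W. G V v * c (insert u (V - {v})) (insert u (W - {v}))) * B (V - W))"
      proof (cases l)
        case 0
        have "N V 0 = {{}}" using V by (auto simp: N_def dest: finite_subset)
        then show ?thesis using 0 by simp
      next
        case (Suc m)
        have "(\<Sum>v\<in>V. G V v * (\<Sum>W | W \<subseteq> V - {v} \<and> Suc (card W) = l. c (insert u (V - {v})) (insert u W) * B (V - {v} - W))) =
          (\<Sum>W\<in>N V l. \<Sum>v\<in>W. G V v * c (insert u (V - {v})) (insert u (W - {v})) * B (V - {v} - (W - {v})))"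
          unfolding N_def sum_distrib_left mult.assoc Suc nat.inject by (rule sum_subset_first[OF V(1)])
        also have "\<dots> = (\<Sum>W\<in>N V l. (\<Sum>v\<in>W. G V v * c (insert u (V - {v})) (insert u (W - {v}))) * B (V - W))"
          unfolding sum_distrib_right
        proof (intro sum.cong refl)
          fix W v assume "W \<in> N V l" "v \<in> W"
          then have "V - {v} - (W - {v}) = V - W" by auto
          then show "G V v * c (insert u (V - {v})) (insert u (W - {v})) * B (V - {v} - (W - {v})) =
            G V v * c (insert u (V - {v})) (insert u (W - {v})) * B (V - W)" by simp
        qed
        finally show ?thesis .
      qed
      show ?thesis
      proof -
        have "(\<Sum>v\<in>V. G V v * bethe_occ q s (l # ls) (insert u (V - {v}))) =
          (\<Sum>W\<in>N V (Suc l). (\<Sum>v\<in>W. G V v * c (insert u (V - {v})) (W - {v})) * B (insert u (V - W))) +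
          (\<Sum>W\<in>N V l. (\<Sum>v\<in>W. G V v * c (insert u (V - {v})) (insert u (W - {v}))) * B (V - W))"
          unfolding occ B_def[symmetric] N_ins distrib_left sum.distrib s1 s2 ..
        moreover have "xprod q V {u} * bethe_occ q s (l # ls) V = (\<Sum>W\<in>N V l. xprod q V {u} * c V W * B (V - W))"
          unfolding occ B_def by (simp add: sum_distrib_left mult.assoc)
        moreover have G_eq: "(1 - q) * u / (u - v) * xprod q (K - {v}) {v} = G K v" for K v
          by (simp add: G_def)
        ultimately show ?thesis unfolding LHS G_eq
          by (simp only: distrib_right sum.distrib add_ac)
      qed
    qed
    ultimately show ?case ..
  qed
  then show "?B ls V" "?A ls V" by auto
qed

section \<open>Partition functions of path configurations\<close>

text \<open>
  The horizontal edges of a row are determined by its vertical edges and by the number \<open>j\<close> of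
  paths that enter from the left, because paths are conserved at every vertex. The weight is
  \<open>0\<close> when conservation fails or when a path leaves the row on the right.
\<close>
fun row_weight :: "real \<Rightarrow> real \<Rightarrow> complex \<Rightarrow> nat \<Rightarrow> nat list \<Rightarrow> nat list \<Rightarrow> complex" where
  "row_weight q s u j [] [] = (if j = 0 then 1 else 0)"
| "row_weight q s u j (g # gs) (l # ls) =
     (if l \<le> g + j then vertex_weight q s u g j l (g + j - l) * row_weight q s u (g + j - l) gs ls else 0)"
| "row_weight q s u j _ _ = 0"

lemma row_weight_eq_prod:
  assumes "length gs = length ls" "\<forall>x<length ls. gs ! x + h x = ls ! x + h (Suc x)" "h (length ls) = 0"
  shows "row_weight q s u (h 0) gs ls =
    (\<Prod>x<length ls. vertex_weight q s u (gs ! x) (h x) (ls ! x) (h (Suc x)))"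
  using assms
proof (induction gs ls arbitrary: h rule: list_induct2')
  case (4 g gs l ls)
  have a: "g + h 0 = l + h (Suc 0)" using 4(3) by (metis length_Cons nth_Cons_0 zero_less_Suc)
  have "row_weight q s u (h (Suc 0)) gs ls =
    (\<Prod>x<length ls. vertex_weight q s u (gs ! x) (h (Suc x)) (ls ! x) (h (Suc (Suc x))))"
    using 4(1)[of "\<lambda>x. h (Suc x)"] 4(2-4) by fastforce
  moreover have "g + h 0 - l = h (Suc 0)" "l \<le> g + h 0" using a by auto
  ultimately show ?case by (simp add: prod.lessThan_Suc_shift del: prod.lessThan_Suc)
qed auto

lemma row_weight_nonzero:
  assumes "row_weight q s u j gs ls \<noteq> 0"
  shows "\<exists>h. h 0 = j \<and> (\<forall>x<length ls. gs ! x + h x = ls ! x + h (Suc x)) \<and> (\<forall>x\<ge>length ls. h x = 0)"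
    and "sum_list gs + j = sum_list ls"
  using assms
proof (induction q s u j gs ls rule: row_weight.induct)
  case (2 q s u j g gs l ls)
  {
    case 1
    then have le: "l \<le> g + j" and nz: "row_weight q s u (g + j - l) gs ls \<noteq> 0" by (auto split: if_splits)
    then obtain h where h: "h 0 = g + j - l" "\<forall>x<length ls. gs ! x + h x = ls ! x + h (Suc x)"
       "\<forall>x\<ge>length ls. h x = 0" using 2 by blast
    define h' where "h' = (\<lambda>x. case x of 0 \<Rightarrow> j | Suc x \<Rightarrow> h x)"
    have "(g # gs) ! x + h' x = (l # ls) ! x + h' (Suc x)" if "x < length (l # ls)" for x
      using that h le by (cases x) (auto simp: h'_def)
    moreover have "h' x = 0" if "x \<ge> length (l # ls)" for x
      using that h by (cases x) (auto simp: h'_def)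
    ultimately show ?case by (intro exI[of _ h']) (auto simp: h'_def)
  next
    case 2
    then have le: "l \<le> g + j" and nz: "row_weight q s u (g + j - l) gs ls \<noteq> 0" by (auto split: if_splits)
    then have "sum_list gs + (g + j - l) = sum_list ls" using "2.IH" by blast
    then show ?case using le by simp
  }
qed (auto split: if_splits)

text \<open>
  Given the upper occupation number \<open>l\<close> of the first column and at most one path from the
  left, at most one path leaves to the right, so the lower occupation number is \<open>l\<close>, \<open>l + 1\<close>
  or \<open>l - 1\<close>; these are the terms of the recursion. The bound \<open>B\<close> only serves to make the sum
  finite.
\<close>
lemma row_transfer_eq_sum:
  assumes "set ls \<subseteq> {..<B}"
  shows "row_transfer (of_real q) (of_real s) u j S ls =
     (\<Sum>gs | length gs = length ls \<and> set gs \<subseteq> {..B}. S gs * row_weight q s u (if j then 1 else 0) gs ls)"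
  using assms
proof (induction ls arbitrary: S j)
  case Nil
  have "{gs :: nat list. length gs = length [] \<and> set gs \<subseteq> {..B}} = {[]}" by auto
  then show ?case by (cases j) simp_all
next
  case (Cons l ls)
  define A where "A = {gs :: nat list. length gs = length ls \<and> set gs \<subseteq> {..B}}"
  have A: "{gs :: nat list. length gs = length (l # ls) \<and> set gs \<subseteq> {..B}} = (\<lambda>(g, gs). g # gs) ` ({..B} \<times> A)"
    by (auto simp: A_def image_iff length_Suc_conv)
  have fA: "finite A" using finite_lists_length_eq[of "{..B}" "length ls"] by (simp add: A_def conj_commute)
  define J where "J = (if j then 1 else 0 :: nat)"
  have l: "l < B" using Cons by auto
  define T where "T = (\<lambda>g. \<Sum>gs\<in>A. S (g # gs) * row_weight q s u J (g # gs) (l # ls))"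
  have "(\<Sum>gs | length gs = length (l # ls) \<and> set gs \<subseteq> {..B}. S gs * row_weight q s u J gs (l # ls))
    = (\<Sum>(g, gs)\<in>{..B} \<times> A. S (g # gs) * row_weight q s u J (g # gs) (l # ls))"
    unfolding A by (subst sum.reindex) (auto simp: inj_on_def case_prod_unfold)
  also have "\<dots> = (\<Sum>g\<le>B. T g)"
    unfolding T_def by (rule sum.cartesian_product[symmetric])
  also have "\<dots> = (\<Sum>g\<in>{l - 1, l, Suc l}. T g)"
  proof (rule sum.mono_neutral_right)
    show "\<forall>g\<in>{..B} - {l - 1, l, Suc l}. T g = 0"
    proof
      fix g assume g: "g \<in> {..B} - {l - 1, l, Suc l}"
      have ne: "g \<noteq> l" "g \<noteq> Suc l" "Suc g \<noteq> l" using g by auto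
      have "vertex_weight q s u g J l (g + J - l) = 0" if le: "l \<le> g + J"
      proof (cases j)
        case True
        then have "J = 1" "g + J - l \<noteq> 1" "g + J - l \<noteq> 0" using ne le by (auto simp: J_def)
        then show ?thesis by (simp add: vertex_weight_def)
      next
        case False
        then have "J = 0" "g - l \<noteq> 0" "g - l \<noteq> 1" using ne le by (auto simp: J_def)
        then show ?thesis by (simp add: vertex_weight_def)
      qed
      then show "T g = 0" unfolding T_def by (cases "l \<le> g + J") simp_all
    qed
  qed (use l in auto)
  also have "\<dots> = row_transfer (of_real q) (of_real s) u j S (l # ls)"
  proof -
    have IH: "(\<Sum>gs\<in>A. S (g # gs) * (c * row_weight q s u (if j' then 1 else 0) gs ls)) =
       c * row_transfer (of_real q) (of_real s) u j' (\<lambda>gs. S (g # gs)) ls" for g c j'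
      using Cons.IH[of j' "\<lambda>gs. S (g # gs)"] Cons.prems by (simp add: A_def sum_distrib_left mult_ac)
    show ?thesis
    proof (cases j)
      case True
      have "T (Suc l) = 0" unfolding T_def J_def using True by (intro sum.neutral) (auto simp: vertex_weight_def)
      moreover have "T l = (u - s * q ^ l) / (1 - s * u) * row_transfer (of_real q) (of_real s) u True (\<lambda>gs. S (l # gs)) ls"
        unfolding IH[of l _ True, symmetric] T_def J_def using True by (simp add: vertex_weight_def)
      moreover have "l \<noteq> 0 \<Longrightarrow> T (l - 1) = (1 - q ^ l) / (1 - s * u) * row_transfer (of_real q) (of_real s) u False (\<lambda>gs. S ((l - 1) # gs)) ls"
        unfolding IH[of "l - 1" _ False, symmetric] T_def J_def using True by (simp add: vertex_weight_def)
      ultimately show ?thesis using True by (cases l) simp_all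
    next
      case False
      have "l \<noteq> 0 \<Longrightarrow> T (l - 1) = 0" unfolding T_def J_def using False by (intro sum.neutral) (auto simp: vertex_weight_def)
      moreover have "T l = (1 - s * q ^ l * u) / (1 - s * u) * row_transfer (of_real q) (of_real s) u False (\<lambda>gs. S (l # gs)) ls"
        unfolding IH[of l _ False, symmetric] T_def J_def using False by (simp add: vertex_weight_def)
      moreover have "T (Suc l) = (1 - s\<^sup>2 * q ^ l) * u / (1 - s * u) * row_transfer (of_real q) (of_real s) u True (\<lambda>gs. S (Suc l # gs)) ls"
        unfolding IH[of "Suc l" _ True, symmetric] T_def J_def using False by (simp add: vertex_weight_def)
      ultimately show ?thesis using False by (cases l) simp_all
    qed
  qed
  finally show ?case unfolding J_def ..
qed

text \<open>
  The configurations with prescribed occupation numbers \<open>c\<close> at the top, where \<open>c\<close> is any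
  function, in particular one given by a list that is indexed by columns.
\<close>
definition row_configs :: "nat \<Rightarrow> (nat \<Rightarrow> nat) \<Rightarrow> ((nat \<Rightarrow> nat \<Rightarrow> nat) \<times> (nat \<Rightarrow> nat \<Rightarrow> nat)) set" where
  "row_configs N c = {(v, h).
     (\<forall>y\<in>{1..N}. h 0 y = 1) \<and>
     (\<forall>x. v x 0 = 0) \<and>
     (\<forall>x. v x N = c x) \<and>
     (\<forall>x. \<forall>y\<in>{1..N}. v x (y - 1) + h x y = v x y + h (x + 1) y) \<and>
     (\<forall>x y. y > N \<longrightarrow> v x y = 0) \<and>
     (\<forall>x y. y \<notin> {1..N} \<longrightarrow> h x y = 0)}"

lemma row_configs_conserve:
  assumes "(v, h) \<in> row_configs N c" "Suc y \<le> N"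
  shows "v x y + h x (Suc y) = v x (Suc y) + h (Suc x) (Suc y)"
proof -
  have "\<forall>y\<in>{1..N}. v x (y - 1) + h x y = v x y + h (x + 1) y"
    using assms(1) by (simp add: row_configs_def)
  from bspec[OF this, of "Suc y"] show ?thesis using assms(2) by simp
qed

text \<open>
  In each of the first \<open>y\<close> rows one path enters; it is now either left of column \<open>X\<close> or has
  crossed into it.
\<close>
lemma row_configs_flux:
  assumes "(v, h) \<in> row_configs N c" "y \<le> N"
  shows "(\<Sum>x<X. v x y) + (\<Sum>i\<in>{1..y}. h X i) = y"
  using assms(2)
proof (induction y)
  case 0
  then show ?case using assms(1) by (simp add: row_configs_def)
next
  case (Suc y)
  have cons: "v x y + h x (Suc y) = v x (Suc y) + h (Suc x) (Suc y)" for x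
    using row_configs_conserve[OF assms(1)] Suc.prems by simp
  have h0: "h 0 (Suc y) = 1" using assms(1) Suc.prems by (auto simp: row_configs_def)
  have "(\<Sum>x<X. v x (Suc y)) + h X (Suc y) = (\<Sum>x<X. v x y) + 1"
  proof (induction X)
    case (Suc X) then show ?case using cons[of X] by simp
  qed (simp add: h0)
  then show ?case using Suc by simp
qed

lemma row_configs_support:
  assumes vh: "(v, h) \<in> row_configs N c" and c: "\<forall>x\<ge>L. c x = 0" "(\<Sum>x<L. c x) = N"
  shows "x \<ge> L \<Longrightarrow> h x y = 0" "x \<ge> L \<Longrightarrow> v x y = 0" "v x y \<le> N" "h x y \<le> N"
proof -
  have vN: "v x N = c x" for x using vh by (auto simp: row_configs_def)
  show h0: "h x y = 0" if x: "x \<ge> L" for x y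
  proof (cases "y \<in> {1..N}")
    case True
    have "(\<Sum>x<x. c x) = (\<Sum>x<L. c x)"
      using x c by (intro sum.mono_neutral_right) auto
    then have "(\<Sum>i\<in>{1..N}. h x i) = 0" using row_configs_flux[OF vh order.refl, of x] c by (simp add: vN)
    then show ?thesis using True by simp
  next
    case False then show ?thesis using vh by (auto simp: row_configs_def)
  qed
  show le: "v x y \<le> N" for x y
  proof (cases "y \<le> N")
    case True
    have "v x y \<le> (\<Sum>x<Suc x. v x y)" by simp
    then show ?thesis using row_configs_flux[OF vh True, of "Suc x"] True by linarith
  next
    case False then show ?thesis using vh by (auto simp: row_configs_def)
  qed
  show "h x y \<le> N"
  proof (cases "y \<in> {1..N}")
    case True
    have "h x y \<le> (\<Sum>i\<in>{1..N}. h x i)" using True by (intro member_le_sum) auto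
    then show ?thesis using row_configs_flux[OF vh order.refl, of x] by linarith
  next
    case False then show ?thesis using vh by (auto simp: row_configs_def)
  qed
  show "v x y = 0" if x: "x \<ge> L" for x y
  proof (cases "y \<le> N")
    case True
    then show ?thesis
    proof (induction y)
      case 0 then show ?case using vh by (auto simp: row_configs_def)
    next
      case (Suc y)
      have "v x y + h x (Suc y) = v x (Suc y) + h (Suc x) (Suc y)"
        using row_configs_conserve[OF vh] Suc.prems by simp
      then show ?case using Suc h0[OF x] by simp
    qed
  next
    case False then show ?thesis using vh by (auto simp: row_configs_def)
  qed
qed

lemma finite_row_configs:
  assumes c: "\<forall>x\<ge>L. c x = 0" "(\<Sum>x<L. c x) = N"
  shows "finite (row_configs N c)"
proof -
  define D where "D = {f :: nat \<times> nat \<Rightarrow> nat. \<forall>p. (p \<in> {..<L} \<times> {..N} \<longrightarrow> f p \<in> {..N}) \<and> (p \<notin> {..<L} \<times> {..N} \<longrightarrow> f p = 0)}"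
  have "finite D" unfolding D_def by (rule finite_set_of_finite_funs) auto
  moreover have "row_configs N c \<subseteq> (\<lambda>(f, g). (curry f, curry g)) ` (D \<times> D)"
  proof (safe)
    fix v h assume vh: "(v, h) \<in> row_configs N c"
    note sup = row_configs_support[OF vh c]
    have "y > N \<Longrightarrow> v x y = 0" "y > N \<Longrightarrow> h x y = 0" for x y using vh by (auto simp: row_configs_def)
    then have "case_prod v \<in> D" "case_prod h \<in> D" using sup by (auto simp: D_def not_less not_le)
    then have "(case_prod v, case_prod h) \<in> D \<times> D" by simp
    moreover have "(v, h) = (\<lambda>(f, g). (curry f, curry g)) (case_prod v, case_prod h)" by simp
    ultimately show "(v, h) \<in> (\<lambda>(f, g). (curry f, curry g)) ` (D \<times> D)" by (rule rev_image_eqI)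
  qed
  ultimately show ?thesis by (meson finite_SigmaI finite_imageI finite_subset)
qed

definition occ_fun :: "nat list \<Rightarrow> nat \<Rightarrow> nat" where
  "occ_fun ls x = (if x < length ls then ls ! x else 0)"

lemma occ_fun_sum: "(\<forall>x\<ge>length ls. occ_fun ls x = 0)" "(\<Sum>x<length ls. occ_fun ls x) = sum_list ls"
  by (auto simp: occ_fun_def sum_list_sum_nth atLeast0LessThan)

definition partition_fun :: "real \<Rightarrow> real \<Rightarrow> nat list \<Rightarrow> complex list \<Rightarrow> complex" where
  "partition_fun q s ls us = (\<Sum>(v, h)\<in>row_configs (length us) (occ_fun ls).
     \<Prod>y\<in>{1..length us}. \<Prod>x<length ls.
        vertex_weight q s (us ! (y - 1)) (v x (y - 1)) (h x y) (v x y) (h (x + 1) y))"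

text \<open>
  A configuration of \<open>N + 1\<close> rows is one of \<open>N\<close> rows together with its top row, and the
  horizontal edges of the top row are determined by the vertical edges around it.
\<close>
lemma row_fiber:
  fixes us :: "complex list"
  assumes len: "length gs = length ls" and h: "h 0 = 1"
    "\<forall>x<length ls. gs ! x + h x = ls ! x + h (Suc x)" "\<forall>x\<ge>length ls. h x = 0"
  defines "N \<equiv> length us"
  shows "bij_betw (\<lambda>(v, k). (\<lambda>x y. if y = Suc N then occ_fun ls x else v x y, \<lambda>x y. if y = Suc N then h x else k x y))
    (row_configs N (occ_fun gs)) {(v, k) \<in> row_configs (Suc N) (occ_fun ls). \<forall>x. v x N = occ_fun gs x}"
proof -
  have hx: "occ_fun gs x + h x = occ_fun ls x + h (Suc x)" for x
    using h len by (auto simp: occ_fun_def)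
  show ?thesis
  proof (rule bij_betw_byWitness[where f' = "\<lambda>(v, k). (\<lambda>x y. if y = Suc N then 0 else v x y, \<lambda>x y. if y = Suc N then 0 else k x y)"], goal_cases)
    case 1
    show ?case by (auto simp: row_configs_def fun_eq_iff)
  next
    case 2
    have "v x (Suc N) = occ_fun ls x" "k x (Suc N) = h x"
      if vk: "(v, k) \<in> row_configs (Suc N) (occ_fun ls)" and vN: "\<forall>x. v x N = occ_fun gs x" for v k x
    proof -
      show v1: "v x (Suc N) = occ_fun ls x" for x using vk by (auto simp: row_configs_def)
      have k0: "k 0 (Suc N) = 1" using vk by (auto simp: row_configs_def)
      have cons: "v x N + k x (Suc N) = v x (Suc N) + k (Suc x) (Suc N)" for x
        using row_configs_conserve[OF vk] by simp
      show "k x (Suc N) = h x"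
      proof (induction x)
        case 0 then show ?case using k0 h by simp
      next
        case (Suc x) then show ?case using cons[of x] hx[of x] v1 vN by simp
      qed
    qed
    then show ?case by (auto simp: fun_eq_iff)
  next
    case 3
    show ?case using hx h by (auto simp: row_configs_def)
  next
    case 4
    show ?case by (auto simp: row_configs_def)
  qed
qed

text \<open>
  The configurations are grouped by the occupation numbers \<open>gs\<close> of the vertical edges below
  the top row.
\<close>
lemma partition_fun_snoc:
  assumes sum: "sum_list ls = Suc (length us)" and B: "length us < B"
  shows "partition_fun q s ls (us @ [u]) =
    (\<Sum>gs | length gs = length ls \<and> set gs \<subseteq> {..B}. partition_fun q s gs us * row_weight q s u 1 gs ls)"
proof -
  define N where "N = length us"
  define A where "A = {gs :: nat list. length gs = length ls \<and> set gs \<subseteq> {..B}}"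
  define C where "C = row_configs (Suc N) (occ_fun ls)"
  define wt where "wt = (\<lambda>ls us (v, h). \<Prod>y\<in>{1..length us}. \<Prod>x<length (ls :: nat list).
        vertex_weight q s (us ! (y - 1)) (v x (y - 1)) (h x y) (v x y) (h (x + 1) y))"
  \<comment> \<open>The occupation numbers just below the top row.\<close>
  define top where "top = (\<lambda>(v :: nat \<Rightarrow> nat \<Rightarrow> nat, h :: nat \<Rightarrow> nat \<Rightarrow> nat). map (\<lambda>x. v x N) [0..<length ls])"
  have oc: "\<forall>x\<ge>length ls. occ_fun ls x = 0" "(\<Sum>x<length ls. occ_fun ls x) = Suc N"
    using occ_fun_sum[of ls] sum by (auto simp: N_def)
  have fC: "finite C" unfolding C_def by (rule finite_row_configs[OF oc])
  have fA: "finite A" using finite_lists_length_eq[of "{..B}" "length ls"] by (simp add: A_def conj_commute)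
  have topA: "top ` C \<subseteq> A"
  proof -
    have "v x N \<le> B" if "(v, h) \<in> C" for v h x
      using row_configs_support(3)[OF that[unfolded C_def] oc, of x N] B N_def by simp
    then show ?thesis by (auto simp: top_def A_def)
  qed
  have fib: "{p \<in> C. top p = gs} = {(v, h) \<in> C. \<forall>x. v x N = occ_fun gs x}" if gs: "gs \<in> A" for gs
  proof -
    have "top (v, h) = gs \<longleftrightarrow> (\<forall>x. v x N = occ_fun gs x)" if vh: "(v, h) \<in> C" for v h
    proof -
      have v0: "v x N = 0" if "x \<ge> length ls" for x
        using row_configs_support(2)[OF vh[unfolded C_def] oc that] .
      have len: "length gs = length ls" using gs by (simp add: A_def)
      have "top (v, h) = gs \<longleftrightarrow> (\<forall>x<length ls. v x N = gs ! x)"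
        unfolding top_def list_eq_iff_nth_eq using len by simp
      also have "\<dots> \<longleftrightarrow> (\<forall>x. v x N = occ_fun gs x)"
      proof (intro iffI allI)
        fix x assume a: "\<forall>x<length ls. v x N = gs ! x"
        show "v x N = occ_fun gs x"
        proof (cases "x < length ls")
          case True then show ?thesis using a len by (simp add: occ_fun_def)
        next
          case False then show ?thesis using v0[of x] len by (simp add: occ_fun_def)
        qed
      next
        fix x assume a: "\<forall>x. v x N = occ_fun gs x"
        show "x < length ls \<longrightarrow> v x N = gs ! x" using a len by (simp add: occ_fun_def)
      qed
      finally show ?thesis .
    qed
    then show ?thesis by blast
  qed
  have "partition_fun q s ls (us @ [u]) = (\<Sum>p\<in>C. wt ls (us @ [u]) p)"
    by (simp add: partition_fun_def wt_def C_def N_def)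
  also have "\<dots> = (\<Sum>gs\<in>A. \<Sum>p\<in>{p \<in> C. top p = gs}. wt ls (us @ [u]) p)"
    by (rule sum.group[OF fC fA topA, symmetric])
  also have "\<dots> = (\<Sum>gs\<in>A. partition_fun q s gs us * row_weight q s u 1 gs ls)"
  proof (rule sum.cong[OF refl])
    fix gs assume gs: "gs \<in> A"
    then have len: "length gs = length ls" by (simp add: A_def)
    show "(\<Sum>p\<in>{p \<in> C. top p = gs}. wt ls (us @ [u]) p) = partition_fun q s gs us * row_weight q s u 1 gs ls"
    proof (cases "\<exists>h. h 0 = 1 \<and> (\<forall>x<length ls. gs ! x + h x = ls ! x + h (Suc x)) \<and> (\<forall>x\<ge>length ls. h x = 0)")
      case True
      then obtain h where h: "h 0 = 1" "\<forall>x<length ls. gs ! x + h x = ls ! x + h (Suc x)" "\<forall>x\<ge>length ls. h x = 0"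
        by blast
      define E where "E = (\<lambda>(v, k). (\<lambda>x y. if y = Suc N then occ_fun ls x else v x y, \<lambda>x y. if y = Suc N then h x else k x y))"
      have "(\<Sum>p\<in>{p \<in> C. top p = gs}. wt ls (us @ [u]) p) = (\<Sum>p\<in>row_configs N (occ_fun gs). wt ls (us @ [u]) (E p))"
        unfolding fib[OF gs] unfolding C_def E_def N_def
        by (rule sum.reindex_bij_betw[symmetric, OF row_fiber[OF len h, of us]])
      also have "\<dots> = (\<Sum>p\<in>row_configs N (occ_fun gs). wt gs us p * row_weight q s u 1 gs ls)"
      proof (rule sum.cong[OF refl])
        fix p assume "p \<in> row_configs N (occ_fun gs)"
        then obtain v k where p: "p = (v, k)" "(v, k) \<in> row_configs N (occ_fun gs)" by (cases p) auto
        have vN: "v x N = occ_fun gs x" for x using p by (auto simp: row_configs_def)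
        have "wt ls (us @ [u]) (E p) = (\<Prod>y\<in>{1..N}. \<Prod>x<length ls.
            vertex_weight q s (us ! (y - 1)) (v x (y - 1)) (k x y) (v x y) (k (x + 1) y)) *
            (\<Prod>x<length ls. vertex_weight q s u (gs ! x) (h x) (ls ! x) (h (Suc x)))"
        proof -
          have "wt ls (us @ [u]) (E p) = (\<Prod>y\<in>{1..N}. \<Prod>x<length ls.
             vertex_weight q s ((us @ [u]) ! (y - 1)) (fst (E p) x (y - 1)) (snd (E p) x y) (fst (E p) x y) (snd (E p) (x + 1) y)) *
             (\<Prod>x<length ls. vertex_weight q s u (fst (E p) x N) (snd (E p) x (Suc N)) (fst (E p) x (Suc N)) (snd (E p) (Suc x) (Suc N)))"
            by (simp add: wt_def N_def split_beta nth_append)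
          also have "(\<Prod>x<length ls. vertex_weight q s u (fst (E p) x N) (snd (E p) x (Suc N)) (fst (E p) x (Suc N)) (snd (E p) (Suc x) (Suc N)))
            = (\<Prod>x<length ls. vertex_weight q s u (gs ! x) (h x) (ls ! x) (h (Suc x)))"
            by (rule prod.cong) (use len in \<open>auto simp: E_def p vN occ_fun_def\<close>)
          also have "(\<Prod>y\<in>{1..N}. \<Prod>x<length ls.
             vertex_weight q s ((us @ [u]) ! (y - 1)) (fst (E p) x (y - 1)) (snd (E p) x y) (fst (E p) x y) (snd (E p) (x + 1) y)) =
            (\<Prod>y\<in>{1..N}. \<Prod>x<length ls.
            vertex_weight q s (us ! (y - 1)) (v x (y - 1)) (k x y) (v x y) (k (x + 1) y))"
            by (intro prod.cong refl) (auto simp: E_def p nth_append N_def)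
          finally show ?thesis .
        qed
        also have "(\<Prod>x<length ls. vertex_weight q s u (gs ! x) (h x) (ls ! x) (h (Suc x))) = row_weight q s u 1 gs ls"
          using row_weight_eq_prod[OF len h(2), of q s u] h by simp
        finally show "wt ls (us @ [u]) (E p) = wt gs us p * row_weight q s u 1 gs ls"
          by (simp add: wt_def p len N_def)
      qed
      finally show ?thesis by (simp add: partition_fun_def wt_def sum_distrib_right N_def)
    next
      case False
      have "{p \<in> C. top p = gs} = {}"
      proof (rule ccontr)
        assume "{p \<in> C. top p = gs} \<noteq> {}"
        then obtain v k where vk: "(v, k) \<in> C" "\<forall>x. v x N = occ_fun gs x" unfolding fib[OF gs] by auto
        have "v x N + k x (Suc N) = v x (Suc N) + k (Suc x) (Suc N)" for x
          using row_configs_conserve[OF vk(1)[unfolded C_def]] by simp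
        moreover have "v x (Suc N) = occ_fun ls x" "k 0 (Suc N) = 1" for x using vk(1) by (auto simp: row_configs_def C_def)
        moreover have "k x (Suc N) = 0" if "x \<ge> length ls" for x
          using row_configs_support(1)[OF vk(1)[unfolded C_def] oc that] .
        ultimately show False using False vk(2) len
          by (auto dest!: spec[of _ "\<lambda>x. k x (Suc N)"] simp: occ_fun_def) (metis)
      qed
      moreover have "row_weight q s u 1 gs ls = 0" using row_weight_nonzero(1)[of q s u 1 gs ls] False by blast
      ultimately show ?thesis by (simp only: sum.empty mult_zero_right)
    qed
  qed
  finally show ?thesis unfolding A_def .
qed

text \<open>
  The signature with the given occupation numbers, built so that removing the first column
  subtracts \<open>1\<close> from all remaining parts.
\<close>
fun parts_of_occ :: "nat list \<Rightarrow> nat list" where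
  "parts_of_occ [] = []"
| "parts_of_occ (l # ls) = map Suc (parts_of_occ ls) @ replicate l 0"

lemma length_parts_of_occ [simp]: "length (parts_of_occ ls) = sum_list ls"
  by (induction ls) auto

lemma parts_of_occ_count:
  fixes \<mu> :: "nat list"
  assumes "sorted_wrt (\<ge>) \<mu>" "\<forall>p\<in>set \<mu>. p < L"
  shows "parts_of_occ (map (count_list \<mu>) [0..<L]) = \<mu>"
proof -
  have sorted: "sorted_wrt (\<ge>) (parts_of_occ ls)" for ls
  proof (induction ls)
    case (Cons l ls)
    have "sorted_wrt (\<ge>) (replicate l (0 :: nat))" by (induction l) auto
    then show ?case using Cons by (auto simp: sorted_wrt_append sorted_wrt_map)
  qed simp
  have count: "count_list (parts_of_occ ls) x = occ_fun ls x" for ls x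
  proof (induction ls arbitrary: x)
    case (Cons l ls)
    have "count_list (map Suc xs) x = (case x of 0 \<Rightarrow> 0 | Suc y \<Rightarrow> count_list xs y)" for xs x
      by (induction xs) (auto split: nat.splits)
    moreover have "count_list (replicate l 0) x = (if x = 0 then l else 0)" for l and x :: nat
      by (induction l) auto
    ultimately show ?case using Cons by (auto simp: occ_fun_def split: nat.splits)
  qed (simp add: occ_fun_def)
  let ?p = "parts_of_occ (map (count_list \<mu>) [0..<L])"
  have "count_list \<mu> x = 0" if "\<not> x < L" for x using assms(2) that by (auto simp: count_list_0_iff)
  then have "mset ?p = mset \<mu>"
    by (intro multiset_eqI) (auto simp: count_mset count occ_fun_def)
  then have "mset (rev ?p) = mset (rev \<mu>)" by simp
  moreover have "sorted (rev ?p)" "sorted (rev \<mu>)" using sorted assms(1) by (simp_all add: sorted_wrt_rev)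
  ultimately have "rev ?p = rev \<mu>" by (metis properties_for_sort)
  then show ?thesis by simp
qed

lemma bethe_shift:
  assumes "finite V" "card V = length \<theta>"
  shows "bethe q s (map Suc \<theta>) V = yprod s V * bethe q s \<theta> V"
  using assms
proof (induction \<theta> arbitrary: V)
  case (Cons t \<theta>)
  have "yprod s V = (u - s) / (1 - s * u) * yprod s (V - {u})" if "u \<in> V" for u
    using yprod_insert[of "V - {u}" u s] Cons that by (simp add: insert_absorb)
  moreover have "bethe q s (map Suc \<theta>) (V - {u}) = yprod s (V - {u}) * bethe q s \<theta> (V - {u})" if "u \<in> V" for u
    using Cons that by auto
  ultimately show ?case
    by (simp add: sum_distrib_left) (intro sum.cong refl, simp)
qed (simp add: yprod_def)

text \<open>
  In a signature the zeros come last, so \<open>bethe_append\<close> splits the parameters of the first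
  column off.
\<close>
lemma bethe_occ_eq:
  assumes "finite V" "card V = sum_list ls" "0 \<notin> V" "\<forall>v\<in>V. 1 - s * v \<noteq> 0"
  shows "bethe_occ q s ls V = bethe q s (parts_of_occ ls) V"
  using assms
proof (induction ls arbitrary: V)
  case (Cons l ls)
  note V = Cons.prems
  have fin: "finite K" if "K \<subseteq> V" for K using that V finite_subset by auto
  have "bethe q s (parts_of_occ (l # ls)) V = (\<Sum>K | K \<subseteq> V \<and> card K = sum_list ls.
      xprod q K (V - K) * bethe q s (map Suc (parts_of_occ ls)) K * bethe q s (replicate l 0) (V - K))"
    using bethe_append[OF V(1), of q s "map Suc (parts_of_occ ls)" "replicate l 0"] by simp
  also have "\<dots> = (\<Sum>W | W \<subseteq> V \<and> card W = l.
      xprod q (V - W) W * zero_weight q s W * yprod s (V - W) * bethe_occ q s ls (V - W))"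
  proof (rule sum.reindex_bij_witness[of _ "\<lambda>W. V - W" "\<lambda>K. V - K"])
    fix K assume K: "K \<in> {K. K \<subseteq> V \<and> card K = sum_list ls}"
    then have c: "card (V - K) = l" using V by (simp add: card_Diff_subset fin)
    then have "bethe q s (replicate l 0) (V - K) = zero_weight q s (V - K)"
      using bethe_zeros[of "V - K" s q] V by auto
    moreover have "bethe_occ q s ls K = bethe q s (parts_of_occ ls) K"
      by (rule Cons.IH) (use K V fin in auto)
    then have "bethe q s (map Suc (parts_of_occ ls)) K = yprod s K * bethe_occ q s ls K"
      using K fin bethe_shift[of K "parts_of_occ ls" q s] by auto
    moreover have "V - (V - K) = K" using K by auto
    ultimately show "xprod q (V - (V - K)) (V - K) * zero_weight q s (V - K) * yprod s (V - (V - K)) * bethe_occ q s ls (V - (V - K)) =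
      xprod q K (V - K) * bethe q s (map Suc (parts_of_occ ls)) K * bethe q s (replicate l 0) (V - K)" by simp
  qed (use V fin in \<open>auto simp: card_Diff_subset\<close>)
  finally show ?case by simp
qed simp

text \<open>
  The parameters for which no denominator in the Bethe sum and in its derivation vanishes.
\<close>
definition generic :: "real \<Rightarrow> complex list \<Rightarrow> bool" where
  "generic s us \<longleftrightarrow> distinct us \<and> (\<forall>u\<in>set us. u \<noteq> 0 \<and> u \<noteq> of_real s \<and> 1 - of_real s * u \<noteq> 0)"

lemma partition_fun_eq_bethe:
  assumes q: "0 < q" "q < 1" and g: "generic s us" and len: "sum_list ls = length us"
  shows "partition_fun q s ls us = bethe (of_real q) (of_real s) (parts_of_occ ls) (set us)"
  using g len
proof (induction us arbitrary: ls rule: rev_induct)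
  case Nil
  then have "ls = replicate (length ls) 0" by (auto intro: replicate_eqI)
  have z: "occ_fun ls x = 0" for x using Nil by (auto simp: occ_fun_def)
  have "row_configs 0 (occ_fun ls) = {(\<lambda>x y. 0, \<lambda>x y. 0)}"
    using z by (auto simp: row_configs_def fun_eq_iff) (metis gr0I)
  moreover have "parts_of_occ ls = []" using Nil length_parts_of_occ[of ls] by (metis length_0_conv list.size(3))
  ultimately show ?case by (simp add: partition_fun_def)
next
  case (snoc u us)
  let ?q = "complex_of_real q" and ?s = "complex_of_real s"
  have gu: "generic s us" and u: "u \<notin> set us" "u \<noteq> 0" "1 - ?s * u \<noteq> 0" using snoc.prems by (auto simp: generic_def)
  have nq: "1 - ?q ^ Suc l \<noteq> 0" for l
  proof
    assume "1 - ?q ^ Suc l = 0"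
    then have "?q ^ Suc l = of_real 1" by simp
    then have "q ^ Suc l = 1" unfolding of_real_power[symmetric] of_real_eq_iff .
    moreover have "q ^ Suc l < 1" using q by (intro power_Suc_less_one) auto
    ultimately show False by simp
  qed
  define B where "B = Suc (Suc (length us))"
  have "x \<le> sum_list ls" if "x \<in> set ls" for x using that member_le_sum_list by blast
  then have B: "set ls \<subseteq> {..<B}" using snoc.prems(2) by (auto simp: B_def intro!: le_imp_less_Suc)
  have "partition_fun q s ls (us @ [u]) =
    (\<Sum>gs | length gs = length ls \<and> set gs \<subseteq> {..B}. partition_fun q s gs us * row_weight q s u 1 gs ls)"
    by (rule partition_fun_snoc) (use snoc.prems in \<open>auto simp: B_def\<close>)
  also have "\<dots> = (\<Sum>gs | length gs = length ls \<and> set gs \<subseteq> {..B}.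
     bethe_occ ?q ?s gs (set us) * row_weight q s u (if True then 1 else 0) gs ls)"
  proof (rule sum.cong[OF refl])
    fix gs
    show "partition_fun q s gs us * row_weight q s u 1 gs ls =
      bethe_occ ?q ?s gs (set us) * row_weight q s u (if True then 1 else 0) gs ls"
    proof (cases "row_weight q s u 1 gs ls = 0")
      case False
      then have sum: "sum_list gs = length us" using row_weight_nonzero(2)[OF False] snoc.prems by simp
      have "bethe_occ ?q ?s gs (set us) = bethe ?q ?s (parts_of_occ gs) (set us)"
        by (rule bethe_occ_eq) (use gu sum in \<open>auto simp: generic_def distinct_card\<close>)
      then show ?thesis using snoc.IH[OF gu sum] by simp
    qed simp
  qed
  also have "\<dots> = row_transfer ?q ?s u True (\<lambda>gs. bethe_occ ?q ?s gs (set us)) ls"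
    by (rule row_transfer_eq_sum[OF B, symmetric])
  also have "\<dots> = bethe_occ ?q ?s ls (insert u (set us))"
    by (rule row_transfer_bethe(1)[OF nq]) (use gu u in \<open>auto simp: generic_def\<close>)
  also have "\<dots> = bethe ?q ?s (parts_of_occ ls) (set (us @ [u]))"
    using bethe_occ_eq[of "set (us @ [u])" ls ?s ?q] snoc.prems distinct_card[of "us @ [u]"]
    by (auto simp: generic_def)
  finally show ?case .
qed

text \<open>
  The Bethe sum is built row by row: \<open>partition_fun_snoc\<close> isolates the top row, and
  \<open>row_transfer_bethe\<close> evaluates it.
\<close>
theorem F_fun_eq_bethe:
  assumes q: "0 < q" "q < 1" and g: "generic s us" and mu: "\<mu> \<in> signatures (length us)"
  shows "F_fun q s \<mu> us = bethe (of_real q) (of_real s) \<mu> (set us)"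
proof -
  define L where "L = Suc (hd \<mu>)"
  define ls where "ls = map (count_list \<mu>) [0..<L]"
  have sorted: "sorted_wrt (\<ge>) \<mu>" and len: "length \<mu> = length us" using mu by (auto simp: signatures_def)
  have lt: "p < L" if "p \<in> set \<mu>" for p using sorted that by (cases \<mu>) (auto simp: L_def)
  have parts: "parts_of_occ ls = \<mu>" unfolding ls_def by (rule parts_of_occ_count) (use sorted lt in auto)
  have sum: "sum_list ls = length us" using length_parts_of_occ[of ls] parts len by simp
  have "count_list \<mu> x = 0" if "\<not> x < L" for x using lt that by (auto simp: count_list_0_iff)
  then have occ: "occ_fun ls = count_list \<mu>" by (auto simp: occ_fun_def ls_def fun_eq_iff)
  have "arrow_configs \<mu> = row_configs (length us) (occ_fun ls)"
    unfolding arrow_configs_def row_configs_def occ len ..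
  then have "F_fun q s \<mu> us = partition_fun q s ls us"
    unfolding F_fun_def partition_fun_def by (simp add: len ls_def L_def lessThan_Suc_atMost)
  then show ?thesis using partition_fun_eq_bethe[OF q g sum] parts by simp
qed

section \<open>Inserting a part into a signature\<close>

fun insert_part :: "nat \<Rightarrow> nat list \<Rightarrow> nat list" where
  "insert_part m [] = [m]"
| "insert_part m (h # \<theta>) = (if m > h then m # h # \<theta> else h # insert_part m \<theta>)"

text \<open>
  With the sign and the powers of \<open>s\<close> absorbed, the dependence on a part \<open>t\<close> is
  \<open>(zfac s u) ^ t\<close>, and the assumption that \<open>|s (u - s) / (1 - s u)| < 1\<close> becomes
  \<open>|zfac s u| < 1\<close>.
\<close>
definition bethe_s :: "complex \<Rightarrow> complex \<Rightarrow> nat list \<Rightarrow> complex set \<Rightarrow> complex" where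
  "bethe_s q s \<theta> U = (- s) ^ sum_list \<theta> * bethe q s \<theta> U"

definition bethe_coeff :: "complex \<Rightarrow> complex \<Rightarrow> complex set \<Rightarrow> complex \<Rightarrow> complex" where
  "bethe_coeff q s U u = (1 - q) / (1 - s * u) * (\<Prod>w\<in>U - {u}. cross q u w)"

definition zfac :: "complex \<Rightarrow> complex \<Rightarrow> complex" where
  "zfac s u = - s * ((u - s) / (1 - s * u))"

lemma bethe_s_Nil [simp]: "bethe_s q s [] U = 1"
  by (simp add: bethe_s_def)

lemma bethe_s_Cons:
  "bethe_s q s (t # \<theta>) U = (\<Sum>u\<in>U. bethe_coeff q s U u * zfac s u ^ t * bethe_s q s \<theta> (U - {u}))"
proof -
  have "zfac s u ^ t = (- s) ^ t * ((u - s) / (1 - s * u)) ^ t" for u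
    by (simp only: zfac_def power_mult_distrib)
  then show ?thesis unfolding bethe_s_def bethe.simps sum_distrib_left
    by (intro sum.cong refl) (simp add: bethe_coeff_def power_add mult_ac)
qed

lemma zfac_rel:
  assumes "1 - s * u \<noteq> 0"
  shows "zfac s u - s\<^sup>2 = - s * u * (1 - zfac s u)"
proof -
  have "zfac s u * (1 - s * u) = - s * (u - s)" using assms by (simp add: zfac_def)
  then have "zfac s u = - s * (u - s) + zfac s u * (s * u)" by (simp add: algebra_simps)
  then show ?thesis by (simp add: algebra_simps power2_eq_square)
qed

lemma zfac_step:
  assumes "1 - s * u \<noteq> 0"
  shows "zfac s u ^ Suc C - s\<^sup>2 * zfac s u ^ C = - s * u * (zfac s u ^ C - zfac s u ^ Suc C)"
proof -
  have "zfac s u ^ Suc C - s\<^sup>2 * zfac s u ^ C = (zfac s u - s\<^sup>2) * zfac s u ^ C" by (simp add: algebra_simps)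
  then show ?thesis unfolding zfac_rel[OF assms] by (simp add: algebra_simps)
qed

text \<open>
  The weights \<open>1\<close> and \<open>s\<^sup>2\<close> are such that the geometric sums cancel the denominator \<open>1 - s u\<close>
  of the one-particle factor.
\<close>
lemma zfac_geometric:
  assumes nz: "1 - s * u \<noteq> 0"
  shows "(\<Sum>m\<le>C. zfac s u ^ m) - s\<^sup>2 * (\<Sum>m<C. zfac s u ^ m) = (1 - s * u) + s * u * zfac s u ^ C"
proof (induction C)
  case (Suc C)
  have "(\<Sum>m\<le>Suc C. zfac s u ^ m) - s\<^sup>2 * (\<Sum>m<Suc C. zfac s u ^ m) =
     ((\<Sum>m\<le>C. zfac s u ^ m) - s\<^sup>2 * (\<Sum>m<C. zfac s u ^ m)) + (zfac s u ^ Suc C - s\<^sup>2 * zfac s u ^ C)"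
    by (simp add: algebra_simps)
  then show ?case unfolding Suc zfac_step[OF nz] by (simp add: algebra_simps)
qed simp

lemma zfac_geometric_between:
  assumes nz: "1 - s * u \<noteq> 0" and "c \<le> C"
  shows "(\<Sum>m\<in>{c<..C}. zfac s u ^ m) - s\<^sup>2 * (\<Sum>m\<in>{c..<C}. zfac s u ^ m) = - s * u * (zfac s u ^ c - zfac s u ^ C)"
  using assms(2)
proof (induction C rule: dec_induct)
  case (step C)
  have 1: "{c<..Suc C} = insert (Suc C) {c<..C}" "{c..<Suc C} = insert C {c..<C}" using step by auto
  have "(\<Sum>m\<in>{c<..Suc C}. zfac s u ^ m) - s\<^sup>2 * (\<Sum>m\<in>{c..<Suc C}. zfac s u ^ m) =
     ((\<Sum>m\<in>{c<..C}. zfac s u ^ m) - s\<^sup>2 * (\<Sum>m\<in>{c..<C}. zfac s u ^ m)) + (zfac s u ^ Suc C - s\<^sup>2 * zfac s u ^ C)"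
    unfolding 1 by (simp add: algebra_simps)
  then show ?case unfolding step.IH zfac_step[OF nz] by (simp add: algebra_simps)
qed simp

lemma insert_part_top:
  assumes "sorted_wrt (\<ge>) \<theta>" "\<forall>x\<in>set \<theta>. x \<le> m"
  shows "insert_part m \<theta> = m # \<theta>"
  using assms by (induction \<theta>) auto

lemma set_insert_part [simp]: "set (insert_part m \<theta>) = insert m (set \<theta>)"
  by (induction \<theta>) auto

lemma length_insert_part [simp]: "length (insert_part m \<theta>) = Suc (length \<theta>)"
  by (induction \<theta>) auto

lemma sorted_insert_part: "sorted_wrt (\<ge>) \<theta> \<Longrightarrow> sorted_wrt (\<ge>) (insert_part m \<theta>)"
  by (induction \<theta>) auto

lemma count_insert_part: "count_list (insert_part m \<theta>) j = count_list \<theta> j + (if j = m then 1 else 0)"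
  by (induction \<theta>) auto

definition n_ge :: "nat \<Rightarrow> nat list \<Rightarrow> nat" where "n_ge m \<theta> = length (filter (\<lambda>x. m \<le> x) \<theta>)"
definition n_gt :: "nat \<Rightarrow> nat list \<Rightarrow> nat" where "n_gt m \<theta> = length (filter (\<lambda>x. m < x) \<theta>)"

lemma n_ge_simps [simp]: "n_ge m [] = 0" "n_ge m (h # \<theta>) = (if m \<le> h then Suc (n_ge m \<theta>) else n_ge m \<theta>)"
  and n_gt_simps [simp]: "n_gt m [] = 0" "n_gt m (h # \<theta>) = (if m < h then Suc (n_gt m \<theta>) else n_gt m \<theta>)"
  by (simp_all add: n_ge_def n_gt_def)

lemma n_gt_0: "\<forall>x\<in>set \<theta>. x \<le> m \<Longrightarrow> n_gt m \<theta> = 0"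
  and n_ge_0: "\<forall>x\<in>set \<theta>. x < m \<Longrightarrow> n_ge m \<theta> = 0"
  by (auto simp: n_ge_def n_gt_def filter_empty_conv)

text \<open>
  Up to constants, the coefficients are those with which the part \<open>m\<close> enters the recursion for
  the moments (see \<open>insert_weight_c_factor\<close>). The sum is truncated at \<open>C\<close>. The two pieces have
  different ranges, so that the term \<open>m\<close> of the second one cancels against the term \<open>m + 1\<close> of
  the first one up to differences of successive powers, and the sum telescopes.
\<close>
definition insertion_sum :: "complex \<Rightarrow> complex \<Rightarrow> nat list \<Rightarrow> complex set \<Rightarrow> nat \<Rightarrow> complex" where
  "insertion_sum q s \<kappa> U C =
     (\<Sum>m\<le>C. bethe_s q s (insert_part m \<kappa>) U / q ^ Suc (n_ge m \<kappa>)) -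
     s\<^sup>2 * (\<Sum>m<C. bethe_s q s (insert_part m \<kappa>) U / q ^ Suc (n_gt m \<kappa>))"

lemma antisymmetric_sum_zero:
  fixes H :: "'a \<Rightarrow> 'a \<Rightarrow> complex"
  assumes "finite U" "\<And>u v. u \<in> U \<Longrightarrow> v \<in> U \<Longrightarrow> u \<noteq> v \<Longrightarrow> H u v = - H v u"
  shows "(\<Sum>u\<in>U. \<Sum>v\<in>U - {u}. H u v) = 0"
proof -
  define H' where "H' = (\<lambda>u v. if u = v then 0 else H u v)"
  have S: "(\<Sum>v\<in>U - {u}. H u v) = (\<Sum>v\<in>U. H' u v)" if "u \<in> U" for u
  proof -
    have "(\<Sum>v\<in>U - {u}. H u v) = (\<Sum>v\<in>U - {u}. H' u v)" by (intro sum.cong) (auto simp: H'_def)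
    also have "\<dots> = (\<Sum>v\<in>U. H' u v)" using assms(1) by (intro sum.mono_neutral_left) (auto simp: H'_def)
    finally show ?thesis .
  qed
  have "(\<Sum>u\<in>U. \<Sum>v\<in>U. H' u v) = (\<Sum>v\<in>U. \<Sum>u\<in>U. H' u v)" by (rule sum.swap)
  also have "\<dots> = (\<Sum>v\<in>U. \<Sum>u\<in>U. - H' v u)"
    by (intro sum.cong refl) (auto simp: H'_def intro: assms(2))
  also have "\<dots> = - (\<Sum>u\<in>U. \<Sum>v\<in>U. H' u v)" by (simp add: sum_negf)
  finally have "(\<Sum>u\<in>U. \<Sum>v\<in>U. H' u v) = 0" by (simp add: eq_neg_iff_add_eq_0)
  then show ?thesis using S by simp
qed

text \<open>
  Induction on \<open>\<kappa>\<close>. A part above the largest part \<open>c\<close> of \<open>c # \<kappa>\<close> becomes the new first part,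
  and these terms form a geometric sum between \<open>c\<close> and \<open>C\<close>; a smaller one is inserted into
  \<open>\<kappa>\<close>, with truncation at \<open>c\<close>, after the first parameter has been chosen. Both produce double
  sums over two parameters that go with the parts \<open>c, c\<close>. These cancel, because exchanging the
  two parameters changes the product of the cross factors only by \<open>(u - q v) / (q u - v)\<close>.
\<close>
lemma insertion_sum_eq:
  assumes "sorted_wrt (\<ge>) \<kappa>" "\<forall>x\<in>set \<kappa>. x \<le> C" and U: "finite U" "0 \<notin> U" "\<forall>u\<in>U. 1 - s * u \<noteq> 0" and q: "q \<noteq> 0"
  shows "insertion_sum q s \<kappa> U C = (1 - q ^ (card U - length \<kappa>)) / q ^ Suc (length \<kappa>) * bethe_s q s \<kappa> U +
    s / q * (\<Sum>u\<in>U. u * bethe_coeff q s U u * zfac s u ^ C * bethe_s q s \<kappa> (U - {u}))"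
  using assms(1-5)
proof (induction \<kappa> arbitrary: U C)
  case Nil
  have "insertion_sum q s [] U C = 1 / q * ((\<Sum>u\<in>U. bethe_coeff q s U u * (\<Sum>m\<le>C. zfac s u ^ m)) -
     s\<^sup>2 * (\<Sum>u\<in>U. bethe_coeff q s U u * (\<Sum>m<C. zfac s u ^ m)))"
    unfolding insertion_sum_def insert_part.simps bethe_s_Cons n_ge_simps n_gt_simps sum_divide_distrib[symmetric]
    by (subst (1 2) sum.swap) (simp add: sum_distrib_left diff_divide_distrib)
  also have "(\<Sum>u\<in>U. bethe_coeff q s U u * (\<Sum>m\<le>C. zfac s u ^ m)) -
     s\<^sup>2 * (\<Sum>u\<in>U. bethe_coeff q s U u * (\<Sum>m<C. zfac s u ^ m)) =
     (\<Sum>u\<in>U. bethe_coeff q s U u * ((\<Sum>m\<le>C. zfac s u ^ m) - s\<^sup>2 * (\<Sum>m<C. zfac s u ^ m)))"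
    by (simp add: sum_distrib_left sum_subtractf[symmetric] right_diff_distrib mult_ac)
  also have "\<dots> = (\<Sum>u\<in>U. (1 - q) * (\<Prod>w\<in>U - {u}. cross q u w) + s * (u * bethe_coeff q s U u * zfac s u ^ C))"
  proof (intro sum.cong refl)
    fix u assume "u \<in> U"
    then have nz: "1 - s * u \<noteq> 0" using Nil by auto
    show "bethe_coeff q s U u * ((\<Sum>m\<le>C. zfac s u ^ m) - s\<^sup>2 * (\<Sum>m<C. zfac s u ^ m)) =
      (1 - q) * (\<Prod>w\<in>U - {u}. cross q u w) + s * (u * bethe_coeff q s U u * zfac s u ^ C)"
      unfolding zfac_geometric[OF nz] distrib_left using nz by (simp add: bethe_coeff_def mult_ac)
  qed
  also have "\<dots> = (\<Sum>u\<in>U. (1 - q) * (\<Prod>w\<in>U - {u}. cross q u w)) +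
     s * (\<Sum>u\<in>U. u * bethe_coeff q s U u * zfac s u ^ C)"
    by (simp add: sum.distrib sum_distrib_left)
  finally show ?case using cross_sum[of U q] Nil by (simp add: distrib_left)
next
  case (Cons c \<kappa>)
  note U = Cons.prems(3-5)
  have sorted: "sorted_wrt (\<ge>) \<kappa>" "\<forall>x\<in>set \<kappa>. x \<le> c" "c \<le> C" using Cons.prems by auto
  let ?A = "bethe_coeff q s" and ?z = "zfac s" and ?p = "bethe_s q s"
  have up: "insert_part m (c # \<kappa>) = m # c # \<kappa>" "n_gt m (c # \<kappa>) = 0" if "c \<le> m" for m
    using insert_part_top[of "c # \<kappa>" m] n_gt_0[of "c # \<kappa>" m] sorted that by fastforce+
  have up': "n_ge m \<kappa> = 0" if "c < m" for m
    using n_ge_0[of \<kappa> m] sorted that by fastforce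
  have lin: "1 / q * (\<Sum>u\<in>U. A u * X u * P u) - k * (1 / q * (\<Sum>u\<in>U. A u * Y u * P u)) =
     1 / q * (\<Sum>u\<in>U. A u * (X u - k * Y u) * P u)" for A X Y P :: "complex \<Rightarrow> complex" and k
    by (simp add: right_diff_distrib left_diff_distrib sum_subtractf sum_distrib_left diff_divide_distrib mult_ac)
  have s1: "{..C} = {..c} \<union> {c<..C}" "{..<C} = {..<c} \<union> {c..<C}" using sorted by auto
  have "insertion_sum q s (c # \<kappa>) U C =
     ((\<Sum>m\<le>c. ?p (c # insert_part m \<kappa>) U / q ^ Suc (Suc (n_ge m \<kappa>))) -
     s\<^sup>2 * (\<Sum>m<c. ?p (c # insert_part m \<kappa>) U / q ^ Suc (Suc (n_gt m \<kappa>)))) +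
     ((\<Sum>m\<in>{c<..C}. ?p (m # c # \<kappa>) U / q) - s\<^sup>2 * (\<Sum>m\<in>{c..<C}. ?p (m # c # \<kappa>) U / q))"
  proof -
    have "(\<Sum>m\<le>C. ?p (insert_part m (c # \<kappa>)) U / q ^ Suc (n_ge m (c # \<kappa>))) =
      (\<Sum>m\<le>c. ?p (c # insert_part m \<kappa>) U / q ^ Suc (Suc (n_ge m \<kappa>))) + (\<Sum>m\<in>{c<..C}. ?p (m # c # \<kappa>) U / q)"
      unfolding s1(1) by (subst sum.union_disjoint) (auto simp: up' intro!: sum.cong arg_cong2[of _ _ _ _ "(+)"])
    moreover have "(\<Sum>m<C. ?p (insert_part m (c # \<kappa>)) U / q ^ Suc (n_gt m (c # \<kappa>))) =
      (\<Sum>m<c. ?p (c # insert_part m \<kappa>) U / q ^ Suc (Suc (n_gt m \<kappa>))) + (\<Sum>m\<in>{c..<C}. ?p (m # c # \<kappa>) U / q)"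
      unfolding s1(2) by (subst sum.union_disjoint)
        (auto simp: up simp del: n_gt_simps(2) insert_part.simps(2) intro!: sum.cong arg_cong2[of _ _ _ _ "(+)"], auto)
    ultimately show ?thesis unfolding insertion_sum_def by (simp add: algebra_simps)
  qed
  also have "(\<Sum>m\<in>{c<..C}. ?p (m # c # \<kappa>) U / q) - s\<^sup>2 * (\<Sum>m\<in>{c..<C}. ?p (m # c # \<kappa>) U / q) =
     1 / q * (\<Sum>u\<in>U. ?A U u * (- s * u * (?z u ^ c - ?z u ^ C)) * ?p (c # \<kappa>) (U - {u}))"
  proof -
    have sw: "(\<Sum>m\<in>M. ?p (m # c # \<kappa>) U / q) = 1 / q * (\<Sum>u\<in>U. ?A U u * (\<Sum>m\<in>M. ?z u ^ m) * ?p (c # \<kappa>) (U - {u}))" for M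
      unfolding bethe_s_Cons[of _ _ _ "c # \<kappa>"] sum_divide_distrib[symmetric]
      by (subst sum.swap) (simp add: sum_distrib_left sum_distrib_right sum_divide_distrib)
    have "1 / q * (\<Sum>u\<in>U. ?A U u * (\<Sum>m\<in>{c<..C}. ?z u ^ m) * ?p (c # \<kappa>) (U - {u})) -
       s\<^sup>2 * (1 / q * (\<Sum>u\<in>U. ?A U u * (\<Sum>m\<in>{c..<C}. ?z u ^ m) * ?p (c # \<kappa>) (U - {u}))) =
       1 / q * (\<Sum>u\<in>U. ?A U u * ((\<Sum>m\<in>{c<..C}. ?z u ^ m) - s\<^sup>2 * (\<Sum>m\<in>{c..<C}. ?z u ^ m)) * ?p (c # \<kappa>) (U - {u}))"
      by (rule lin)
    also have "\<dots> = 1 / q * (\<Sum>u\<in>U. ?A U u * (- s * u * (?z u ^ c - ?z u ^ C)) * ?p (c # \<kappa>) (U - {u}))"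
      using U zfac_geometric_between[OF _ sorted(3)] by simp
    finally show ?thesis unfolding sw .
  qed
  also have "(\<Sum>m\<le>c. ?p (c # insert_part m \<kappa>) U / q ^ Suc (Suc (n_ge m \<kappa>))) -
     s\<^sup>2 * (\<Sum>m<c. ?p (c # insert_part m \<kappa>) U / q ^ Suc (Suc (n_gt m \<kappa>))) =
     1 / q * (\<Sum>u\<in>U. ?A U u * ?z u ^ c * insertion_sum q s \<kappa> (U - {u}) c)"
  proof -
    have sw: "(\<Sum>m\<in>M. ?p (c # insert_part m \<kappa>) U / q ^ Suc (Suc (f m))) =
      1 / q * (\<Sum>u\<in>U. ?A U u * ?z u ^ c * (\<Sum>m\<in>M. ?p (insert_part m \<kappa>) (U - {u}) / q ^ Suc (f m)))" for M and f :: "nat \<Rightarrow> nat"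
      unfolding bethe_s_Cons sum_divide_distrib sum_distrib_left
      by (subst sum.swap) (simp add: mult_ac)
    show ?thesis unfolding sw insertion_sum_def
      using lin[where P = "\<lambda>_. 1"] by simp
  qed
  also have "(\<Sum>u\<in>U. ?A U u * ?z u ^ c * insertion_sum q s \<kappa> (U - {u}) c) =
    (\<Sum>u\<in>U. ?A U u * ?z u ^ c * ((1 - q ^ (card U - length (c # \<kappa>))) / q ^ length (c # \<kappa>) * ?p \<kappa> (U - {u}) +
       s / q * (\<Sum>v\<in>U - {u}. v * ?A (U - {u}) v * ?z v ^ c * ?p \<kappa> (U - {u} - {v}))))"
  proof (intro sum.cong refl)
    fix u assume u: "u \<in> U"
    have "card (U - {u}) - length \<kappa> = card U - length (c # \<kappa>)" using u U by simp
    then show "?A U u * ?z u ^ c * insertion_sum q s \<kappa> (U - {u}) c = ?A U u * ?z u ^ c *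
       ((1 - q ^ (card U - length (c # \<kappa>))) / q ^ length (c # \<kappa>) * ?p \<kappa> (U - {u}) +
       s / q * (\<Sum>v\<in>U - {u}. v * ?A (U - {u}) v * ?z v ^ c * ?p \<kappa> (U - {u} - {v})))"
      using Cons.IH[of c "U - {u}"] sorted U by simp
  qed
  also have "\<dots> = (1 - q ^ (card U - length (c # \<kappa>))) / q ^ length (c # \<kappa>) * ?p (c # \<kappa>) U +
     s / q * (\<Sum>u\<in>U. \<Sum>v\<in>U - {u}. v * (?A U u * ?z u ^ c * (?A (U - {u}) v * ?z v ^ c * ?p \<kappa> (U - {u} - {v}))))"
    by (simp only: bethe_s_Cons sum_distrib_left distrib_left sum.distrib mult_ac)
  also have "(\<Sum>u\<in>U. ?A U u * (- s * u * (?z u ^ c - ?z u ^ C)) * ?p (c # \<kappa>) (U - {u})) =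
     s * (\<Sum>u\<in>U. u * ?A U u * ?z u ^ C * ?p (c # \<kappa>) (U - {u})) -
     s * (\<Sum>u\<in>U. \<Sum>v\<in>U - {u}. u * (?A U u * ?z u ^ c * (?A (U - {u}) v * ?z v ^ c * ?p \<kappa> (U - {u} - {v}))))"
  proof -
    have "(\<Sum>u\<in>U. ?A U u * (- s * u * (?z u ^ c - ?z u ^ C)) * ?p (c # \<kappa>) (U - {u})) =
      s * (\<Sum>u\<in>U. u * ?A U u * ?z u ^ C * ?p (c # \<kappa>) (U - {u})) - s * (\<Sum>u\<in>U. u * (?A U u * ?z u ^ c * ?p (c # \<kappa>) (U - {u})))"
      by (simp add: sum_distrib_left sum_subtractf[symmetric] algebra_simps)
    then show ?thesis unfolding bethe_s_Cons[of _ _ _ _ "_ - _"] sum_distrib_left by simp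
  qed
  finally have main: "insertion_sum q s (c # \<kappa>) U C =
    1 / q * ((1 - q ^ (card U - length (c # \<kappa>))) / q ^ length (c # \<kappa>) * ?p (c # \<kappa>) U +
     s / q * (\<Sum>u\<in>U. \<Sum>v\<in>U - {u}. v * (?A U u * ?z u ^ c * (?A (U - {u}) v * ?z v ^ c * ?p \<kappa> (U - {u} - {v}))))) +
    1 / q * (s * (\<Sum>u\<in>U. u * ?A U u * ?z u ^ C * ?p (c # \<kappa>) (U - {u})) -
     s * (\<Sum>u\<in>U. \<Sum>v\<in>U - {u}. u * (?A U u * ?z u ^ c * (?A (U - {u}) v * ?z v ^ c * ?p \<kappa> (U - {u} - {v})))))" .
  \<comment> \<open>The sum of the antisymmetric \<open>H\<close> is the first double sum minus \<open>q\<close> times the second one.\<close>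
  define H where "H = (\<lambda>u v. (v - q * u) * (?A U u * ?z u ^ c * (?A (U - {u}) v * ?z v ^ c * ?p \<kappa> (U - {u} - {v}))))"
  have "(\<Sum>u\<in>U. \<Sum>v\<in>U - {u}. H u v) = 0"
  proof (rule antisymmetric_sum_zero[OF U(1)])
    fix u v assume uv: "u \<in> U" "v \<in> U" "u \<noteq> v"
    define R where "R = U - {u} - {v}"
    have A1: "?A U u * ?A (U - {u}) v = (1 - q) / (1 - s * u) * ((1 - q) / (1 - s * v)) * cross q u v *
       ((\<Prod>w\<in>R. cross q u w) * (\<Prod>w\<in>R. cross q v w))" if "u \<in> U" "v \<in> U" "u \<noteq> v" "R = U - {u} - {v}" for u v R
    proof -
      have "(\<Prod>w\<in>U - {u}. cross q u w) = cross q u v * (\<Prod>w\<in>R. cross q u w)"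
        using that U by (simp add: prod.remove[of "U - {u}" v])
      then show ?thesis using that by (simp add: bethe_coeff_def)
    qed
    have R': "U - {v} - {u} = R" unfolding R_def by auto
    have "(v - q * u) * cross q u v = - ((u - q * v) * cross q v u)"
      using uv unfolding cross_def by (simp add: divide_simps) (simp add: algebra_simps)
    moreover define E where "E = (1 - q) / (1 - s * u) * ((1 - q) / (1 - s * v)) * ((\<Prod>w\<in>R. cross q u w) * (\<Prod>w\<in>R. cross q v w))"
    have "?A U u * ?A (U - {u}) v = cross q u v * E" "?A U v * ?A (U - {v}) u = cross q v u * E"
      unfolding A1[OF uv R_def] A1[OF uv(2,1) uv(3)[symmetric] R'[symmetric]] E_def by (simp_all only: mult_ac)
    ultimately have "(v - q * u) * (?A U u * ?A (U - {u}) v) = - ((u - q * v) * (?A U v * ?A (U - {v}) u))"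
      by (simp only: mult.assoc[symmetric]) simp
    then have "(v - q * u) * (?A U u * ?A (U - {u}) v) * (?z u ^ c * ?z v ^ c * ?p \<kappa> R) =
       - ((u - q * v) * (?A U v * ?A (U - {v}) u)) * (?z u ^ c * ?z v ^ c * ?p \<kappa> R)" by simp
    then show "H u v = - H v u" unfolding H_def R_def[symmetric] R' by (simp add: mult_ac)
  qed
  then have "(\<Sum>u\<in>U. \<Sum>v\<in>U - {u}. v * (?A U u * ?z u ^ c * (?A (U - {u}) v * ?z v ^ c * ?p \<kappa> (U - {u} - {v})))) =
     q * (\<Sum>u\<in>U. \<Sum>v\<in>U - {u}. u * (?A U u * ?z u ^ c * (?A (U - {u}) v * ?z v ^ c * ?p \<kappa> (U - {u} - {v}))))"
    unfolding H_def left_diff_distrib sum_subtractf by (simp add: sum_distrib_left mult.assoc)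
  moreover have "1 / q * (a / b * p + s / q * (q * S)) + 1 / q * (s * T - s * S) = a / (q * b) * p + s / q * T" for a b p S T
    using q by (simp add: divide_simps) (simp add: algebra_simps)
  ultimately show ?case unfolding main by (simp only: power_Suc)
qed

section \<open>The observable\<close>

text \<open>
  A subset of the positions either contains the first one or not; removing the first entry of
  \<open>\<nu>\<close> lowers every chosen position by \<open>1\<close>, which costs one factor \<open>q\<close> for each of them.
\<close>
fun q_obs_rec :: "real \<Rightarrow> nat list \<Rightarrow> nat list \<Rightarrow> real" where
  "q_obs_rec q [] \<nu> = 1"
| "q_obs_rec q (h # \<eta>) [] = 0"
| "q_obs_rec q (h # \<eta>) (x # \<nu>) =
     q ^ Suc (length \<eta>) * (q_obs_rec q (h # \<eta>) \<nu> + (if h = x then q_obs_rec q \<eta> \<nu> else 0))"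

lemma sorted_list_image_Suc:
  assumes "finite I"
  shows "sorted_list_of_set (Suc ` I) = map Suc (sorted_list_of_set I)"
proof (rule sorted_distinct_set_unique)
  show "sorted (map Suc (sorted_list_of_set I))"
    by (simp add: sorted_map)
qed (use assms in \<open>auto simp: distinct_map\<close>)

lemma Q_obs_eq_rec: "Q_obs q \<eta> \<nu> = q_obs_rec q \<eta> \<nu>"
proof -
  define S where "S = (\<lambda>\<eta> \<nu>. {I. I \<subseteq> {1..length \<nu>} \<and> map (\<lambda>i. \<nu> ! (i - 1)) (sorted_list_of_set I) = (\<eta> :: nat list)})"
  define T where "T = (\<lambda>\<eta> \<nu>. \<Sum>I\<in>S \<eta> \<nu>. q ^ \<Sum>I)"
  have fin: "finite I" if "I \<in> S \<eta> \<nu>" for I \<eta> \<nu> using that finite_subset by (auto simp: S_def)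
  have cardS: "card I = length \<eta>" if "I \<in> S \<eta> \<nu>" for I \<eta> \<nu>
    using that by (metis (mono_tags, lifting) S_def length_map length_sorted_list_of_set mem_Collect_eq)
  have pos: "1 \<le> i" if "I \<in> S \<eta> \<nu>" "i \<in> I" for I i \<eta> \<nu> using that by (auto simp: S_def)
  have shift: "map (\<lambda>i. (x # \<nu>) ! (i - 1)) (sorted_list_of_set (Suc ` I)) = map (\<lambda>i. \<nu> ! (i - 1)) (sorted_list_of_set I)"
    if I: "I \<subseteq> {1..length \<nu>}" for I x and \<nu> :: "nat list"
  proof -
    have fI: "finite I" using I finite_subset by auto
    have "map (\<lambda>i. (x # \<nu>) ! (i - 1)) (map Suc (sorted_list_of_set I)) = map (\<lambda>i. (x # \<nu>) ! i) (sorted_list_of_set I)"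
      by simp
    also have "\<dots> = map (\<lambda>i. \<nu> ! (i - 1)) (sorted_list_of_set I)"
      using I fI by (intro map_cong refl) (auto simp: nth_Cons')
    finally show ?thesis unfolding sorted_list_image_Suc[OF fI] .
  qed
  have sub: "I \<subseteq> {1..Suc n} \<Longrightarrow> 1 \<notin> I \<Longrightarrow> \<exists>I'. I = Suc ` I' \<and> I' \<subseteq> {1..n}" for I n
  proof -
    assume I: "I \<subseteq> {1..Suc n}" "1 \<notin> I"
    have "I = Suc ` ((\<lambda>i. i - 1) ` I)" using I by (force simp: image_iff)
    moreover have "(\<lambda>i. i - 1) ` I \<subseteq> {1..n}"
    proof
      fix j assume "j \<in> (\<lambda>i. i - 1) ` I"
      then obtain i where i: "i \<in> I" "j = i - 1" by auto
      then have "i \<le> Suc n" "1 \<le> i" "i \<noteq> 1" using I by auto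
      then show "j \<in> {1..n}" using i by auto
    qed
    ultimately show ?thesis by blast
  qed
  \<comment> \<open>Subsets without and with the position \<open>1\<close>.\<close>
  have S_Cons: "S \<eta> (x # \<nu>) = (`) Suc ` S \<eta> \<nu> \<union>
     (case \<eta> of [] \<Rightarrow> {} | h # \<eta>' \<Rightarrow> if h = x then (\<lambda>I. insert 1 (Suc ` I)) ` S \<eta>' \<nu> else {})" for \<eta> x \<nu>
  proof (intro equalityI subsetI)
    fix I assume I: "I \<in> S \<eta> (x # \<nu>)"
    have fI: "finite I" using fin[OF I] .
    show "I \<in> (`) Suc ` S \<eta> \<nu> \<union>
     (case \<eta> of [] \<Rightarrow> {} | h # \<eta>' \<Rightarrow> if h = x then (\<lambda>I. insert 1 (Suc ` I)) ` S \<eta>' \<nu> else {})"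
    proof (cases "1 \<in> I")
      case False
      then obtain I' where I': "I = Suc ` I'" "I' \<subseteq> {1..length \<nu>}" using sub[of I "length \<nu>"] I by (auto simp: S_def)
      then have "I' \<in> S \<eta> \<nu>" using I shift[OF I'(2), of x] by (simp add: S_def)
      then show ?thesis using I' by auto
    next
      case True
      obtain I' where I': "I - {1} = Suc ` I'" "I' \<subseteq> {1..length \<nu>}"
        using sub[of "I - {1}" "length \<nu>"] I by (auto simp: S_def)
      have "Min I = 1" using True fI pos[OF I] by (intro Min_eqI) auto
      then have sl: "sorted_list_of_set I = 1 # sorted_list_of_set (I - {1})"
        using sorted_list_of_set_nonempty[OF fI] True by auto
      have "\<eta> = map (\<lambda>i. (x # \<nu>) ! (i - 1)) (sorted_list_of_set I)" using I by (simp add: S_def)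
      also have "\<dots> = x # map (\<lambda>i. (x # \<nu>) ! (i - 1)) (sorted_list_of_set (Suc ` I'))"
        unfolding sl I'(1) by simp
      finally have "\<eta> = x # map (\<lambda>i. \<nu> ! (i - 1)) (sorted_list_of_set I')"
        unfolding shift[OF I'(2)] .
      moreover have "I' \<in> S (map (\<lambda>i. \<nu> ! (i - 1)) (sorted_list_of_set I')) \<nu>" using I' by (simp add: S_def)
      moreover have "I = insert 1 (Suc ` I')" using True I' by auto
      ultimately show ?thesis by auto
    qed
  next
    fix I assume "I \<in> (`) Suc ` S \<eta> \<nu> \<union>
     (case \<eta> of [] \<Rightarrow> {} | h # \<eta>' \<Rightarrow> if h = x then (\<lambda>I. insert 1 (Suc ` I)) ` S \<eta>' \<nu> else {})"
    then consider I' where "I = Suc ` I'" "I' \<in> S \<eta> \<nu>"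
      | \<eta>' I' where "\<eta> = x # \<eta>'" "I = insert 1 (Suc ` I')" "I' \<in> S \<eta>' \<nu>"
      by (auto split: list.splits if_splits)
    then show "I \<in> S \<eta> (x # \<nu>)"
    proof cases
      case 1
      then show ?thesis using shift[of I' \<nu> x] by (auto simp: S_def)
    next
      case 2
      have fI: "finite I" using 2(2) fin[OF 2(3)] by simp
      have sub: "I' \<subseteq> {1..length \<nu>}" using 2(3) by (simp add: S_def)
      have "0 \<notin> I'" using sub by auto
      have "Min I = 1" using 2 fI by (intro Min_eqI) auto
      moreover have "I - {1} = Suc ` I'" using 2 sub by auto
      ultimately have "sorted_list_of_set I = 1 # sorted_list_of_set (Suc ` I')"
        using sorted_list_of_set_nonempty[OF fI] 2 by auto
      then show ?thesis using 2 shift[OF sub, of x] by (auto simp: S_def)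
    qed
  qed
  have sumSuc: "\<Sum>(Suc ` I) = \<Sum>I + card I" if "finite I" for I :: "nat set"
    using that by (simp add: sum.reindex sum.distrib flip: sum_constant) (simp add: sum_Suc)
  have inj1: "inj_on ((`) Suc) A" for A by (simp add: inj_on_def inj_image_eq_iff)
  have A: "(\<Sum>I\<in>(`) Suc ` S \<eta> \<nu>. q ^ \<Sum>I) = q ^ length \<eta> * T \<eta> \<nu>" for \<eta> \<nu>
    unfolding T_def sum_distrib_left by (subst sum.reindex[OF inj1]) (auto simp: sumSuc fin cardS power_add intro!: sum.cong)
  have finS: "finite (S \<eta> \<nu>)" for \<eta> \<nu> unfolding S_def by (rule finite_subset[of _ "Pow {1..length \<nu>}"]) auto
  have one: "1 \<notin> Suc ` I" if "I \<in> S \<eta> \<nu>" for I \<eta> \<nu>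
  proof
    assume "1 \<in> Suc ` I"
    then have "0 \<in> I" by auto
    then show False using pos[OF that] by auto
  qed
  have inj2: "inj_on (\<lambda>I. insert 1 (Suc ` I)) (S \<eta> \<nu>)" for \<eta> \<nu>
  proof (rule inj_onI)
    fix I I' assume I: "I \<in> S \<eta> \<nu>" "I' \<in> S \<eta> \<nu>" "insert 1 (Suc ` I) = insert 1 (Suc ` I')"
    then have "Suc ` I = Suc ` I'" using insert_ident[OF one[OF I(1)] one[OF I(2)]] by simp
    then show "I = I'" by (simp add: inj_image_eq_iff)
  qed
  have B: "(\<Sum>I\<in>(\<lambda>I. insert 1 (Suc ` I)) ` S \<eta> \<nu>. q ^ \<Sum>I) = q ^ Suc (length \<eta>) * T \<eta> \<nu>" for \<eta> \<nu>
  proof -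
    have "q ^ \<Sum>(insert 1 (Suc ` I)) = q ^ Suc (length \<eta>) * q ^ \<Sum>I" if I: "I \<in> S \<eta> \<nu>" for I
    proof -
      have "1 \<notin> Suc ` I" using one[OF I] .
      then have "\<Sum>(insert 1 (Suc ` I)) = Suc (\<Sum>I + length \<eta>)"
        using fin[OF I] cardS[OF I] by (simp add: sumSuc[unfolded One_nat_def])
      then show ?thesis by (simp add: power_add)
    qed
    then show ?thesis unfolding T_def sum_distrib_left by (subst sum.reindex[OF inj2]) (auto intro!: sum.cong)
  qed
  have T_Cons: "T (h # \<eta>) (x # \<nu>) = q ^ Suc (length \<eta>) * (T (h # \<eta>) \<nu> + (if h = x then T \<eta> \<nu> else 0))" for h \<eta> x \<nu>
  proof (cases "h = x")
    case True
    have "(`) Suc ` S (h # \<eta>) \<nu> \<inter> (\<lambda>I. insert 1 (Suc ` I)) ` S \<eta> \<nu> = {}"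
    proof -
      have "Suc ` I \<noteq> insert 1 (Suc ` I')" if "I \<in> S (h # \<eta>) \<nu>" for I I' using one[OF that] by (metis insertI1)
      then show ?thesis by blast
    qed
    then have "T (h # \<eta>) (x # \<nu>) = (\<Sum>I\<in>(`) Suc ` S (h # \<eta>) \<nu>. q ^ \<Sum>I) + (\<Sum>I\<in>(\<lambda>I. insert 1 (Suc ` I)) ` S \<eta> \<nu>. q ^ \<Sum>I)"
      unfolding T_def S_Cons using True finS by (simp add: sum.union_disjoint)
    then show ?thesis unfolding A B using True by (simp add: distrib_left)
  next
    case False
    then have "T (h # \<eta>) (x # \<nu>) = (\<Sum>I\<in>(`) Suc ` S (h # \<eta>) \<nu>. q ^ \<Sum>I)" unfolding T_def S_Cons by simp
    then show ?thesis unfolding A using False by simp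
  qed
  have S_Nil: "S [] \<nu> = {{}}" for \<nu> using finite_subset by (fastforce simp: S_def)
  have "T \<eta> \<nu> = q_obs_rec q \<eta> \<nu>"
  proof (induction \<nu> arbitrary: \<eta>)
    case Nil
    have "S (h # \<eta>) [] = {}" for h \<eta> by (auto simp: S_def)
    then show ?case by (cases \<eta>) (simp_all add: T_def S_Nil)
  next
    case (Cons x \<nu>)
    then show ?case by (cases \<eta>) (simp_all add: T_Cons, simp add: T_def S_Nil)
  qed
  then show ?thesis by (simp add: T_def S_def Q_obs_def)
qed

lemma q_obs_rec_zero:
  "\<not> set \<eta> \<subseteq> set \<nu> \<Longrightarrow> q_obs_rec q \<eta> \<nu> = 0" "length \<eta> > length \<nu> \<Longrightarrow> q_obs_rec q \<eta> \<nu> = 0"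
proof (induction q \<eta> \<nu> rule: q_obs_rec.induct)
  case (3 q h \<eta> x \<nu>)
  {
    case 1
    then obtain y where y: "y \<in> set (h # \<eta>)" "y \<noteq> x" "y \<notin> set \<nu>" by auto
    then have "q_obs_rec q (h # \<eta>) \<nu> = 0" using "3.IH"(1) by auto
    moreover have "h = x \<Longrightarrow> q_obs_rec q \<eta> \<nu> = 0" using "3.IH"(3) y by auto
    ultimately show ?case by auto
  next
    case 2
    then show ?case using "3.IH" by auto
  }
qed auto

lemma q_obs_rec_nonneg: "0 \<le> q \<Longrightarrow> q_obs_rec q \<eta> \<nu> \<ge> 0"
  by (induction q \<eta> \<nu> rule: q_obs_rec.induct) auto

lemma q_obs_rec_bound: "0 \<le> q \<Longrightarrow> q \<le> 1 \<Longrightarrow> q_obs_rec q \<eta> \<nu> \<le> 2 ^ length \<nu>"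
proof (induction q \<eta> \<nu> rule: q_obs_rec.induct)
  case (3 q h \<eta> x \<nu>)
  have "(if h = x then q_obs_rec q \<eta> \<nu> else 0) \<le> 2 ^ length \<nu>" using 3 by auto
  then have "q_obs_rec q (h # \<eta>) \<nu> + (if h = x then q_obs_rec q \<eta> \<nu> else 0) \<le> 2 ^ length \<nu> + 2 ^ length \<nu>"
    using 3 by (intro add_mono) auto
  moreover have "q ^ Suc (length \<eta>) \<le> 1" using 3 by (intro power_le_one) auto
  ultimately have "q ^ Suc (length \<eta>) * (q_obs_rec q (h # \<eta>) \<nu> + (if h = x then q_obs_rec q \<eta> \<nu> else 0)) \<le> 1 * (2 ^ length \<nu> + 2 ^ length \<nu>)"
    using q_obs_rec_nonneg 3(3) by (intro mult_mono) (auto intro!: add_nonneg_nonneg)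
  then show ?case by simp
qed auto

lemma q_obs_rec_full:
  assumes "length \<eta> = length \<nu>"
  shows "q_obs_rec q \<eta> \<nu> = (if \<eta> = \<nu> then q ^ (length \<nu> * (length \<nu> + 1) div 2) else 0)"
  using assms
proof (induction \<eta> \<nu> rule: list_induct2)
  case (Cons h \<eta> x \<nu>)
  have "Suc n * (Suc n + 1) div 2 = Suc n + n * (n + 1) div 2" for n
  proof -
    have "Suc n * (Suc n + 1) = 2 * Suc n + n * (n + 1)" by simp
    then show ?thesis by simp
  qed
  then have "q ^ (length (x # \<nu>) * (length (x # \<nu>) + 1) div 2) = q ^ Suc (length \<nu>) * q ^ (length \<nu> * (length \<nu> + 1) div 2)"
    by (simp only: length_Cons power_add)
  then show ?case using Cons by (auto simp: q_obs_rec_zero)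
qed simp

text \<open>
  The sum of \<open>q ^ (- p)\<close> over all positions \<open>p\<close> of the enlarged signature at which the removal
  of the entry gives back \<open>\<theta>\<close>.
\<close>
fun insert_weight :: "real \<Rightarrow> nat list \<Rightarrow> nat \<Rightarrow> real" where
  "insert_weight q [] m = 1 / q"
| "insert_weight q (h # \<theta>) m = ((if m \<ge> h then 1 else 0) + (if m \<le> h then insert_weight q \<theta> m else 0)) / q"

lemma insert_weight_nonneg: "0 \<le> q \<Longrightarrow> insert_weight q \<theta> m \<ge> 0"
  by (induction \<theta>) auto

lemma insert_weight_closed:
  assumes "sorted_wrt (\<ge>) \<theta>" "0 < q" "q < 1"
  shows "insert_weight q \<theta> m = (1 - q ^ Suc (count_list \<theta> m)) / ((1 - q) * q ^ Suc (n_ge m \<theta>))"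
  using assms(1)
proof (induction \<theta>)
  case Nil
  then show ?case using assms by simp
next
  case (Cons h \<theta>)
  consider "m > h" | "m < h" | "m = h" by linarith
  then show ?case
  proof cases
    case 1
    have "count_list \<theta> m = 0" "n_ge m \<theta> = 0"
      using Cons 1 by (fastforce simp: count_list_0_iff, intro n_ge_0, fastforce)
    then show ?thesis using 1 assms by simp
  next
    case 2
    then show ?thesis using Cons by (simp add: mult_ac)
  next
    case 3
    have "n_ge m \<theta> = count_list \<theta> m" using Cons.prems unfolding 3
    proof (induction \<theta>)
      case (Cons y \<theta>)
      then show ?case
        by (cases "y = h") (auto simp: count_list_0_iff intro!: n_ge_0)
    qed simp
    then have "insert_weight q \<theta> m = (1 - q ^ Suc (count_list \<theta> m)) / ((1 - q) * q ^ Suc (count_list \<theta> m))"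
      using Cons by simp
    moreover have "(1 + (1 - X) / ((1 - q) * X)) / q = (1 - q * X) / ((1 - q) * (q * X))" if "X \<noteq> 0" for X
      using assms that by (simp add: divide_simps) (simp add: algebra_simps)
    ultimately show ?thesis using 3 \<open>n_ge m \<theta> = count_list \<theta> m\<close> assms by simp
  qed
qed

text \<open>
  Adding a position \<open>i\<close> to the \<open>k\<close> chosen ones multiplies the summand of the observable by
  \<open>q ^ i\<close>, and the weight divides it by \<open>q ^ p\<close>, where \<open>p\<close> is the rank of \<open>i\<close> among the
  enlarged set of positions. The difference \<open>i - p\<close> counts the unchosen positions before \<open>i\<close>,
  hence runs through \<open>0, \<dots>, length \<nu> - k - 1\<close>.
\<close>
lemma sum_insert_q_obs:
  assumes "sorted_wrt (\<ge>) \<theta>" "sorted_wrt (\<ge>) \<nu>" "\<forall>x\<in>set \<nu>. x < B" and q: "0 < q"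
  shows "(\<Sum>m<B. insert_weight q \<theta> m * q_obs_rec q (insert_part m \<theta>) \<nu>) =
     (\<Sum>i<length \<nu> - length \<theta>. q ^ i) * q_obs_rec q \<theta> \<nu>"
  using assms(1-3)
proof (induction \<nu> arbitrary: \<theta>)
  case Nil
  have "q_obs_rec q (insert_part m \<theta>) [] = 0" for m by (rule q_obs_rec_zero) simp
  then show ?case by simp
next
  case (Cons x \<nu>)
  have nu: "sorted_wrt (\<ge>) \<nu>" "\<forall>y\<in>set \<nu>. y \<le> x" "x < B" "\<forall>y\<in>set \<nu>. y < B" using Cons.prems by auto
  have geo: "1 + q * (\<Sum>i<n. q ^ i) = (\<Sum>i<Suc n. q ^ i)" for n
    by (simp add: sum.lessThan_Suc_shift sum_distrib_left del: sum.lessThan_Suc)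
  show ?case
  proof (cases \<theta>)
    case Nil
    have IH: "(\<Sum>m<B. q_obs_rec q [m] \<nu> / q) = (\<Sum>i<length \<nu>. q ^ i)" using Cons.IH[of "[]"] nu by simp
    have "(\<Sum>m<B. insert_weight q \<theta> m * q_obs_rec q (insert_part m \<theta>) (x # \<nu>)) =
       q * (\<Sum>m<B. q_obs_rec q [m] \<nu> / q) + (\<Sum>m<B. if m = x then 1 else 0)"
      unfolding Nil sum_distrib_left sum.distrib[symmetric] using q
      by (intro sum.cong) auto
    also have "\<dots> = (\<Sum>i<Suc (length \<nu>). q ^ i)" unfolding IH geo[symmetric] using nu by simp
    finally show ?thesis using Nil by simp
  next
    case (Cons h \<theta>')
    note th = Cons
    define k where "k = length \<theta>"
    have sorted: "sorted_wrt (\<ge>) \<theta>'" "\<forall>y\<in>set \<theta>'. y \<le> h" using Cons.prems th by auto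
    show ?thesis
    proof (cases "h \<le> x")
      case False
      have "\<not> set \<theta> \<subseteq> set (x # \<nu>)" using False nu th by fastforce
      then have "q_obs_rec q \<theta> (x # \<nu>) = 0" "q_obs_rec q (insert_part m \<theta>) (x # \<nu>) = 0" for m
        by (auto intro!: q_obs_rec_zero(1))
      then show ?thesis by simp
    next
      case hx: True
      have IH: "(\<Sum>m<B. insert_weight q \<theta> m * q_obs_rec q (insert_part m \<theta>) \<nu>) =
         (\<Sum>i<length \<nu> - k. q ^ i) * q_obs_rec q \<theta> \<nu>"
        unfolding k_def by (rule Cons.IH) (use Cons.prems nu in auto)
      have IH': "(\<Sum>m<B. insert_weight q \<theta>' m * q_obs_rec q (insert_part m \<theta>') \<nu>) =
         (\<Sum>i<length \<nu> - length \<theta>'. q ^ i) * q_obs_rec q \<theta>' \<nu>"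
        by (rule Cons.IH) (use sorted nu in auto)
      define X where "X = (\<lambda>m. insert_weight q \<theta> m * (if hd (insert_part m \<theta>) = x then q_obs_rec q (tl (insert_part m \<theta>)) \<nu> else 0))"
      have step: "q_obs_rec q (insert_part m \<theta>) (x # \<nu>) = q ^ Suc k * (q_obs_rec q (insert_part m \<theta>) \<nu> +
         (if hd (insert_part m \<theta>) = x then q_obs_rec q (tl (insert_part m \<theta>)) \<nu> else 0))" for m
      proof -
        obtain a l where al: "insert_part m \<theta> = a # l" using th by (cases "insert_part m \<theta>") (auto split: if_splits)
        then have "length l = k" unfolding k_def by (metis length_Cons length_insert_part nat.inject)
        then show ?thesis unfolding al by simp
      qed
      have "(\<Sum>m<B. insert_weight q \<theta> m * q_obs_rec q (insert_part m \<theta>) (x # \<nu>)) =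
         q ^ Suc k * (\<Sum>m<B. insert_weight q \<theta> m * q_obs_rec q (insert_part m \<theta>) \<nu>) + q ^ Suc k * (\<Sum>m<B. X m)"
        unfolding step X_def by (simp add: sum_distrib_left sum.distrib[symmetric] algebra_simps)
      also have "(\<Sum>m<B. X m) = q_obs_rec q \<theta> \<nu> / q +
         (if h = x then (\<Sum>m<B. insert_weight q \<theta>' m * q_obs_rec q (insert_part m \<theta>') \<nu>) / q else 0)"
      proof (cases "h = x")
        case False
        then have hx': "h < x" using hx by simp
        have "X m = (if m = x then q_obs_rec q \<theta> \<nu> / q else 0)" for m
          using hx' th unfolding X_def by auto
        then show ?thesis using False nu by simp
      next
        case True
        have "X m = (if m = x then q_obs_rec q \<theta> \<nu> / q else 0) + insert_weight q \<theta>' m * q_obs_rec q (insert_part m \<theta>') \<nu> / q" for m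
        proof -
          consider "m > h" | "m < h" | "m = h" by linarith
          then show ?thesis
          proof cases
            case 1
            then have "\<not> set (insert_part m \<theta>') \<subseteq> set \<nu>" using nu True by auto
            then show ?thesis using 1 th True by (simp add: X_def q_obs_rec_zero)
          next
            case 2
            then show ?thesis using th True by (simp add: X_def)
          next
            case 3
            then have "insert_part m \<theta>' = m # \<theta>'" using insert_part_top[of \<theta>' m] sorted by simp
            then show ?thesis using th True 3 by (simp add: X_def add_divide_distrib distrib_right)
          qed
        qed
        then show ?thesis using True nu by (simp add: sum.distrib sum_divide_distrib)
      qed
      finally have main: "(\<Sum>m<B. insert_weight q \<theta> m * q_obs_rec q (insert_part m \<theta>) (x # \<nu>)) =
        q ^ k * (q * (\<Sum>i<length \<nu> - k. q ^ i) + 1) * q_obs_rec q \<theta> \<nu> +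
        (if h = x then q ^ k * ((\<Sum>i<length \<nu> - length \<theta>'. q ^ i) * q_obs_rec q \<theta>' \<nu>) else 0)"
        unfolding IH IH' using q by (auto simp: algebra_simps)
      have "q ^ k * (q * (\<Sum>i<length \<nu> - k. q ^ i) + 1) * q_obs_rec q \<theta> \<nu> =
         q ^ k * (\<Sum>i<Suc (length \<nu>) - k. q ^ i) * q_obs_rec q \<theta> \<nu>"
      proof (cases "k \<le> length \<nu>")
        case True
        then show ?thesis using geo[of "length \<nu> - k"] by (simp add: Suc_diff_le add.commute)
      next
        case False
        then show ?thesis using q_obs_rec_zero(2)[of \<nu> \<theta> q] by (simp add: k_def)
      qed
      note a = this
      have b: "length \<nu> - length \<theta>' = Suc (length \<nu>) - k" using th by (simp add: k_def)
      have c: "q_obs_rec q \<theta> (x # \<nu>) = q ^ k * (q_obs_rec q \<theta> \<nu> + (if h = x then q_obs_rec q \<theta>' \<nu> else 0))"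
        using th by (simp add: k_def)
      have d: "length (x # \<nu>) - length \<theta> = Suc (length \<nu>) - k" by (simp add: k_def)
      have e: "A * G * y + (if P then A * (G * z) else 0) = G * (A * (y + (if P then z else 0)))" for A G y z :: real and P
        by (simp add: distrib_left mult_ac)
      show ?thesis unfolding main a b c d by (rule e)
    qed
  qed
qed

section \<open>Expectations for generic parameters\<close>

lemma c_factor_superset:
  assumes "finite A" "set l \<subseteq> A"
  shows "c_factor q s l = (\<Prod>j\<in>A. qpoch (s\<^sup>2) q (count_list l j) / qpoch q q (count_list l j))"
  unfolding c_factor_def
proof (rule prod.mono_neutral_left[OF assms])
  have "count_list l j = 0" if "j \<in> A - set l" for j using that by (simp add: count_list_0_iff)
  then show "\<forall>j\<in>A - set l. qpoch (s\<^sup>2) q (count_list l j) / qpoch q q (count_list l j) = 1"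
    by (simp add: qpoch_def)
qed

lemma c_factor_insert_part:
  assumes q: "0 < q" "q < 1"
  shows "c_factor q s (insert_part m \<theta>) =
    c_factor q s \<theta> * (1 - s\<^sup>2 * q ^ count_list \<theta> m) / (1 - q ^ Suc (count_list \<theta> m))"
proof -
  define A where "A = insert m (set \<theta>)"
  define g where "g = (\<lambda>n. qpoch (s\<^sup>2) q n / qpoch q q n)"
  have A: "finite A" "m \<in> A" by (auto simp: A_def)
  have gS: "g (Suc n) = g n * (1 - s\<^sup>2 * q ^ n) / (1 - q ^ Suc n)" for n
    by (simp add: g_def qpoch_def)
  have "c_factor q s (insert_part m \<theta>) = (\<Prod>j\<in>A. g (count_list (insert_part m \<theta>) j))"
    unfolding g_def by (rule c_factor_superset) (auto simp: A_def)
  also have "\<dots> = g (Suc (count_list \<theta> m)) * (\<Prod>j\<in>A - {m}. g (count_list \<theta> j))"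
    by (subst prod.remove[OF A]) (auto simp: count_insert_part intro!: prod.cong)
  also have "\<dots> = (\<Prod>j\<in>A. g (count_list \<theta> j)) * (1 - s\<^sup>2 * q ^ count_list \<theta> m) / (1 - q ^ Suc (count_list \<theta> m))"
    by (subst prod.remove[OF A]) (simp add: gS)
  also have "(\<Prod>j\<in>A. g (count_list \<theta> j)) = c_factor q s \<theta>"
    unfolding g_def by (rule c_factor_superset[symmetric]) (auto simp: A_def)
  finally show ?thesis .
qed

lemma n_ge_eq: "n_ge m \<theta> = n_gt m \<theta> + count_list \<theta> m"
  by (induction \<theta>) auto

text \<open>
  The factor \<open>1 - q ^ (mult + 1)\<close> in the denominator of the quotient of the two \<open>c_factor\<close>s
  cancels against the closed form of the insertion weight; the numerator leaves the two terms
  of \<open>insertion_sum\<close>.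
\<close>
lemma insert_weight_c_factor:
  assumes "sorted_wrt (\<ge>) \<theta>" and q: "0 < q" "q < 1"
  shows "insert_weight q \<theta> m * c_factor q s (insert_part m \<theta>) =
    c_factor q s \<theta> / (1 - q) * (1 / q ^ Suc (n_ge m \<theta>) - s\<^sup>2 / q ^ Suc (n_gt m \<theta>))"
proof -
  define l where "l = count_list \<theta> m"
  define a where "a = n_gt m \<theta>"
  have "q ^ Suc l < 1" using q by (intro power_Suc_less_one) auto
  then have nz: "1 - q ^ Suc l \<noteq> 0" by simp
  have "insert_weight q \<theta> m * c_factor q s (insert_part m \<theta>) =
    c_factor q s \<theta> * (((1 - q ^ Suc l) * (1 - s\<^sup>2 * q ^ l)) / ((1 - q ^ Suc l) * ((1 - q) * q ^ Suc (a + l))))"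
    unfolding insert_weight_closed[OF assms] c_factor_insert_part[OF q] l_def a_def n_ge_eq
    by (simp only: mult_ac times_divide_eq_left times_divide_eq_right divide_divide_eq_left)
  also have "\<dots> = c_factor q s \<theta> * ((1 - s\<^sup>2 * q ^ l) / ((1 - q) * q ^ Suc (a + l)))"
    using nz by (simp del: power_Suc)
  also have "\<dots> = c_factor q s \<theta> / (1 - q) * (1 / q ^ Suc (a + l) - s\<^sup>2 / q ^ Suc a)"
  proof -
    have "(1 - s\<^sup>2 * q ^ l) / q ^ Suc (a + l) = 1 / q ^ Suc (a + l) - s\<^sup>2 / q ^ Suc a"
      using q by (simp add: diff_divide_distrib power_add)
    then show ?thesis by (metis (no_types, lifting) divide_divide_eq_left mult.assoc times_divide_eq_left times_divide_eq_right mult.commute)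
  qed
  finally show ?thesis by (simp add: n_ge_eq l_def a_def)
qed

lemma c_factor_bound:
  assumes q: "0 < q" "q < 1" and s: "-1 < s" "s < 1"
  obtains D where "\<And>l. length l = n \<Longrightarrow> \<bar>c_factor q s l\<bar> \<le> D"
proof -
  define g where "g = (\<lambda>n. qpoch (s\<^sup>2) q n / qpoch q q n)"
  define G where "G = Max (insert 1 ((\<lambda>m. \<bar>g m\<bar>) ` {..n}))"
  have G1: "1 \<le> G" unfolding G_def by (intro Max_ge) auto
  have Gg: "\<bar>g m\<bar> \<le> G" if "m \<le> n" for m unfolding G_def using that by (intro Max_ge) auto
  show ?thesis
  proof (rule that)
    fix l :: "nat list" assume l: "length l = n"
    have "\<bar>c_factor q s l\<bar> = (\<Prod>j\<in>set l. \<bar>g (count_list l j)\<bar>)" by (simp add: c_factor_def g_def abs_prod)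
    also have "\<dots> \<le> (\<Prod>j\<in>set l. G)"
      using count_le_length l by (intro prod_mono conjI Gg) (auto intro: order.trans)
    also have "\<dots> = G ^ card (set l)" by simp
    also have "\<dots> \<le> G ^ n" using G1 l card_length[of l] by (intro power_increasing) auto
    finally show "\<bar>c_factor q s l\<bar> \<le> G ^ n" .
  qed
qed

lemma summable_on_lists_power:
  fixes \<rho> :: real
  assumes "0 \<le> \<rho>" "\<rho> < 1"
  shows "(\<lambda>l. \<rho> ^ sum_list l) summable_on {l :: nat list. length l = n}"
proof (induction n)
  case 0
  then show ?case by (intro summable_on_finite) auto
next
  case (Suc n)
  have e: "{l :: nat list. length l = Suc n} = (\<lambda>(x, l). x # l) ` (UNIV \<times> {l. length l = n})"
    by (auto simp: length_Suc_conv image_iff)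
  have "(\<lambda>(x, l). \<rho> ^ x * \<rho> ^ sum_list l) summable_on (UNIV \<times> {l :: nat list. length l = n})"
  proof (rule summable_on_SigmaI[where g = "\<lambda>x. \<rho> ^ x * (\<Sum>\<^sub>\<infinity>l\<in>{l. length l = n}. \<rho> ^ sum_list l)"])
    fix x
    show "((\<lambda>l. case (x, l) of (x, l) \<Rightarrow> \<rho> ^ x * \<rho> ^ sum_list l) has_sum
       \<rho> ^ x * (\<Sum>\<^sub>\<infinity>l\<in>{l. length l = n}. \<rho> ^ sum_list l)) {l :: nat list. length l = n}"
      unfolding prod.case by (intro has_sum_cmult_right has_sum_infsum Suc)
  next
    have "summable (\<lambda>n. norm (\<rho> ^ n))" using assms by (simp add: summable_geometric)
    then have "(\<lambda>x. \<rho> ^ x) summable_on UNIV" by (intro norm_summable_imp_summable_on)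
    then show "(\<lambda>x. \<rho> ^ x * (\<Sum>\<^sub>\<infinity>l\<in>{l. length l = n}. \<rho> ^ sum_list l)) summable_on UNIV"
      by (intro summable_on_cmult_left)
  qed (use assms in auto)
  then show ?case unfolding e
    by (subst summable_on_reindex) (auto simp: inj_on_def o_def case_prod_unfold power_add)
qed

lemma bethe_s_bound:
  fixes P \<rho> :: real
  assumes U: "finite U" and P: "1 \<le> P" and \<rho>: "0 \<le> \<rho>"
    and a: "\<And>u. u \<in> U \<Longrightarrow> cmod ((1 - q) / (1 - s * u)) \<le> P"
    and b: "\<And>u v. u \<in> U \<Longrightarrow> v \<in> U \<Longrightarrow> u \<noteq> v \<Longrightarrow> cmod (cross q u v) \<le> P"
    and z: "\<And>u. u \<in> U \<Longrightarrow> cmod (zfac s u) \<le> \<rho>"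
    and V: "V \<subseteq> U"
  shows "cmod (bethe_s q s \<theta> V) \<le> (card U * P ^ Suc (card U)) ^ length \<theta> * \<rho> ^ sum_list \<theta>"
  using V
proof (induction \<theta> arbitrary: V)
  case (Cons t \<theta>)
  have fV: "finite V" using Cons.prems U finite_subset by auto
  define K where "K = card U * P ^ Suc (card U)"
  have coeff: "cmod (bethe_coeff q s V u) \<le> P ^ Suc (card U)" if u: "u \<in> V" for u
  proof -
    have "cmod (\<Prod>w\<in>V - {u}. cross q u w) = (\<Prod>w\<in>V - {u}. cmod (cross q u w))" by (simp add: prod_norm)
    also have "\<dots> \<le> (\<Prod>w\<in>V - {u}. P)" using Cons.prems u by (intro prod_mono conjI b) auto
    also have "\<dots> = P ^ card (V - {u})" by simp
    also have "\<dots> \<le> P ^ card U" using P Cons.prems U by (intro power_increasing card_mono) auto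
    finally have "cmod ((1 - q) / (1 - s * u)) * cmod (\<Prod>w\<in>V - {u}. cross q u w) \<le> P * P ^ card U"
      using a[of u] u Cons.prems P by (intro mult_mono) auto
    then show ?thesis unfolding bethe_coeff_def norm_mult by simp
  qed
  have "cmod (bethe_s q s (t # \<theta>) V) \<le> (\<Sum>u\<in>V. cmod (bethe_coeff q s V u) * cmod (zfac s u) ^ t * cmod (bethe_s q s \<theta> (V - {u})))"
    unfolding bethe_s_Cons by (rule order.trans[OF norm_sum]) (simp add: norm_mult norm_power)
  also have "\<dots> \<le> (\<Sum>u\<in>V. P ^ Suc (card U) * \<rho> ^ t * (K ^ length \<theta> * \<rho> ^ sum_list \<theta>))"
  proof (rule sum_mono)
    fix u assume u: "u \<in> V"
    have "cmod (bethe_s q s \<theta> (V - {u})) \<le> K ^ length \<theta> * \<rho> ^ sum_list \<theta>"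
      unfolding K_def by (rule Cons.IH) (use Cons.prems in auto)
    moreover have "cmod (zfac s u) ^ t \<le> \<rho> ^ t" using z u Cons.prems by (intro power_mono) auto
    ultimately show "cmod (bethe_coeff q s V u) * cmod (zfac s u) ^ t * cmod (bethe_s q s \<theta> (V - {u}))
      \<le> P ^ Suc (card U) * \<rho> ^ t * (K ^ length \<theta> * \<rho> ^ sum_list \<theta>)"
      using coeff[OF u] P \<rho> by (intro mult_mono) auto
  qed
  also have "\<dots> = card V * (P ^ Suc (card U) * \<rho> ^ t * (K ^ length \<theta> * \<rho> ^ sum_list \<theta>))" by simp
  also have "\<dots> \<le> card U * (P ^ Suc (card U) * \<rho> ^ t * (K ^ length \<theta> * \<rho> ^ sum_list \<theta>))"
    using card_mono[OF U Cons.prems] P \<rho> by (intro mult_right_mono) (auto simp: K_def)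
  also have "\<dots> = K ^ length (t # \<theta>) * \<rho> ^ sum_list (t # \<theta>)"
    by (simp add: K_def power_add mult_ac)
  finally show ?case unfolding K_def .
qed simp

text \<open>
  The truncated sums of \<open>insertion_sum_eq\<close> converge, because the remainder consists of
  multiples of \<open>C\<close>-th powers of the numbers \<open>zfac s u\<close>. Extending the second sum of
  \<open>insertion_sum\<close> by \<open>m = C\<close> adds another term of this kind.
\<close>
lemma insertion_limit:
  assumes "sorted_wrt (\<ge>) \<kappa>" and U: "finite U" "0 \<notin> U" "\<forall>u\<in>U. 1 - s * u \<noteq> 0" and q: "q \<noteq> 0"
    and z: "\<forall>u\<in>U. cmod (zfac s u) < 1"
  shows "(\<lambda>C. \<Sum>m\<le>C. (1 / q ^ Suc (n_ge m \<kappa>) - s\<^sup>2 / q ^ Suc (n_gt m \<kappa>)) * bethe_s q s (insert_part m \<kappa>) U)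
     \<longlonglongrightarrow> (1 - q ^ (card U - length \<kappa>)) / q ^ Suc (length \<kappa>) * bethe_s q s \<kappa> U"
proof -
  obtain B where B: "\<forall>x\<in>set \<kappa>. x \<le> B" using finite_nat_set_iff_bounded_le[of "set \<kappa>"] by auto
  define R where "R = (\<lambda>C. s / q * (\<Sum>u\<in>U. u * bethe_coeff q s U u * zfac s u ^ C * bethe_s q s \<kappa> (U - {u}))
     - s\<^sup>2 / q * (\<Sum>u\<in>U. bethe_coeff q s U u * zfac s u ^ C * bethe_s q s \<kappa> (U - {u})))"
  have zl: "(\<lambda>C. zfac s u ^ C) \<longlonglongrightarrow> 0" if "u \<in> U" for u using z that by (intro LIMSEQ_power_zero) auto
  have "R \<longlonglongrightarrow> s / q * (\<Sum>u\<in>U. u * bethe_coeff q s U u * 0 * bethe_s q s \<kappa> (U - {u}))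
     - s\<^sup>2 / q * (\<Sum>u\<in>U. bethe_coeff q s U u * 0 * bethe_s q s \<kappa> (U - {u}))"
    unfolding R_def by (intro tendsto_intros zl)
  then have R0: "R \<longlonglongrightarrow> 0" by simp
  have "(\<Sum>m\<le>C. (1 / q ^ Suc (n_ge m \<kappa>) - s\<^sup>2 / q ^ Suc (n_gt m \<kappa>)) * bethe_s q s (insert_part m \<kappa>) U) =
     (1 - q ^ (card U - length \<kappa>)) / q ^ Suc (length \<kappa>) * bethe_s q s \<kappa> U + R C" if C: "B \<le> C" for C
  proof -
    have C': "\<forall>x\<in>set \<kappa>. x \<le> C" using B C by fastforce
    have "(\<Sum>m\<le>C. (1 / q ^ Suc (n_ge m \<kappa>) - s\<^sup>2 / q ^ Suc (n_gt m \<kappa>)) * bethe_s q s (insert_part m \<kappa>) U) =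
      (\<Sum>m\<le>C. bethe_s q s (insert_part m \<kappa>) U / q ^ Suc (n_ge m \<kappa>)) -
      s\<^sup>2 * (\<Sum>m\<le>C. bethe_s q s (insert_part m \<kappa>) U / q ^ Suc (n_gt m \<kappa>))"
      by (simp add: left_diff_distrib sum_subtractf sum_distrib_left del: power_Suc)
    also have "(\<Sum>m\<le>C. bethe_s q s (insert_part m \<kappa>) U / q ^ Suc (n_gt m \<kappa>)) =
      (\<Sum>m<C. bethe_s q s (insert_part m \<kappa>) U / q ^ Suc (n_gt m \<kappa>)) + bethe_s q s (C # \<kappa>) U / q"
      using insert_part_top[OF assms(1) C'] n_gt_0[OF C'] by (simp add: lessThan_Suc_atMost[symmetric])
    finally show ?thesis
      using insertion_sum_eq[OF assms(1) C' U q]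
      by (simp add: insertion_sum_def R_def bethe_s_Cons algebra_simps del: power_Suc)
  qed
  then have "\<forall>\<^sub>F C in sequentially. (1 - q ^ (card U - length \<kappa>)) / q ^ Suc (length \<kappa>) * bethe_s q s \<kappa> U + R C =
     (\<Sum>m\<le>C. (1 / q ^ Suc (n_ge m \<kappa>) - s\<^sup>2 / q ^ Suc (n_gt m \<kappa>)) * bethe_s q s (insert_part m \<kappa>) U)"
    by (intro eventually_sequentiallyI[of B]) simp
  moreover have "(\<lambda>C. (1 - q ^ (card U - length \<kappa>)) / q ^ Suc (length \<kappa>) * bethe_s q s \<kappa> U + R C)
     \<longlonglongrightarrow> (1 - q ^ (card U - length \<kappa>)) / q ^ Suc (length \<kappa>) * bethe_s q s \<kappa> U"
    using tendsto_add[OF tendsto_const R0] by simp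
  ultimately show ?thesis by (rule Lim_transform_eventually[rotated])
qed

lemma bethe_weight_summable:
  fixes P \<rho> :: real
  assumes q: "0 < q" "q < 1" and s: "-1 < s" "s < 1" and \<rho>: "0 \<le> \<rho>" "\<rho> < 1"
  obtains D where "\<And>\<nu>. length \<nu> = n \<Longrightarrow> \<bar>c_factor q s \<nu>\<bar> \<le> D"
    and "(\<lambda>\<nu>. D * (K ^ n * \<rho> ^ sum_list \<nu>)) summable_on signatures n"
proof -
  obtain D where D: "\<And>l. length l = n \<Longrightarrow> \<bar>c_factor q s l\<bar> \<le> D" using c_factor_bound[OF q s] by blast
  have "(\<lambda>\<nu>. \<rho> ^ sum_list \<nu>) summable_on signatures n"
    by (rule summable_on_subset_banach[OF summable_on_lists_power[OF \<rho>, of n]]) (auto simp: signatures_def)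
  then have "(\<lambda>\<nu>. D * (K ^ n * \<rho> ^ sum_list \<nu>)) summable_on signatures n"
    by (intro summable_on_cmult_right)
  then show ?thesis using that D by blast
qed

text \<open>
  Downward induction on \<open>k\<close>. For \<open>k = n\<close> only \<open>\<nu> = \<theta>\<close> contributes. For the step, the sum over
  \<open>\<nu>\<close> and \<open>m\<close> of the insertion weight times the observable of the signature with \<open>m\<close> inserted
  is evaluated in both orders: the sum over \<open>m\<close> first gives a multiple of the moment of \<open>\<theta>\<close> by
  \<open>sum_insert_q_obs\<close>, the sum over \<open>\<nu>\<close> first gives the moments with \<open>k + 1\<close> parts, which are
  summed by \<open>insertion_limit\<close>.
\<close>
lemma expectation_bethe:
  fixes U :: "complex set"
  assumes q: "0 < q" "q < 1" and s: "-1 < s" "s < 1"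
    and U: "finite U" "0 \<notin> U" "\<forall>u\<in>U. 1 - of_real s * u \<noteq> 0" "\<forall>u\<in>U. cmod (zfac (of_real s) u) < 1"
    and n: "card U = n"
    and \<theta>: "\<theta> \<in> signatures k" "k \<le> n"
  shows "((\<lambda>\<nu>. c_factor q s \<nu> * bethe_s (of_real q) (of_real s) \<nu> U * q_obs_rec q \<theta> \<nu>) has_sum
     q ^ (k * (k + 1) div 2) * c_factor q s \<theta> * bethe_s (of_real q) (of_real s) \<theta> U) (signatures n)"
proof -
  let ?b = "\<lambda>\<nu>. bethe_s (of_real q) (of_real s) \<nu> U"
  define \<mu> where "\<mu> = (\<lambda>\<nu>. complex_of_real (c_factor q s \<nu>) * ?b \<nu>)"
  have mu_sum: "(\<lambda>\<nu>. norm (\<mu> \<nu>)) summable_on signatures n"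
  proof -
    define P where "P = 1 + (\<Sum>u\<in>U. cmod ((1 - of_real q) / (1 - of_real s * u))) +
       (\<Sum>(u, v)\<in>U \<times> U. cmod (cross (of_real q) u v))"
    define \<rho> where "\<rho> = Max (insert 0 ((\<lambda>u. cmod (zfac (of_real s) u)) ` U))"
    have nn: "0 \<le> (\<Sum>u\<in>U. cmod ((1 - of_real q) / (1 - of_real s * u)))"
      "0 \<le> (\<Sum>(u, v)\<in>U \<times> U. cmod (cross (of_real q) u v))" by (auto intro!: sum_nonneg)
    have P: "1 \<le> P" using nn by (simp add: P_def)
    have a: "cmod ((1 - of_real q) / (1 - of_real s * u)) \<le> P" if "u \<in> U" for u
      using member_le_sum[OF that, of "\<lambda>u. cmod ((1 - of_real q) / (1 - of_real s * u))"] U nn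
      by (simp add: P_def)
    have b: "cmod (cross (of_real q) u v) \<le> P" if "u \<in> U" "v \<in> U" for u v
    proof -
      have "(\<lambda>(u, v). cmod (cross (of_real q) u v)) (u, v) \<le> (\<Sum>(u, v)\<in>U \<times> U. cmod (cross (of_real q) u v))"
        by (rule member_le_sum) (use that U in auto)
      then show ?thesis using nn unfolding P_def by simp
    qed
    have \<rho>: "0 \<le> \<rho>" "\<rho> < 1" unfolding \<rho>_def using U by auto
    have z: "cmod (zfac (of_real s) u) \<le> \<rho>" if "u \<in> U" for u unfolding \<rho>_def using that U by (intro Max_ge) auto
    obtain D where D: "\<And>\<nu>. length \<nu> = n \<Longrightarrow> \<bar>c_factor q s \<nu>\<bar> \<le> D"
      "(\<lambda>\<nu>. D * ((card U * P ^ Suc (card U)) ^ n * \<rho> ^ sum_list \<nu>)) summable_on signatures n"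
      using bethe_weight_summable[OF q s \<rho>] by blast
    show ?thesis
    proof (rule summable_on_comparison_test[OF D(2)])
      fix \<nu> assume "\<nu> \<in> signatures n"
      then have l: "length \<nu> = n" by (simp add: signatures_def)
      have "cmod (?b \<nu>) \<le> (card U * P ^ Suc (card U)) ^ n * \<rho> ^ sum_list \<nu>"
        using bethe_s_bound[OF U(1) P \<rho>(1) a b z subset_refl, of \<nu>] l by simp
      then show "norm (\<mu> \<nu>) \<le> D * ((card U * P ^ Suc (card U)) ^ n * \<rho> ^ sum_list \<nu>)"
        unfolding \<mu>_def norm_mult using D(1)[OF l] by (intro mult_mono) auto
    qed auto
  qed
  have summ: "(\<lambda>\<nu>. norm (\<mu> \<nu>) * q_obs_rec q \<eta> \<nu>) summable_on signatures n" for \<eta>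
  proof (rule summable_on_comparison_test[OF summable_on_cmult_left[OF mu_sum, of "2 ^ n"]])
    fix \<nu> assume "\<nu> \<in> signatures n"
    then show "norm (\<mu> \<nu>) * q_obs_rec q \<eta> \<nu> \<le> norm (\<mu> \<nu>) * 2 ^ n"
      using q_obs_rec_bound[of q \<eta> \<nu>] q by (intro mult_left_mono) (auto simp: signatures_def)
  qed (use q_obs_rec_nonneg q in auto)
  have "((\<lambda>\<nu>. \<mu> \<nu> * q_obs_rec q \<theta> \<nu>) has_sum
     q ^ (k * (k + 1) div 2) * c_factor q s \<theta> * ?b \<theta>) (signatures n)"
    using \<theta>(2,1)
  proof (induction k arbitrary: \<theta> rule: inc_induct)
    case base
    have "((\<lambda>\<nu>. \<mu> \<nu> * q_obs_rec q \<theta> \<nu>) has_sum (\<Sum>\<nu>\<in>{\<theta>}. \<mu> \<nu> * q_obs_rec q \<theta> \<nu>)) (signatures n)"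
    proof (rule has_sum_finite_neutralI)
      fix \<nu> assume "\<nu> \<in> signatures n - {\<theta>}"
      then show "\<mu> \<nu> * q_obs_rec q \<theta> \<nu> = 0"
        using base q_obs_rec_full[of \<theta> \<nu> q] by (auto simp: signatures_def)
    qed (use base in auto)
    then show ?case using base q_obs_rec_full[of \<theta> \<theta> q] by (simp add: \<mu>_def signatures_def mult_ac)
  next
    case (step k)
    have sorted: "sorted_wrt (\<ge>) \<theta>" and len: "length \<theta> = k" using step.prems by (auto simp: signatures_def)
    define c where "c = (\<Sum>i<n - k. q ^ i)"
    have c: "c * (1 - q) = 1 - q ^ (n - k)" using q by (simp add: c_def sum_gp_strict)
    have "n - k = Suc (n - Suc k)" using step(2) by simp
    then have "q ^ (n - k) < 1" using q by (metis power_Suc_less_one)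
    then have c0: "c > 0" using c q by (metis diff_gt_0_iff_gt zero_less_mult_pos2)
    define F where "F = (\<lambda>\<nu> m. complex_of_real (insert_weight q \<theta> m) * (\<mu> \<nu> * q_obs_rec q (insert_part m \<theta>) \<nu>))"
    have Fm: "((\<lambda>m. insert_weight q \<theta> m * q_obs_rec q (insert_part m \<theta>) \<nu>) has_sum c * q_obs_rec q \<theta> \<nu>) UNIV"
      if \<nu>: "\<nu> \<in> signatures n" for \<nu>
    proof -
      obtain B where B: "\<forall>x\<in>set \<nu>. x < B" using finite_nat_set_iff_bounded[of "set \<nu>"] by auto
      have "((\<lambda>m. insert_weight q \<theta> m * q_obs_rec q (insert_part m \<theta>) \<nu>) has_sum
        (\<Sum>m<B. insert_weight q \<theta> m * q_obs_rec q (insert_part m \<theta>) \<nu>)) UNIV"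
      proof (rule has_sum_finite_neutralI)
        fix m assume "m \<in> UNIV - {..<B}"
        then have "\<not> set (insert_part m \<theta>) \<subseteq> set \<nu>" using B by fastforce
        then show "insert_weight q \<theta> m * q_obs_rec q (insert_part m \<theta>) \<nu> = 0" by (simp add: q_obs_rec_zero)
      qed auto
      then show ?thesis using sum_insert_q_obs[OF sorted _ B q(1)] \<nu> len by (simp add: signatures_def c_def)
    qed
    have Fm': "(F \<nu> has_sum c * (\<mu> \<nu> * q_obs_rec q \<theta> \<nu>)) UNIV" if "\<nu> \<in> signatures n" for \<nu>
      using has_sum_cmult_right[OF has_sum_of_real[OF Fm[OF that], where 'a = complex], of "\<mu> \<nu>"]
      by (simp add: F_def mult_ac)
    have nF: "norm (F \<nu> m) = norm (\<mu> \<nu>) * (insert_weight q \<theta> m * q_obs_rec q (insert_part m \<theta>) \<nu>)" for \<nu> m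
      using insert_weight_nonneg[of q \<theta> m] q_obs_rec_nonneg[of q "insert_part m \<theta>" \<nu>] q
      by (simp add: F_def norm_mult mult_ac)
    have "(\<lambda>(\<nu>, m). norm (F \<nu> m)) summable_on (signatures n \<times> UNIV)"
    proof (rule summable_on_SigmaI[where g = "\<lambda>\<nu>. norm (\<mu> \<nu>) * (c * q_obs_rec q \<theta> \<nu>)"])
      fix \<nu> assume "\<nu> \<in> signatures n"
      then show "((\<lambda>m. case (\<nu>, m) of (\<nu>, m) \<Rightarrow> norm (F \<nu> m)) has_sum norm (\<mu> \<nu>) * (c * q_obs_rec q \<theta> \<nu>)) UNIV"
        unfolding prod.case nF by (intro has_sum_cmult_right Fm)
    next
      show "(\<lambda>\<nu>. norm (\<mu> \<nu>) * (c * q_obs_rec q \<theta> \<nu>)) summable_on signatures n"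
        using summable_on_cmult_right[OF summ, of c \<theta>] by (simp add: mult_ac)
    qed auto
    then have Fsum: "(\<lambda>(\<nu>, m). F \<nu> m) summable_on (signatures n \<times> UNIV)"
      by (rule abs_summable_summable[OF summable_on_cong[THEN iffD1], rotated]) auto
    then obtain S where S: "((\<lambda>(\<nu>, m). F \<nu> m) has_sum S) (signatures n \<times> UNIV)"
      by (auto simp: summable_on_def)
    have S1: "((\<lambda>\<nu>. c * (\<mu> \<nu> * q_obs_rec q \<theta> \<nu>)) has_sum S) (signatures n)"
      by (rule has_sum_SigmaD[OF S]) (use Fm' in simp)
    define E where "E = (\<lambda>m. complex_of_real (insert_weight q \<theta> m) *
       (q ^ (Suc k * (Suc k + 1) div 2) * c_factor q s (insert_part m \<theta>) * ?b (insert_part m \<theta>)))"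
    have S2: "(E has_sum S) UNIV"
    proof (rule has_sum_SigmaD)
      show "((\<lambda>(m, \<nu>). F \<nu> m) has_sum S) (UNIV \<times> signatures n)" using S by (subst (asm) has_sum_swap) simp
      fix m :: nat
      have "insert_part m \<theta> \<in> signatures (Suc k)" using sorted len sorted_insert_part by (simp add: signatures_def)
      from has_sum_cmult_right[OF step.IH[OF this], of "complex_of_real (insert_weight q \<theta> m)"]
      show "((\<lambda>\<nu>. case (m, \<nu>) of (m, \<nu>) \<Rightarrow> F \<nu> m) has_sum E m) (signatures n)" by (simp add: F_def E_def)
    qed
    have "(\<lambda>C. \<Sum>m<Suc C. E m) \<longlonglongrightarrow> S"
      using has_sum_imp_sums[OF S2] by (intro LIMSEQ_Suc) (simp add: sums_def)
    moreover define d where "d = complex_of_real (q ^ (Suc k * (Suc k + 1) div 2) * (c_factor q s \<theta> / (1 - q)))"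
    have E_eq: "E m = d * ((1 / of_real q ^ Suc (n_ge m \<theta>) - (of_real s)\<^sup>2 / of_real q ^ Suc (n_gt m \<theta>)) * ?b (insert_part m \<theta>))" for m
    proof -
      have "E m = of_real (q ^ (Suc k * (Suc k + 1) div 2) * (insert_weight q \<theta> m * c_factor q s (insert_part m \<theta>))) * ?b (insert_part m \<theta>)"
        by (simp add: E_def mult_ac)
      then show ?thesis unfolding insert_weight_c_factor[OF sorted q] d_def by (simp del: power_Suc add: mult_ac)
    qed
    have "(\<lambda>C. \<Sum>m\<le>C. E m) \<longlonglongrightarrow> d * ((1 - of_real q ^ (card U - length \<theta>)) / of_real q ^ Suc (length \<theta>) * ?b \<theta>)"
      unfolding E_eq sum_distrib_left[symmetric]
      by (intro tendsto_mult tendsto_const insertion_limit[OF sorted U(1-3) _ U(4)]) (use q in auto)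
    ultimately have "S = d * ((1 - of_real q ^ (card U - length \<theta>)) / of_real q ^ Suc (length \<theta>) * ?b \<theta>)"
      by (intro LIMSEQ_unique) (simp_all only: lessThan_Suc_atMost)
    also have "\<dots> = c * (q ^ (k * (k + 1) div 2) * c_factor q s \<theta> * ?b \<theta>)"
    proof -
      have "Suc k * (Suc k + 1) = 2 * Suc k + k * (k + 1)" by simp
      then have e: "Suc k * (Suc k + 1) div 2 = Suc k + k * (k + 1) div 2" by simp
      have "1 - of_real q ^ (n - k) = complex_of_real (c * (1 - q))" unfolding c by simp
      then show ?thesis using q unfolding d_def n len e power_add by (simp del: power_Suc)
    qed
    finally have "((\<lambda>\<nu>. c * (\<mu> \<nu> * q_obs_rec q \<theta> \<nu>)) has_sum c * (q ^ (k * (k + 1) div 2) * c_factor q s \<theta> * ?b \<theta>)) (signatures n)"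
      using S1 by simp
    from has_sum_cmult_right[OF this, of "1 / of_real c"] show ?case using c0 by simp
  qed
  then show ?thesis by (simp add: \<mu>_def)
qed

section \<open>Iterated contour integrals depending on a parameter\<close>

text \<open>
  Continuous and separately holomorphic functions of finitely many variables. The variables
  are the values of a function on the natural numbers, so that their number need not be a
  type; all but finitely many of the sets \<open>U i\<close> are meant to be \<open>UNIV\<close>. Continuity in all
  variables together is what makes the class closed under integration over one variable.
\<close>
definition multi_hol :: "(nat \<Rightarrow> complex set) \<Rightarrow> ((nat \<Rightarrow> complex) \<Rightarrow> complex) \<Rightarrow> bool" where
  "multi_hol U f \<longleftrightarrow> continuous_on {x. \<forall>i. x i \<in> U i} f \<and>
     (\<forall>x i. (\<forall>j. x j \<in> U j) \<longrightarrow> (\<lambda>z. f (x(i := z))) holomorphic_on U i)"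

lemma multi_hol_const [intro]: "multi_hol U (\<lambda>x. c)"
  by (simp add: multi_hol_def)

lemma multi_hol_coord [intro]: "multi_hol U (\<lambda>x. x i)"
proof -
  have "continuous_on {x. \<forall>i. x i \<in> U i} (\<lambda>x. x i)"
    by (rule continuous_on_subset[OF continuous_on_product_coordinates]) simp
  moreover have "(\<lambda>z. (x(j := z)) i) holomorphic_on U j" for x and j
    by (cases "i = j") auto
  ultimately show ?thesis by (simp add: multi_hol_def)
qed

lemma multi_hol_add [intro]: "multi_hol U f \<Longrightarrow> multi_hol U g \<Longrightarrow> multi_hol U (\<lambda>x. f x + g x)"
  and multi_hol_diff [intro]: "multi_hol U f \<Longrightarrow> multi_hol U g \<Longrightarrow> multi_hol U (\<lambda>x. f x - g x)"
  and multi_hol_mult [intro]: "multi_hol U f \<Longrightarrow> multi_hol U g \<Longrightarrow> multi_hol U (\<lambda>x. f x * g x)"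
  unfolding multi_hol_def by (auto intro!: continuous_intros holomorphic_intros)

lemma multi_hol_compose:
  assumes "multi_hol U f" "g holomorphic_on S" "\<And>x. (\<forall>i. x i \<in> U i) \<Longrightarrow> f x \<in> S"
  shows "multi_hol U (\<lambda>x. g (f x))"
proof -
  have "continuous_on {x. \<forall>i. x i \<in> U i} (\<lambda>x. g (f x))"
    by (rule continuous_on_compose2[OF holomorphic_on_imp_continuous_on[OF assms(2)]])
      (use assms in \<open>auto simp: multi_hol_def\<close>)
  moreover have "(\<lambda>z. g (f (x(i := z)))) holomorphic_on U i" if "\<forall>j. x j \<in> U j" for x i
  proof -
    have "(g \<circ> (\<lambda>z. f (x(i := z)))) holomorphic_on U i"
      by (rule holomorphic_on_compose_gen[OF _ assms(2)])
        (use assms(1,3) that in \<open>auto simp: multi_hol_def\<close>)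
    then show ?thesis by (simp add: o_def)
  qed
  ultimately show ?thesis by (simp add: multi_hol_def)
qed

lemma multi_hol_divide:
  assumes "multi_hol U f" "multi_hol U g" "\<And>x. (\<forall>i. x i \<in> U i) \<Longrightarrow> g x \<noteq> 0"
  shows "multi_hol U (\<lambda>x. f x / g x)"
proof -
  have "multi_hol U (\<lambda>x. inverse (g x))"
    by (rule multi_hol_compose[OF assms(2), of inverse "-{0}"]) (use assms(3) in \<open>auto intro!: holomorphic_intros\<close>)
  then show ?thesis using assms(1) unfolding divide_inverse by (intro multi_hol_mult)
qed

lemma multi_hol_prod: "(\<And>i. i \<in> A \<Longrightarrow> multi_hol U (f i)) \<Longrightarrow> multi_hol U (\<lambda>x. \<Prod>i\<in>A. f i x)"
  by (induction A rule: infinite_finite_induct) auto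

lemma multi_hol_sum: "(\<And>i. i \<in> A \<Longrightarrow> multi_hol U (f i)) \<Longrightarrow> multi_hol U (\<lambda>x. \<Sum>i\<in>A. f i x)"
  by (induction A rule: infinite_finite_induct) auto

lemma multi_hol_power: "multi_hol U f \<Longrightarrow> multi_hol U (\<lambda>x. f x ^ n)"
  by (induction n) auto

text \<open>
  The derivative of a valid path may be unbounded near finitely many parameter values. A
  polynomial loop close to it has the same integrals of holomorphic functions and a continuous
  derivative, so that continuity and exchange of integrals follow from the theorems for
  continuous integrands on compact sets.
\<close>
lemma polynomial_loop_approx:
  assumes g: "valid_path g" "pathfinish g = pathstart g" and S: "open S" "path_image g \<subseteq> S"
  obtains p p' where "valid_path p" "pathfinish p = pathstart p" "path_image p \<subseteq> S"
    "\<And>f. f holomorphic_on S \<Longrightarrow> contour_integral g f = contour_integral p f"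
    "continuous_on UNIV p" "continuous_on UNIV p'" "\<And>t. vector_derivative p (at t) = p' t"
proof -
  obtain d where d: "d > 0" "\<And>g1 h1. valid_path g1 \<and> valid_path h1 \<and>
      (\<forall>t\<in>{0..1}. cmod (g1 t - g t) < d \<and> cmod (h1 t - g t) < d) \<and>
      pathfinish g1 = pathstart g1 \<and> pathfinish h1 = pathstart h1 \<Longrightarrow>
      path_image g1 \<subseteq> S \<and> path_image h1 \<subseteq> S \<and>
      (\<forall>f. f holomorphic_on S \<longrightarrow> contour_integral h1 f = contour_integral g1 f)"
    using contour_integral_nearby_loops[OF S(1) valid_path_imp_path[OF g(1)] S(2)] by blast
  obtain p where p: "polynomial_function p" "pathstart p = pathstart g" "pathfinish p = pathfinish g"
     "\<forall>t\<in>{0..1}. cmod (p t - g t) < d"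
    by (rule path_approx_polynomial_function[OF valid_path_imp_path[OF g(1)] d(1)]) auto
  obtain p' where p': "polynomial_function p'" "\<And>x. (p has_vector_derivative p' x) (at x)"
    using has_vector_derivative_polynomial_function[OF p(1)] by blast
  have vp: "valid_path p" by (rule valid_path_polynomial_function[OF p(1)])
  have near: "path_image g \<subseteq> S \<and> path_image p \<subseteq> S \<and>
      (\<forall>f. f holomorphic_on S \<longrightarrow> contour_integral p f = contour_integral g f)"
    by (rule d(2)) (use g p d vp in auto)
  show ?thesis
  proof (rule that[of p p'])
    show "pathfinish p = pathstart p" using g p by simp
    show "vector_derivative p (at t) = p' t" for t by (rule vector_derivative_at[OF p'(2)])
    show "valid_path p" by (rule vp)
    show "path_image p \<subseteq> S" using near by blast
    show "contour_integral g f = contour_integral p f" if "f holomorphic_on S" for f using near that by metis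
    show "continuous_on UNIV p" by (rule continuous_on_polymonial_function[OF p(1)])
    show "continuous_on UNIV p'" by (rule continuous_on_polymonial_function[OF p'(1)])
  qed
qed

lemma continuous_on_fun_upd:
  fixes f :: "'b::topological_space \<Rightarrow> nat \<Rightarrow> complex"
  assumes "continuous_on S f" "continuous_on S g"
  shows "continuous_on S (\<lambda>z. (f z)(i := g z))"
proof (rule continuous_on_coordinatewise_then_product)
  fix j
  show "continuous_on S (\<lambda>z. ((f z)(i := g z)) j)"
    using assms(2) continuous_on_product_then_coordinatewise[OF assms(1), of j] by (cases "j = i") simp_all
qed

text \<open>
  Holomorphy in another variable follows from Morera's theorem: the integral over a triangle
  may be exchanged with the contour integral, and the inner one then vanishes by Cauchy's
  theorem.
\<close>
lemma multi_hol_contour_integral: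
  assumes f: "multi_hol U f" and U: "\<And>j. open (U j)"
    and g: "valid_path g" "pathfinish g = pathstart g" "path_image g \<subseteq> U i"
  shows "multi_hol (U(i := UNIV)) (\<lambda>x. contour_integral g (\<lambda>w. f (x(i := w))))"
proof -
  obtain p p' where p: "valid_path p" "pathfinish p = pathstart p" "path_image p \<subseteq> U i"
    "\<And>f. f holomorphic_on U i \<Longrightarrow> contour_integral g f = contour_integral p f"
    "continuous_on UNIV p" "continuous_on UNIV p'" "\<And>t. vector_derivative p (at t) = p' t"
    using polynomial_loop_approx[OF g(1,2) U g(3)] by metis
  define X where "X = {x. \<forall>j. x j \<in> (U(i := UNIV)) j}"
  define F where "F = (\<lambda>x. contour_integral p (\<lambda>w. f (x(i := w))))"
  have fc: "continuous_on {x. \<forall>j. x j \<in> U j} f"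
    and fh: "\<And>x j. \<forall>j. x j \<in> U j \<Longrightarrow> (\<lambda>z. f (x(j := z))) holomorphic_on U j"
    using f by (auto simp: multi_hol_def)
  obtain a where a: "a \<in> U i" using p(3) path_image_nonempty by blast
  have gF: "contour_integral g (\<lambda>w. f (x(i := w))) = F x" if "x \<in> X" for x
    unfolding F_def
  proof (rule p(4))
    have "\<forall>j. (x(i := a)) j \<in> U j" using that a by (auto simp: X_def split: if_splits)
    from fh[of "x(i := a)" i, OF this] show "(\<lambda>w. f (x(i := w))) holomorphic_on U i"
      by (simp only: fun_upd_upd)
  qed
  have pU: "p t \<in> U i" if "t \<in> {0..1}" for t using p(3) that by (auto simp: path_image_def)
  have contF: "continuous_on X F"
  proof -
    have "continuous_on (X \<times> cbox 0 1) (\<lambda>(x, t). f (x(i := p t)) * p' t)"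
    proof -
      have "continuous_on (X \<times> {0..1}) (\<lambda>z. (fst z)(i := p (snd z)))"
        by (intro continuous_on_fun_upd continuous_on_fst continuous_on_id
              continuous_on_compose2[OF p(5) continuous_on_snd[OF continuous_on_id]]) simp
      then have "continuous_on (X \<times> {0..1}) (\<lambda>z. f ((fst z)(i := p (snd z))))"
        by (rule continuous_on_compose2[OF fc]) (auto simp: X_def pU)
      moreover have "continuous_on (X \<times> {0..1}) (\<lambda>z :: (nat \<Rightarrow> complex) \<times> real. p' (snd z))"
        by (rule continuous_on_compose2[OF p(6) continuous_on_snd[OF continuous_on_id]]) simp
      ultimately have "continuous_on (X \<times> {0..1}) (\<lambda>z. f ((fst z)(i := p (snd z))) * p' (snd z))"
        by (rule continuous_on_mult)
      then show ?thesis by (simp add: case_prod_unfold)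
    qed
    from integral_continuous_on_param[OF this]
    show ?thesis unfolding F_def contour_integral_integral by (simp add: p(7))
  qed
  have holF: "(\<lambda>z. F (x(j := z))) holomorphic_on (U(i := UNIV)) j" if x: "x \<in> X" for x j
  proof (cases "j = i")
    case True
    then show ?thesis by (simp add: F_def)
  next
    case False
    define h where "h = (\<lambda>z w. f (x(j := z, i := w)))"
    define G where "G = (\<lambda>z. F (x(j := z)))"
    have Gh: "G z = contour_integral p (h z)" for z by (simp add: G_def F_def h_def)
    have inU: "\<forall>l. (x(j := z, i := w)) l \<in> U l" if "z \<in> U j" "w \<in> U i" for z w
      using that x False by (auto simp: X_def split: if_splits)
    have contG: "continuous_on (U j) G"
      unfolding G_def
    proof (rule continuous_on_compose2[OF contF])
      show "continuous_on (U j) (\<lambda>z. x(j := z))"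
        by (intro continuous_on_fun_upd continuous_on_const continuous_on_id)
    qed (use x False in \<open>auto simp: X_def split: if_splits\<close>)
    have conth: "continuous_on (U j \<times> U i) (\<lambda>(z, w). h z w)"
    proof -
      have "continuous_on (U j \<times> U i) (\<lambda>z. x(j := fst z, i := snd z))"
        by (intro continuous_on_fun_upd continuous_on_const continuous_on_id continuous_on_fst continuous_on_snd)
      then have "continuous_on (U j \<times> U i) (\<lambda>z. f (x(j := fst z, i := snd z)))"
        by (rule continuous_on_compose2[OF fc]) (use inU in auto)
      then show ?thesis by (simp add: h_def case_prod_unfold)
    qed
    have holh: "(\<lambda>z. h z w) holomorphic_on U j" if w: "w \<in> U i" for w
    proof -
      have "x j \<in> U j" using x False by (auto simp: X_def dest: spec[of _ j])
      from fh[of "x(j := x j, i := w)" j, OF inU[OF this w]] show ?thesis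
        unfolding h_def fun_upd_triv fun_upd_twist[OF False] .
    qed
    have "G analytic_on U j"
    proof (rule Morera_triangle[OF contG U], intro impI)
      fix a b c assume abc: "convex hull {a, b, c} \<subseteq> U j"
      have seg: "closed_segment a b \<subseteq> U j" "closed_segment b c \<subseteq> U j" "closed_segment c a \<subseteq> U j"
      proof -
        have "closed_segment y z \<subseteq> convex hull {a, b, c}" if "y \<in> {a, b, c}" "z \<in> {a, b, c}" for y z
          using that by (intro closed_segment_subset_convex_hull) (auto simp: hull_inc)
        then show "closed_segment a b \<subseteq> U j" "closed_segment b c \<subseteq> U j" "closed_segment c a \<subseteq> U j"
          using abc by blast+
      qed
      define L where "L = (\<lambda>a b w. contour_integral (linepath a b) (\<lambda>z. h z w))"
      have sw: "contour_integral (linepath y z) G = contour_integral p (L y z)"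
        and int: "L y z contour_integrable_on p" if yz: "closed_segment y z \<subseteq> U j" for y z
      proof -
        have sub: "path_image (linepath y z) \<times> path_image p \<subseteq> U j \<times> U i" using yz p(3) by auto
        show "contour_integral (linepath y z) G = contour_integral p (L y z)"
          unfolding Gh L_def
          by (rule contour_integral_swap[OF continuous_on_subset[OF conth sub]])
            (use p continuous_on_subset[OF p(6) subset_UNIV] in \<open>auto intro!: continuous_intros\<close>)
        have "continuous_on (cbox 0 (1 :: real) \<times> cbox 0 (1 :: real)) (\<lambda>(s, t). h (linepath y z t) (p s) * (z - y))"
        proof -
          have "continuous_on ({0..1} \<times> {0..1}) (\<lambda>r. (\<lambda>(z, w). h z w) (linepath y z (snd r), p (fst r)))"
            using yz pU
            by (intro continuous_on_compose2[OF conth] continuous_intros continuous_on_compose2[OF p(5)]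
                  continuous_on_compose2[OF continuous_on_linepath])
              (auto simp: linepath_in_path subset_iff)
          then show ?thesis by (auto simp: case_prod_unfold intro!: continuous_intros)
        qed
        from integral_continuous_on_param[OF this]
        have "continuous_on {0..1} (\<lambda>t. L y z (p t))"
          unfolding L_def contour_integral_integral by simp
        then have "continuous_on {0..1} (\<lambda>t. L y z (p t) * p' t)"
          using continuous_on_subset[OF p(6)] by (intro continuous_intros) auto
        then show "L y z contour_integrable_on p"
          unfolding contour_integrable_on p(7) by (rule integrable_continuous_real)
      qed
      have "contour_integral (linepath a b) G + contour_integral (linepath b c) G + contour_integral (linepath c a) G =
         contour_integral p (\<lambda>w. L a b w + L b c w + L c a w)"
        using sw[OF seg(1)] sw[OF seg(2)] sw[OF seg(3)] int[OF seg(1)] int[OF seg(2)] int[OF seg(3)]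
        by (simp add: contour_integral_add contour_integrable_add)
      also have "\<dots> = contour_integral p (\<lambda>w. 0)"
      proof (rule contour_integral_cong[OF refl])
        fix w assume w: "w \<in> path_image p"
        have hol: "(\<lambda>z. h z w) holomorphic_on convex hull {a, b, c}"
          using holh[of w] w p(3) abc holomorphic_on_subset by blast
        have i: "(\<lambda>z. h z w) contour_integrable_on linepath y z" if "closed_segment y z \<subseteq> U j" for y z
          using holomorphic_on_imp_continuous_on[OF holh[of w]] w p(3) that
          by (intro contour_integrable_continuous_linepath) (auto intro: continuous_on_subset)
        have "((\<lambda>z. h z w) has_contour_integral 0) (linepath a b +++ linepath b c +++ linepath c a)"
          by (rule Cauchy_theorem_triangle[OF hol])
        then have "contour_integral (linepath a b +++ linepath b c +++ linepath c a) (\<lambda>z. h z w) = 0"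
          by (rule contour_integral_unique)
        then show "L a b w + L b c w + L c a w = 0"
          using i[OF seg(1)] i[OF seg(2)] i[OF seg(3)] by (simp add: L_def add.assoc)
      qed
      finally show "contour_integral (linepath a b) G + contour_integral (linepath b c) G + contour_integral (linepath c a) G = 0"
        by simp
    qed
    then have "G holomorphic_on U j" by (rule analytic_imp_holomorphic)
    then show ?thesis using False by (simp add: G_def)
  qed
  have "continuous_on X (\<lambda>x. contour_integral g (\<lambda>w. f (x(i := w))))"
    using contF gF by (simp cong: continuous_on_cong)
  moreover have "(\<lambda>z. contour_integral g (\<lambda>w. f (x(j := z, i := w)))) holomorphic_on (U(i := UNIV)) j"
    if x: "x \<in> X" for x j
  proof -
    have "x(j := z) \<in> X" if "z \<in> (U(i := UNIV)) j" for z
      using x that by (auto simp: X_def split: if_splits)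
    then show ?thesis using holF[OF x, of j] gF by (auto cong: holomorphic_cong)
  qed
  ultimately show ?thesis unfolding multi_hol_def X_def by simp
qed

text \<open>
  The variables of the iterated integral occupy consecutive coordinates, starting with \<open>m\<close>.
\<close>
fun upd_list :: "nat \<Rightarrow> (nat \<Rightarrow> complex) \<Rightarrow> complex list \<Rightarrow> nat \<Rightarrow> complex" where
  "upd_list m x [] = x"
| "upd_list m x (w # ws) = upd_list (Suc m) (x(m := w)) ws"

lemma upd_list_apply: "upd_list m x ws j = (if m \<le> j \<and> j < m + length ws then ws ! (j - m) else x j)"
proof (induction ws arbitrary: m x)
  case (Cons w ws)
  show ?case by (auto simp: Cons nth_Cons' Suc_le_eq)
qed auto

lemma multi_hol_iter_oint:
  assumes f: "multi_hol U f" and U: "\<And>j. open (U j)"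
    and Cs: "\<And>i g. i < length Cs \<Longrightarrow> g \<in> Cs ! i \<Longrightarrow> valid_path g \<and> pathfinish g = pathstart g \<and> path_image g \<subseteq> U (m + i)"
  shows "multi_hol (\<lambda>j. if m \<le> j \<and> j < m + length Cs then UNIV else U j) (\<lambda>x. iter_oint Cs (\<lambda>ws. f (upd_list m x ws)))"
  using Cs
proof (induction Cs arbitrary: m)
  case Nil
  have "(\<lambda>j. if m \<le> j \<and> j < m + length [] then UNIV else U j) = U" by (auto simp: fun_eq_iff)
  then show ?case using f by simp
next
  case (Cons C Cs)
  define V where "V = (\<lambda>j. if Suc m \<le> j \<and> j < Suc m + length Cs then UNIV else U j)"
  define G where "G = (\<lambda>x. iter_oint Cs (\<lambda>ws. f (upd_list (Suc m) x ws)))"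
  have G: "multi_hol V G"
    unfolding V_def G_def
  proof (rule Cons.IH)
    fix i g assume "i < length Cs" "g \<in> Cs ! i"
    then show "valid_path g \<and> pathfinish g = pathstart g \<and> path_image g \<subseteq> U (Suc m + i)"
      using Cons.prems[of "Suc i" g] by simp
  qed
  have V: "open (V j)" for j using U by (simp add: V_def)
  have "multi_hol (V(m := UNIV)) (\<lambda>x. (\<Sum>g\<in>C. contour_integral g (\<lambda>w. G (x(m := w)))) / (2 * pi * \<i>))"
  proof (intro multi_hol_divide multi_hol_sum multi_hol_const)
    fix g assume "g \<in> C"
    then have "valid_path g \<and> pathfinish g = pathstart g \<and> path_image g \<subseteq> V m"
      using Cons.prems[of 0 g] by (simp add: V_def)
    then show "multi_hol (V(m := UNIV)) (\<lambda>x. contour_integral g (\<lambda>w. G (x(m := w))))"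
      by (intro multi_hol_contour_integral[OF G V]) auto
  qed auto
  moreover have "V(m := UNIV) = (\<lambda>j. if m \<le> j \<and> j < m + length (C # Cs) then UNIV else U j)"
    by (auto simp: V_def fun_eq_iff)
  ultimately show ?case by (simp add: oint_def G_def)
qed

lemma iter_oint_cong:
  assumes "\<And>ws. length ws = length Cs \<Longrightarrow> (\<And>i. i < length Cs \<Longrightarrow> ws ! i \<in> (\<Union>g\<in>Cs ! i. path_image g)) \<Longrightarrow> f ws = g ws"
  shows "iter_oint Cs f = iter_oint Cs g"
  using assms
proof (induction Cs arbitrary: f g)
  case (Cons C Cs)
  have "iter_oint Cs (\<lambda>ws. f (w # ws)) = iter_oint Cs (\<lambda>ws. g (w # ws))" if "p \<in> C" "w \<in> path_image p" for w p
    by (rule Cons.IH, rule Cons.prems) (use that in \<open>auto simp: nth_Cons' less_Suc_eq_0_disj\<close>)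
  then show ?case by (simp add: oint_def cong: contour_integral_cong)
qed simp

text \<open>
  Coordinate \<open>0\<close> holds the parameter, and the coordinates from \<open>1\<close> on the integration
  variables.
\<close>
lemma holomorphic_iter_oint:
  fixes \<Phi> :: "complex \<Rightarrow> complex list \<Rightarrow> complex"
  defines "U \<equiv> \<lambda>T Us j. if j = 0 then T else if j \<le> length Us then Us ! (j - 1) else UNIV"
  assumes f: "multi_hol (U T Us) (\<lambda>x. \<Phi> (x 0) (map x [1..<Suc (length Us)]))"
    and op: "open T" "\<And>i. i < length Us \<Longrightarrow> open (Us ! i)" and len: "length Us = length Cs"
    and Cs: "\<And>i g. i < length Cs \<Longrightarrow> g \<in> Cs ! i \<Longrightarrow> valid_path g \<and> pathfinish g = pathstart g \<and> path_image g \<subseteq> Us ! i"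
  shows "(\<lambda>t. iter_oint Cs (\<Phi> t)) holomorphic_on T"
proof (cases "T = {}")
  case False
  then obtain a where a: "a \<in> T" by auto
  define k where "k = length Cs"
  have Uo: "open (U T Us j)" for j using op by (auto simp: U_def)
  have "multi_hol (\<lambda>j. if 1 \<le> j \<and> j < 1 + length Cs then UNIV else U T Us j)
     (\<lambda>x. iter_oint Cs (\<lambda>ws. (\<lambda>x. \<Phi> (x 0) (map x [1..<Suc (length Us)])) (upd_list 1 x ws)))"
    by (rule multi_hol_iter_oint[OF f Uo]) (use Cs len in \<open>auto simp: U_def\<close>)
  moreover have "iter_oint Cs (\<lambda>ws. (\<lambda>x. \<Phi> (x 0) (map x [1..<Suc (length Us)])) (upd_list 1 x ws)) = iter_oint Cs (\<Phi> (x 0))" for x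
  proof (rule iter_oint_cong)
    fix ws :: "complex list" assume "length ws = length Cs"
    then have l: "length ws = length Us" using len by simp
    have "map (upd_list 1 x ws) [1..<Suc (length Us)] = ws"
    proof (rule nth_equalityI)
      fix i assume "i < length (map (upd_list 1 x ws) [1..<Suc (length Us)])"
      then have "i < length Us" by (simp del: upt_Suc)
      then show "map (upd_list 1 x ws) [1..<Suc (length Us)] ! i = ws ! i"
        using l by (simp add: upd_list_apply del: upt_Suc)
    qed (use l in \<open>simp del: upt_Suc\<close>)
    moreover have "upd_list 1 x ws 0 = x 0" by (simp add: upd_list_apply)
    ultimately show "\<Phi> (upd_list 1 x ws 0) (map (upd_list 1 x ws) [1..<Suc (length Us)]) = \<Phi> (x 0) ws" by simp
  qed
  ultimately have mh: "multi_hol (\<lambda>j. if 1 \<le> j \<and> j < 1 + length Cs then UNIV else U T Us j) (\<lambda>x. iter_oint Cs (\<Phi> (x 0)))"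
    by simp
  have "\<forall>j. (\<lambda>_. a) j \<in> (if 1 \<le> j \<and> j < 1 + length Cs then UNIV else U T Us j)"
    using a len by (auto simp: U_def)
  note mh[unfolded multi_hol_def, THEN conjunct2, THEN spec, of "\<lambda>_. a", THEN spec, of 0, THEN mp, OF this]
  then show ?thesis by (simp add: U_def)
qed (simp add: holomorphic_on_def)

section \<open>Evaluation of the nested integral by residues\<close>

text \<open>
  The factor of the integrand that couples an outer variable \<open>w\<close> to an inner variable \<open>v\<close>. If
  \<open>w = 1 / u\<close> and \<open>v = 1 / u'\<close>, it is the reciprocal of \<open>cross q u' u\<close>.
\<close>
definition kern :: "complex \<Rightarrow> complex \<Rightarrow> complex \<Rightarrow> complex" where
  "kern q w v = (w - v) / (w - q * v)"

definition rho :: "complex \<Rightarrow> nat \<Rightarrow> complex \<Rightarrow> complex" where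
  "rho s t w = 1 / (w - s) * ((1 - s * w) / (w - s)) ^ t"

definition moment_integrand :: "complex \<Rightarrow> complex \<Rightarrow> nat list \<Rightarrow> (complex \<Rightarrow> complex) \<Rightarrow> complex list \<Rightarrow> complex" where
  "moment_integrand q s \<theta> \<phi> w =
     (\<Prod>\<beta><length \<theta>. \<Prod>\<alpha><\<beta>. (w ! \<alpha> - w ! \<beta>) / (w ! \<alpha> - q * w ! \<beta>)) *
     (\<Prod>i<length \<theta>. 1 / (w ! i - s) * ((1 - s * w ! i) / (w ! i - s)) ^ (\<theta> ! i) * \<phi> (w ! i))"

lemma moment_integrand_Nil [simp]: "moment_integrand q s [] \<phi> w = 1"
  by (simp add: moment_integrand_def)

text \<open>
  The outermost variable enters the remaining integral only through the one-variable function
  \<open>\<phi>\<close>, which is why \<open>\<phi>\<close> is kept arbitrary.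
\<close>
lemma moment_integrand_Cons:
  "moment_integrand q s (t # \<theta>) \<phi> (w # ws) = rho s t w * \<phi> w * moment_integrand q s \<theta> (\<lambda>v. kern q w v * \<phi> v) ws"
proof -
  let ?k = "length \<theta>"
  have "(\<Prod>\<beta><Suc ?k. \<Prod>\<alpha><\<beta>. ((w # ws) ! \<alpha> - (w # ws) ! \<beta>) / ((w # ws) ! \<alpha> - q * (w # ws) ! \<beta>)) =
    (\<Prod>\<beta><?k. kern q w (ws ! \<beta>) * (\<Prod>\<alpha><\<beta>. (ws ! \<alpha> - ws ! \<beta>) / (ws ! \<alpha> - q * ws ! \<beta>)))"
    by (simp add: prod.lessThan_Suc_shift kern_def del: prod.lessThan_Suc)
  moreover have "(\<Prod>i<Suc ?k. 1 / ((w # ws) ! i - s) * ((1 - s * (w # ws) ! i) / ((w # ws) ! i - s)) ^ ((t # \<theta>) ! i) * \<phi> ((w # ws) ! i)) =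
    rho s t w * \<phi> w * (\<Prod>i<?k. 1 / (ws ! i - s) * ((1 - s * ws ! i) / (ws ! i - s)) ^ (\<theta> ! i) * \<phi> (ws ! i))"
    by (simp add: prod.lessThan_Suc_shift rho_def del: prod.lessThan_Suc)
  moreover have "(\<Prod>i<?k. 1 / (ws ! i - s) * ((1 - s * ws ! i) / (ws ! i - s)) ^ (\<theta> ! i) * (kern q w (ws ! i) * \<phi> (ws ! i))) =
    (\<Prod>\<beta><?k. kern q w (ws ! \<beta>)) * (\<Prod>i<?k. 1 / (ws ! i - s) * ((1 - s * ws ! i) / (ws ! i - s)) ^ (\<theta> ! i) * \<phi> (ws ! i))"
    by (subst prod.distrib[symmetric]) (intro prod.cong refl, simp only: mult_ac)
  ultimately show ?thesis
    unfolding moment_integrand_def length_Cons prod.distrib by (simp only: mult_ac)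
qed

lemma moment_integrand_cong:
  assumes "\<And>i. i < length \<theta> \<Longrightarrow> \<phi> (ws ! i) = \<psi> (ws ! i)"
  shows "moment_integrand q s \<theta> \<phi> ws = moment_integrand q s \<theta> \<psi> ws"
  unfolding moment_integrand_def using assms by simp

lemma contour_integral_mult_left: "contour_integral g (\<lambda>w. c * f w) = c * contour_integral g f"
  unfolding contour_integral_integral by (simp add: mult.assoc)

lemma iter_oint_mult_left: "iter_oint Cs (\<lambda>ws. c * f ws) = c * iter_oint Cs f"
  by (induction Cs arbitrary: f) (simp_all add: oint_def contour_integral_mult_left sum_distrib_left[symmetric])

text \<open>
  Open neighbourhoods of the contours, needed because holomorphy is a statement about open
  sets. A common small \<open>\<epsilon>\<close> is found with the filter \<open>at_right 0\<close>.
\<close>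
definition thicken :: "real \<Rightarrow> complex set \<Rightarrow> complex set" where
  "thicken \<epsilon> A = (\<Union>a\<in>A. ball a \<epsilon>)"

lemma open_thicken [simp]: "open (thicken \<epsilon> A)" by (auto simp: thicken_def)

lemma subset_thicken: "\<epsilon> > 0 \<Longrightarrow> A \<subseteq> thicken \<epsilon> A" by (force simp: thicken_def)

lemma eventually_thicken_separated:
  assumes A: "compact A" and B: "compact B" and q: "cmod q < 1" and sep: "\<forall>a\<in>A. \<forall>b\<in>B. a \<noteq> q * b"
  shows "\<forall>\<^sub>F \<epsilon> in at_right 0. \<forall>a\<in>thicken \<epsilon> A. \<forall>b\<in>thicken \<epsilon> B. a \<noteq> q * b"
proof -
  have "compact ((*) q ` B)" using B by (intro compact_continuous_image continuous_intros)
  then have "closed ((*) q ` B)" by (rule compact_imp_closed)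
  moreover have "A \<inter> (*) q ` B = {}" using sep by auto
  ultimately obtain d where d: "d > 0" "\<forall>x\<in>A. \<forall>y\<in>(*) q ` B. d \<le> dist x y"
    using separate_compact_closed[OF A, of "(*) q ` B"] by auto
  have "\<forall>\<^sub>F \<epsilon> in at_right (0 :: real). \<epsilon> < d / 2"
    using eventually_at_right_real[of 0 "d / 2"] d by (simp add: eventually_mono)
  then show ?thesis
  proof eventually_elim
    case (elim \<epsilon>)
    show ?case
    proof (intro ballI notI)
      fix a b assume "a \<in> thicken \<epsilon> A" "b \<in> thicken \<epsilon> B" and eq: "a = q * b"
      then obtain a' b' where ab: "a' \<in> A" "dist a' a < \<epsilon>" "b' \<in> B" "dist b' b < \<epsilon>" by (auto simp: thicken_def)
      have "dist (q * b) (q * b') = cmod (q * (b - b'))" by (simp add: dist_norm right_diff_distrib)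
      also have "\<dots> = cmod q * dist b b'" by (simp only: norm_mult dist_norm)
      also have "\<dots> \<le> 1 * dist b b'" using q by (intro mult_right_mono) auto
      finally have "dist (q * b) (q * b') < \<epsilon>" using ab by (simp add: dist_commute)
      then have "dist a' (q * b') < d" using ab eq elim dist_triangle[of a' "q * b'" a] by simp
      then show False using d ab by force
    qed
  qed
qed

lemma eventually_thicken_avoid:
  assumes A: "compact A" and p: "p \<notin> A"
  shows "\<forall>\<^sub>F \<epsilon> in at_right 0. p \<notin> thicken \<epsilon> A"
proof -
  obtain d where d: "d > 0" "\<forall>x\<in>A. d \<le> dist x p"
    using separate_compact_closed[OF A, of "{p}"] p by auto
  have "\<forall>\<^sub>F \<epsilon> in at_right (0 :: real). \<epsilon> < d"
    using eventually_at_right_real[of 0 d] d by (simp add: eventually_mono)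
  then show ?thesis by eventually_elim (use d in \<open>force simp: thicken_def\<close>)
qed

lemma multi_hol_moment_integrand:
  fixes T :: "complex set" and Us :: "complex set list"
  defines "U \<equiv> \<lambda>j. if j = 0 then T else if j \<le> length Us then Us ! (j - 1) else UNIV"
  assumes len: "length Us = length \<theta>"
    and sep: "\<And>\<alpha> \<beta> w v. \<beta> < length \<theta> \<Longrightarrow> \<alpha> < \<beta> \<Longrightarrow> w \<in> Us ! \<alpha> \<Longrightarrow> v \<in> Us ! \<beta> \<Longrightarrow> w \<noteq> q * v"
    and s: "\<And>i. i < length \<theta> \<Longrightarrow> s \<notin> Us ! i"
    and \<phi>: "\<And>i. i < length \<theta> \<Longrightarrow> multi_hol U (\<lambda>x. \<phi> (x 0) (x (Suc i)))"
  shows "multi_hol U (\<lambda>x. moment_integrand q s \<theta> (\<phi> (x 0)) (map x [1..<Suc (length Us)]))"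
proof -
  have nth: "map x [1..<Suc (length Us)] ! i = x (Suc i)" if "i < length \<theta>" for i and x :: "nat \<Rightarrow> complex"
    using that len by (simp del: upt_Suc)
  have inU: "x (Suc i) \<in> Us ! i" if "\<forall>j. x j \<in> U j" "i < length \<theta>" for x i
    using that(1)[THEN spec, of "Suc i"] that(2) len by (simp add: U_def)
  have "multi_hol U (\<lambda>x. (\<Prod>\<beta><length \<theta>. \<Prod>\<alpha><\<beta>. (x (Suc \<alpha>) - x (Suc \<beta>)) / (x (Suc \<alpha>) - q * x (Suc \<beta>))) *
     (\<Prod>i<length \<theta>. 1 / (x (Suc i) - s) * ((1 - s * x (Suc i)) / (x (Suc i) - s)) ^ (\<theta> ! i) * \<phi> (x 0) (x (Suc i))))"
  proof (intro multi_hol_mult multi_hol_prod multi_hol_divide multi_hol_power multi_hol_diff multi_hol_coord multi_hol_const \<phi>, goal_cases)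
    case (1 \<beta> \<alpha> x)
    then show ?case using sep[of \<beta> \<alpha> "x (Suc \<alpha>)" "x (Suc \<beta>)"] inU[of x \<alpha>] inU[of x \<beta>] by auto
  next
    case (2 i x)
    then show ?case using s[of i] inU[of x i] by auto
  next
    case (3 i x)
    then show ?case using s[of i] inU[of x i] by auto
  qed auto
  moreover have "moment_integrand q s \<theta> (\<phi> (x 0)) (map x [1..<Suc (length Us)]) =
    (\<Prod>\<beta><length \<theta>. \<Prod>\<alpha><\<beta>. (x (Suc \<alpha>) - x (Suc \<beta>)) / (x (Suc \<alpha>) - q * x (Suc \<beta>))) *
     (\<Prod>i<length \<theta>. 1 / (x (Suc i) - s) * ((1 - s * x (Suc i)) / (x (Suc i) - s)) ^ (\<theta> ! i) * \<phi> (x 0) (x (Suc i)))" for x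
    unfolding moment_integrand_def
    by (intro arg_cong2[of _ _ _ _ "(*)"] prod.cong refl) (auto simp: nth[unfolded One_nat_def] simp del: upt_Suc)
  ultimately show ?thesis by simp
qed

text \<open>
  The product of \<open>(1 - q u w) / (1 - u w)\<close> over \<open>u \<in> U\<close> after cancellation of common factors.
  It has poles only at \<open>1 / u\<close> for those \<open>u\<close> that start a string \<open>u, q u, q\<^sup>2 u, \<dots>\<close> in \<open>U\<close>;
  all other points \<open>1 / u\<close> may lie inside or on the contours or outside of them.
\<close>
definition reduced_product :: "complex \<Rightarrow> complex set \<Rightarrow> complex \<Rightarrow> complex" where
  "reduced_product q U w = (\<Prod>c\<in>(*) q ` U - U. 1 - c * w) / (\<Prod>b\<in>U - (*) q ` U. 1 - b * w)"

lemma reduced_product_eq: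
  assumes U: "finite U" and q: "q \<noteq> 0" and w: "\<forall>u\<in>U. 1 - u * w \<noteq> 0"
  shows "(\<Prod>u\<in>U. (1 - q * u * w) / (1 - u * w)) = reduced_product q U w"
proof -
  have inj: "inj_on ((*) q) U" using q by (auto simp: inj_on_def)
  have "(\<Prod>u\<in>U. 1 - q * u * w) = (\<Prod>c\<in>(*) q ` U. 1 - c * w)" by (simp add: prod.reindex[OF inj])
  also have "\<dots> = (\<Prod>c\<in>(*) q ` U - U. 1 - c * w) * (\<Prod>c\<in>(*) q ` U \<inter> U. 1 - c * w)"
    using U by (subst prod.union_disjoint[symmetric]) (auto intro!: prod.cong)
  finally have 1: "(\<Prod>u\<in>U. 1 - q * u * w) = (\<Prod>c\<in>(*) q ` U - U. 1 - c * w) * (\<Prod>c\<in>(*) q ` U \<inter> U. 1 - c * w)" .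
  have 2: "(\<Prod>u\<in>U. 1 - u * w) = (\<Prod>c\<in>U - (*) q ` U. 1 - c * w) * (\<Prod>c\<in>(*) q ` U \<inter> U. 1 - c * w)"
    using U by (subst prod.union_disjoint[symmetric]) (auto intro!: prod.cong)
  have "(\<Prod>c\<in>(*) q ` U \<inter> U. 1 - c * w) \<noteq> 0" using U w by auto
  then show ?thesis unfolding reduced_product_def prod_dividef 1 2 by simp
qed

text \<open>
  The coupling to an outer variable at \<open>1 / u\<close> is \<open>(1 - u w) / (1 - q u w)\<close>, the reciprocal of
  the factor of \<open>u\<close> in the product. If \<open>q u \<in> U\<close>, then \<open>q u\<close> becomes the start of a string.
\<close>
lemma reduced_product_remove:
  assumes U: "finite U" "0 \<notin> U" and q: "q \<noteq> 0" "cmod q < 1" and u: "u \<in> U - (*) q ` U"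
    and w: "1 - u * w \<noteq> 0" "1 - q * u * w \<noteq> 0"
  shows "kern q (inverse u) w * reduced_product q U w = reduced_product q (U - {u}) w"
proof -
  have u0: "u \<noteq> 0" using u U by auto
  have qu: "q * u \<noteq> u" using q u0 by auto
  have inj: "inj ((*) q)" using q by (auto simp: inj_def)
  have k: "kern q (inverse u) w = (1 - u * w) / (1 - q * u * w)"
  proof -
    have "kern q (inverse u) w = (u * (inverse u - w)) / (u * (inverse u - q * w))"
      unfolding kern_def using u0 by simp
    then show ?thesis using u0 by (simp add: right_diff_distrib mult_ac)
  qed
  have im: "(*) q ` (U - {u}) = (*) q ` U - {q * u}" using image_set_diff[OF inj, of U "{u}"] by simp
  show ?thesis
  proof (cases "q * u \<in> U")
    case True
    have 1: "(*) q ` (U - {u}) - (U - {u}) = (*) q ` U - U" using True u im by auto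
    have 2: "(U - {u}) - (*) q ` (U - {u}) = insert (q * u) (U - (*) q ` U - {u})" using True qu u im by auto
    have "(\<Prod>b\<in>U - (*) q ` U. 1 - b * w) = (1 - u * w) * (\<Prod>b\<in>U - (*) q ` U - {u}. 1 - b * w)"
      using U u by (intro prod.remove) auto
    moreover have "(\<Prod>b\<in>insert (q * u) (U - (*) q ` U - {u}). 1 - b * w) = (1 - q * u * w) * (\<Prod>b\<in>U - (*) q ` U - {u}. 1 - b * w)"
      using U u True by (intro prod.insert) auto
    ultimately show ?thesis unfolding reduced_product_def 1 2 k using w by simp
  next
    case False
    have 1: "(*) q ` (U - {u}) - (U - {u}) = ((*) q ` U - U) - {q * u}" using u im by auto
    have 2: "(U - {u}) - (*) q ` (U - {u}) = U - (*) q ` U - {u}" using False im by auto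
    have "(\<Prod>b\<in>U - (*) q ` U. 1 - b * w) = (1 - u * w) * (\<Prod>b\<in>U - (*) q ` U - {u}. 1 - b * w)"
      using U u by (intro prod.remove) auto
    moreover have "(\<Prod>b\<in>(*) q ` U - U. 1 - b * w) = (1 - q * u * w) * (\<Prod>b\<in>((*) q ` U - U) - {q * u}. 1 - b * w)"
      using U u False by (intro prod.remove) auto
    ultimately show ?thesis unfolding reduced_product_def 1 2 k using w by simp
  qed
qed

text \<open>
  Up to the factor \<open>- 1 / u\<close> this is the residue at \<open>1 / u\<close>; it contains the cross factors of
  \<open>u\<close> with all other parameters because the factors that cancelled in the reduced product also
  cancel here.
\<close>
lemma reduced_product_residue:
  assumes U: "finite U" "0 \<notin> U" and q: "q \<noteq> 0" "cmod q < 1" and u: "u \<in> U - (*) q ` U"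
  shows "(\<Prod>c\<in>(*) q ` U - U. 1 - c * inverse u) / (\<Prod>b\<in>U - (*) q ` U - {u}. 1 - b * inverse u) =
     (1 - q) * (\<Prod>w\<in>U - {u}. cross q u w)"
proof -
  have u0: "u \<noteq> 0" using u U by auto
  have qu: "q * u \<noteq> u" using q u0 by auto
  have inj: "inj_on ((*) q) U" using q by (auto simp: inj_on_def)
  have fac: "u - q * w = u * (1 - q * w * inverse u)" "u - w = u * (1 - w * inverse u)" for w
    using u0 by (simp_all add: right_diff_distrib)
  have cr: "cross q u w = (1 - q * w * inverse u) / (1 - w * inverse u)" for w
    unfolding cross_def fac using u0 by simp
  have A: "(\<Prod>w\<in>U. 1 - q * w * inverse u) = (\<Prod>c\<in>(*) q ` U. 1 - c * inverse u)" by (simp add: prod.reindex[OF inj])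
  have B: "(\<Prod>c\<in>(*) q ` U. 1 - c * inverse u) = (\<Prod>c\<in>(*) q ` U - U. 1 - c * inverse u) * (\<Prod>c\<in>(*) q ` U \<inter> U. 1 - c * inverse u)"
    using U by (subst prod.union_disjoint[symmetric]) (auto intro!: prod.cong)
  have C: "(\<Prod>c\<in>U - {u}. 1 - c * inverse u) = (\<Prod>c\<in>U - (*) q ` U - {u}. 1 - c * inverse u) * (\<Prod>c\<in>(*) q ` U \<inter> U. 1 - c * inverse u)"
    using U u by (subst prod.union_disjoint[symmetric]) (auto intro!: prod.cong)
  have nz: "(\<Prod>c\<in>(*) q ` U \<inter> U. 1 - c * inverse u) \<noteq> 0"
  proof -
    have "1 - c * inverse u \<noteq> 0" if "c \<in> (*) q ` U \<inter> U" for c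
      using that u u0 by (auto simp: field_simps)
    then show ?thesis using U by auto
  qed
  have "(1 - q) * (\<Prod>w\<in>U - {u}. cross q u w) = ((1 - q * u * inverse u) * (\<Prod>w\<in>U - {u}. 1 - q * w * inverse u)) / (\<Prod>w\<in>U - {u}. 1 - w * inverse u)"
    using u0 by (simp add: cr prod_dividef)
  also have "(1 - q * u * inverse u) * (\<Prod>w\<in>U - {u}. 1 - q * w * inverse u) = (\<Prod>w\<in>U. 1 - q * w * inverse u)"
    using U u by (subst prod.remove[of U u]) auto
  finally show ?thesis unfolding A B C using nz by simp
qed

lemma inverse_prod_expand:
  fixes B :: "complex set"
  assumes B: "finite B" "0 \<notin> B" and w: "\<forall>b\<in>B. 1 - b * w \<noteq> 0"
  shows "1 / (\<Prod>b\<in>B. 1 - b * w) = (if B = {} then 1 else 0) +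
     (\<Sum>b\<in>B. - 1 / (b * (\<Prod>c\<in>B - {b}. 1 - c * inverse b)) / (w - inverse b))"
proof -
  have inj: "inj_on inverse B" by (auto simp: inj_on_def)
  have fac: "1 - b * x = - b * (x - inverse b)" if "b \<in> B" for b x
    using that B by (cases "b = 0") (auto simp: right_diff_distrib)
  have nw: "w \<notin> inverse ` B" using w B by (auto simp: right_inverse) (metis right_inverse)
  have nz: "(\<Prod>b\<in>B. - b) \<noteq> 0" using B by auto
  have "1 / (\<Prod>b\<in>B. 1 - b * w) = (1 / (\<Prod>b\<in>B. - b)) * (poly 1 w / (\<Prod>a\<in>inverse ` B. w - a))"
  proof -
    have "(\<Prod>b\<in>B. 1 - b * w) = (\<Prod>b\<in>B. (- b) * (w - inverse b))" by (rule prod.cong) (use fac in auto)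
    also have "\<dots> = (\<Prod>b\<in>B. - b) * (\<Prod>a\<in>inverse ` B. w - a)"
      by (simp only: prod.distrib prod.reindex[OF inj] o_def)
    finally show ?thesis by simp
  qed
  also have "poly 1 w / (\<Prod>a\<in>inverse ` B. w - a) = coeff 1 (card (inverse ` B)) +
      (\<Sum>a\<in>inverse ` B. poly 1 a / (\<Prod>v\<in>inverse ` B - {a}. a - v) / (w - a))"
    by (rule partial_fractions) (use B nw in auto)
  also have "coeff 1 (card (inverse ` B)) = (if B = {} then 1 else (0 :: complex))"
    using B by (auto simp: card_image[OF inj] coeff_1 card_gt_0_iff)
  also have "(\<Sum>a\<in>inverse ` B. poly 1 a / (\<Prod>v\<in>inverse ` B - {a}. a - v) / (w - a)) =
     (\<Sum>b\<in>B. 1 / (\<Prod>c\<in>B - {b}. inverse b - inverse c) / (w - inverse b))"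
    unfolding sum.reindex[OF inj] o_def
  proof (rule sum.cong[OF refl])
    fix b assume b: "b \<in> B"
    have "inverse ` B - {inverse b} = inverse ` (B - {b})" by auto
    moreover have "inj_on inverse (B - {b})" by (auto simp: inj_on_def)
    ultimately show "poly 1 (inverse b) / (\<Prod>v\<in>inverse ` B - {inverse b}. inverse b - v) / (w - inverse b) =
      1 / (\<Prod>c\<in>B - {b}. inverse b - inverse c) / (w - inverse b)" by (simp add: prod.reindex)
  qed
  also have "1 / (\<Prod>b\<in>B. - b) * ((if B = {} then 1 else 0) + (\<Sum>b\<in>B. 1 / (\<Prod>c\<in>B - {b}. inverse b - inverse c) / (w - inverse b))) =
     (if B = {} then 1 else 0) + (\<Sum>b\<in>B. - 1 / (b * (\<Prod>c\<in>B - {b}. 1 - c * inverse b)) / (w - inverse b))"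
    unfolding distrib_left sum_distrib_left
  proof (intro arg_cong2[of _ _ _ _ "(+)"] sum.cong refl)
    fix b assume b: "b \<in> B"
    have "(\<Prod>b\<in>B. - b) * (\<Prod>c\<in>B - {b}. inverse b - inverse c) = - b * (\<Prod>c\<in>B - {b}. - c * (inverse b - inverse c))"
      using prod.remove[OF B(1) b, of uminus] by (simp only: prod.distrib mult.assoc)
    also have "(\<Prod>c\<in>B - {b}. - c * (inverse b - inverse c)) = (\<Prod>c\<in>B - {b}. 1 - c * inverse b)"
      by (rule prod.cong) (use fac in auto)
    finally have XY: "(\<Prod>b\<in>B. - b) * (\<Prod>c\<in>B - {b}. inverse b - inverse c) = - b * (\<Prod>c\<in>B - {b}. 1 - c * inverse b)" .
    have gen: "1 / X * (1 / Y / D) = 1 / (X * Y) / D" for X Y D :: complex by simp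
    show "1 / (\<Prod>b\<in>B. - b) * (1 / (\<Prod>c\<in>B - {b}. inverse b - inverse c) / (w - inverse b)) =
      - 1 / (b * (\<Prod>c\<in>B - {b}. 1 - c * inverse b)) / (w - inverse b)"
      unfolding gen XY by simp
  qed auto
  finally show ?thesis .
qed

definition closed_region :: "(real \<Rightarrow> complex) \<Rightarrow> complex set" where
  "closed_region g = inside (path_image g) \<union> path_image g"

text \<open>
  The function \<open>1 / \<Prod> (1 - b w)\<close> is expanded into partial fractions, and Cauchy's formula is
  applied to each term. The global form of Cauchy's theorem allows an open set with holes,
  such as the complement of the poles of the coupling factors.
\<close>
lemma contour_integral_simple_poles:
  fixes B :: "complex set"
  assumes g: "positive_contour g" and S: "open S" "closed_region g \<subseteq> S" and H: "H holomorphic_on S"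
    and B: "finite B" "0 \<notin> B" "\<forall>b\<in>B. inverse b \<notin> path_image g"
  shows "contour_integral g (\<lambda>w. H w / (\<Prod>b\<in>B. 1 - b * w)) =
    2 * pi * \<i> * (\<Sum>b | b \<in> B \<and> inverse b \<in> inside (path_image g). - H (inverse b) / (b * (\<Prod>c\<in>B - {b}. 1 - c * inverse b)))"
proof -
  have vg: "valid_path g" "pathfinish g = pathstart g"
    and wn: "\<And>z. z \<in> inside (path_image g) \<Longrightarrow> winding_number g z = 1"
    using g by (auto simp: positive_contour_def)
  have pS: "path_image g \<subseteq> S" using S by (auto simp: closed_region_def)
  have out: "winding_number g z = 0" if "z \<notin> closed_region g" for z
  proof -
    have "z \<in> outside (path_image g)" using that by (auto simp: closed_region_def inside_Un_outside outside_inside)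
    then show ?thesis using winding_number_zero_in_outside[OF valid_path_imp_path[OF vg(1)] vg(2)] by simp
  qed
  define r where "r = (\<lambda>b. - 1 / (b * (\<Prod>c\<in>B - {b}. 1 - c * inverse b)))"
  define i where "i = (\<lambda>b. if inverse b \<in> inside (path_image g) then H (inverse b) else 0)"
  have single: "((\<lambda>w. H w / (w - inverse b)) has_contour_integral 2 * pi * \<i> * i b) g" if b: "b \<in> B" for b
  proof (cases "inverse b \<in> inside (path_image g)")
    case True
    have "((\<lambda>w. H w / (w - inverse b)) has_contour_integral complex_of_real (2 * pi) * \<i> * winding_number g (inverse b) * H (inverse b)) g"
      by (rule Cauchy_integral_formula_global[OF S(1) H])
        (use True vg pS S B b out in \<open>auto simp: closed_region_def\<close>)
    then show ?thesis using True wn by (simp add: i_def)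
  next
    case False
    have "((\<lambda>w. H w / (w - inverse b)) has_contour_integral 0) g"
    proof (rule Cauchy_theorem_global)
      show "open (S - {inverse b})" using S by auto
      show "(\<lambda>w. H w / (w - inverse b)) holomorphic_on S - {inverse b}"
        using H by (auto intro!: holomorphic_intros intro: holomorphic_on_subset)
      show "winding_number g w = 0" if "w \<notin> S - {inverse b}" for w
        using that out[of w] S False B b by (auto simp: closed_region_def)
    qed (use vg pS B b in auto)
    then show ?thesis using False by (simp add: i_def)
  qed
  have zero: "((\<lambda>w. H w * (if B = {} then 1 else 0)) has_contour_integral 0) g"
    by (rule Cauchy_theorem_global[OF S(1) _ vg(1,2) pS]) (use H out S in \<open>auto intro!: holomorphic_intros\<close>)
  have "((\<lambda>w. H w * (if B = {} then 1 else 0) + (\<Sum>b\<in>B. r b * (H w / (w - inverse b)))) has_contour_integral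
     (0 + (\<Sum>b\<in>B. r b * (2 * pi * \<i> * i b)))) g"
    by (intro has_contour_integral_add zero has_contour_integral_sum has_contour_integral_lmul single B(1))
  then have "contour_integral g (\<lambda>w. H w * (if B = {} then 1 else 0) + (\<Sum>b\<in>B. r b * (H w / (w - inverse b)))) =
     (\<Sum>b\<in>B. r b * (2 * pi * \<i> * i b))" by (simp add: contour_integral_unique)
  moreover have "contour_integral g (\<lambda>w. H w / (\<Prod>b\<in>B. 1 - b * w)) =
     contour_integral g (\<lambda>w. H w * (if B = {} then 1 else 0) + (\<Sum>b\<in>B. r b * (H w / (w - inverse b))))"
  proof (rule contour_integral_cong[OF refl])
    fix w assume w: "w \<in> path_image g"
    have "1 - b * w \<noteq> 0" if "b \<in> B" for b
    proof
      assume "1 - b * w = 0"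
      then have "w = inverse b" using B that by (metis eq_iff_diff_eq_0 inverse_unique)
      then show False using B that w by auto
    qed
    then have "H w / (\<Prod>b\<in>B. 1 - b * w) = H w * ((if B = {} then 1 else 0) + (\<Sum>b\<in>B. r b / (w - inverse b)))"
      using inverse_prod_expand[OF B(1,2), of w] by (simp add: r_def divide_inverse)
    then show "H w / (\<Prod>b\<in>B. 1 - b * w) = H w * (if B = {} then 1 else 0) + (\<Sum>b\<in>B. r b * (H w / (w - inverse b)))"
      by (simp add: distrib_left sum_distrib_left mult_ac)
  qed
  moreover have "(\<Sum>b\<in>B. r b * (2 * pi * \<i> * i b)) =
    2 * pi * \<i> * (\<Sum>b | b \<in> B \<and> inverse b \<in> inside (path_image g). - H (inverse b) / (b * (\<Prod>c\<in>B - {b}. 1 - c * inverse b)))"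
    unfolding sum_distrib_left
    by (rule sum.mono_neutral_cong_right) (use B in \<open>auto simp: i_def r_def\<close>)
  ultimately show ?thesis by simp
qed

text \<open>
  The condition \<open>w \<noteq> q v\<close> is imposed for all \<open>w\<close> in the closed region bounded by the outer
  contour and not only on the curve itself. Hence the coupling factors have no poles there,
  and the outer integral only meets the poles of the product over the parameters.
\<close>
fun separated_contours :: "complex \<Rightarrow> complex \<Rightarrow> (real \<Rightarrow> complex) set list \<Rightarrow> bool" where
  "separated_contours q s [] \<longleftrightarrow> True"
| "separated_contours q s (C # Cs) \<longleftrightarrow> finite C \<and> (\<forall>g\<in>C. positive_contour g \<and> s \<notin> closed_region g) \<and>
     (\<forall>C'\<in>set Cs. \<forall>h\<in>C'. \<forall>g\<in>C. \<forall>w\<in>closed_region g. \<forall>v\<in>path_image h. w \<noteq> q * v) \<and>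
     separated_contours q s Cs"

text \<open>
  Only the poles of the reduced product have to be enclosed, and the set of these poles
  changes from one contour to the next, because the parameter whose residue was taken is
  removed. Inside exactly one curve of the contour means that each residue is counted once.
\<close>
fun poles_enclosed :: "complex \<Rightarrow> (real \<Rightarrow> complex) set list \<Rightarrow> complex set \<Rightarrow> bool" where
  "poles_enclosed q [] U \<longleftrightarrow> True"
| "poles_enclosed q (C # Cs) U \<longleftrightarrow> (\<forall>b\<in>U - (*) q ` U.
     (\<exists>g\<in>C. inverse b \<in> inside (path_image g) \<and> (\<forall>h\<in>C - {g}. inverse b \<notin> closed_region h)) \<and>
     (\<forall>C'\<in>set Cs. \<forall>h\<in>C'. inverse b \<notin> path_image h) \<and>
     poles_enclosed q Cs (U - {b}))"

lemma path_image_subset_region: "path_image g \<subseteq> closed_region g"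
  by (simp add: closed_region_def)

lemma positive_contourD:
  assumes "positive_contour g"
  shows "valid_path g" "pathfinish g = pathstart g" "compact (path_image g)"
  using assms by (auto simp: positive_contour_def valid_path_imp_path compact_path_image)

lemma separated_contours_nth:
  assumes "separated_contours q s Cs" "i < length Cs"
  shows "finite (Cs ! i)" "g \<in> Cs ! i \<Longrightarrow> positive_contour g" "g \<in> Cs ! i \<Longrightarrow> s \<notin> closed_region g"
    "j < i \<Longrightarrow> g \<in> Cs ! i \<Longrightarrow> h \<in> Cs ! j \<Longrightarrow> w \<in> closed_region h \<Longrightarrow> v \<in> path_image g \<Longrightarrow> w \<noteq> q * v"
proof -
  have "finite (Cs ! i) \<and> (g \<in> Cs ! i \<longrightarrow> positive_contour g \<and> s \<notin> closed_region g) \<and>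
    (\<forall>j<i. g \<in> Cs ! i \<longrightarrow> h \<in> Cs ! j \<longrightarrow> w \<in> closed_region h \<longrightarrow> v \<in> path_image g \<longrightarrow> w \<noteq> q * v)"
    using assms
  proof (induction Cs arbitrary: i)
    case (Cons C Cs)
    show ?case
    proof (cases i)
      case 0
      then show ?thesis using Cons.prems by auto
    next
      case (Suc k)
      then have k: "k < length Cs" using Cons.prems by simp
      have IH: "finite (Cs ! k) \<and> (g \<in> Cs ! k \<longrightarrow> positive_contour g \<and> s \<notin> closed_region g) \<and>
        (\<forall>j<k. g \<in> Cs ! k \<longrightarrow> h \<in> Cs ! j \<longrightarrow> w \<in> closed_region h \<longrightarrow> v \<in> path_image g \<longrightarrow> w \<noteq> q * v)"
        by (rule Cons.IH) (use Cons.prems k in auto)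
      have "w \<noteq> q * v" if "j < i" "g \<in> (C # Cs) ! i" "h \<in> (C # Cs) ! j" "w \<in> closed_region h" "v \<in> path_image g" for j
      proof (cases j)
        case 0
        then have "h \<in> C" "g \<in> Cs ! k" "Cs ! k \<in> set Cs" using that Suc k by auto
        then show ?thesis using Cons.prems(1) that by auto
      next
        case (Suc l)
        then show ?thesis using IH that \<open>i = Suc k\<close> by auto
      qed
      then show ?thesis using IH Suc by auto
    qed
  qed simp
  then show "finite (Cs ! i)" "g \<in> Cs ! i \<Longrightarrow> positive_contour g" "g \<in> Cs ! i \<Longrightarrow> s \<notin> closed_region g"
    "j < i \<Longrightarrow> g \<in> Cs ! i \<Longrightarrow> h \<in> Cs ! j \<Longrightarrow> w \<in> closed_region h \<Longrightarrow> v \<in> path_image g \<Longrightarrow> w \<noteq> q * v"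
    by blast+
qed

definition contour_support :: "(real \<Rightarrow> complex) set \<Rightarrow> complex set" where
  "contour_support C = (\<Union>g\<in>C. path_image g)"

lemma separated_contours_support:
  assumes "separated_contours q s Cs" "i < length Cs"
  shows "compact (contour_support (Cs ! i))" "s \<notin> contour_support (Cs ! i)"
    "j < i \<Longrightarrow> \<forall>w\<in>contour_support (Cs ! j). \<forall>v\<in>contour_support (Cs ! i). w \<noteq> q * v"
proof -
  note n = separated_contours_nth[OF assms]
  show "compact (contour_support (Cs ! i))"
    unfolding contour_support_def using n(1) positive_contourD(3)[OF n(2)] by (intro compact_UN) auto
  show "s \<notin> contour_support (Cs ! i)" using n(3) by (auto simp: contour_support_def closed_region_def)
  show "\<forall>w\<in>contour_support (Cs ! j). \<forall>v\<in>contour_support (Cs ! i). w \<noteq> q * v" if "j < i"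
    using n(4)[OF that] path_image_subset_region by (fastforce simp: contour_support_def)
qed

text \<open>
  The property \<open>P\<close> stands for whatever else is required of the neighbourhoods.
\<close>
lemma separated_neighbourhoods:
  assumes sep: "separated_contours q s Cs" and q: "cmod q < 1"
    and P: "\<And>i. i < length Cs \<Longrightarrow> \<forall>\<^sub>F \<epsilon> in at_right 0. P i \<epsilon>"
  obtains \<epsilon> :: real where "\<epsilon> > 0"
    "\<And>i. i < length Cs \<Longrightarrow> P i \<epsilon>"
    "\<And>i. i < length Cs \<Longrightarrow> s \<notin> thicken \<epsilon> (contour_support (Cs ! i))"
    "\<And>i j w v. i < length Cs \<Longrightarrow> j < i \<Longrightarrow> w \<in> thicken \<epsilon> (contour_support (Cs ! j)) \<Longrightarrow>
       v \<in> thicken \<epsilon> (contour_support (Cs ! i)) \<Longrightarrow> w \<noteq> q * v"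
proof -
  note S = separated_contours_support[OF sep]
  have 1: "\<forall>\<^sub>F \<epsilon> in at_right 0. \<forall>i\<in>{..<length Cs}. P i \<epsilon>"
    by (rule eventually_ball_finite) (use P in auto)
  have 2: "\<forall>\<^sub>F \<epsilon> in at_right 0. \<forall>i\<in>{..<length Cs}. s \<notin> thicken \<epsilon> (contour_support (Cs ! i))"
    by (rule eventually_ball_finite) (use S eventually_thicken_avoid in auto)
  have 3: "\<forall>\<^sub>F \<epsilon> in at_right 0. \<forall>i\<in>{..<length Cs}. \<forall>j\<in>{..<i}. \<forall>w\<in>thicken \<epsilon> (contour_support (Cs ! j)).
     \<forall>v\<in>thicken \<epsilon> (contour_support (Cs ! i)). w \<noteq> q * v"
    by (intro eventually_ball_finite ballI finite_lessThan eventually_thicken_separated S q) auto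
  have 4: "\<forall>\<^sub>F \<epsilon> in at_right (0 :: real). \<epsilon> > 0" by (rule eventually_at_right_less)
  have "\<exists>\<epsilon>. (((\<forall>i\<in>{..<length Cs}. P i \<epsilon>) \<and> (\<forall>i\<in>{..<length Cs}. s \<notin> thicken \<epsilon> (contour_support (Cs ! i)))) \<and>
    (\<forall>i\<in>{..<length Cs}. \<forall>j\<in>{..<i}. \<forall>w\<in>thicken \<epsilon> (contour_support (Cs ! j)).
     \<forall>v\<in>thicken \<epsilon> (contour_support (Cs ! i)). w \<noteq> q * v)) \<and> \<epsilon> > 0"
    by (rule eventually_happens'[OF _ eventually_conj[OF eventually_conj[OF eventually_conj[OF 1 2] 3] 4]]) simp
  then show ?thesis using that by blast
qed

text \<open>
  As a function of the outermost variable, the remaining integral is holomorphic wherever the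
  coupling factors have no pole, in particular inside the outermost contour.
\<close>
lemma moment_integral_holomorphic:
  assumes sep: "separated_contours q s Cs" and q: "cmod q < 1" and len: "length Cs = length \<theta>"
    and U: "finite U" "0 \<notin> U"
    and b: "\<And>b i. b \<in> U - (*) q ` U \<Longrightarrow> i < length Cs \<Longrightarrow> inverse b \<notin> contour_support (Cs ! i)"
    and D: "\<And>w v i. w \<in> D \<Longrightarrow> i < length Cs \<Longrightarrow> v \<in> contour_support (Cs ! i) \<Longrightarrow> w \<noteq> q * v"
  shows "(\<lambda>w. iter_oint Cs (moment_integrand q s \<theta> (\<lambda>v. kern q w v * reduced_product q U v))) holomorphic_on D"
proof -
  define K where "K = (\<lambda>w. iter_oint Cs (moment_integrand q s \<theta> (\<lambda>v. kern q w v * reduced_product q U v)))"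
  note S = separated_contours_support[OF sep]
  have "\<exists>T. open T \<and> w0 \<in> T \<and> K holomorphic_on T" if w0: "w0 \<in> D" for w0
  proof -
    have ev: "\<forall>\<^sub>F \<epsilon> in at_right 0. (\<forall>w\<in>thicken \<epsilon> {w0}. \<forall>v\<in>thicken \<epsilon> (contour_support (Cs ! i)). w \<noteq> q * v) \<and>
       (\<forall>b\<in>U - (*) q ` U. inverse b \<notin> thicken \<epsilon> (contour_support (Cs ! i)))" if i: "i < length Cs" for i
    proof (rule eventually_conj)
      show "\<forall>\<^sub>F \<epsilon> in at_right 0. \<forall>w\<in>thicken \<epsilon> {w0}. \<forall>v\<in>thicken \<epsilon> (contour_support (Cs ! i)). w \<noteq> q * v"
        by (rule eventually_thicken_separated) (use S(1)[OF i] q D[OF w0 i] in auto)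
      show "\<forall>\<^sub>F \<epsilon> in at_right 0. \<forall>b\<in>U - (*) q ` U. inverse b \<notin> thicken \<epsilon> (contour_support (Cs ! i))"
        by (rule eventually_ball_finite) (use U b i S(1)[OF i] eventually_thicken_avoid in auto)
    qed
    define P where "P = (\<lambda>i \<epsilon>. (\<forall>w\<in>thicken \<epsilon> {w0}. \<forall>v\<in>thicken \<epsilon> (contour_support (Cs ! i)). w \<noteq> q * v) \<and>
       (\<forall>b\<in>U - (*) q ` U. inverse b \<notin> thicken \<epsilon> (contour_support (Cs ! i))))"
    have evP: "\<forall>\<^sub>F \<epsilon> in at_right 0. P i \<epsilon>" if "i < length Cs" for i unfolding P_def by (rule ev[OF that])
    obtain \<epsilon> where e: "\<epsilon> > 0"
      "\<And>i. i < length Cs \<Longrightarrow> (\<forall>w\<in>thicken \<epsilon> {w0}. \<forall>v\<in>thicken \<epsilon> (contour_support (Cs ! i)). w \<noteq> q * v) \<and>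
       (\<forall>b\<in>U - (*) q ` U. inverse b \<notin> thicken \<epsilon> (contour_support (Cs ! i)))"
      "\<And>i. i < length Cs \<Longrightarrow> s \<notin> thicken \<epsilon> (contour_support (Cs ! i))"
      "\<And>i j w v. i < length Cs \<Longrightarrow> j < i \<Longrightarrow> w \<in> thicken \<epsilon> (contour_support (Cs ! j)) \<Longrightarrow>
       v \<in> thicken \<epsilon> (contour_support (Cs ! i)) \<Longrightarrow> w \<noteq> q * v"
      by (rule separated_neighbourhoods[OF sep q evP]) (auto simp: P_def)
    define Us where "Us = map (\<lambda>C. thicken \<epsilon> (contour_support C)) Cs"
    define T where "T = thicken \<epsilon> {w0}"
    define V where "V = (\<lambda>j. if j = 0 then T else if j \<le> length Us then Us ! (j - 1) else UNIV)"
    have lU: "length Us = length Cs" by (simp add: Us_def)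
    have inV: "x 0 \<in> T" "i < length Cs \<Longrightarrow> x (Suc i) \<in> Us ! i" if "\<forall>j. x j \<in> V j" for x i
      using that[THEN spec, of 0] that[THEN spec, of "Suc i"] by (auto simp: V_def lU)
    have "K holomorphic_on T"
      unfolding K_def
    proof (rule holomorphic_iter_oint)
      show "multi_hol (\<lambda>j. if j = 0 then T else if j \<le> length Us then Us ! (j - 1) else UNIV)
        (\<lambda>x. moment_integrand q s \<theta> (\<lambda>v. kern q (x 0) v * reduced_product q U v) (map x [1..<Suc (length Us)]))"
      proof (rule multi_hol_moment_integrand)
        fix i assume i: "i < length \<theta>"
        then have i': "i < length Cs" using len by simp
        have "multi_hol V (\<lambda>x. (x 0 - x (Suc i)) / (x 0 - q * x (Suc i)) *
           ((\<Prod>c\<in>(*) q ` U - U. 1 - c * x (Suc i)) / (\<Prod>b\<in>U - (*) q ` U. 1 - b * x (Suc i))))"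
        proof (intro multi_hol_mult multi_hol_divide multi_hol_prod multi_hol_diff multi_hol_coord multi_hol_const)
          fix x assume x: "\<forall>j. x j \<in> V j"
          show "x 0 - q * x (Suc i) \<noteq> 0"
            using e(2)[OF i'] inV(1)[OF x] inV(2)[OF x i'] i' by (auto simp: Us_def T_def)
          have "1 - b * x (Suc i) \<noteq> 0" if "b \<in> U - (*) q ` U" for b
          proof
            assume "1 - b * x (Suc i) = 0"
            then have "x (Suc i) = inverse b" by (metis eq_iff_diff_eq_0 inverse_unique)
            then show False using e(2)[OF i'] inV(2)[OF x i'] that i' by (auto simp: Us_def)
          qed
          then show "(\<Prod>b\<in>U - (*) q ` U. 1 - b * x (Suc i)) \<noteq> 0" using U by auto
        qed
        then show "multi_hol (\<lambda>j. if j = 0 then T else if j \<le> length Us then Us ! (j - 1) else UNIV)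
          (\<lambda>x. kern q (x 0) (x (Suc i)) * reduced_product q U (x (Suc i)))"
          by (simp add: V_def kern_def reduced_product_def)
      qed (use len e in \<open>auto simp: Us_def\<close>)
      show "open T" by (simp add: T_def)
      show "length Us = length Cs" by (rule lU)
      show "open (Us ! i)" if "i < length Us" for i using that by (simp add: Us_def)
      show "valid_path g \<and> pathfinish g = pathstart g \<and> path_image g \<subseteq> Us ! i" if i: "i < length Cs" and g: "g \<in> Cs ! i" for i g
      proof -
        have "path_image g \<subseteq> contour_support (Cs ! i)" using g by (auto simp: contour_support_def)
        then show ?thesis
          using positive_contourD[OF separated_contours_nth(2)[OF sep i g]] subset_thicken[OF e(1)] i
          by (auto simp: Us_def)
      qed
    qed
    then show ?thesis using e(1) subset_thicken[of \<epsilon> "{w0}"] by (intro exI[of _ T]) (auto simp: T_def)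
  qed
  then have "K analytic_on D"
    unfolding analytic_on_def by (meson holomorphic_on_subset open_contains_ball)
  then show ?thesis unfolding K_def by (rule analytic_imp_holomorphic)
qed

lemma inside_not_on_path: "x \<in> inside S \<Longrightarrow> x \<notin> S"
  using inside_no_overlap[of S] by blast

text \<open>
  Each pole lies inside exactly one curve, so exchanging the sums over curves and poles counts
  every residue once.
\<close>
lemma oint_simple_poles:
  fixes B :: "complex set"
  assumes C: "finite C" "\<And>g. g \<in> C \<Longrightarrow> positive_contour g \<and> closed_region g \<subseteq> S" and S: "open S" and H: "H holomorphic_on S"
    and B: "finite B" "0 \<notin> B"
    and enc: "\<And>b. b \<in> B \<Longrightarrow> \<exists>g\<in>C. inverse b \<in> inside (path_image g) \<and> (\<forall>h\<in>C - {g}. inverse b \<notin> closed_region h)"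
  shows "oint C (\<lambda>w. H w / (\<Prod>b\<in>B. 1 - b * w)) = (\<Sum>b\<in>B. - H (inverse b) / (b * (\<Prod>c\<in>B - {b}. 1 - c * inverse b)))"
proof -
  define r where "r = (\<lambda>b. - H (inverse b) / (b * (\<Prod>c\<in>B - {b}. 1 - c * inverse b)))"
  have on_path: "inverse b \<notin> path_image g" if "b \<in> B" "g \<in> C" for b g
  proof -
    obtain g' where g': "g' \<in> C" "inverse b \<in> inside (path_image g')" "\<forall>h\<in>C - {g'}. inverse b \<notin> closed_region h"
      using enc[OF \<open>b \<in> B\<close>] by blast
    then show ?thesis using inside_not_on_path[OF g'(2)] that path_image_subset_region[of g] by (cases "g = g'") auto
  qed
  have "oint C (\<lambda>w. H w / (\<Prod>b\<in>B. 1 - b * w)) = (\<Sum>g\<in>C. 2 * pi * \<i> * (\<Sum>b | b \<in> B \<and> inverse b \<in> inside (path_image g). r b)) / (2 * pi * \<i>)"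
    unfolding oint_def r_def
    by (intro arg_cong2[of _ _ _ _ "(/)"] sum.cong refl contour_integral_simple_poles[OF _ S _ H B])
      (use C on_path in auto)
  also have "\<dots> = (\<Sum>g\<in>C. \<Sum>b | b \<in> B \<and> inverse b \<in> inside (path_image g). r b)"
    by (simp add: sum_distrib_left[symmetric])
  also have "\<dots> = (\<Sum>b\<in>B. \<Sum>g | g \<in> C \<and> inverse b \<in> inside (path_image g). r b)"
    by (rule sum.swap_restrict[OF C(1) B(1)])
  also have "\<dots> = (\<Sum>b\<in>B. r b)"
  proof (rule sum.cong[OF refl])
    fix b assume b: "b \<in> B"
    obtain g' where g': "g' \<in> C" "inverse b \<in> inside (path_image g')" "\<forall>h\<in>C - {g'}. inverse b \<notin> closed_region h"
      using enc[OF b] by blast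
    have "{g. g \<in> C \<and> inverse b \<in> inside (path_image g)} = {g'}"
      using g' by (auto simp: closed_region_def)
    then show "(\<Sum>g | g \<in> C \<and> inverse b \<in> inside (path_image g). r b) = r b" by simp
  qed
  finally show ?thesis by (simp add: r_def)
qed

text \<open>
  The residue of the outermost variable at \<open>1 / b\<close> produces the one-particle factor, the cross
  factors of \<open>b\<close> with all other parameters, and the integral for \<open>U - {b}\<close>: this is the
  recursion of the Bethe sum.
\<close>
theorem moment_integral_eq_bethe:
  assumes q: "q \<noteq> 0" "cmod q < 1"
    and "separated_contours q s Cs" "poles_enclosed q Cs U" "length Cs = length \<theta>"
    and "finite U" "0 \<notin> U" "\<forall>u\<in>U. 1 - s * u \<noteq> 0"
  shows "iter_oint Cs (moment_integrand q s \<theta> (reduced_product q U)) = (- 1) ^ length \<theta> * bethe q s \<theta> U"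
  using assms(3-)
proof (induction \<theta> arbitrary: Cs U)
  case Nil
  then show ?case by simp
next
  case (Cons t \<theta> Cs0 U)
  then obtain C Cs where Cs0: "Cs0 = C # Cs" by (cases Cs0) auto
  note U = Cons.prems(4-6)
  have len: "length Cs = length \<theta>" using Cons.prems Cs0 by simp
  have C: "finite C" "\<And>g. g \<in> C \<Longrightarrow> positive_contour g" "\<And>g. g \<in> C \<Longrightarrow> s \<notin> closed_region g"
    and CCs: "\<And>C' h g w v. C' \<in> set Cs \<Longrightarrow> h \<in> C' \<Longrightarrow> g \<in> C \<Longrightarrow> w \<in> closed_region g \<Longrightarrow> v \<in> path_image h \<Longrightarrow> w \<noteq> q * v"
    and sepCs: "separated_contours q s Cs"
    using Cons.prems(1) by (auto simp: Cs0)
  define B where "B = U - (*) q ` U"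
  have B: "finite B" "0 \<notin> B" using U by (auto simp: B_def)
  have enc: "\<exists>g\<in>C. inverse b \<in> inside (path_image g) \<and> (\<forall>h\<in>C - {g}. inverse b \<notin> closed_region h)"
    and bpath: "\<And>C' h. C' \<in> set Cs \<Longrightarrow> h \<in> C' \<Longrightarrow> inverse b \<notin> path_image h"
    and rest: "poles_enclosed q Cs (U - {b})" if "b \<in> B" for b
  proof -
    have "\<forall>b\<in>B. (\<exists>g\<in>C. inverse b \<in> inside (path_image g) \<and> (\<forall>h\<in>C - {g}. inverse b \<notin> closed_region h)) \<and>
       (\<forall>C'\<in>set Cs. \<forall>h\<in>C'. inverse b \<notin> path_image h) \<and> poles_enclosed q Cs (U - {b})"
      using Cons.prems(2) unfolding Cs0 poles_enclosed.simps B_def .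
    note * = bspec[OF this that]
    show "\<exists>g\<in>C. inverse b \<in> inside (path_image g) \<and> (\<forall>h\<in>C - {g}. inverse b \<notin> closed_region h)"
      using * by (rule conjunct1)
    show "\<And>C' h. C' \<in> set Cs \<Longrightarrow> h \<in> C' \<Longrightarrow> inverse b \<notin> path_image h" using * by blast
    show "poles_enclosed q Cs (U - {b})" using * by blast
  qed
  define E where "E = (*) q ` U - U"
  define K where "K = (\<lambda>w. iter_oint Cs (moment_integrand q s \<theta> (\<lambda>v. kern q w v * reduced_product q U v)))"
  define D where "D = - (\<Union>C'\<in>set Cs. (*) q ` contour_support C')"
  define H where "H = (\<lambda>w. rho s t w * (\<Prod>c\<in>E. 1 - c * w) * K w)"
  have "open D"
  proof -
    have "compact ((*) q ` contour_support C')" if C': "C' \<in> set Cs" for C'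
    proof -
      obtain i where "i < length Cs" "C' = Cs ! i" using C' by (metis in_set_conv_nth)
      then show ?thesis using separated_contours_support(1)[OF sepCs] by (intro compact_continuous_image continuous_intros) auto
    qed
    then show ?thesis unfolding D_def by (intro open_Compl closed_UN) (auto intro: compact_imp_closed)
  qed
  then have S: "open (D - {s})" by auto
  have K: "K holomorphic_on D"
    unfolding K_def
  proof (rule moment_integral_holomorphic[OF sepCs q(2) len U(1,2)])
    fix b i assume "b \<in> U - (*) q ` U" "i < length Cs"
    then show "inverse b \<notin> contour_support (Cs ! i)" using bpath[of b "Cs ! i"] by (auto simp: contour_support_def B_def)
  next
    fix w v i assume "w \<in> D" "i < length Cs" "v \<in> contour_support (Cs ! i)"
    then show "w \<noteq> q * v" by (auto simp: D_def)
  qed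
  have H: "H holomorphic_on D - {s}"
    unfolding H_def rho_def by (intro holomorphic_intros holomorphic_on_subset[OF K]) auto
  have region: "closed_region g \<subseteq> D - {s}" if g: "g \<in> C" for g
    using C(3)[OF g] CCs[OF _ _ g] by (auto simp: D_def contour_support_def)
  define r where "r = (\<lambda>b. - H (inverse b) / (b * (\<Prod>c\<in>B - {b}. 1 - c * inverse b)))"
  have "iter_oint Cs0 (moment_integrand q s (t # \<theta>) (reduced_product q U)) = oint C (\<lambda>w. H w / (\<Prod>b\<in>B. 1 - b * w))"
    unfolding Cs0 iter_oint.simps moment_integrand_Cons iter_oint_mult_left
    by (simp add: H_def K_def B_def E_def reduced_product_def mult_ac)
  also have "\<dots> = (\<Sum>b\<in>B. r b)"
    unfolding r_def by (rule oint_simple_poles[OF C(1) _ S H B enc]) (use C(2) region in auto)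
  also have "\<dots> = (\<Sum>b\<in>B. - ((- 1) ^ length \<theta> * ((1 - q) / (1 - s * b) * ((b - s) / (1 - s * b)) ^ t *
     (\<Prod>w\<in>U - {b}. cross q b w) * bethe q s \<theta> (U - {b}))))"
  proof (rule sum.cong[OF refl])
    fix b assume b: "b \<in> B"
    then have b0: "b \<noteq> 0" and bU: "b \<in> U" "1 - s * b \<noteq> 0" using B U by (auto simp: B_def)
    have "K (inverse b) = iter_oint Cs (moment_integrand q s \<theta> (reduced_product q (U - {b})))"
      unfolding K_def
    proof (intro iter_oint_cong moment_integrand_cong)
      fix ws :: "complex list" and i
      assume ws: "\<And>i. i < length Cs \<Longrightarrow> ws ! i \<in> (\<Union>g\<in>Cs ! i. path_image g)" and "i < length \<theta>"
      then have i: "i < length Cs" using len by simp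
      then obtain h where h: "h \<in> Cs ! i" "ws ! i \<in> path_image h" using ws by blast
      have 1: "1 - b * ws ! i \<noteq> 0"
      proof
        assume "1 - b * ws ! i = 0"
        then have "ws ! i = inverse b" by (metis eq_iff_diff_eq_0 inverse_unique)
        then show False using bpath[OF b, of "Cs ! i" h] h i by auto
      qed
      have 2: "1 - q * b * ws ! i \<noteq> 0"
      proof
        assume "1 - q * b * ws ! i = 0"
        then have "inverse b = q * ws ! i" by (metis eq_iff_diff_eq_0 inverse_unique mult.assoc mult.commute)
        moreover obtain g where "g \<in> C" "inverse b \<in> closed_region g" using enc[OF b] by (auto simp: closed_region_def)
        ultimately show False using CCs[of "Cs ! i" h g "inverse b" "ws ! i"] h i by auto
      qed
      show "kern q (inverse b) (ws ! i) * reduced_product q U (ws ! i) = reduced_product q (U - {b}) (ws ! i)"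
        by (rule reduced_product_remove[OF U(1,2) q]) (use b 1 2 in \<open>auto simp: B_def\<close>)
    qed
    also have "\<dots> = (- 1) ^ length \<theta> * bethe q s \<theta> (U - {b})"
      by (rule Cons.IH[OF sepCs rest[OF b] len]) (use U in auto)
    finally have Kb: "K (inverse b) = (- 1) ^ length \<theta> * bethe q s \<theta> (U - {b})" .
    have fac: "inverse b - s = inverse b * (1 - s * b)" "1 - s * inverse b = inverse b * (b - s)"
      using b0 by (simp_all add: right_diff_distrib)
    have rh: "rho s t (inverse b) = b / (1 - s * b) * ((b - s) / (1 - s * b)) ^ t"
      
    proof -
      have "inverse b * (b - s) / (inverse b * (1 - s * b)) = (b - s) / (1 - s * b)" using b0 by simp
      moreover have "1 / (inverse b * (1 - s * b)) = b / (1 - s * b)" using b0 by (simp add: divide_inverse)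
      ultimately show ?thesis unfolding rho_def fac by simp
    qed
    have "r b = - (rho s t (inverse b) / b * ((\<Prod>c\<in>E. 1 - c * inverse b) / (\<Prod>c\<in>B - {b}. 1 - c * inverse b)) * K (inverse b))"
      by (simp add: r_def H_def)
    also have "(\<Prod>c\<in>E. 1 - c * inverse b) / (\<Prod>c\<in>B - {b}. 1 - c * inverse b) = (1 - q) * (\<Prod>w\<in>U - {b}. cross q b w)"
      unfolding E_def B_def by (rule reduced_product_residue[OF U(1,2) q]) (use b in \<open>auto simp: B_def\<close>)
    finally show "r b = - ((- 1) ^ length \<theta> * ((1 - q) / (1 - s * b) * ((b - s) / (1 - s * b)) ^ t *
     (\<Prod>w\<in>U - {b}. cross q b w) * bethe q s \<theta> (U - {b})))"
      unfolding rh Kb using b0 by (simp add: mult_ac)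
  qed
  also have "\<dots> = (\<Sum>b\<in>U. - ((- 1) ^ length \<theta> * ((1 - q) / (1 - s * b) * ((b - s) / (1 - s * b)) ^ t *
     (\<Prod>w\<in>U - {b}. cross q b w) * bethe q s \<theta> (U - {b}))))"
  proof (rule sum.mono_neutral_left[OF U(1)])
    show "B \<subseteq> U" by (auto simp: B_def)
    show "\<forall>b\<in>U - B. - ((- 1) ^ length \<theta> * ((1 - q) / (1 - s * b) * ((b - s) / (1 - s * b)) ^ t *
     (\<Prod>w\<in>U - {b}. cross q b w) * bethe q s \<theta> (U - {b}))) = 0"
    proof
      fix b assume "b \<in> U - B"
      then obtain v where v: "v \<in> U" "b = q * v" by (auto simp: B_def)
      then have "v \<noteq> b" using q U by auto
      then have "(\<Prod>w\<in>U - {b}. cross q b w) = 0" using v U by (intro prod_zero) (auto simp: cross_def intro!: bexI[of _ v])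
      then show "- ((- 1) ^ length \<theta> * ((1 - q) / (1 - s * b) * ((b - s) / (1 - s * b)) ^ t *
     (\<Prod>w\<in>U - {b}. cross q b w) * bethe q s \<theta> (U - {b}))) = 0" by simp
    qed
  qed
  also have "\<dots> = (- 1) ^ length (t # \<theta>) * bethe q s (t # \<theta>) U"
    by (simp add: sum_negf sum_distrib_left)
  finally show ?case .
qed

section \<open>Coinciding parameters: the expectation\<close>

definition moved :: "complex list \<Rightarrow> complex list \<Rightarrow> complex \<Rightarrow> complex list" where
  "moved us ds t = map2 (\<lambda>u d. u + t * d) us ds"

lemma length_moved [simp]: "length us = length ds \<Longrightarrow> length (moved us ds t) = length us"
  by (simp add: moved_def)

lemma moved_nth: "length us = length ds \<Longrightarrow> i < length us \<Longrightarrow> moved us ds t ! i = us ! i + t * ds ! i"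
  by (simp add: moved_def)

lemma moved_0 [simp]: "length us = length ds \<Longrightarrow> moved us ds 0 = us"
  by (intro nth_equalityI) (simp_all add: moved_nth)

lemma vertex_weight_affine:
  obtains a b where "\<And>u. vertex_weight q s u i1 j1 i2 j2 = (a + b * u) / (1 - of_real s * u)"
proof -
  consider "j1 = 0 \<and> j2 = 0 \<and> i1 = i2" | "j1 = 0 \<and> j2 = 1 \<and> i1 = i2 + 1" | "j1 = 1 \<and> j2 = 1 \<and> i1 = i2"
    | "j1 = 1 \<and> j2 = 0 \<and> i2 = i1 + 1"
    | "\<not> (j1 = 0 \<and> j2 = 0 \<and> i1 = i2) \<and> \<not> (j1 = 0 \<and> j2 = 1 \<and> i1 = i2 + 1) \<and> \<not> (j1 = 1 \<and> j2 = 1 \<and> i1 = i2)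
       \<and> \<not> (j1 = 1 \<and> j2 = 0 \<and> i2 = i1 + 1)" by blast
  then show ?thesis
  proof cases
    case 1
    then show ?thesis by (intro that[of 1 "- of_real s * of_real q ^ i1"]) (simp add: vertex_weight_def)
  next
    case 2
    then show ?thesis by (intro that[of 0 "1 - (of_real s)\<^sup>2 * of_real q ^ i2"]) (simp add: vertex_weight_def)
  next
    case 3
    then show ?thesis by (intro that[of "- of_real s * of_real q ^ i1" 1]) (simp add: vertex_weight_def)
  next
    case 4
    then show ?thesis by (intro that[of "1 - of_real q ^ i2" 0]) (simp add: vertex_weight_def)
  next
    case 5
    then have "vertex_weight q s u i1 j1 i2 j2 = 0" for u
      unfolding vertex_weight_def by (simp only: if_False)
    then show ?thesis by (intro that[of 0 0]) simp
  qed
qed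

lemma F_fun_moved_holomorphic:
  assumes len: "length us = length ds" and mu: "length \<mu> = length us"
    and T: "\<And>t i. t \<in> T \<Longrightarrow> i < length us \<Longrightarrow> 1 - of_real s * (us ! i + t * ds ! i) \<noteq> 0"
  shows "(\<lambda>t. F_fun q s \<mu> (moved us ds t)) holomorphic_on T"
proof -
  have "(\<lambda>t. vertex_weight q s (moved us ds t ! i) a b c d) holomorphic_on T" if "i < length us" for i a b c d
  proof -
    obtain A B where "\<And>u. vertex_weight q s u a b c d = (A + B * u) / (1 - of_real s * u)"
      using vertex_weight_affine[of q s a b c d] by blast
    then show ?thesis unfolding moved_nth[OF len that] using T[OF _ that] by (auto intro!: holomorphic_intros)
  qed
  then have "(\<lambda>t. \<Prod>y\<in>{1..length \<mu>}. \<Prod>x\<le>hd \<mu>. vertex_weight q s (moved us ds t ! (y - 1)) (v x (y - 1)) (h x y) (v x y) (h (x + 1) y)) holomorphic_on T" for v h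
    using mu by (intro holomorphic_on_prod) auto
  then show ?thesis unfolding F_fun_def case_prod_unfold by (intro holomorphic_on_sum)
qed

lemma bounded_on_compact:
  fixes f :: "complex \<Rightarrow> complex"
  assumes "compact K" "continuous_on K f"
  obtains M where "\<And>x. x \<in> K \<Longrightarrow> cmod (f x) \<le> M"
  using compact_imp_bounded[OF compact_continuous_image[OF assms(2,1)]] by (auto simp: bounded_iff)

lemma uniform_bound_on_compact:
  fixes f :: "'a \<Rightarrow> complex \<Rightarrow> complex"
  assumes "finite I" "compact K" "\<And>i. i \<in> I \<Longrightarrow> continuous_on K (f i)"
  obtains M where "\<And>i x. i \<in> I \<Longrightarrow> x \<in> K \<Longrightarrow> cmod (f i x) \<le> M"
proof -
  have "\<forall>i\<in>I. \<exists>M. \<forall>x\<in>K. cmod (f i x) \<le> M" using bounded_on_compact[OF assms(2)] assms(3) by meson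
  then obtain M where M: "\<And>i x. i \<in> I \<Longrightarrow> x \<in> K \<Longrightarrow> cmod (f i x) \<le> M i" by metis
  have "cmod (f i x) \<le> (\<Sum>i\<in>I. \<bar>M i\<bar>)" if "i \<in> I" "x \<in> K" for i x
  proof -
    have "cmod (f i x) \<le> \<bar>M i\<bar>" using M[OF that] by simp
    also have "\<dots> \<le> (\<Sum>i\<in>I. \<bar>M i\<bar>)" using that assms(1) by (intro member_le_sum) auto
    finally show ?thesis .
  qed
  then show ?thesis using that by blast
qed

text \<open>
  On the circle \<open>|t| = \<epsilon>\<close> the parameters are distinct with differences bounded away from \<open>0\<close>,
  and the Bethe sum gives an exponential bound with ratio \<open>\<rho> < 1\<close>. The partition function is
  holomorphic in \<open>t\<close> on the whole disc, so by the maximum modulus principle the bound also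
  holds inside, where the individual terms of the Bethe sum may blow up.
\<close>
lemma signatures_weight_bound:
  assumes q: "0 < q" "q < 1" and s: "-1 < s" "s < 1"
    and len: "length us = length ds"
    and u: "\<And>u. u \<in> set us \<Longrightarrow> 1 - of_real s * u \<noteq> 0 \<and> cmod (zfac (of_real s) u) < 1"
    and gen: "\<forall>\<^sub>F t in at 0. generic s (moved us ds t)"
  obtains \<epsilon> K \<rho> :: real where "\<epsilon> > 0" "0 \<le> \<rho>" "\<rho> < 1"
    "\<And>t. cmod t \<le> \<epsilon> \<Longrightarrow> t \<noteq> 0 \<Longrightarrow> generic s (moved us ds t)"
    "\<And>t u. cmod t \<le> \<epsilon> \<Longrightarrow> u \<in> set (moved us ds t) \<Longrightarrow> 1 - of_real s * u \<noteq> 0 \<and> cmod (zfac (of_real s) u) \<le> \<rho>"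
    "\<And>t \<nu>. cmod t \<le> \<epsilon> \<Longrightarrow> \<nu> \<in> signatures (length us) \<Longrightarrow>
       cmod ((- of_real s) ^ sum_list \<nu> * F_fun q s \<nu> (moved us ds t)) \<le> K ^ length us * \<rho> ^ sum_list \<nu>"
proof -
  define n where "n = length us"
  let ?q = "complex_of_real q" and ?s = "complex_of_real s"
  let ?u = "\<lambda>i t. us ! i + t * ds ! i"
  have set_moved: "set (moved us ds t) = (\<lambda>i. ?u i t) ` {..<n}" for t
  proof -
    have "moved us ds t = map (\<lambda>i. ?u i t) [0..<n]"
      by (rule nth_equalityI) (use len in \<open>auto simp: moved_nth n_def\<close>)
    then show ?thesis by (simp add: atLeast0LessThan)
  qed
  have nz0: "\<forall>\<^sub>F t in nhds 0. 1 - ?s * ?u i t \<noteq> 0" if "i < n" for i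
  proof -
    have "((\<lambda>t. 1 - ?s * ?u i t) \<longlongrightarrow> 1 - ?s * ?u i 0) (nhds 0)" by (intro tendsto_intros filterlim_ident)
    moreover have "1 - ?s * ?u i 0 \<noteq> 0" using u that by (simp add: n_def)
    ultimately show ?thesis by (rule tendsto_imp_eventually_ne)
  qed
  define \<rho> where "\<rho> = (1 + Max (insert 0 ((\<lambda>u. cmod (zfac ?s u)) ` set us))) / 2"
  define \<rho>0 where "\<rho>0 = Max (insert 0 ((\<lambda>u. cmod (zfac ?s u)) ` set us))"
  have r0: "0 \<le> \<rho>0" "\<rho>0 < 1" unfolding \<rho>0_def using u by auto
  have \<rho>: "0 \<le> \<rho>" "\<rho> < 1" "\<rho>0 < \<rho>" using r0 unfolding \<rho>_def \<rho>0_def[symmetric] by auto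
  have z0: "\<forall>\<^sub>F t in nhds 0. cmod (zfac ?s (?u i t)) < \<rho>" if "i < n" for i
  proof -
    have "((\<lambda>t. cmod (zfac ?s (?u i t))) \<longlongrightarrow> cmod (zfac ?s (?u i 0))) (nhds 0)"
      unfolding zfac_def using u[of "us ! i"] that by (intro tendsto_intros filterlim_ident) (auto simp: n_def)
    moreover have "cmod (zfac ?s (?u i 0)) \<le> \<rho>0" unfolding \<rho>0_def using that by (intro Max_ge) (auto simp: n_def)
    ultimately show ?thesis using \<rho>(3) by (elim order_tendstoD(2)) linarith
  qed
  have "\<forall>\<^sub>F t in nhds 0. (\<forall>i\<in>{..<n}. 1 - ?s * ?u i t \<noteq> 0 \<and> cmod (zfac ?s (?u i t)) < \<rho>) \<and> (t \<noteq> 0 \<longrightarrow> generic s (moved us ds t))"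
    using gen by (intro eventually_conj eventually_ball_finite ballI nz0 z0) (auto simp: eventually_at_filter)
  then obtain e where e: "e > 0" "\<And>t. cmod t < e \<Longrightarrow> (\<forall>i\<in>{..<n}. 1 - ?s * ?u i t \<noteq> 0 \<and> cmod (zfac ?s (?u i t)) < \<rho>) \<and> (t \<noteq> 0 \<longrightarrow> generic s (moved us ds t))"
    unfolding eventually_nhds_metric by (auto simp: dist_norm)
  define \<epsilon> where "\<epsilon> = e / 2"
  have eps: "\<epsilon> > 0" "\<And>t. cmod t \<le> \<epsilon> \<Longrightarrow> cmod t < e" using e by (auto simp: \<epsilon>_def)
  have genr: "generic s (moved us ds t)" if "cmod t \<le> \<epsilon>" "t \<noteq> 0" for t using e(2)[OF eps(2)[OF that(1)]] that by auto
  have near: "1 - ?s * ?u i t \<noteq> 0" "cmod (zfac ?s (?u i t)) < \<rho>" if "cmod t \<le> \<epsilon>" "i < n" for t i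
    using e(2)[OF eps(2)[OF that(1)]] that by auto
  have ne: "?u i t \<noteq> ?u j t" if "cmod t \<le> \<epsilon>" "t \<noteq> 0" "i < n" "j < n" "i \<noteq> j" for t i j
  proof -
    have "distinct (moved us ds t)" using genr[OF that(1,2)] by (simp add: generic_def)
    then show ?thesis using that len nth_eq_iff_index_eq[of "moved us ds t" i j] by (simp add: moved_nth n_def)
  qed
  obtain P1 where P1: "\<And>i t. i \<in> {..<n} \<Longrightarrow> t \<in> sphere 0 \<epsilon> \<Longrightarrow> cmod ((1 - ?q) / (1 - ?s * ?u i t)) \<le> P1"
    by (rule uniform_bound_on_compact[of "{..<n}" "sphere 0 \<epsilon>" "\<lambda>i t. (1 - ?q) / (1 - ?s * ?u i t)"])
      (use near in \<open>auto intro!: continuous_intros\<close>)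
  define I where "I = {(i, j). i < n \<and> j < n \<and> i \<noteq> j}"
  have fI: "finite I" unfolding I_def by (rule finite_subset[of _ "{..<n} \<times> {..<n}"]) auto
  have cI: "continuous_on (sphere 0 \<epsilon>) (\<lambda>t. cross ?q (?u (fst p) t) (?u (snd p) t))" if p: "p \<in> I" for p
    unfolding cross_def
  proof (intro continuous_intros ballI)
    fix t :: complex assume "t \<in> sphere 0 \<epsilon>"
    then have "cmod t \<le> \<epsilon>" "t \<noteq> 0" using eps by auto
    then show "?u (fst p) t - ?u (snd p) t \<noteq> 0" using ne[of t "fst p" "snd p"] p by (auto simp: I_def)
  qed
  obtain P2 where P2: "\<And>p t. p \<in> I \<Longrightarrow> t \<in> sphere 0 \<epsilon> \<Longrightarrow> cmod (cross ?q (?u (fst p) t) (?u (snd p) t)) \<le> P2"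
    using uniform_bound_on_compact[of I "sphere 0 \<epsilon>" "\<lambda>p t. cross ?q (?u (fst p) t) (?u (snd p) t)", OF fI compact_sphere cI]
    by metis
  define P where "P = Max {1, P1, P2}"
  have P: "1 \<le> P" "P1 \<le> P" "P2 \<le> P" by (auto simp: P_def)
  define K where "K = real n * P ^ Suc n"
  have bound: "cmod ((- ?s) ^ sum_list \<nu> * F_fun q s \<nu> (moved us ds t)) \<le> K ^ n * \<rho> ^ sum_list \<nu>"
    if t: "cmod t \<le> \<epsilon>" and \<nu>: "\<nu> \<in> signatures (length us)" for t \<nu>
  proof -
    have ln: "length \<nu> = length us" using \<nu> by (simp add: signatures_def)
    define f where "f = (\<lambda>t. (- ?s) ^ sum_list \<nu> * F_fun q s \<nu> (moved us ds t))"
    have hol: "f holomorphic_on ball 0 e"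
      unfolding f_def using e(2) by (intro holomorphic_intros F_fun_moved_holomorphic[OF len ln]) (auto simp: n_def)
    have "cmod (f t) \<le> K ^ n * \<rho> ^ sum_list \<nu>"
    proof (rule maximum_modulus_frontier[of f "cball 0 \<epsilon>"])
      have cb: "cball (0 :: complex) \<epsilon> \<subseteq> ball 0 e" using eps by auto
      show "f holomorphic_on interior (cball 0 \<epsilon>)"
        by (rule holomorphic_on_subset[OF hol]) (use cb interior_subset in blast)
      show "continuous_on (closure (cball 0 \<epsilon>)) f"
        using holomorphic_on_imp_continuous_on[OF hol] cb by (auto intro: continuous_on_subset)
      show "bounded (cball 0 \<epsilon> :: complex set)" by simp
      show "t \<in> cball 0 \<epsilon>" using t by simp
      fix z assume "z \<in> frontier (cball 0 \<epsilon> :: complex set)"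
      then have z: "z \<in> sphere 0 \<epsilon>" by simp
      then have z': "cmod z \<le> \<epsilon>" "z \<noteq> 0" using eps by auto
      let ?U = "set (moved us ds z)"
      have g: "generic s (moved us ds z)" using genr z' by simp
      have cU: "card ?U = n" using distinct_card[of "moved us ds z"] g len by (simp add: generic_def n_def)
      have "f z = bethe_s ?q ?s \<nu> ?U"
        unfolding f_def bethe_s_def by (subst F_fun_eq_bethe[OF q g]) (use \<nu> len in auto)
      moreover have "cmod (bethe_s ?q ?s \<nu> ?U) \<le> (card ?U * P ^ Suc (card ?U)) ^ length \<nu> * \<rho> ^ sum_list \<nu>"
      proof (rule bethe_s_bound)
        show "cmod ((1 - ?q) / (1 - ?s * u)) \<le> P" if "u \<in> ?U" for u
          using that P1[OF _ z] P unfolding set_moved by fastforce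
        show "cmod (zfac ?s u) \<le> \<rho>" if "u \<in> ?U" for u
          using that near(2)[OF z'(1)] unfolding set_moved by (auto intro: less_imp_le)
        show "cmod (cross ?q u v) \<le> P" if uv: "u \<in> ?U" "v \<in> ?U" "u \<noteq> v" for u v
        proof -
          obtain i j where ij: "i < n" "j < n" "u = ?u i z" "v = ?u j z" using uv unfolding set_moved by auto
          then have "i \<noteq> j" using uv by auto
          then show ?thesis using P2[of "(i, j)" z] z ij P by (auto simp: I_def)
        qed
      qed (use P \<rho> in auto)
      ultimately show "cmod (f z) \<le> K ^ n * \<rho> ^ sum_list \<nu>" using ln by (simp add: cU K_def n_def)
    qed
    then show ?thesis by (simp add: f_def)
  qed
  show ?thesis
  proof (rule that[of \<epsilon> \<rho> K])
    show "1 - ?s * u \<noteq> 0 \<and> cmod (zfac ?s u) \<le> \<rho>" if "cmod t \<le> \<epsilon>" "u \<in> set (moved us ds t)" for t u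
      using that(2) near[OF that(1)] unfolding set_moved by (auto intro: less_imp_le)
  qed (use eps \<rho> genr bound in \<open>auto simp: n_def\<close>)
qed

lemma q_obs_rec_map_Suc: "q_obs_rec q (map Suc \<eta>) (map Suc \<nu>) = q_obs_rec q \<eta> \<nu>"
  by (induction q \<eta> \<nu> rule: q_obs_rec.induct) auto

text \<open>
  Only signatures with positive parts have nonzero weight; subtracting \<open>1\<close> from all parts
  makes the shift in the measure and the one in the observable disappear.
\<close>
lemma has_expectation_iff:
  "has_expectation q s us (\<lambda>\<nu>. complex_of_real (Q_obs q (map (\<lambda>t. t + 1) \<theta>) \<nu>)) E \<longleftrightarrow>
   ((\<lambda>\<nu>. c_factor q s \<nu> * ((- of_real s) ^ sum_list \<nu> * F_fun q s \<nu> us) * q_obs_rec q \<theta> \<nu>) has_sum E) (signatures (length us))"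
proof -
  define A where "A = map Suc ` signatures (length us)"
  have A_iff: "\<nu> \<in> A \<longleftrightarrow> \<nu> \<in> signatures (length us) \<and> (\<forall>p\<in>set \<nu>. p \<ge> 1)" for \<nu>
  proof
    assume "\<nu> \<in> A"
    then show "\<nu> \<in> signatures (length us) \<and> (\<forall>p\<in>set \<nu>. p \<ge> 1)"
      by (auto simp: A_def signatures_def sorted_wrt_map)
  next
    assume a: "\<nu> \<in> signatures (length us) \<and> (\<forall>p\<in>set \<nu>. p \<ge> 1)"
    then have "\<nu> = map Suc (map (\<lambda>p. p - 1) \<nu>)" by (auto simp: o_def intro!: map_idI[symmetric])
    moreover have "map (\<lambda>p. p - 1) \<nu> \<in> signatures (length us)"
      using a by (auto simp: signatures_def sorted_wrt_map elim!: sorted_wrt_mono_rel[rotated])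
    ultimately show "\<nu> \<in> A" unfolding A_def by blast
  qed
  have "has_expectation q s us (\<lambda>\<nu>. complex_of_real (Q_obs q (map (\<lambda>t. t + 1) \<theta>) \<nu>)) E \<longleftrightarrow>
    ((\<lambda>\<nu>. M_weight q s us \<nu> * Q_obs q (map (\<lambda>t. t + 1) \<theta>) \<nu>) has_sum E) A"
    unfolding has_expectation_def
    by (rule has_sum_cong_neutral) (auto simp: A_iff M_weight_def)
  also have "\<dots> \<longleftrightarrow> ((\<lambda>\<nu>. M_weight q s us (map Suc \<nu>) * Q_obs q (map (\<lambda>t. t + 1) \<theta>) (map Suc \<nu>)) has_sum E) (signatures (length us))"
    unfolding A_def by (subst has_sum_reindex) (auto simp: inj_on_def o_def)
  also have "\<dots> \<longleftrightarrow> ((\<lambda>\<nu>. c_factor q s \<nu> * ((- of_real s) ^ sum_list \<nu> * F_fun q s \<nu> us) * q_obs_rec q \<theta> \<nu>) has_sum E) (signatures (length us))"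
  proof (rule has_sum_cong)
    fix \<nu> :: "nat list"
    have "sum_list (map Suc \<nu>) = sum_list \<nu> + length \<nu>" by (induction \<nu>) auto
    then have "sum_list (map Suc \<nu>) - length \<nu> = sum_list \<nu>" by simp
    moreover have "map (\<lambda>p. p - 1) (map Suc \<nu>) = \<nu>" by (simp add: o_def)
    ultimately have "M_weight q s us (map Suc \<nu>) = (- of_real s) ^ sum_list \<nu> * c_factor q s \<nu> * F_fun q s \<nu> us"
      unfolding M_weight_def by simp
    moreover have "map (\<lambda>t. t + 1) \<theta> = map Suc \<theta>" by simp
    ultimately show "M_weight q s us (map Suc \<nu>) * Q_obs q (map (\<lambda>t. t + 1) \<theta>) (map Suc \<nu>) =
      c_factor q s \<nu> * ((- of_real s) ^ sum_list \<nu> * F_fun q s \<nu> us) * q_obs_rec q \<theta> \<nu>"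
      by (simp only: Q_obs_eq_rec q_obs_rec_map_Suc) (simp add: mult_ac)
  qed
  finally show ?thesis .
qed

text \<open>
  The bound of \<open>signatures_weight_bound\<close> is summable and independent of \<open>t\<close>, so the
  expectation is a continuous function of \<open>t\<close> near \<open>0\<close>, with the value of \<open>expectation_bethe\<close>
  for \<open>t \<noteq> 0\<close>.
\<close>
theorem expectation_limit:
  assumes q: "0 < q" "q < 1" and s: "-1 < s" "s < 1"
    and len: "length us = length ds"
    and u: "\<And>u. u \<in> set us \<Longrightarrow> 1 - of_real s * u \<noteq> 0 \<and> cmod (zfac (of_real s) u) < 1"
    and gen: "\<forall>\<^sub>F t in at 0. generic s (moved us ds t)"
    and \<theta>: "\<theta> \<in> signatures k" "k \<le> length us"
    and L: "((\<lambda>t. q ^ (k * (k + 1) div 2) * c_factor q s \<theta> *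
        bethe_s (of_real q) (of_real s) \<theta> (set (moved us ds t))) \<longlongrightarrow> L) (at 0)"
  shows "has_expectation q s us (\<lambda>\<nu>. complex_of_real (Q_obs q (map (\<lambda>t. t + 1) \<theta>) \<nu>)) L"
proof -
  let ?q = "complex_of_real q" and ?s = "complex_of_real s"
  define n where "n = length us"
  obtain \<epsilon> K \<rho> :: real where b: "\<epsilon> > 0" "0 \<le> \<rho>" "\<rho> < 1"
    "\<And>t. cmod t \<le> \<epsilon> \<Longrightarrow> t \<noteq> 0 \<Longrightarrow> generic s (moved us ds t)"
    "\<And>t u. cmod t \<le> \<epsilon> \<Longrightarrow> u \<in> set (moved us ds t) \<Longrightarrow> 1 - ?s * u \<noteq> 0 \<and> cmod (zfac ?s u) \<le> \<rho>"
    "\<And>t \<nu>. cmod t \<le> \<epsilon> \<Longrightarrow> \<nu> \<in> signatures n \<Longrightarrow>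
       cmod ((- ?s) ^ sum_list \<nu> * F_fun q s \<nu> (moved us ds t)) \<le> K ^ n * \<rho> ^ sum_list \<nu>"
    unfolding n_def using signatures_weight_bound[OF q s len u gen] by metis
  obtain D where D: "\<And>\<nu>. length \<nu> = n \<Longrightarrow> \<bar>c_factor q s \<nu>\<bar> \<le> D"
    "(\<lambda>\<nu>. D * (K ^ n * \<rho> ^ sum_list \<nu>)) summable_on signatures n"
    using bethe_weight_summable[OF q s b(2,3)] by blast
  define f where "f = (\<lambda>\<nu> t. c_factor q s \<nu> * ((- ?s) ^ sum_list \<nu> * F_fun q s \<nu> (moved us ds t)) * q_obs_rec q \<theta> \<nu>)"
  define M where "M = (\<lambda>\<nu>. D * (K ^ n * \<rho> ^ sum_list \<nu>) * 2 ^ n)"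
  have bound: "norm (f \<nu> t) \<le> M \<nu>" if \<nu>: "\<nu> \<in> signatures n" and t: "t \<in> cball 0 \<epsilon>" for \<nu> t
  proof -
    have ln: "length \<nu> = n" using \<nu> by (simp add: signatures_def)
    have "norm (f \<nu> t) = \<bar>c_factor q s \<nu>\<bar> * cmod ((- ?s) ^ sum_list \<nu> * F_fun q s \<nu> (moved us ds t)) * q_obs_rec q \<theta> \<nu>"
      using q_obs_rec_nonneg[of q \<theta> \<nu>] q by (simp add: f_def norm_mult)
    also have "\<dots> \<le> D * (K ^ n * \<rho> ^ sum_list \<nu>) * 2 ^ n"
    proof -
      have D0: "0 \<le> D" using D(1)[OF ln] by linarith
      have K0: "0 \<le> K ^ n * \<rho> ^ sum_list \<nu>"
        by (rule order.trans[OF norm_ge_zero b(6)[OF _ \<nu>, of 0]]) (use b(1) in simp)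
      have Q: "q_obs_rec q \<theta> \<nu> \<le> 2 ^ n" using q_obs_rec_bound[of q \<theta> \<nu>] q ln by simp
      have t': "cmod t \<le> \<epsilon>" using t by simp
      show ?thesis
        by (intro mult_mono D(1)[OF ln] b(6)[OF t' \<nu>] Q D0 mult_nonneg_nonneg K0 q_obs_rec_nonneg norm_ge_zero)
          (use q in auto)
    qed
    finally show ?thesis by (simp add: M_def)
  qed
  have Msum: "M summable_on signatures n" unfolding M_def by (rule summable_on_cmult_left[OF D(2)])
  have summ: "(\<lambda>\<nu>. f \<nu> t) summable_on signatures n" if "t \<in> cball 0 \<epsilon>" for t
    by (rule abs_summable_summable, rule summable_on_comparison_test[OF Msum]) (use bound that in auto)
  define g where "g = (\<lambda>t. \<Sum>\<^sub>\<infinity>\<nu>\<in>signatures n. f \<nu> t)"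
  have "uniform_limit (cball 0 \<epsilon>) (\<lambda>X t. \<Sum>\<nu>\<in>X. f \<nu> t) g (finite_subsets_at_top (signatures n))"
    unfolding g_def by (rule Weierstrass_m_test_general[OF bound Msum])
  moreover have "\<forall>\<^sub>F X in finite_subsets_at_top (signatures n). continuous_on (cball 0 \<epsilon>) (\<lambda>t. \<Sum>\<nu>\<in>X. f \<nu> t)"
  proof (rule eventually_finite_subsets_at_top_weakI)
    fix X assume X: "finite X" "X \<subseteq> signatures n"
    have "(\<lambda>t. F_fun q s \<nu> (moved us ds t)) holomorphic_on cball 0 \<epsilon>" if "\<nu> \<in> X" for \<nu>
    proof (rule F_fun_moved_holomorphic[OF len])
      show "length \<nu> = length us" using that X by (auto simp: signatures_def n_def)
      show "1 - ?s * (us ! i + t * ds ! i) \<noteq> 0" if "t \<in> cball 0 \<epsilon>" "i < length us" for t i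
      proof -
        have "us ! i + t * ds ! i \<in> set (moved us ds t)"
          using that len by (metis length_moved moved_nth nth_mem)
        then show ?thesis using b(5)[of t] that by auto
      qed
    qed
    then show "continuous_on (cball 0 \<epsilon>) (\<lambda>t. \<Sum>\<nu>\<in>X. f \<nu> t)"
      unfolding f_def by (intro continuous_intros holomorphic_on_imp_continuous_on)
  qed
  ultimately have "continuous_on (cball 0 \<epsilon>) g"
    by (intro uniform_limit_theorem[OF _ _ finite_subsets_at_top_neq_bot])
  then have "continuous_on (ball 0 \<epsilon>) g" by (rule continuous_on_subset) auto
  then have "isCont g 0" using b(1) by (simp add: continuous_on_eq_continuous_at)
  then have g0: "(g \<longlongrightarrow> g 0) (at 0)" by (simp add: isCont_def)
  have gR: "g t = q ^ (k * (k + 1) div 2) * c_factor q s \<theta> * bethe_s ?q ?s \<theta> (set (moved us ds t))"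
    if t: "cmod t \<le> \<epsilon>" "t \<noteq> 0" for t
  proof -
    have gt: "generic s (moved us ds t)" using b(4) t by simp
    have lm: "length (moved us ds t) = n" using len by (simp add: n_def)
    have z: "cmod (zfac ?s u) < 1" if "u \<in> set (moved us ds t)" for u using b(5)[OF t(1) that] b(3) by linarith
    have "((\<lambda>\<nu>. c_factor q s \<nu> * bethe_s ?q ?s \<nu> (set (moved us ds t)) * q_obs_rec q \<theta> \<nu>) has_sum
      q ^ (k * (k + 1) div 2) * c_factor q s \<theta> * bethe_s ?q ?s \<theta> (set (moved us ds t))) (signatures n)"
      by (rule expectation_bethe[OF q s])
        (use gt z \<theta> lm distinct_card[of "moved us ds t"] in \<open>auto simp: generic_def n_def\<close>)
    moreover have "c_factor q s \<nu> * bethe_s ?q ?s \<nu> (set (moved us ds t)) * q_obs_rec q \<theta> \<nu> = f \<nu> t"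
      if "\<nu> \<in> signatures n" for \<nu>
      unfolding f_def bethe_s_def by (subst F_fun_eq_bethe[OF q gt]) (use that lm in auto)
    ultimately have "((\<lambda>\<nu>. f \<nu> t) has_sum
      q ^ (k * (k + 1) div 2) * c_factor q s \<theta> * bethe_s ?q ?s \<theta> (set (moved us ds t))) (signatures n)"
      by (simp cong: has_sum_cong)
    then show ?thesis unfolding g_def by (rule infsumI)
  qed
  have "\<forall>\<^sub>F t in at 0. q ^ (k * (k + 1) div 2) * c_factor q s \<theta> * bethe_s ?q ?s \<theta> (set (moved us ds t)) = g t"
    unfolding eventually_at using gR b(1) by (intro exI[of _ \<epsilon>]) (auto simp: dist_norm less_imp_le)
  then have "(g \<longlongrightarrow> L) (at 0)" by (rule Lim_transform_eventually[OF L])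
  then have "g 0 = L" using g0 tendsto_unique trivial_limit_at by blast
  moreover have "((\<lambda>\<nu>. f \<nu> 0) has_sum g 0) (signatures n)"
    unfolding g_def using summ[of 0] b(1) by (intro has_sum_infsum) auto
  ultimately show ?thesis unfolding has_expectation_iff f_def n_def using len by simp
qed

section \<open>Coinciding parameters: the integral\<close>

lemma eventually_thicken_nonzero:
  assumes A: "compact A" and nz: "\<forall>w\<in>A. 1 - b * w \<noteq> 0"
  shows "\<forall>\<^sub>F \<epsilon> in at_right 0. \<forall>t\<in>thicken \<epsilon> {0}. \<forall>w\<in>thicken \<epsilon> A. 1 - (b + t * b') * w \<noteq> 0"
proof -
  have o: "open ((\<lambda>p. 1 - (b + fst p * b') * snd p) -` (- {0 :: complex}))"
    by (intro open_vimage) (auto intro!: continuous_intros)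
  have c: "compact ({0 :: complex} \<times> A)" using A by (intro compact_Times) auto
  have sb: "{0} \<times> A \<subseteq> (\<lambda>p. 1 - (b + fst p * b') * snd p) -` (- {0})" using nz by auto
  obtain e where e: "e > 0" "(\<Union>p\<in>{0} \<times> A. ball p e) \<subseteq> (\<lambda>p. 1 - (b + fst p * b') * snd p) -` (- {0})"
    by (rule compact_subset_open_imp_ball_epsilon_subset[OF c o sb])
  have "\<forall>\<^sub>F \<epsilon> in at_right (0 :: real). \<epsilon> < e / 2"
    using eventually_at_right_real[of 0 "e / 2"] e(1) by (simp add: eventually_mono)
  then show ?thesis
  proof eventually_elim
    case (elim \<epsilon>)
    show ?case
    proof (intro ballI)
      fix t w assume "t \<in> thicken \<epsilon> {0}" "w \<in> thicken \<epsilon> A"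
      then obtain a where a: "dist 0 t < \<epsilon>" "a \<in> A" "dist a w < \<epsilon>" by (auto simp: thicken_def)
      have "dist (0, a) (t, w) \<le> dist 0 t + dist a w"
        unfolding dist_Pair_Pair by (rule sqrt_sum_squares_le_sum) auto
      then have "(t, w) \<in> ball (0, a) e" using a elim by simp
      then have "(t, w) \<in> (\<lambda>p. 1 - (b + fst p * b') * snd p) -` (- {0})" using e(2) a(2) by blast
      then show "1 - (b + t * b') * w \<noteq> 0" by simp
    qed
  qed
qed

text \<open>
  A product of this form with coefficients depending affinely on \<open>t\<close> covers both the full
  product over all parameters and the product over strings, in which the factors common to
  numerator and denominator have been cancelled.
\<close>
definition fraction_product :: "nat \<Rightarrow> (nat \<Rightarrow> complex) \<Rightarrow> (nat \<Rightarrow> complex) \<Rightarrow> complex \<Rightarrow> complex" where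
  "fraction_product m b c w = (\<Prod>i<m. (1 - c i * w) / (1 - b i * w))"

lemma moment_integral_tendsto:
  assumes sep: "separated_contours q s Cs" and q: "cmod q < 1" and len: "length Cs = length \<theta>"
    and b: "\<And>i j w. i < m \<Longrightarrow> j < length Cs \<Longrightarrow> w \<in> contour_support (Cs ! j) \<Longrightarrow> 1 - b i * w \<noteq> 0"
  shows "((\<lambda>t. iter_oint Cs (moment_integrand q s \<theta> (fraction_product m (\<lambda>i. b i + t * b' i) (\<lambda>i. c i + t * c' i)))) \<longlongrightarrow>
     iter_oint Cs (moment_integrand q s \<theta> (fraction_product m b c))) (at 0)"
proof -
  note S = separated_contours_support[OF sep]
  define P where "P = (\<lambda>j \<epsilon>. \<forall>i\<in>{..<m}. \<forall>t\<in>thicken \<epsilon> {0}. \<forall>w\<in>thicken \<epsilon> (contour_support (Cs ! j)). 1 - (b i + t * b' i) * w \<noteq> 0)"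
  have evP: "\<forall>\<^sub>F \<epsilon> in at_right 0. P j \<epsilon>" if "j < length Cs" for j
    unfolding P_def by (intro eventually_ball_finite ballI eventually_thicken_nonzero S(1)[OF that]) (use b that in auto)
  obtain \<epsilon> where e: "\<epsilon> > 0" "\<And>i. i < length Cs \<Longrightarrow> P i \<epsilon>"
    "\<And>i. i < length Cs \<Longrightarrow> s \<notin> thicken \<epsilon> (contour_support (Cs ! i))"
    "\<And>i j w v. i < length Cs \<Longrightarrow> j < i \<Longrightarrow> w \<in> thicken \<epsilon> (contour_support (Cs ! j)) \<Longrightarrow>
       v \<in> thicken \<epsilon> (contour_support (Cs ! i)) \<Longrightarrow> w \<noteq> q * v"
    by (rule separated_neighbourhoods[where P = P, OF sep q evP]) auto
  define Us where "Us = map (\<lambda>C. thicken \<epsilon> (contour_support C)) Cs"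
  define T where "T = thicken \<epsilon> {0}"
  define V where "V = (\<lambda>j. if j = 0 then T else if j \<le> length Us then Us ! (j - 1) else UNIV)"
  have lU: "length Us = length Cs" by (simp add: Us_def)
  have inV: "x 0 \<in> T" "i < length Cs \<Longrightarrow> x (Suc i) \<in> Us ! i" if "\<forall>j. x j \<in> V j" for x i
    using that[THEN spec, of 0] that[THEN spec, of "Suc i"] by (auto simp: V_def lU)
  define F where "F = (\<lambda>t. iter_oint Cs (moment_integrand q s \<theta> (fraction_product m (\<lambda>i. b i + t * b' i) (\<lambda>i. c i + t * c' i))))"
  have "F holomorphic_on T"
    unfolding F_def
  proof (rule holomorphic_iter_oint)
    show "multi_hol (\<lambda>j. if j = 0 then T else if j \<le> length Us then Us ! (j - 1) else UNIV)
      (\<lambda>x. moment_integrand q s \<theta> (fraction_product m (\<lambda>i. b i + x 0 * b' i) (\<lambda>i. c i + x 0 * c' i)) (map x [1..<Suc (length Us)]))"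
    proof (rule multi_hol_moment_integrand)
      fix i assume i: "i < length \<theta>"
      then have i': "i < length Cs" using len by simp
      have "multi_hol V (\<lambda>x. \<Prod>l<m. (1 - (c l + x 0 * c' l) * x (Suc i)) / (1 - (b l + x 0 * b' l) * x (Suc i)))"
      proof (intro multi_hol_mult multi_hol_divide multi_hol_prod multi_hol_diff multi_hol_add multi_hol_coord multi_hol_const)
        fix l x assume x: "\<forall>j. x j \<in> V j" and l: "l \<in> {..<m}"
        show "1 - (b l + x 0 * b' l) * x (Suc i) \<noteq> 0"
          using e(2)[OF i'] inV(1)[OF x] inV(2)[OF x i'] i' l by (auto simp: Us_def T_def P_def)
      qed
      then show "multi_hol (\<lambda>j. if j = 0 then T else if j \<le> length Us then Us ! (j - 1) else UNIV)
        (\<lambda>x. fraction_product m (\<lambda>i. b i + x 0 * b' i) (\<lambda>i. c i + x 0 * c' i) (x (Suc i)))"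
        by (simp add: V_def fraction_product_def)
    qed (use len e in \<open>auto simp: Us_def\<close>)
    show "open T" by (simp add: T_def)
    show "length Us = length Cs" by (rule lU)
    show "open (Us ! i)" if "i < length Us" for i using that by (simp add: Us_def)
    show "valid_path g \<and> pathfinish g = pathstart g \<and> path_image g \<subseteq> Us ! i" if i: "i < length Cs" and g: "g \<in> Cs ! i" for i g
    proof -
      have "path_image g \<subseteq> contour_support (Cs ! i)" using g by (auto simp: contour_support_def)
      then show ?thesis
        using positive_contourD[OF separated_contours_nth(2)[OF sep i g]] subset_thicken[OF e(1)] i
        by (auto simp: Us_def)
    qed
  qed
  moreover have "0 \<in> T" using subset_thicken[OF e(1), of "{0}"] by (auto simp: T_def)
  moreover have "open T" by (simp add: T_def)
  ultimately have "isCont F 0"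
    using holomorphic_on_imp_continuous_on continuous_on_eq_continuous_at by blast
  then have "(F \<longlongrightarrow> F 0) (at 0)" by (simp add: isCont_def)
  then show ?thesis by (simp add: F_def)
qed

lemma moment_formula_eq:
  "moment_formula q s \<theta> Cs \<phi> = of_real ((- 1) ^ length \<theta> * q ^ (length \<theta> * (length \<theta> + 1) div 2) *
     (- s) ^ sum_list \<theta> * c_factor q s \<theta>) * iter_oint Cs (moment_integrand (of_real q) (of_real s) \<theta> \<phi>)"
  by (simp only: moment_formula_def moment_integrand_def[abs_def] Let_def)

text \<open>
  For generic parameters both sides are multiples of the same Bethe sum; the directions \<open>ds\<close>
  make the parameters generic, and both sides are continuous at \<open>t = 0\<close>.
\<close>
lemma moment_expectation:
  assumes q: "0 < q" "q < 1" and s: "-1 < s" "s < 1"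
    and len: "length us = length ds"
    and u: "\<And>u. u \<in> set us \<Longrightarrow> 1 - of_real s * u \<noteq> 0 \<and> cmod (zfac (of_real s) u) < 1"
    and gen: "\<forall>\<^sub>F t in at 0. generic s (moved us ds t)"
    and \<theta>: "\<theta> \<in> signatures k" "k \<le> length us"
    and Cs: "length Cs = k" "separated_contours (of_real q) (of_real s) Cs"
    and enc: "\<forall>\<^sub>F t in at 0. poles_enclosed (of_real q) Cs (set (moved us ds t))"
    and b: "\<And>i j w. i < m \<Longrightarrow> j < k \<Longrightarrow> w \<in> contour_support (Cs ! j) \<Longrightarrow> 1 - b i * w \<noteq> 0"
    and \<phi>: "\<forall>\<^sub>F t in at 0. \<forall>j<k. \<forall>w\<in>contour_support (Cs ! j).
        fraction_product m (\<lambda>i. b i + t * b' i) (\<lambda>i. c i + t * c' i) w = reduced_product (of_real q) (set (moved us ds t)) w"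
  shows "has_expectation q s us (\<lambda>\<nu>. complex_of_real (Q_obs q (map (\<lambda>t. t + 1) \<theta>) \<nu>))
    (moment_formula q s \<theta> Cs (fraction_product m b c))"
proof (rule expectation_limit[OF q s len u gen \<theta>])
  let ?q = "complex_of_real q" and ?s = "complex_of_real s"
  let ?\<phi> = "\<lambda>t. fraction_product m (\<lambda>i. b i + t * b' i) (\<lambda>i. c i + t * c' i)"
  have lt: "length \<theta> = k" using \<theta> by (simp add: signatures_def)
  have q': "?q \<noteq> 0" "cmod ?q < 1" using q by auto
  have lim: "((\<lambda>t. moment_formula q s \<theta> Cs (?\<phi> t)) \<longlongrightarrow> moment_formula q s \<theta> Cs (fraction_product m b c)) (at 0)"
    unfolding moment_formula_eq
    by (intro tendsto_mult tendsto_const moment_integral_tendsto[OF Cs(2) q'(2)]) (use Cs lt b in auto)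
  have "\<forall>\<^sub>F t in at 0. moment_formula q s \<theta> Cs (?\<phi> t) =
     q ^ (k * (k + 1) div 2) * c_factor q s \<theta> * bethe_s ?q ?s \<theta> (set (moved us ds t))"
    using gen enc \<phi>
  proof eventually_elim
    case (elim t)
    define U where "U = set (moved us ds t)"
    have "iter_oint Cs (moment_integrand ?q ?s \<theta> (?\<phi> t)) = iter_oint Cs (moment_integrand ?q ?s \<theta> (reduced_product ?q U))"
    proof (intro iter_oint_cong moment_integrand_cong)
      fix ws :: "complex list" and i
      assume "\<And>i. i < length Cs \<Longrightarrow> ws ! i \<in> (\<Union>g\<in>Cs ! i. path_image g)" "i < length \<theta>"
      then have "i < k" "ws ! i \<in> contour_support (Cs ! i)" using lt Cs by (auto simp: contour_support_def)
      then show "?\<phi> t (ws ! i) = reduced_product ?q U (ws ! i)" using elim(3) by (simp add: U_def)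
    qed
    also have "\<dots> = (- 1) ^ length \<theta> * bethe ?q ?s \<theta> U"
      by (rule moment_integral_eq_bethe[OF q' Cs(2)]) (use elim Cs lt in \<open>auto simp: U_def generic_def\<close>)
    finally have it: "iter_oint Cs (moment_integrand ?q ?s \<theta> (?\<phi> t)) = (- 1) ^ k * bethe ?q ?s \<theta> U" by (simp add: lt)
    have "(- 1) ^ k * X * (- s) ^ sum_list \<theta> * c_factor q s \<theta> * (- 1) ^ k = X * c_factor q s \<theta> * (- s) ^ sum_list \<theta>" for X
      by (simp add: power_mult_distrib[symmetric])
    then have "of_real ((- 1) ^ k * X * (- s) ^ sum_list \<theta> * c_factor q s \<theta>) * ((- 1) ^ k * Y) =
      of_real (X * c_factor q s \<theta>) * ((- ?s) ^ sum_list \<theta> * Y)" for X and Y :: complex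
      by (simp add: power_mult_distrib[symmetric] mult_ac)
    then show ?case unfolding moment_formula_eq it lt bethe_s_def U_def by simp
  qed
  then show "((\<lambda>t. q ^ (k * (k + 1) div 2) * c_factor q s \<theta> * bethe_s ?q ?s \<theta> (set (moved us ds t))) \<longlongrightarrow>
     moment_formula q s \<theta> Cs (fraction_product m b c)) (at 0)"
    by (rule Lim_transform_eventually[OF lim])
qed

lemma eventually_affine_nonzero:
  fixes a d :: complex
  assumes "a \<noteq> 0 \<or> d \<noteq> 0"
  shows "\<forall>\<^sub>F t in at 0. a + t * d \<noteq> 0"
proof (cases "a = 0")
  case True
  then show ?thesis using assms by (simp add: eventually_at_filter)
next
  case False
  have "((\<lambda>t. a + t * d) \<longlongrightarrow> a + 0 * d) (at 0)" by (intro tendsto_intros)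
  then show ?thesis using False by (intro tendsto_imp_eventually_ne) auto
qed

lemma eventually_generic:
  assumes len: "length us = length ds"
    and u: "\<And>u. u \<in> set us \<Longrightarrow> 1 - of_real s * u \<noteq> 0"
    and d: "\<And>i. i < length ds \<Longrightarrow> ds ! i \<noteq> 0"
    and ne: "\<And>i j. i < j \<Longrightarrow> j < length us \<Longrightarrow> us ! i \<noteq> us ! j \<or> ds ! i \<noteq> ds ! j"
  shows "\<forall>\<^sub>F t in at 0. generic s (moved us ds t)"
proof -
  let ?n = "length us"
  have 1: "\<forall>\<^sub>F t in at 0. \<forall>i\<in>{..<?n}. us ! i + t * ds ! i \<noteq> 0 \<and> (us ! i - of_real s) + t * ds ! i \<noteq> 0 \<and>
      (1 - of_real s * us ! i) + t * (- of_real s * ds ! i) \<noteq> 0"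
    using d u len by (intro eventually_ball_finite ballI eventually_conj eventually_affine_nonzero) auto
  have 2: "\<forall>\<^sub>F t in at 0. \<forall>j\<in>{..<?n}. \<forall>i\<in>{..<j}. (us ! i - us ! j) + t * (ds ! i - ds ! j) \<noteq> 0"
    using ne by (intro eventually_ball_finite ballI eventually_affine_nonzero) auto
  show ?thesis using 1 2
  proof eventually_elim
    case (elim t)
    have "moved us ds t ! i \<noteq> moved us ds t ! j" if "i < j" "j < ?n" for i j
      using elim(2) that len by (auto simp: moved_nth algebra_simps)
    then have "distinct (moved us ds t)" unfolding distinct_conv_nth using len
      by (metis length_moved linorder_neqE_nat)
    moreover have "u \<noteq> 0 \<and> u \<noteq> of_real s \<and> 1 - of_real s * u \<noteq> 0" if um: "u \<in> set (moved us ds t)" for u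
    proof -
      obtain i where "i < ?n" "u = us ! i + t * ds ! i" using um len by (metis in_set_conv_nth length_moved moved_nth)
      then show ?thesis using elim(1) by (auto simp: algebra_simps)
    qed
    ultimately show ?case by (simp add: generic_def)
  qed
qed

lemma poles_enclosedI:
  assumes "\<And>C u. C \<in> set Cs \<Longrightarrow> u \<in> U \<Longrightarrow> \<exists>g\<in>C. inverse u \<in> inside (path_image g) \<and> (\<forall>h\<in>C - {g}. inverse u \<notin> closed_region h)"
  shows "poles_enclosed q Cs U"
  using assms
proof (induction Cs arbitrary: U)
  case (Cons C Cs)
  have "inverse b \<notin> path_image h" if b: "b \<in> U" and C': "C' \<in> set Cs" and h: "h \<in> C'" for b C' h
  proof -
    obtain g where g: "g \<in> C'" "inverse b \<in> inside (path_image g)" "\<forall>h\<in>C' - {g}. inverse b \<notin> closed_region h"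
      using Cons.prems[of C' b] b C' by auto
    then show ?thesis
      using inside_not_on_path[OF g(2)] h by (cases "h = g") (auto simp: closed_region_def)
  qed
  moreover have "poles_enclosed q Cs (U - {b})" for b
    by (rule Cons.IH) (use Cons.prems in auto)
  ultimately show ?case using Cons.prems[of C] by auto
qed simp

lemma closed_closed_region: "path g \<Longrightarrow> closed (closed_region g)"
proof -
  assume "path g"
  then have "open (outside (path_image g))" by (intro open_outside closed_path_image)
  moreover have "closed_region g = - outside (path_image g)"
    by (simp add: closed_region_def union_with_inside[symmetric] Un_commute)
  ultimately show ?thesis by (simp add: closed_def)
qed

lemma positive_contour_open_closed:
  assumes "positive_contour g"
  shows "open (inside (path_image g))" "closed (closed_region g)"
  using assms by (auto simp: positive_contour_def valid_path_imp_path intro!: open_inside closed_path_image closed_closed_region)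

text \<open>
  If every contour encloses all poles, it is irrelevant which of the directions is taken, as
  long as they are distinct and nonzero; \<open>1, 2, 3, \<dots>\<close> will do.
\<close>
lemma moment_expectation_all:
  assumes q: "0 < q" "q < 1" and s: "-1 < s" "s < 1"
    and u: "\<And>u. u \<in> set us \<Longrightarrow> 1 - of_real s * u \<noteq> 0 \<and> cmod (zfac (of_real s) u) < 1"
    and \<theta>: "\<theta> \<in> signatures k" "k \<le> length us"
    and Cs: "length Cs = k" "separated_contours (of_real q) (of_real s) Cs"
    and enc: "\<And>C u. C \<in> set Cs \<Longrightarrow> u \<in> set us \<Longrightarrow> u \<noteq> 0 \<and>
       (\<exists>g\<in>C. inverse u \<in> inside (path_image g) \<and> (\<forall>h\<in>C - {g}. inverse u \<notin> closed_region h))"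
  shows "has_expectation q s us (\<lambda>\<nu>. complex_of_real (Q_obs q (map (\<lambda>t. t + 1) \<theta>) \<nu>))
    (moment_formula q s \<theta> Cs (u_product q us))"
proof -
  let ?q = "complex_of_real q" and ?n = "length us"
  define ds where "ds = map (\<lambda>i. of_nat (Suc i) :: complex) [0..<?n]"
  have len: "?n = length ds" by (simp add: ds_def)
  have dn: "ds ! i = of_nat (Suc i)" if "i < ?n" for i using that by (simp add: ds_def)
  have gen: "\<forall>\<^sub>F t in at 0. generic s (moved us ds t)"
    by (rule eventually_generic[OF len]) (use u len dn in \<open>auto simp del: of_nat_Suc\<close>)
  define E where "E = (\<lambda>C w. \<exists>g\<in>C. w \<in> inside (path_image g) \<and> (\<forall>h\<in>C - {g}. w \<notin> closed_region h))"
  have evE: "\<forall>\<^sub>F t in at 0. \<forall>C\<in>set Cs. \<forall>i\<in>{..<?n}. E C (inverse (us ! i + t * ds ! i))"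
  proof (intro eventually_ball_finite ballI finite_set finite_lessThan)
    fix C i assume C: "C \<in> set Cs" and i: "i \<in> {..<?n}"
    obtain l where l: "l < length Cs" "C = Cs ! l" using C by (metis in_set_conv_nth)
    note sc = separated_contours_nth[OF Cs(2) l(1), folded l(2)]
    obtain g where g: "g \<in> C" "inverse (us ! i) \<in> inside (path_image g)" "\<forall>h\<in>C - {g}. inverse (us ! i) \<notin> closed_region h"
      and nz: "us ! i \<noteq> 0"
      using enc[OF C, of "us ! i"] i by auto
    have lim: "((\<lambda>t. inverse (us ! i + t * ds ! i)) \<longlongrightarrow> inverse (us ! i)) (at 0)"
      using nz by (auto intro!: tendsto_eq_intros)
    have "\<forall>\<^sub>F t in at 0. inverse (us ! i + t * ds ! i) \<in> inside (path_image g)"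
      by (rule topological_tendstoD[OF lim positive_contour_open_closed(1)[OF sc(2)[OF g(1)]] g(2)])
    moreover have "\<forall>\<^sub>F t in at 0. \<forall>h\<in>C - {g}. inverse (us ! i + t * ds ! i) \<in> - closed_region h"
      using sc(1) g(3) positive_contour_open_closed(2)[OF sc(2)]
      by (intro eventually_ball_finite ballI topological_tendstoD[OF lim]) (auto simp: open_Compl)
    ultimately show "\<forall>\<^sub>F t in at 0. E C (inverse (us ! i + t * ds ! i))"
      by eventually_elim (use g(1) in \<open>auto simp: E_def\<close>)
  qed
  have off: "1 - v * w \<noteq> 0" if vE: "E C (inverse v)" and wC: "w \<in> contour_support C" for v w C
  proof
    assume "1 - v * w = 0"
    then have w: "w = inverse v" by (metis eq_iff_diff_eq_0 inverse_unique)
    obtain g where g: "inverse v \<in> inside (path_image g)" "\<forall>h\<in>C - {g}. inverse v \<notin> closed_region h"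
      using vE by (auto simp: E_def)
    obtain h where "h \<in> C" "w \<in> path_image h" using wC by (auto simp: contour_support_def)
    then show False using g w inside_not_on_path[OF g(1)] by (cases "h = g") (auto simp: closed_region_def)
  qed
  have mem: "u \<in> set (moved us ds t) \<longleftrightarrow> (\<exists>i<?n. u = us ! i + t * ds ! i)" for u t
    using len by (metis in_set_conv_nth length_moved moved_nth)
  have main: "has_expectation q s us (\<lambda>\<nu>. complex_of_real (Q_obs q (map (\<lambda>t. t + 1) \<theta>) \<nu>))
    (moment_formula q s \<theta> Cs (fraction_product ?n (\<lambda>i. us ! i) (\<lambda>i. ?q * us ! i)))"
  proof (rule moment_expectation[OF q s len u gen \<theta> Cs])
    show "\<forall>\<^sub>F t in at 0. poles_enclosed ?q Cs (set (moved us ds t))"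
      using evE
    proof eventually_elim
      case (elim t)
      show ?case by (rule poles_enclosedI) (use elim mem in \<open>auto simp: E_def\<close>)
    qed
    show "1 - us ! i * w \<noteq> 0" if "i < ?n" "j < k" "w \<in> contour_support (Cs ! j)" for i j w
      by (rule off[OF _ that(3)]) (use enc[of "Cs ! j" "us ! i"] that Cs in \<open>auto simp: E_def\<close>)
    show "\<forall>\<^sub>F t in at 0. \<forall>j<k. \<forall>w\<in>contour_support (Cs ! j).
        fraction_product ?n (\<lambda>i. us ! i + t * ds ! i) (\<lambda>i. ?q * us ! i + t * (?q * ds ! i)) w = reduced_product ?q (set (moved us ds t)) w"
      using evE gen
    proof eventually_elim
      case (elim t)
      show ?case
      proof (intro allI impI ballI)
        fix j w assume j: "j < k" and w: "w \<in> contour_support (Cs ! j)"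
        have dist: "distinct (moved us ds t)" using elim by (simp add: generic_def)
        have "fraction_product ?n (\<lambda>i. us ! i + t * ds ! i) (\<lambda>i. ?q * us ! i + t * (?q * ds ! i)) w =
           (\<Prod>i<?n. (1 - ?q * moved us ds t ! i * w) / (1 - moved us ds t ! i * w))"
          unfolding fraction_product_def using len by (intro prod.cong refl) (simp add: moved_nth algebra_simps)
        also have "\<dots> = (\<Prod>u\<in>set (moved us ds t). (1 - ?q * u * w) / (1 - u * w))"
          using dist len by (intro prod.reindex_bij_betw bij_betw_nth) auto
        also have "\<dots> = reduced_product ?q (set (moved us ds t)) w"
        proof (rule reduced_product_eq)
          show "\<forall>u\<in>set (moved us ds t). 1 - u * w \<noteq> 0"
            using off[OF _ w] elim(1) mem j Cs by auto
        qed (use q in auto)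
        finally show "fraction_product ?n (\<lambda>i. us ! i + t * ds ! i) (\<lambda>i. ?q * us ! i + t * (?q * ds ! i)) w = reduced_product ?q (set (moved us ds t)) w" .
      qed
    qed
  qed
  have "u_product q us = fraction_product ?n (\<lambda>i. us ! i) (\<lambda>i. ?q * us ! i)"
    by (auto simp: fun_eq_iff u_product_def fraction_product_def prod.list_conv_set_nth atLeast0LessThan)
  then show ?thesis using main by simp
qed

section \<open>Nested contours and small circles\<close>

text \<open>
  The complement of the inside of \<open>h\<close>, scaled by \<open>q\<close>, is connected, unbounded and disjoint
  from \<open>g\<close>. Hence it lies outside of \<open>g\<close>, although only the curve \<open>g\<close> is assumed to be mapped
  inside \<open>h\<close>.
\<close>
lemma nested_region_subset:
  assumes h: "positive_contour h" and q: "0 < q"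
    and sub: "(\<lambda>w. w / complex_of_real q) ` path_image g \<subseteq> inside (path_image h)" and w: "w \<in> closed_region g"
  shows "w / of_real q \<in> inside (path_image h)"
proof (rule ccontr)
  assume out: "w / of_real q \<notin> inside (path_image h)"
  define Q where "Q = - inside (path_image h)"
  have J: "connected (outside (path_image h))" "\<not> bounded (outside (path_image h))"
    "inside (path_image h) \<inter> outside (path_image h) = {}"
    "inside (path_image h) \<union> outside (path_image h) = - path_image h"
    "frontier (outside (path_image h)) = path_image h" "open (outside (path_image h))"
    using Jordan_inside_outside[of h] h by (auto simp: positive_contour_def)
  have "closure (outside (path_image h)) = outside (path_image h) \<union> path_image h"
    using J(5) by (metis closure_Un_frontier)
  also have "\<dots> = Q"
    using J(3,4) inside_no_overlap[of "path_image h"] unfolding Q_def by blast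
  finally have "connected Q" "outside (path_image h) \<subseteq> Q"
    using J(1) connected_imp_connected_closure closure_subset by metis+
  define R where "R = (\<lambda>z. of_real q * z) ` Q"
  have cR: "connected R" unfolding R_def by (intro connected_continuous_image continuous_intros \<open>connected Q\<close>)
  have "\<not> bounded R"
  proof
    assume "bounded R"
    then have "bounded ((\<lambda>z. z / of_real q) ` R)" by (rule bounded_linear_image[OF _ bounded_linear_divide])
    moreover have "(\<lambda>z. z / of_real q) ` R = Q" using q by (simp add: R_def image_image)
    ultimately show False using J(2) \<open>outside (path_image h) \<subseteq> Q\<close> bounded_subset by metis
  qed
  have disj: "R \<inter> path_image g = {}"
  proof -
    have "of_real q * z \<notin> path_image g" if "z \<in> Q" for z
    proof
      assume "of_real q * z \<in> path_image g"
      then have "of_real q * z / of_real q \<in> inside (path_image h)" using sub by blast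
      then show False using that q by (simp add: Q_def)
    qed
    then show ?thesis by (auto simp: R_def)
  qed
  have "w = of_real q * (w / of_real q)" using q by simp
  then have wR: "w \<in> R" using out unfolding R_def Q_def by blast
  have "w \<notin> path_image g" using wR disj by auto
  then have "w \<in> inside (path_image g)" using w by (simp add: closed_region_def)
  then have "bounded (connected_component_set (- path_image g) w)" by (simp add: inside_def)
  moreover have "R \<subseteq> connected_component_set (- path_image g) w"
    by (rule connected_component_maximal[OF wR cR]) (use disj in auto)
  ultimately show False using \<open>\<not> bounded R\<close> bounded_subset by metis
qed

lemma separated_contoursI:
  assumes "\<And>C. C \<in> set Cs \<Longrightarrow> finite C" "\<And>C g. C \<in> set Cs \<Longrightarrow> g \<in> C \<Longrightarrow> positive_contour g \<and> s \<notin> closed_region g"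
    and "sorted_wrt (\<lambda>C C'. \<forall>h\<in>C'. \<forall>g\<in>C. \<forall>w\<in>closed_region g. \<forall>v\<in>path_image h. w \<noteq> q * v) Cs"
  shows "separated_contours q s Cs"
  using assms
proof (induction Cs)
  case (Cons C Cs)
  have "separated_contours q s Cs" by (rule Cons.IH) (use Cons.prems in auto)
  then show ?case using Cons.prems(1)[of C] Cons.prems(2)[of C] Cons.prems(3) by auto
qed simp

lemma nested_contoursD:
  assumes nest: "nested_contours q s P \<gamma>" and q: "0 < q"
  shows "separated_contours (of_real q) (of_real s) (map (\<lambda>g. {g}) \<gamma>)"
    and "sorted_wrt (\<lambda>g h. \<forall>z\<in>inside (path_image g). z / of_real q \<in> inside (path_image h)) \<gamma>"
proof -
  have pc: "positive_contour g" "complex_of_real s \<in> outside (path_image g)" if "g \<in> set \<gamma>" for g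
    using nest that by (auto simp: nested_contours_def)
  have step: "w / of_real q \<in> inside (path_image (\<gamma> ! \<beta>))" if "\<alpha> < \<beta>" "\<beta> < length \<gamma>" "w \<in> closed_region (\<gamma> ! \<alpha>)" for \<alpha> \<beta> w
    by (rule nested_region_subset[OF pc(1) q _ that(3)]) (use nest that in \<open>auto simp: nested_contours_def\<close>)
  show "sorted_wrt (\<lambda>g h. \<forall>z\<in>inside (path_image g). z / of_real q \<in> inside (path_image h)) \<gamma>"
    using step by (auto simp: sorted_wrt_iff_nth_less closed_region_def)
  show "separated_contours (of_real q) (of_real s) (map (\<lambda>g. {g}) \<gamma>)"
  proof (rule separated_contoursI)
    fix C g assume "C \<in> set (map (\<lambda>g. {g}) \<gamma>)" "g \<in> C"
    then have "g \<in> set \<gamma>" by auto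
    then show "positive_contour g \<and> complex_of_real s \<notin> closed_region g"
      using pc[of g] by (auto simp: closed_region_def outside_inside)
  next
    have "w \<noteq> of_real q * v" if "\<alpha> < \<beta>" "\<beta> < length \<gamma>" "w \<in> closed_region (\<gamma> ! \<alpha>)" "v \<in> path_image (\<gamma> ! \<beta>)" for \<alpha> \<beta> w v
    proof
      assume "w = of_real q * v"
      then have "v \<in> inside (path_image (\<gamma> ! \<beta>))" using step[OF that(1-3)] q by simp
      then show False using inside_not_on_path that(4) by blast
    qed
    then show "sorted_wrt (\<lambda>C C'. \<forall>h\<in>C'. \<forall>g\<in>C. \<forall>w\<in>closed_region g. \<forall>v\<in>path_image h. w \<noteq> of_real q * v) (map (\<lambda>g. {g}) \<gamma>)"
      by (auto simp: sorted_wrt_iff_nth_less)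
  qed auto
qed

text \<open>
  All points \<open>1 / u\<close> lie inside every contour, so no matter how they are grouped into strings
  all poles are enclosed.
\<close>
lemma moment_expectation_nested:
  assumes q: "0 < q" "q < 1" and s: "-1 < s" "s < 1" and \<theta>: "\<theta> \<in> signatures k" "k \<le> length us"
    and u: "\<forall>u\<in>set us. 1 - of_real s * u \<noteq> 0 \<and> cmod (of_real s * ((u - of_real s) / (1 - of_real s * u))) < 1"
    and \<gamma>: "length \<gamma> = k" "nested_contours q s P \<gamma>"
    and enc: "\<forall>g\<in>set \<gamma>. \<forall>u\<in>set us. u \<noteq> 0 \<and> inverse u \<in> inside (path_image g)"
  shows "has_expectation q s us (\<lambda>\<nu>. complex_of_real (Q_obs q (map (\<lambda>t. t + 1) \<theta>) \<nu>))
    (moment_formula q s \<theta> (map (\<lambda>g. {g}) \<gamma>) (u_product q us))"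
proof (rule moment_expectation_all[OF q s _ \<theta> _ nested_contoursD(1)[OF \<gamma>(2) q(1)]])
  fix u assume "u \<in> set us"
  then show "1 - of_real s * u \<noteq> 0 \<and> cmod (zfac (of_real s) u) < 1"
    using u by (auto simp: zfac_def norm_mult norm_divide)
qed (use \<gamma> enc in auto)

lemma closed_region_circlepath:
  fixes a :: complex
  assumes "r > 0"
  shows "inside (path_image (circlepath a r)) = ball a r" "closed_region (circlepath a r) = cball a r"
    "positive_contour (circlepath a r)" "path_image (circlepath a r) = sphere a r"
proof -
  show 1: "path_image (circlepath a r) = sphere a r" using assms by simp
  have "inside (frontier (cball a r)) = interior (cball a r)"
    by (rule inside_frontier_eq_interior) auto
  then show 2: "inside (path_image (circlepath a r)) = ball a r" unfolding 1 by (simp only: frontier_cball interior_cball)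
  show "closed_region (circlepath a r) = cball a r" unfolding closed_region_def unfolding 2 unfolding 1 by auto
  have "winding_number (circlepath a r) z = 1" if "z \<in> ball a r" for z
    using that by (intro winding_number_circlepath) (simp add: dist_norm norm_minus_commute)
  then show "positive_contour (circlepath a r)"
    using assms unfolding positive_contour_def unfolding 2 by (auto simp: simple_path_circlepath)
qed

text \<open>
  A point \<open>w\<close> with \<open>w = q v\<close> in the two discs would make \<open>1 / q\<close> times the first disc meet the
  second one. Being connected and disjoint from the boundary of the second disc, the scaled
  disc lies in it, which is excluded by the condition on the boundary of the first disc.
\<close>
lemma small_radii_disjoint:
  assumes r: "small_radii q s P r" and q: "0 < q" and ab: "a \<in> P" "b \<in> P"
  shows "w \<in> cball a (r a) \<Longrightarrow> v \<in> cball b (r b) \<Longrightarrow> w \<noteq> of_real q * v"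
proof
  assume w: "w \<in> cball a (r a)" and v: "v \<in> cball b (r b)" and eq: "w = of_real q * v"
  have sp: "cball a (r a) \<inter> (\<lambda>w. of_real q * w) ` sphere b (r b) = {}" "cball b (r b) \<inter> (\<lambda>w. w / of_real q) ` sphere a (r a) = {}"
    using r ab by (auto simp: small_radii_def)
  have pos: "r a > 0" "r b > 0" using r ab by (auto simp: small_radii_def)
  define A where "A = (\<lambda>w. w / complex_of_real q) ` cball a (r a)"
  have cA: "connected A" unfolding A_def by (intro connected_continuous_image continuous_intros) (use q in auto)
  have "v \<in> A" using w q unfolding A_def eq by (intro image_eqI[of _ _ "of_real q * v"]) auto
  have "A \<inter> sphere b (r b) = {}"
  proof -
    have "z / of_real q \<notin> sphere b (r b)" if "z \<in> cball a (r a)" for z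
    proof
      assume "z / of_real q \<in> sphere b (r b)"
      then have "of_real q * (z / of_real q) \<in> (\<lambda>w. of_real q * w) ` sphere b (r b)" by blast
      then show False using sp(1) that q by auto
    qed
    then show ?thesis by (auto simp: A_def)
  qed
  have "A \<subseteq> cball b (r b)"
  proof (rule ccontr)
    assume "\<not> A \<subseteq> cball b (r b)"
    then have "A - cball b (r b) \<noteq> {}" by auto
    moreover have "A \<inter> cball b (r b) \<noteq> {}" using \<open>v \<in> A\<close> v by auto
    ultimately have "A \<inter> frontier (cball b (r b)) \<noteq> {}" using connected_Int_frontier[OF cA] by blast
    then show False using \<open>A \<inter> sphere b (r b) = {}\<close> by simp
  qed
  moreover obtain z where "z \<in> sphere a (r a)" using pos by (metis less_imp_le equals0I sphere_eq_empty not_less)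
  then have "z / of_real q \<in> A" "z / of_real q \<in> (\<lambda>w. w / of_real q) ` sphere a (r a)" unfolding A_def by (auto simp del: mem_cball mem_sphere intro!: imageI) (auto simp: )
  ultimately show False using sp(2) by blast
qed

lemma circles_contours:
  assumes r: "small_radii q s P r" and q: "0 < q" and P: "finite P"
  shows "separated_contours (of_real q) (of_real s) (replicate k (circles P r))"
    and "a \<in> P \<Longrightarrow> \<exists>g\<in>circles P r. a \<in> inside (path_image g) \<and> (\<forall>h\<in>circles P r - {g}. a \<notin> closed_region h)"
proof -
  have pos: "r a > 0" "of_real s \<notin> cball a (r a)" if "a \<in> P" for a using r that by (auto simp: small_radii_def)
  show "separated_contours (of_real q) (of_real s) (replicate k (circles P r))"
  proof (rule separated_contoursI)
    fix C assume "C \<in> set (replicate k (circles P r))"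
    then show "finite C" using P by (simp add: circles_def)
  next
    fix C g assume "C \<in> set (replicate k (circles P r))" "g \<in> C"
    then obtain a where a: "a \<in> P" "g = circlepath a (r a)" by (auto simp: circles_def)
    then show "positive_contour g \<and> of_real s \<notin> closed_region g"
      using closed_region_circlepath[OF pos(1)[OF a(1)], of a] pos(2)[OF a(1)] by simp
  next
    have "w \<noteq> of_real q * v" if gh: "g \<in> circles P r" "h \<in> circles P r" "w \<in> closed_region g" "v \<in> path_image h" for g h w v
    proof -
      obtain a b where ab: "a \<in> P" "g = circlepath a (r a)" "b \<in> P" "h = circlepath b (r b)" using gh by (auto simp: circles_def)
      show ?thesis
        by (rule small_radii_disjoint[OF r q ab(1,3)])
          (use gh ab closed_region_circlepath[OF pos(1)[OF ab(1)], of a] closed_region_circlepath[OF pos(1)[OF ab(3)], of b]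
            path_image_subset_region[of h] in auto)
    qed
    then show "sorted_wrt (\<lambda>C C'. \<forall>h\<in>C'. \<forall>g\<in>C. \<forall>w\<in>closed_region g. \<forall>v\<in>path_image h. w \<noteq> of_real q * v) (replicate k (circles P r))"
      by (auto simp: sorted_wrt_iff_nth_less)
  qed
  assume a: "a \<in> P"
  show "\<exists>g\<in>circles P r. a \<in> inside (path_image g) \<and> (\<forall>h\<in>circles P r - {g}. a \<notin> closed_region h)"
  proof (intro bexI conjI ballI)
    show "circlepath a (r a) \<in> circles P r" using a by (simp add: circles_def)
    show "a \<in> inside (path_image (circlepath a (r a)))"
      using closed_region_circlepath(1)[OF pos(1)[OF a], of a] pos(1)[OF a] by simp
    fix h assume "h \<in> circles P r - {circlepath a (r a)}"
    then obtain b where b: "b \<in> P" "h = circlepath b (r b)" "b \<noteq> a" by (auto simp: circles_def)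
    have "cball a (r a) \<inter> cball b (r b) = {}" using r a b by (simp add: small_radii_def)
    then show "a \<notin> closed_region h"
      using closed_region_circlepath(2)[OF pos(1)[OF b(1)], of b] b pos(1)[OF a] by (auto simp: disjoint_iff)
  qed
qed

text \<open>
  This is \<open>- s (u - s) < 1 - s u\<close>, that is, \<open>s\<^sup>2 < 1\<close>.
\<close>
lemma positive_parameter:
  assumes s: "-1 < s" "s < 0" and u: "0 < (u :: real)"
  shows "1 - complex_of_real s * of_real u \<noteq> 0 \<and> cmod (zfac (of_real s) (of_real u)) < 1"
proof -
  have p: "1 - s * u > 0" using s u by (smt (verit) mult_neg_pos)
  have z: "zfac (of_real s) (of_real u) = complex_of_real (- s * ((u - s) / (1 - s * u)))" by (simp add: zfac_def)
  have "s * s < 1" using s by (smt (verit) mult_le_cancel_left1 mult_minus_left mult_minus_right)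
  then have "- s * (u - s) < 1 - s * u" by (simp add: algebra_simps)
  then have "- s * ((u - s) / (1 - s * u)) < 1" using p by (simp add: divide_simps)
  moreover have "0 \<le> - s * ((u - s) / (1 - s * u))" using s u p by (intro mult_nonneg_nonneg divide_nonneg_pos) auto
  ultimately have "cmod (zfac (of_real s) (of_real u)) < 1" unfolding z norm_of_real by linarith
  moreover have "1 - complex_of_real s * of_real u = of_real (1 - s * u)" by simp
  then have "1 - complex_of_real s * of_real u \<noteq> 0" using p by (simp only: of_real_eq_0_iff)
  ultimately show ?thesis by simp
qed

lemma moment_expectation_circles:
  fixes us :: "real list"
  assumes q: "0 < q" "q < 1" and s: "-1 < s" "s < 0" and \<theta>: "\<theta> \<in> signatures k" "k \<le> length us"
    and u: "\<forall>u\<in>set us. u > 0"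
    and r: "small_radii q s ((\<lambda>u. inverse (complex_of_real u)) ` set us) r"
  defines "us' \<equiv> map complex_of_real us"
  shows "has_expectation q s us' (\<lambda>\<nu>. complex_of_real (Q_obs q (map (\<lambda>t. t + 1) \<theta>) \<nu>))
    (moment_formula q s \<theta> (replicate k (circles (inverse ` set us') r)) (u_product q us'))"
proof (rule moment_expectation_all[OF q])
  have P: "inverse ` set us' = (\<lambda>u. inverse (complex_of_real u)) ` set us" by (simp add: us'_def image_image)
  have r': "small_radii q s (inverse ` set us') r" using r unfolding P .
  show "separated_contours (of_real q) (of_real s) (replicate k (circles (inverse ` set us') r))"
    by (rule circles_contours(1)[OF r' q(1)]) simp
  show "1 - of_real s * u \<noteq> 0 \<and> cmod (zfac (of_real s) u) < 1" if uu: "u \<in> set us'" for u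
  proof -
    obtain x where "x \<in> set us" "u = of_real x" using uu by (auto simp: us'_def)
    then show ?thesis using positive_parameter[OF s, of x] u by blast
  qed
  show "u \<noteq> 0 \<and> (\<exists>g\<in>C. inverse u \<in> inside (path_image g) \<and> (\<forall>h\<in>C - {g}. inverse u \<notin> closed_region h))"
    if C: "C \<in> set (replicate k (circles (inverse ` set us') r))" and uu: "u \<in> set us'" for C u
  proof -
    have "C = circles (inverse ` set us') r" using C by simp
    moreover have "u \<noteq> 0" using uu u by (auto simp: us'_def)
    ultimately show ?thesis using circles_contours(2)[OF r' q(1) _, of "inverse u"] uu by simp
  qed
qed (use s \<theta> in \<open>auto simp: us'_def\<close>)

section \<open>Parameters in geometric progressions\<close>

lemma iter_oint_spike:
  assumes "\<And>C g. C \<in> set Cs \<Longrightarrow> g \<in> C \<Longrightarrow> finite {t \<in> {0..1}. g t \<in> E}"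
    and "\<And>ws. length ws = length Cs \<Longrightarrow> (\<forall>w\<in>set ws. w \<notin> E) \<Longrightarrow> f ws = g ws"
  shows "iter_oint Cs f = iter_oint Cs g"
  using assms
proof (induction Cs arbitrary: f g)
  case (Cons C Cs)
  have IH: "iter_oint Cs (\<lambda>ws. f (w # ws)) = iter_oint Cs (\<lambda>ws. g (w # ws))" if "w \<notin> E" for w
    by (rule Cons.IH) (use Cons.prems that in auto)
  have "contour_integral p (\<lambda>w. iter_oint Cs (\<lambda>ws. f (w # ws))) = contour_integral p (\<lambda>w. iter_oint Cs (\<lambda>ws. g (w # ws)))"
    if p: "p \<in> C" for p
    unfolding contour_integral_integral
  proof (rule integral_spike)
    show "negligible {t \<in> {0..1}. p t \<in> E}" using Cons.prems(1)[of C p] p by (intro negligible_finite) simp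
  qed (use IH in auto)
  then show ?case by (simp add: oint_def)
qed simp

lemma simple_path_finite_hits:
  assumes "simple_path g" "finite E"
  shows "finite {t \<in> {0..1}. g t \<in> E}"
proof -
  have "finite (g -` E \<inter> {0<..<1})"
    by (rule finite_vimage_IntI[OF assms(2) simple_path_inj_on[OF assms(1)]])
  moreover have "{t \<in> {0..1}. g t \<in> E} \<subseteq> (g -` E \<inter> {0<..<1}) \<union> {0, 1}" by auto
  ultimately show ?thesis by (meson finite.emptyI finite.insertI finite_UnI finite_subset)
qed

text \<open>
  If the residue at \<open>1 / b\<close> has been taken, the only new pole is \<open>1 / (q b)\<close>, at \<open>1 / q\<close> times
  a point inside the present contour, hence inside all later ones.
\<close>
lemma poles_enclosed_chain:
  assumes "sorted_wrt (\<lambda>g h. \<forall>z\<in>inside (path_image g). z / q \<in> inside (path_image h)) \<gamma>"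
    and "\<And>b g. b \<in> U - (*) q ` U \<Longrightarrow> g \<in> set \<gamma> \<Longrightarrow> inverse b \<in> inside (path_image g)"
  shows "poles_enclosed q (map (\<lambda>g. {g}) \<gamma>) U"
  using assms
proof (induction \<gamma> arbitrary: U)
  case (Cons g \<gamma>)
  have "poles_enclosed q (map (\<lambda>g. {g}) \<gamma>) (U - {b})" if b: "b \<in> U - (*) q ` U" for b
  proof (rule Cons.IH)
    fix c h assume c: "c \<in> (U - {b}) - (*) q ` (U - {b})" and h: "h \<in> set \<gamma>"
    show "inverse c \<in> inside (path_image h)"
    proof (cases "c \<in> (*) q ` U")
      case True
      then have "c = q * b" using c by auto
      then have "inverse c = inverse b / q" by (simp add: divide_inverse)
      then show ?thesis using Cons.prems(1) Cons.prems(2)[OF b, of g] h by auto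
    next
      case False
      then show ?thesis using c h Cons.prems(2) by auto
    qed
  qed (use Cons.prems in auto)
  moreover have "inverse b \<in> inside (path_image h) \<and> inverse b \<notin> path_image h"
    if "b \<in> U - (*) q ` U" "h \<in> set (g # \<gamma>)" for b h
    using Cons.prems(2)[OF that] inside_not_on_path by blast
  ultimately show ?case by auto
qed simp

text \<open>
  A flat indexing of the blocks: entry \<open>l\<close> has position \<open>l mod J\<close> in block \<open>l div J\<close>.
\<close>
lemma concat_blocks:
  "concat (map (\<lambda>x. map (f x) [0..<J]) xs) = map (\<lambda>l. f (xs ! (l div J)) (l mod J)) [0..<length xs * J]"
proof (induction xs)
  case (Cons x xs)
  have "[0..<length (x # xs) * J] = [0..<J] @ map (\<lambda>l. l + J) [0..<length xs * J]"
    by (simp add: map_add_upt add.commute upt_add_eq_append[symmetric, of 0 J "length xs * J", simplified])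
  then have "map (\<lambda>l. f ((x # xs) ! (l div J)) (l mod J)) [0..<length (x # xs) * J] =
    map (\<lambda>l. f ((x # xs) ! (l div J)) (l mod J)) [0..<J] @ map (\<lambda>l. f ((x # xs) ! ((l + J) div J)) ((l + J) mod J)) [0..<length xs * J]"
    by (simp add: o_def)
  also have "map (\<lambda>l. f ((x # xs) ! (l div J)) (l mod J)) [0..<J] = map (f x) [0..<J]" by simp
  also have "map (\<lambda>l. f ((x # xs) ! ((l + J) div J)) ((l + J) mod J)) [0..<length xs * J] =
     map (\<lambda>l. f (xs ! (l div J)) (l mod J)) [0..<length xs * J]"
    by (intro map_cong refl) (cases "J = 0", auto)
  finally show ?case using Cons by simp
qed simp

lemma string_product:
  fixes q u w :: complex
  assumes "\<forall>i<J. 1 - q ^ i * u * w \<noteq> 0"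
  shows "(\<Prod>i\<leftarrow>[0..<J]. (1 - q * (q ^ i * u) * w) / (1 - q ^ i * u * w)) = (if J = 0 then 1 else (1 - q ^ J * u * w) / (1 - u * w))"
  using assms
proof (induction J)
  case (Suc J)
  then show ?case by (cases "J = 0") (simp_all add: mult.assoc)
qed simp

text \<open>
  For disjoint strings of length \<open>J\<close> the product telescopes along each string; the only poles
  are at the starting points.
\<close>
lemma reduced_product_strings:
  fixes V :: "complex set" and q :: complex
  assumes V: "finite V" "0 \<notin> V" and q: "q \<noteq> 0" and J: "1 \<le> J"
    and sep: "\<And>v v' j. v \<in> V \<Longrightarrow> v' \<in> V \<Longrightarrow> 1 \<le> j \<Longrightarrow> j \<le> J \<Longrightarrow> v \<noteq> q ^ j * v'"
  defines "U \<equiv> (\<lambda>(i, v). q ^ i * v) ` ({..<J} \<times> V)"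
  shows "U - (*) q ` U = V" and "reduced_product q U w = (\<Prod>v\<in>V. (1 - q ^ J * v * w) / (1 - v * w))"
proof -
  have U_iff: "x \<in> U \<longleftrightarrow> (\<exists>i<J. \<exists>v\<in>V. x = q ^ i * v)" for x by (auto simp: U_def)
  have qU_iff: "x \<in> (*) q ` U \<longleftrightarrow> (\<exists>i<J. \<exists>v\<in>V. x = q ^ Suc i * v)" for x
    by (auto simp: U_def image_iff mult.assoc Bex_def)
  show heads: "U - (*) q ` U = V"
  proof (intro equalityI subsetI)
    fix x assume x: "x \<in> U - (*) q ` U"
    then obtain i v where iv: "i < J" "v \<in> V" "x = q ^ i * v" by (auto simp: U_iff)
    show "x \<in> V"
    proof (cases i)
      case 0 then show ?thesis using iv by simp
    next
      case (Suc j)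
      then have "x \<in> (*) q ` U" unfolding qU_iff using iv by (intro exI[of _ j]) auto
      then show ?thesis using x by simp
    qed
  next
    fix v assume v: "v \<in> V"
    then have "v \<in> U" unfolding U_iff using J by (intro exI[of _ 0]) auto
    moreover have "v \<notin> (*) q ` U" unfolding qU_iff using sep[OF v, of _ "Suc _"] by (auto simp del: power_Suc)
    ultimately show "v \<in> U - (*) q ` U" by simp
  qed
  have ends: "(*) q ` U - U = (\<lambda>v. q ^ J * v) ` V"
  proof (intro equalityI subsetI)
    fix x assume x: "x \<in> (*) q ` U - U"
    then obtain i v where iv: "i < J" "v \<in> V" "x = q ^ Suc i * v" by (auto simp: qU_iff simp del: power_Suc)
    have "\<not> Suc i < J" using x iv by (auto simp: U_iff simp del: power_Suc)
    then have "Suc i = J" using iv by simp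
    then show "x \<in> (\<lambda>v. q ^ J * v) ` V" using iv by auto
  next
    fix x assume "x \<in> (\<lambda>v. q ^ J * v) ` V"
    then obtain v where v: "v \<in> V" "x = q ^ J * v" by auto
    have "x \<in> (*) q ` U" unfolding qU_iff using v J by (intro exI[of _ "J - 1"]) (auto simp del: power_Suc)
    moreover have "x \<notin> U"
    proof
      assume "x \<in> U"
      then obtain i v' where iv: "i < J" "v' \<in> V" "x = q ^ i * v'" by (auto simp: U_iff)
      have "q ^ J = q ^ i * q ^ (J - i)" using iv by (simp add: power_add[symmetric])
      then have "v' = q ^ (J - i) * v" using v iv q by simp
      then show False using sep[OF iv(2) v(1), of "J - i"] iv by auto
    qed
    ultimately show "x \<in> (*) q ` U - U" by simp
  qed
  have inj: "inj_on (\<lambda>v. q ^ J * v) V" using q by (auto simp: inj_on_def)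
  show "reduced_product q U w = (\<Prod>v\<in>V. (1 - q ^ J * v * w) / (1 - v * w))"
    unfolding reduced_product_def heads ends by (simp add: prod.reindex[OF inj] prod_dividef)
qed

text \<open>
  The starting point of each string is moved in a direction of its own and the other entries
  along with it, so that the strings persist and the poles stay inside the contours. Moving
  all parameters independently would break up the strings and produce poles whose position
  relative to the contours is unknown.
\<close>
lemma moment_expectation_strings:
  fixes vs :: "real list"
  assumes q: "0 < q" "q < 1" and s: "-1 < s" "s < 0" and \<theta>: "\<theta> \<in> signatures k" "k \<le> J * length vs" and J: "1 \<le> J"
    and pos: "\<forall>u\<in>set vs. u > 0" and sep: "\<forall>u\<in>set vs. \<forall>u'\<in>set vs. q * u < u'"
    and \<gamma>: "length \<gamma> = k" "nested_contours q s ((\<lambda>u. inverse (complex_of_real u)) ` set vs) \<gamma>"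
  defines "us \<equiv> concat (map (\<lambda>u. map (\<lambda>i. complex_of_real (q ^ i * u)) [0..<J]) vs)"
  defines "\<phi> \<equiv> \<lambda>w :: complex. \<Prod>u\<leftarrow>vs. (1 - q ^ J * u * w) / (1 - u * w)"
  shows "has_expectation q s us (\<lambda>\<nu>. complex_of_real (Q_obs q (map (\<lambda>t. t + 1) \<theta>) \<nu>)) (moment_formula q s \<theta> (map (\<lambda>g. {g}) \<gamma>) \<phi>)"
proof -
  let ?q = "complex_of_real q" and ?n = "length vs"
  have us_eq: "us = map (\<lambda>l. complex_of_real (q ^ (l mod J) * vs ! (l div J))) [0..<?n * J]"
    unfolding us_def by (rule concat_blocks)
  define ds where "ds = map (\<lambda>l. ?q ^ (l mod J) * of_nat (Suc (l div J))) [0..<?n * J]"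
  define v where "v = (\<lambda>t a. complex_of_real (vs ! a) + t * of_nat (Suc a))"
  have len: "length us = length ds" by (simp add: us_eq ds_def)
  have lus: "length us = ?n * J" by (simp add: us_eq)
  have div: "l div J < ?n" "l mod J < J" if "l < ?n * J" for l
    using that J by (auto simp: less_mult_imp_div_less)
  have mv: "moved us ds t = map (\<lambda>l. ?q ^ (l mod J) * v t (l div J)) [0..<?n * J]" for t
  proof (rule nth_equalityI)
    fix l assume "l < length (moved us ds t)"
    then have "l < ?n * J" using len lus by simp
    then show "moved us ds t ! l = map (\<lambda>l. ?q ^ (l mod J) * v t (l div J)) [0..<?n * J] ! l"
      using len lus by (simp add: moved_nth) (simp add: us_eq ds_def v_def algebra_simps)
  qed (use len lus in simp)
  define V where "V = (\<lambda>t. v t ` {..<?n})"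
  have set_mv: "set (moved us ds t) = (\<lambda>(i, v). ?q ^ i * v) ` ({..<J} \<times> V t)" for t
  proof (intro equalityI subsetI)
    fix x assume "x \<in> set (moved us ds t)"
    then obtain l where "l < ?n * J" "x = ?q ^ (l mod J) * v t (l div J)" unfolding mv by auto
    then show "x \<in> (\<lambda>(i, v). ?q ^ i * v) ` ({..<J} \<times> V t)"
      using div[of l] by (intro image_eqI[of _ _ "(l mod J, v t (l div J))"]) (auto simp: V_def)
  next
    fix x assume "x \<in> (\<lambda>(i, v). ?q ^ i * v) ` ({..<J} \<times> V t)"
    then obtain i a where ia: "i < J" "a < ?n" "x = ?q ^ i * v t a" by (auto simp: V_def)
    have "i + J * a < J + J * a" using ia by simp
    also have "J + J * a = Suc a * J" by simp
    also have "\<dots> \<le> ?n * J" using ia by (intro mult_le_mono1) simp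
    finally have "i + J * a < ?n * J" .
    moreover have "(i + J * a) mod J = i" "(i + J * a) div J = a" using ia by auto
    ultimately show "x \<in> set (moved us ds t)" unfolding mv using ia by (auto intro!: image_eqI[of _ _ "i + J * a"])
  qed
  have upos: "\<exists>x>0. u = complex_of_real x" if uu: "u \<in> set us" for u
  proof -
    obtain x i where "x \<in> set vs" "u = complex_of_real (q ^ i * x)" using uu unfolding us_def by auto
    then show ?thesis using pos q by (intro exI[of _ "q ^ i * x"]) auto
  qed
  have powlt: "q ^ j * vs ! a < vs ! b" if "1 \<le> j" "a < ?n" "b < ?n" for j a b
  proof -
    have "q ^ j \<le> q ^ 1" using q that by (intro power_decreasing) auto
    then have "q ^ j * vs ! a \<le> q * vs ! a" using pos that by (intro mult_right_mono) (auto intro: less_imp_le)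
    also have "\<dots> < vs ! b" using sep that by auto
    finally show ?thesis .
  qed
  have gen: "\<forall>\<^sub>F t in at 0. generic s (moved us ds t)"
  proof (rule eventually_generic[OF len])
    show "1 - of_real s * u \<noteq> 0" if "u \<in> set us" for u using upos[OF that] positive_parameter[OF s] by blast
    show "ds ! i \<noteq> 0" if "i < length ds" for i using that q by (simp add: ds_def del: of_nat_Suc)
    \<comment> \<open>Entries of different strings at the same position are told apart by their directions, entries at
      different positions by their values, since \<open>q max u < min u\<close>.\<close>
    show "us ! i \<noteq> us ! j \<or> ds ! i \<noteq> ds ! j" if ij: "i < j" "j < length us" for i j
    proof (cases "i mod J = j mod J")
      case True
      then have "i div J \<noteq> j div J" using ij by (metis div_mult_mod_eq nat_neq_iff)
      then show ?thesis using True ij q lus by (simp add: ds_def del: of_nat_Suc)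
    next
      case False
      have ne: "q ^ x * vs ! a \<noteq> q ^ y * vs ! b" if "x < y" "a < ?n" "b < ?n" for x y a b
      proof
        assume eq: "q ^ x * vs ! a = q ^ y * vs ! b"
        have "q ^ y = q ^ x * q ^ (y - x)" using that by (simp add: power_add[symmetric])
        then have "vs ! a = q ^ (y - x) * vs ! b" using eq q by simp
        moreover have "1 \<le> y - x" using that by simp
        ultimately show False using powlt[of "y - x" b a] that by simp
      qed
      have "q ^ (i mod J) * vs ! (i div J) \<noteq> q ^ (j mod J) * vs ! (j div J)"
        using ne[of "i mod J" "j mod J" "i div J" "j div J"] ne[of "j mod J" "i mod J" "j div J" "i div J"] False ij lus div
        by (metis less_trans nat_neq_iff)
      then have "us ! i \<noteq> us ! j" using ij lus unfolding us_eq by (simp only: nth_map nth_upt length_upt) (simp only: of_real_eq_iff, simp)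
      then show ?thesis by simp
    qed
  qed
  have pin: "inverse (complex_of_real (vs ! a)) \<in> inside (path_image g)" if "a < ?n" "g \<in> set \<gamma>" for a g
  proof -
    have "inverse (complex_of_real (vs ! a)) \<in> (\<lambda>u. inverse (complex_of_real u)) ` set vs" using that(1) by (intro imageI) simp
    then show ?thesis using \<gamma>(2) that(2) unfolding nested_contours_def by blast
  qed
  have sepc: "separated_contours ?q (of_real s) (map (\<lambda>g. {g}) \<gamma>)"
    and chain: "sorted_wrt (\<lambda>g h. \<forall>z\<in>inside (path_image g). z / ?q \<in> inside (path_image h)) \<gamma>"
    using nested_contoursD[OF \<gamma>(2) q(1)] by auto
  have posg: "positive_contour g" if "g \<in> set \<gamma>" for g using \<gamma>(2) that by (simp add: nested_contours_def)
  have vlim: "(\<lambda>t. v t a) \<midarrow>0\<rightarrow> of_real (vs ! a)" for a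
    unfolding v_def by (auto intro!: tendsto_eq_intros)
  have ev: "\<forall>\<^sub>F t in at 0. (\<forall>a\<in>{..<?n}. v t a \<noteq> 0) \<and> (\<forall>a\<in>{..<?n}. \<forall>g\<in>set \<gamma>. inverse (v t a) \<in> inside (path_image g)) \<and>
     (\<forall>a\<in>{..<?n}. \<forall>b\<in>{..<?n}. \<forall>j\<in>{1..J}. v t a - ?q ^ j * v t b \<noteq> 0) \<and> (\<forall>a\<in>{..<?n}. \<forall>b\<in>{..<a}. v t a - v t b \<noteq> 0)"
  proof (intro eventually_conj eventually_ball_finite ballI finite_lessThan finite_set finite_atLeastAtMost)
    fix a assume a: "a \<in> {..<?n}"
    have nz: "complex_of_real (vs ! a) \<noteq> 0" using pos a by (metis lessThan_iff less_irrefl nth_mem of_real_eq_0_iff)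
    show "\<forall>\<^sub>F t in at 0. v t a \<noteq> 0" by (rule tendsto_imp_eventually_ne[OF vlim nz])
    show "\<forall>\<^sub>F t in at 0. inverse (v t a) \<in> inside (path_image g)" if "g \<in> set \<gamma>" for g
      by (rule topological_tendstoD[OF tendsto_inverse[OF vlim nz] positive_contour_open_closed(1)[OF posg[OF that]]])
        (use pin a that in auto)
    show "\<forall>\<^sub>F t in at 0. v t a - ?q ^ j * v t b \<noteq> 0" if "b \<in> {..<?n}" "j \<in> {1..J}" for b j
    proof (rule tendsto_imp_eventually_ne)
      show "(\<lambda>t. v t a - ?q ^ j * v t b) \<midarrow>0\<rightarrow> of_real (vs ! a) - ?q ^ j * of_real (vs ! b)" by (intro tendsto_intros vlim)
      have "vs ! a - q ^ j * vs ! b \<noteq> 0" using powlt[of j b a] that a by auto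
      then have "complex_of_real (vs ! a - q ^ j * vs ! b) \<noteq> 0" by (simp only: of_real_eq_0_iff not_False_eq_True)
      then show "complex_of_real (vs ! a) - ?q ^ j * of_real (vs ! b) \<noteq> 0" by simp
    qed
    show "\<forall>\<^sub>F t in at 0. v t a - v t b \<noteq> 0" if "b \<in> {..<a}" for b
    proof -
      have "of_nat (Suc a) - of_nat (Suc b) \<noteq> (0 :: complex)" using that by (simp del: of_nat_Suc)
      from eventually_affine_nonzero[of "of_real (vs ! a) - of_real (vs ! b)" "of_nat (Suc a) - of_nat (Suc b)", OF disjI2[OF this]]
      show ?thesis by (rule eventually_mono) (simp add: v_def algebra_simps)
    qed
  qed
  have \<phi>_eq: "\<phi> = fraction_product ?n (\<lambda>a. of_real (vs ! a)) (\<lambda>a. ?q ^ J * of_real (vs ! a))"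
    by (auto simp: fun_eq_iff \<phi>_def fraction_product_def prod.list_conv_set_nth atLeast0LessThan)
  show ?thesis
    unfolding \<phi>_eq
  proof (rule moment_expectation[OF q s(1) _ len _ gen \<theta>(1) _ _ sepc])
    show "1 - of_real s * u \<noteq> 0 \<and> cmod (zfac (of_real s) u) < 1" if "u \<in> set us" for u
      using upos[OF that] positive_parameter[OF s] by blast
    show "\<forall>\<^sub>F t in at 0. poles_enclosed ?q (map (\<lambda>g. {g}) \<gamma>) (set (moved us ds t))"
      using ev
    proof eventually_elim
      case (elim t)
      have "set (moved us ds t) - (*) ?q ` set (moved us ds t) = V t"
        unfolding set_mv by (rule reduced_product_strings(1)) (use elim q J in \<open>auto simp: V_def\<close>)
      then show ?case by (intro poles_enclosed_chain[OF chain]) (use elim in \<open>auto simp: V_def\<close>)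
    qed
    show "1 - complex_of_real (vs ! i) * w \<noteq> 0" if i: "i < ?n" and j: "j < k" and w: "w \<in> contour_support (map (\<lambda>g. {g}) \<gamma> ! j)" for i j w
    proof
      assume "1 - complex_of_real (vs ! i) * w = 0"
      then have "w = inverse (of_real (vs ! i))" by (metis eq_iff_diff_eq_0 inverse_unique)
      moreover have "w \<in> path_image (\<gamma> ! j)" "\<gamma> ! j \<in> set \<gamma>" using w j \<gamma>(1) by (auto simp: contour_support_def)
      ultimately show False using pin[OF i, of "\<gamma> ! j"] inside_not_on_path by blast
    qed
    show "\<forall>\<^sub>F t in at 0. \<forall>j<k. \<forall>w\<in>contour_support (map (\<lambda>g. {g}) \<gamma> ! j).
        fraction_product ?n (\<lambda>i. complex_of_real (vs ! i) + t * of_nat (Suc i)) (\<lambda>i. ?q ^ J * of_real (vs ! i) + t * (?q ^ J * of_nat (Suc i))) w =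
        reduced_product ?q (set (moved us ds t)) w"
      using ev
    proof eventually_elim
      case (elim t)
      have inj: "inj_on (v t) {..<?n}"
      proof (rule inj_onI)
        fix a b assume "a \<in> {..<?n}" "b \<in> {..<?n}" "v t a = v t b"
        then show "a = b" using elim by (metis eq_iff_diff_eq_0 lessThan_iff nat_neq_iff)
      qed
      have "reduced_product ?q (set (moved us ds t)) w = (\<Prod>v\<in>V t. (1 - ?q ^ J * v * w) / (1 - v * w))" for w
        unfolding set_mv by (rule reduced_product_strings(2)) (use elim q J in \<open>auto simp: V_def\<close>)
      then show ?case
        unfolding V_def prod.reindex[OF inj] by (auto simp: fraction_product_def v_def algebra_simps)
    qed
  qed (use s \<theta> \<gamma> lus in \<open>auto simp: mult.commute\<close>)
qed

lemma u_product_strings: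
  fixes vs :: "real list" and q :: real and w :: complex
  defines "us \<equiv> \<lambda>vs J. concat (map (\<lambda>u. map (\<lambda>i. complex_of_real (q ^ i * u)) [0..<J]) vs)"
  assumes J: "1 \<le> J" and w: "\<forall>u\<in>set (us vs J). 1 - u * w \<noteq> 0"
  shows "u_product q (us vs J) w = (\<Prod>u\<leftarrow>vs. (1 - q ^ J * u * w) / (1 - u * w))"
  using w
proof (induction vs)
  case (Cons u vs)
  have "u_product q (us (u # vs) J) w = (\<Prod>i\<leftarrow>[0..<J]. (1 - complex_of_real q * (complex_of_real q ^ i * complex_of_real u) * w) / (1 - complex_of_real q ^ i * complex_of_real u * w)) * u_product q (us vs J) w"
    by (simp add: us_def u_product_def o_def)
  also have "(\<Prod>i\<leftarrow>[0..<J]. (1 - complex_of_real q * (complex_of_real q ^ i * complex_of_real u) * w) / (1 - complex_of_real q ^ i * complex_of_real u * w)) = (1 - complex_of_real q ^ J * complex_of_real u * w) / (1 - complex_of_real u * w)"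
  proof (subst string_product)
    have "1 - complex_of_real (q ^ i * u) * w \<noteq> 0" if "i < J" for i
      by (rule bspec[OF Cons.prems]) (use that in \<open>auto simp: us_def\<close>)
    then show "\<forall>i<J. 1 - complex_of_real q ^ i * complex_of_real u * w \<noteq> 0" by simp
  qed (use J in simp)
  finally have step: "u_product q (us (u # vs) J) w =
    (1 - complex_of_real q ^ J * complex_of_real u * w) / (1 - complex_of_real u * w) * u_product q (us vs J) w" .
  have "u_product q (us vs J) w = (\<Prod>u\<leftarrow>vs. (1 - q ^ J * u * w) / (1 - u * w))"
    by (rule Cons.IH) (use Cons.prems in \<open>auto simp: us_def\<close>)
  then show ?case unfolding step by simp
qed (simp add: us_def u_product_def)

text \<open>
  The full product over all parameters agrees with the telescoped one except at the finitely
  many points \<open>1 / u\<close>, where a factor of it is a division by zero. The contours may pass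
  through such points, but changing the integrand there does not affect the integral.
\<close>
lemma moment_formula_spike:
  assumes "\<forall>g\<in>set \<gamma>. positive_contour g" "finite E" "\<And>w. w \<notin> E \<Longrightarrow> \<phi> w = \<psi> w" and len: "length \<gamma> = length \<theta>"
  shows "moment_formula q s \<theta> (map (\<lambda>g. {g}) \<gamma>) \<phi> = moment_formula q s \<theta> (map (\<lambda>g. {g}) \<gamma>) \<psi>"
  unfolding moment_formula_eq
proof (rule arg_cong[of _ _ "(*) _"], rule iter_oint_spike[where E = E])
  fix C g assume "C \<in> set (map (\<lambda>g. {g}) \<gamma>)" "g \<in> C"
  then show "finite {t \<in> {0..1}. g t \<in> E}"
    using assms(1,2) by (intro simple_path_finite_hits) (auto simp: positive_contour_def)
next
  fix ws :: "complex list" assume "length ws = length (map (\<lambda>g. {g}) \<gamma>)" "\<forall>w\<in>set ws. w \<notin> E"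
  then show "moment_integrand (of_real q) (of_real s) \<theta> \<phi> ws = moment_integrand (of_real q) (of_real s) \<theta> \<psi> ws"
    using len by (intro moment_integrand_cong assms(3)) auto
qed

section \<open>The symmetrized formula\<close>

text \<open>
  The residue of the product over \<open>U\<close> at \<open>1 / u\<close>, when no two parameters have quotient \<open>q\<close>.
\<close>
definition pole_weight :: "complex \<Rightarrow> complex set \<Rightarrow> complex \<Rightarrow> complex" where
  "pole_weight q U u = - ((1 - q) / u * (\<Prod>v\<in>U - {u}. cross q u v))"

text \<open>
  The inner variables are integrated first; for every value of the outer variable in \<open>S\<close> this
  leaves a finite sum of values of \<open>f\<close>, which is holomorphic in the outer variable.
\<close>
lemma iter_oint_residues:
  assumes C: "finite C" "\<And>g. g \<in> C \<Longrightarrow> positive_contour g \<and> closed_region g \<subseteq> S" and S: "open S"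
    and U: "finite U" "0 \<notin> U" "U \<inter> (*) q ` U = {}" and q: "q \<noteq> 0" "cmod q < 1"
    and enc: "\<And>b. b \<in> U \<Longrightarrow> \<exists>g\<in>C. inverse b \<in> inside (path_image g) \<and> (\<forall>h\<in>C - {g}. inverse b \<notin> closed_region h)"
    and f: "\<And>ws i. length ws = k \<Longrightarrow> set ws \<subseteq> S \<Longrightarrow> i < k \<Longrightarrow> (\<lambda>z. f (ws[i := z])) holomorphic_on S"
  shows "iter_oint (replicate k C) (\<lambda>ws. f ws * (\<Prod>i<k. reduced_product q U (ws ! i))) =
    (\<Sum>us | set us \<subseteq> U \<and> length us = k. (\<Prod>u\<leftarrow>us. pole_weight q U u) * f (map inverse us))"
  using f
proof (induction k arbitrary: f)
  case 0
  have "{us. set us \<subseteq> U \<and> length us = 0} = {[]}" by auto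
  then show ?case by simp
next
  case (Suc k)
  let ?L = "{us. set us \<subseteq> U \<and> length us = k}"
  have inS: "inverse u \<in> S" if "u \<in> U" for u
    using enc[OF that] C(2) by (force simp: closed_region_def)
  have B: "U - (*) q ` U = U" using U by auto
  have fS: "(\<lambda>w. f (w # map inverse us)) holomorphic_on S" if us: "set us \<subseteq> U" "length us = k" for us
  proof (cases "S = {}")
    case False
    then obtain a where "a \<in> S" by auto
    have "(\<lambda>z. f ((a # map inverse us)[0 := z])) holomorphic_on S"
      by (rule Suc.prems) (use us inS \<open>a \<in> S\<close> in auto)
    then show ?thesis by simp
  qed (simp add: holomorphic_on_def)
  define H where "H = (\<lambda>w. (\<Prod>c\<in>(*) q ` U - U. 1 - c * w) * (\<Sum>us\<in>?L. (\<Prod>u\<leftarrow>us. pole_weight q U u) * f (w # map inverse us)))"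
  have hH: "H holomorphic_on S"
    unfolding H_def by (intro holomorphic_intros fS) auto
  have inner: "iter_oint (replicate k C) (\<lambda>ws. f (w # ws) * (\<Prod>i<k. reduced_product q U (ws ! i))) =
      (\<Sum>us\<in>?L. (\<Prod>u\<leftarrow>us. pole_weight q U u) * f (w # map inverse us))" if w: "w \<in> S" for w
  proof (rule Suc.IH)
    fix ws :: "complex list" and i assume "length ws = k" "set ws \<subseteq> S" "i < k"
    then have "(\<lambda>z. f ((w # ws)[Suc i := z])) holomorphic_on S" using w by (intro Suc.prems) auto
    then show "(\<lambda>z. f (w # ws[i := z])) holomorphic_on S" by simp
  qed
  have "iter_oint (replicate (Suc k) C) (\<lambda>ws. f ws * (\<Prod>i<Suc k. reduced_product q U (ws ! i))) =
     oint C (\<lambda>w. reduced_product q U w * iter_oint (replicate k C) (\<lambda>ws. f (w # ws) * (\<Prod>i<k. reduced_product q U (ws ! i))))"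
    by (simp add: prod.lessThan_Suc_shift iter_oint_mult_left[symmetric] mult_ac del: prod.lessThan_Suc)
  also have "\<dots> = oint C (\<lambda>w. H w / (\<Prod>b\<in>U. 1 - b * w))"
  proof -
    have "contour_integral g (\<lambda>w. reduced_product q U w * iter_oint (replicate k C) (\<lambda>ws. f (w # ws) * (\<Prod>i<k. reduced_product q U (ws ! i)))) =
      contour_integral g (\<lambda>w. H w / (\<Prod>b\<in>U. 1 - b * w))" if g: "g \<in> C" for g
    proof (rule contour_integral_cong[OF refl])
      fix w assume "w \<in> path_image g"
      then have "w \<in> S" using C(2)[OF g] path_image_subset_region by blast
      then show "reduced_product q U w * iter_oint (replicate k C) (\<lambda>ws. f (w # ws) * (\<Prod>i<k. reduced_product q U (ws ! i))) =
         H w / (\<Prod>b\<in>U. 1 - b * w)"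
        unfolding inner[OF \<open>w \<in> S\<close>] unfolding H_def reduced_product_def B by simp
    qed
    then show ?thesis by (simp add: oint_def)
  qed
  also have "\<dots> = (\<Sum>b\<in>U. - H (inverse b) / (b * (\<Prod>c\<in>U - {b}. 1 - c * inverse b)))"
    by (rule oint_simple_poles[OF C S hH U(1,2) enc])
  also have "\<dots> = (\<Sum>b\<in>U. pole_weight q U b * (\<Sum>us\<in>?L. (\<Prod>u\<leftarrow>us. pole_weight q U u) * f (inverse b # map inverse us)))"
  proof (rule sum.cong[OF refl])
    fix b assume b: "b \<in> U"
    have "(\<Prod>c\<in>(*) q ` U - U. 1 - c * inverse b) / (\<Prod>c\<in>U - {b}. 1 - c * inverse b) = (1 - q) * (\<Prod>w\<in>U - {b}. cross q b w)"
      using reduced_product_residue[OF U(1,2) q, of b] b unfolding B by simp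
    then have pw: "pole_weight q U b = - ((\<Prod>c\<in>(*) q ` U - U. 1 - c * inverse b) / (\<Prod>c\<in>U - {b}. 1 - c * inverse b) / b)"
      unfolding pole_weight_def by simp
    show "- H (inverse b) / (b * (\<Prod>c\<in>U - {b}. 1 - c * inverse b)) =
      pole_weight q U b * (\<Sum>us\<in>?L. (\<Prod>u\<leftarrow>us. pole_weight q U u) * f (inverse b # map inverse us))"
      unfolding H_def pw by simp
  qed
  also have "\<dots> = (\<Sum>(us, b)\<in>?L \<times> U. (\<Prod>u\<leftarrow>b # us. pole_weight q U u) * f (map inverse (b # us)))"
    by (subst sum.cartesian_product[symmetric], subst sum.swap) (simp add: sum_distrib_left mult_ac)
  also have "\<dots> = (\<Sum>us | set us \<subseteq> U \<and> length us = Suc k. (\<Prod>u\<leftarrow>us. pole_weight q U u) * f (map inverse us))"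
    unfolding lists_length_Suc_eq by (subst sum.reindex) (auto simp: inj_on_def case_prod_unfold)
  finally show ?case .
qed

lemma sum_distinct_lists:
  fixes g :: "'a set \<Rightarrow> complex"
  assumes U: "finite U"
  shows "(\<Sum>us | set us \<subseteq> U \<and> length us = k \<and> distinct us. g (set us)) = fact k * (\<Sum>K | K \<subseteq> U \<and> card K = k. g K)"
proof -
  let ?L = "{us. set us \<subseteq> U \<and> length us = k \<and> distinct us}" and ?T = "{K. K \<subseteq> U \<and> card K = k}"
  have fin: "finite ?L" by (rule finite_subset[OF _ finite_lists_length_eq[OF U, of k]]) auto
  have "(\<Sum>us\<in>?L. g (set us)) = (\<Sum>K\<in>?T. \<Sum>us | us \<in> ?L \<and> set us = K. g (set us))"
    by (rule sum.group[symmetric]) (use fin U in \<open>auto simp: distinct_card\<close>)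
  also have "\<dots> = (\<Sum>K\<in>?T. fact k * g K)"
  proof (rule sum.cong[OF refl])
    fix K assume K: "K \<in> ?T"
    then have fK: "finite K" using U finite_subset by auto
    have "{us. us \<in> ?L \<and> set us = K} = {us. length us = k \<and> distinct us \<and> set us \<subseteq> K}"
    proof (intro equalityI subsetI)
      fix us assume us: "us \<in> {us. length us = k \<and> distinct us \<and> set us \<subseteq> K}"
      then have "set us = K" using card_subset_eq[OF fK, of "set us"] K by (simp add: distinct_card)
      then show "us \<in> {us. us \<in> ?L \<and> set us = K}" using us K by auto
    qed (use K in auto)
    then have "card {us. us \<in> ?L \<and> set us = K} = fact k"
      using card_lists_distinct_length_eq[OF fK, of k] K by (simp add: fact_prod)
    then have "(\<Sum>us | us \<in> ?L \<and> set us = K. g K) = fact k * g K" by simp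
    then show "(\<Sum>us | us \<in> ?L \<and> set us = K. g (set us)) = fact k * g K" by (simp cong: conj_cong)
  qed
  finally show ?thesis by (simp add: sum_distrib_left)
qed

definition symmetric_integrand :: "real \<Rightarrow> real \<Rightarrow> nat list \<Rightarrow> complex list \<Rightarrow> complex" where
  "symmetric_integrand q s \<theta> w =
     (\<Prod>\<alpha><length \<theta>. \<Prod>\<beta>\<in>{..<length \<theta>} - {\<alpha>}. (w ! \<alpha> - w ! \<beta>) / (w ! \<alpha> - q * w ! \<beta>)) *
     (F_fun q s \<theta> (map inverse w) / (\<Prod>i<length \<theta>. w ! i))"

lemma symmetrized_moment_formula_eq:
  "symmetrized_moment_formula q s \<theta> Cs \<phi> =
     ((- 1) ^ length \<theta> * q ^ (length \<theta> * (length \<theta> + 1) div 2) / ((1 - q) ^ length \<theta> * fact (length \<theta>))) * ((- of_real s) ^ sum_list \<theta> * c_factor q s \<theta>) *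
     iter_oint Cs (\<lambda>w. symmetric_integrand q s \<theta> w * (\<Prod>i<length \<theta>. \<phi> (w ! i)))"
  unfolding symmetrized_moment_formula_def symmetric_integrand_def Let_def mult.assoc[of _ "(- of_real s) ^ _ * _"] iter_oint_mult_left[symmetric]
  by (simp add: mult_ac)

lemma multi_hol_symmetric_integrand:
  assumes V: "\<And>i. i < length \<theta> \<Longrightarrow> V (Suc i) = S"
    and S: "0 \<notin> S" "complex_of_real s \<notin> S" "\<And>w v. w \<in> S \<Longrightarrow> v \<in> S \<Longrightarrow> w \<noteq> of_real q * v"
  shows "multi_hol V (\<lambda>x. symmetric_integrand q s \<theta> (map x [1..<Suc (length \<theta>)]))"
proof -
  let ?k = "length \<theta>"
  have nth: "map x [1..<Suc ?k] ! i = x (Suc i)" if "i < ?k" for i and x :: "nat \<Rightarrow> complex"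
    using that by (simp del: upt_Suc)
  have nth': "map inverse (map x [1..<Suc ?k]) ! i = inverse (x (Suc i))" if "i < ?k" for i and x :: "nat \<Rightarrow> complex"
    using that by (simp del: upt_Suc)
  have inS: "x (Suc i) \<in> S" if "\<forall>j. x j \<in> V j" "i < ?k" for x i
    using that V by metis
  have W: "multi_hol V (\<lambda>x. vertex_weight q s (inverse (x (Suc i))) a b c d)" if i: "i < ?k" for i a b c d
  proof -
    obtain A B where AB: "\<And>u. vertex_weight q s u a b c d = (A + B * u) / (1 - of_real s * u)"
      using vertex_weight_affine[of q s a b c d] by blast
    have "multi_hol V (\<lambda>x. (A + B * (1 / x (Suc i))) / (1 - of_real s * (1 / x (Suc i))))"
    proof (intro multi_hol_divide multi_hol_add multi_hol_diff multi_hol_mult multi_hol_const multi_hol_coord)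
      fix x assume x: "\<forall>j. x j \<in> V j"
      have 1: "x (Suc i) \<noteq> 0" "x (Suc i) \<noteq> of_real s" using inS[OF x i] S by auto
      then show "x (Suc i) \<noteq> 0" "x (Suc i) \<noteq> 0" by auto
      show "1 - of_real s * (1 / x (Suc i)) \<noteq> 0" using 1 by (simp add: field_simps)
    qed
    then show ?thesis unfolding AB by (simp add: inverse_eq_divide)
  qed
  have F: "F_fun q s \<theta> (map inverse (map x [1..<Suc ?k])) = (\<Sum>(v, h)\<in>arrow_configs \<theta>. \<Prod>y\<in>{1..length \<theta>}. \<Prod>z\<le>hd \<theta>.
        vertex_weight q s (inverse (x (Suc (y - 1)))) (v z (y - 1)) (h z y) (v z y) (h (z + 1) y))" for x :: "nat \<Rightarrow> complex"
    unfolding F_fun_def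
    unfolding case_prod_unfold by (intro sum.cong prod.cong refl) (subst nth', auto)
  have "multi_hol V (\<lambda>x. (\<Prod>\<alpha><?k. \<Prod>\<beta>\<in>{..<?k} - {\<alpha>}. (x (Suc \<alpha>) - x (Suc \<beta>)) / (x (Suc \<alpha>) - q * x (Suc \<beta>))) *
     ((\<Sum>(v, h)\<in>arrow_configs \<theta>. \<Prod>y\<in>{1..length \<theta>}. \<Prod>z\<le>hd \<theta>.
        vertex_weight q s (inverse (x (Suc (y - 1)))) (v z (y - 1)) (h z y) (v z y) (h (z + 1) y)) / (\<Prod>i<?k. x (Suc i))))"
    unfolding case_prod_unfold
  proof (intro multi_hol_mult multi_hol_prod multi_hol_sum multi_hol_divide multi_hol_diff multi_hol_coord multi_hol_const W, goal_cases)
    case (1 \<alpha> \<beta> x)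
    then show ?case using S(3) inS[of x \<alpha>] inS[of x \<beta>] by auto
  next
    case (2 p y z)
    then show ?case by auto
  next
    case (3 x)
    have "x (Suc i) \<noteq> 0" if "i < ?k" for i using S(1) inS[OF 3 that] by metis
    then show ?case by simp
  qed
  moreover have "symmetric_integrand q s \<theta> (map x [1..<Suc ?k]) = (\<Prod>\<alpha><?k. \<Prod>\<beta>\<in>{..<?k} - {\<alpha>}. (x (Suc \<alpha>) - x (Suc \<beta>)) / (x (Suc \<alpha>) - q * x (Suc \<beta>))) *
     ((\<Sum>(v, h)\<in>arrow_configs \<theta>. \<Prod>y\<in>{1..length \<theta>}. \<Prod>z\<le>hd \<theta>.
        vertex_weight q s (inverse (x (Suc (y - 1)))) (v z (y - 1)) (h z y) (v z y) (h (z + 1) y)) / (\<Prod>i<?k. x (Suc i)))" for x :: "nat \<Rightarrow> complex"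
    unfolding symmetric_integrand_def F
    by (intro arg_cong2[of _ _ _ _ "(*)"] arg_cong2[of _ _ _ _ "(/)"] prod.cong refl) (auto simp: nth[unfolded One_nat_def] simp del: upt_Suc)
  ultimately show ?thesis by (simp only:)
qed

lemma symmetric_integrand_separately_holomorphic:
  assumes S: "0 \<notin> S" "complex_of_real s \<notin> S" "\<And>w v. w \<in> S \<Longrightarrow> v \<in> S \<Longrightarrow> w \<noteq> of_real q * v"
    and ws: "length ws = length \<theta>" "set ws \<subseteq> S" "i < length \<theta>"
  shows "(\<lambda>z. symmetric_integrand q s \<theta> (ws[i := z])) holomorphic_on S"
proof -
  define V where "V = (\<lambda>j. if 1 \<le> j \<and> j \<le> length \<theta> then S else UNIV)"
  define x where "x = (\<lambda>j. if 1 \<le> j \<and> j \<le> length \<theta> then ws ! (j - 1) else 0)"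
  have "multi_hol V (\<lambda>x. symmetric_integrand q s \<theta> (map x [1..<Suc (length \<theta>)]))"
    by (rule multi_hol_symmetric_integrand[OF _ S]) (auto simp: V_def)
  moreover have "\<forall>j. x j \<in> V j" using ws by (auto simp: x_def V_def subset_iff)
  ultimately have "(\<lambda>z. symmetric_integrand q s \<theta> (map (x(Suc i := z)) [1..<Suc (length \<theta>)])) holomorphic_on V (Suc i)"
    unfolding multi_hol_def by blast
  moreover have "map (x(Suc i := z)) [1..<Suc (length \<theta>)] = ws[i := z]" for z
    by (rule nth_equalityI) (use ws in \<open>auto simp: x_def nth_list_update simp del: upt_Suc\<close>)
  moreover have "V (Suc i) = S" using ws by (simp add: V_def)
  ultimately show ?thesis by simp
qed

text \<open>
  At \<open>1 / u\<close> for \<open>u\<close> in a set \<open>K\<close> of \<open>k\<close> distinct parameters, the product over \<open>\<alpha> \<noteq> \<beta>\<close> cancels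
  exactly the cross factors within \<open>K\<close> that the residues contain. The cross factors between
  \<open>K\<close> and \<open>U - K\<close> remain, and the partition function at the points of \<open>K\<close> is a Bethe sum.
\<close>
lemma symmetric_integrand_at_poles:
  assumes q: "0 < q" "q < 1" and us: "generic s us" "set us \<subseteq> U" and \<theta>: "\<theta> \<in> signatures (length us)"
    and U: "finite U" "U \<inter> (*) (complex_of_real q) ` U = {}"
  shows "(\<Prod>u\<leftarrow>us. pole_weight (of_real q) U u) * symmetric_integrand q s \<theta> (map inverse us) =
    (- (1 - of_real q)) ^ length us * (xprod (of_real q) (set us) (U - set us) * bethe (of_real q) (of_real s) \<theta> (set us))"
proof -
  let ?q = "complex_of_real q" and ?k = "length us" and ?K = "set us"
  have lt: "length \<theta> = ?k" using \<theta> by (simp add: signatures_def)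
  have dist: "distinct us" and nz: "0 \<notin> ?K" using us(1) by (auto simp: generic_def)
  have crn: "cross ?q v w \<noteq> 0" if "v \<in> ?K" "w \<in> ?K - {v}" for v w
    using that us(2) U(2) by (auto simp: cross_def disjoint_iff)
  have kr: "(inverse u - inverse v) / (inverse u - ?q * inverse v) = inverse (cross ?q v u)"
    if "u \<in> ?K" "v \<in> ?K" "u \<noteq> v" for u v
  proof -
    have "u \<noteq> 0" "v \<noteq> 0" using nz that by auto
    moreover then have "inverse u - inverse v = (v - u) / (u * v)" "inverse u - ?q * inverse v = (v - ?q * u) / (u * v)"
      by (simp_all add: field_simps)
    ultimately show ?thesis by (simp add: cross_def)
  qed
  have bij: "bij_betw ((!) us) {..<?k} ?K" using dist by (rule bij_betw_nth) auto
  have img: "(!) us ` {..<?k} = ?K" using bij by (simp add: bij_betw_def)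
  define X where "X = (\<Prod>u\<in>?K. \<Prod>v\<in>?K - {u}. cross ?q u v)"
  have "(\<Prod>\<alpha><?k. \<Prod>\<beta>\<in>{..<?k} - {\<alpha>}. (map inverse us ! \<alpha> - map inverse us ! \<beta>) / (map inverse us ! \<alpha> - ?q * map inverse us ! \<beta>)) =
    (\<Prod>\<alpha><?k. \<Prod>v\<in>?K - {us ! \<alpha>}. inverse (cross ?q v (us ! \<alpha>)))"
  proof (rule prod.cong[OF refl])
    fix \<alpha> assume a: "\<alpha> \<in> {..<?k}"
    have "bij_betw ((!) us) ({..<?k} - {\<alpha>}) (?K - {us ! \<alpha>})"
      using bij_betw_DiffI[OF bij bij_betw_singletonI[OF refl, of "(!) us" \<alpha>]] a by auto
    then have "(\<Prod>\<beta>\<in>{..<?k} - {\<alpha>}. inverse (cross ?q (us ! \<beta>) (us ! \<alpha>))) = (\<Prod>v\<in>?K - {us ! \<alpha>}. inverse (cross ?q v (us ! \<alpha>)))"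
      by (rule prod.reindex_bij_betw)
    moreover have "(map inverse us ! \<alpha> - map inverse us ! \<beta>) / (map inverse us ! \<alpha> - ?q * map inverse us ! \<beta>) = inverse (cross ?q (us ! \<beta>) (us ! \<alpha>))"
      if "\<beta> \<in> {..<?k} - {\<alpha>}" for \<beta>
      using that a dist kr[of "us ! \<alpha>" "us ! \<beta>"] by (simp add: nth_eq_iff_index_eq)
    ultimately show "(\<Prod>\<beta>\<in>{..<?k} - {\<alpha>}. (map inverse us ! \<alpha> - map inverse us ! \<beta>) / (map inverse us ! \<alpha> - ?q * map inverse us ! \<beta>)) =
      (\<Prod>v\<in>?K - {us ! \<alpha>}. inverse (cross ?q v (us ! \<alpha>)))" by simp
  qed
  also have "\<dots> = (\<Prod>u\<in>?K. \<Prod>v\<in>?K - {u}. inverse (cross ?q v u))"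
    by (rule prod.reindex_bij_betw[OF bij])
  also have "\<dots> = (\<Prod>v\<in>?K. \<Prod>u\<in>?K - {v}. inverse (cross ?q v u))"
  proof -
    have 1: "?K - {u} = {v \<in> ?K. u \<noteq> v}" "?K - {u} = {v \<in> ?K. v \<noteq> u}" for u by auto
    show ?thesis
      by (subst 1(1), subst prod.swap_restrict[OF finite_set finite_set]) (simp only: 1(2))
  qed
  also have "\<dots> = inverse X" unfolding X_def by (simp add: prod_inversef[symmetric] o_def)
  finally have A: "(\<Prod>\<alpha><?k. \<Prod>\<beta>\<in>{..<?k} - {\<alpha>}. (map inverse us ! \<alpha> - map inverse us ! \<beta>) / (map inverse us ! \<alpha> - ?q * map inverse us ! \<beta>)) = inverse X" .
  have pl: "(\<Prod>u\<leftarrow>us. h u) = (\<Prod>u\<in>?K. h u)" for h :: "complex \<Rightarrow> complex"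
    by (rule prod.distinct_set_conv_list[OF dist, symmetric])
  have P: "(\<Prod>i<?k. map inverse us ! i) = inverse (\<Prod>u\<in>?K. u)"
  proof -
    have "(\<Prod>i<?k. map inverse us ! i) = (\<Prod>i<?k. inverse (us ! i))" by simp
    also have "\<dots> = (\<Prod>u\<in>?K. inverse u)" by (rule prod.reindex_bij_betw[OF bij])
    finally show ?thesis by (simp add: prod_inversef[symmetric] o_def)
  qed
  have W: "(\<Prod>u\<leftarrow>us. pole_weight ?q U u) = (- (1 - ?q)) ^ ?k / (\<Prod>u\<in>?K. u) * (X * xprod ?q ?K (U - ?K))"
  proof -
    have "pole_weight ?q U u = - (1 - ?q) / u * ((\<Prod>v\<in>?K - {u}. cross ?q u v) * (\<Prod>v\<in>U - ?K. cross ?q u v))" if u: "u \<in> ?K" for u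
    proof -
      have "U - {u} = (?K - {u}) \<union> (U - ?K)" using u us(2) by auto
      then have "(\<Prod>v\<in>U - {u}. cross ?q u v) = (\<Prod>v\<in>?K - {u}. cross ?q u v) * (\<Prod>v\<in>U - ?K. cross ?q u v)"
        using U(1) by (metis (no_types, lifting) Diff_disjoint Diff_iff disjoint_iff finite_Diff finite_set prod.union_disjoint)
      then show ?thesis by (simp add: pole_weight_def divide_inverse algebra_simps)
    qed
    then have "(\<Prod>u\<in>?K. pole_weight ?q U u) = (\<Prod>u\<in>?K. - (1 - ?q) / u * ((\<Prod>v\<in>?K - {u}. cross ?q u v) * (\<Prod>v\<in>U - ?K. cross ?q u v)))"
      by (intro prod.cong) auto
    also have "\<dots> = (- (1 - ?q)) ^ ?k / (\<Prod>u\<in>?K. u) * (X * xprod ?q ?K (U - ?K))"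
      using distinct_card[OF dist] by (simp only: prod.distrib prod_dividef prod_constant X_def xprod_def)
    finally show ?thesis unfolding pl .
  qed
  have mi: "map inverse (map inverse us) = us" by (simp add: o_def)
  have "X \<noteq> 0" unfolding X_def using crn by auto
  moreover have "(\<Prod>u\<in>?K. u) \<noteq> 0" using nz by simp
  ultimately show ?thesis
    unfolding symmetric_integrand_def lt A P W mi F_fun_eq_bethe[OF q us(1) \<theta>] by (simp add: field_simps)
qed

text \<open>
  The terms depend on a list of poles only through the underlying set \<open>K\<close>, which explains the
  factor \<open>k!\<close>. The sum over \<open>K\<close> is the right-hand side of \<open>bethe_append\<close> with an empty second
  list.
\<close>
theorem symmetric_integral_eq_bethe:
  assumes q: "0 < q" "q < 1" and g: "generic s vs" and \<theta>: "\<theta> \<in> signatures k"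
    and C: "finite C" "\<And>g. g \<in> C \<Longrightarrow> positive_contour g \<and> closed_region g \<subseteq> S" and So: "open S"
    and S: "0 \<notin> S" "complex_of_real s \<notin> S" "\<And>w v. w \<in> S \<Longrightarrow> v \<in> S \<Longrightarrow> w \<noteq> of_real q * v"
    and U: "set vs \<inter> (*) (complex_of_real q) ` set vs = {}"
    and enc: "\<And>b. b \<in> set vs \<Longrightarrow> \<exists>g\<in>C. inverse b \<in> inside (path_image g) \<and> (\<forall>h\<in>C - {g}. inverse b \<notin> closed_region h)"
  shows "iter_oint (replicate k C) (\<lambda>w. symmetric_integrand q s \<theta> w * (\<Prod>i<k. reduced_product (of_real q) (set vs) (w ! i))) =
    (- (1 - of_real q)) ^ k * fact k * bethe (of_real q) (of_real s) \<theta> (set vs)"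
proof -
  let ?q = "complex_of_real q" and ?U = "set vs"
  have lt: "length \<theta> = k" using \<theta> by (simp add: signatures_def)
  have "iter_oint (replicate k C) (\<lambda>w. symmetric_integrand q s \<theta> w * (\<Prod>i<k. reduced_product ?q ?U (w ! i))) =
    (\<Sum>us | set us \<subseteq> ?U \<and> length us = k. (\<Prod>u\<leftarrow>us. pole_weight ?q ?U u) * symmetric_integrand q s \<theta> (map inverse us))"
    by (rule iter_oint_residues[OF C So _ _ U _ _ enc])
      (use q g lt symmetric_integrand_separately_holomorphic[OF S] in \<open>auto simp: generic_def\<close>)
  also have "\<dots> = (\<Sum>us | set us \<subseteq> ?U \<and> length us = k \<and> distinct us. (\<Prod>u\<leftarrow>us. pole_weight ?q ?U u) * symmetric_integrand q s \<theta> (map inverse us))"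
  proof (rule sum.mono_neutral_right)
    show "\<forall>us\<in>{us. set us \<subseteq> ?U \<and> length us = k} - {us. set us \<subseteq> ?U \<and> length us = k \<and> distinct us}.
       (\<Prod>u\<leftarrow>us. pole_weight ?q ?U u) * symmetric_integrand q s \<theta> (map inverse us) = 0"
    proof
      fix us assume us: "us \<in> {us. set us \<subseteq> ?U \<and> length us = k} - {us. set us \<subseteq> ?U \<and> length us = k \<and> distinct us}"
      \<comment> \<open>If two entries agree, the integrand has a vanishing factor.\<close>
      then obtain i j where ij: "i < k" "j < k" "i \<noteq> j" "us ! i = us ! j" by (auto simp: distinct_conv_nth)
      have "(\<Prod>\<alpha><k. \<Prod>\<beta>\<in>{..<k} - {\<alpha>}. (map inverse us ! \<alpha> - map inverse us ! \<beta>) / (map inverse us ! \<alpha> - ?q * map inverse us ! \<beta>)) = 0"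
      proof (rule prod_zero[OF finite_lessThan], rule bexI[of _ i], rule prod_zero, simp, rule bexI[of _ j])
        show "(map inverse us ! i - map inverse us ! j) / (map inverse us ! i - ?q * map inverse us ! j) = 0"
          using ij us by simp
      qed (use ij in auto)
      then show "(\<Prod>u\<leftarrow>us. pole_weight ?q ?U u) * symmetric_integrand q s \<theta> (map inverse us) = 0"
        by (simp add: symmetric_integrand_def lt)
    qed
  qed (auto simp: finite_lists_length_eq)
  also have "\<dots> = (\<Sum>us | set us \<subseteq> ?U \<and> length us = k \<and> distinct us.
      (- (1 - ?q)) ^ k * (xprod ?q (set us) (?U - set us) * bethe ?q (of_real s) \<theta> (set us)))"
  proof (rule sum.cong[OF refl])
    fix us assume "us \<in> {us. set us \<subseteq> ?U \<and> length us = k \<and> distinct us}"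
    then have us: "set us \<subseteq> ?U" "length us = k" "generic s us" using g by (auto simp: generic_def)
    then show "(\<Prod>u\<leftarrow>us. pole_weight ?q ?U u) * symmetric_integrand q s \<theta> (map inverse us) =
      (- (1 - ?q)) ^ k * (xprod ?q (set us) (?U - set us) * bethe ?q (of_real s) \<theta> (set us))"
      using symmetric_integrand_at_poles[OF q us(3,1) _ _ U] \<theta> by simp
  qed
  also have "\<dots> = fact k * (\<Sum>K | K \<subseteq> ?U \<and> card K = k. (- (1 - ?q)) ^ k * (xprod ?q K (?U - K) * bethe ?q (of_real s) \<theta> K))"
    by (rule sum_distinct_lists) simp
  also have "(\<Sum>K | K \<subseteq> ?U \<and> card K = k. (- (1 - ?q)) ^ k * (xprod ?q K (?U - K) * bethe ?q (of_real s) \<theta> K)) =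
    (- (1 - ?q)) ^ k * bethe ?q (of_real s) \<theta> ?U"
    using bethe_append[of ?U ?q "of_real s" \<theta> "[]"] lt by (simp add: sum_distrib_left)
  finally show ?thesis by (simp only: mult_ac)
qed

lemma symmetric_integral_tendsto:
  fixes q s :: real and \<theta> :: "nat list"
  assumes A: "compact A" "0 \<notin> A" "complex_of_real s \<notin> A" "\<And>w v. w \<in> A \<Longrightarrow> v \<in> A \<Longrightarrow> w \<noteq> of_real q * v" and q: "cmod (complex_of_real q) < 1"
    and C: "\<And>g. g \<in> C \<Longrightarrow> valid_path g \<and> pathfinish g = pathstart g \<and> path_image g \<subseteq> A"
    and b: "\<And>i w. i < m \<Longrightarrow> w \<in> A \<Longrightarrow> 1 - b i * w \<noteq> 0"
  defines "k \<equiv> length \<theta>"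
  shows "((\<lambda>t. iter_oint (replicate k C) (\<lambda>w. symmetric_integrand q s \<theta> w *
       (\<Prod>i<k. fraction_product m (\<lambda>i. b i + t * b' i) (\<lambda>i. c i + t * c' i) (w ! i)))) \<longlongrightarrow>
     iter_oint (replicate k C) (\<lambda>w. symmetric_integrand q s \<theta> w * (\<Prod>i<k. fraction_product m b c (w ! i)))) (at 0)"
proof -
  have ev: "\<forall>\<^sub>F \<epsilon> in at_right 0. ((\<forall>i\<in>{..<m}. \<forall>t\<in>thicken \<epsilon> {0}. \<forall>w\<in>thicken \<epsilon> A. 1 - (b i + t * b' i) * w \<noteq> 0) \<and>
     0 \<notin> thicken \<epsilon> A \<and> of_real s \<notin> thicken \<epsilon> A \<and> (\<forall>w\<in>thicken \<epsilon> A. \<forall>v\<in>thicken \<epsilon> A. w \<noteq> of_real q * v)) \<and> \<epsilon> > 0"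
    by (intro eventually_conj eventually_ball_finite ballI eventually_thicken_nonzero eventually_thicken_avoid
        eventually_thicken_separated eventually_at_right_less) (use A q b in auto)
  obtain \<epsilon> :: real where e: "\<epsilon> > 0" "\<forall>i\<in>{..<m}. \<forall>t\<in>thicken \<epsilon> {0}. \<forall>w\<in>thicken \<epsilon> A. 1 - (b i + t * b' i) * w \<noteq> 0"
    "0 \<notin> thicken \<epsilon> A" "of_real s \<notin> thicken \<epsilon> A" "\<forall>w\<in>thicken \<epsilon> A. \<forall>v\<in>thicken \<epsilon> A. w \<noteq> of_real q * v"
    using eventually_happens'[OF _ ev] by auto
  define T where "T = thicken \<epsilon> {0 :: complex}"
  define S where "S = thicken \<epsilon> A"
  define Us where "Us = replicate k S"
  define V where "V = (\<lambda>j. if j = 0 then T else if j \<le> length Us then Us ! (j - 1) else UNIV)"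
  have lU: "length Us = k" by (simp add: Us_def)
  have VS: "V (Suc i) = S" if "i < k" for i using that by (simp add: V_def Us_def)
  have nth: "map x [1..<Suc k] ! i = x (Suc i)" if "i < k" for i and x :: "nat \<Rightarrow> complex"
    using that by (simp del: upt_Suc)
  define F where "F = (\<lambda>t. iter_oint (replicate k C) (\<lambda>w. symmetric_integrand q s \<theta> w *
       (\<Prod>i<k. fraction_product m (\<lambda>i. b i + t * b' i) (\<lambda>i. c i + t * c' i) (w ! i))))"
  have "F holomorphic_on T"
    unfolding F_def
  proof (rule holomorphic_iter_oint)
    have "multi_hol V (\<lambda>x. symmetric_integrand q s \<theta> (map x [1..<Suc k]) *
      (\<Prod>i<k. \<Prod>l<m. (1 - (c l + x 0 * c' l) * x (Suc i)) / (1 - (b l + x 0 * b' l) * x (Suc i))))"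
    proof (intro multi_hol_mult multi_hol_divide multi_hol_prod multi_hol_diff multi_hol_add multi_hol_coord multi_hol_const)
      show "multi_hol V (\<lambda>x. symmetric_integrand q s \<theta> (map x [1..<Suc k]))"
        unfolding k_def by (rule multi_hol_symmetric_integrand[where S = S]) (use VS e in \<open>auto simp: k_def S_def\<close>)
      fix i l x assume i: "i \<in> {..<k}" and l: "l \<in> {..<m}" and x: "\<forall>j. x j \<in> V j"
      have "x 0 \<in> T" using x[THEN spec, of 0] by (simp add: V_def)
      moreover have "x (Suc i) \<in> S" using x[THEN spec, of "Suc i"] VS i by simp
      ultimately show "1 - (b l + x 0 * b' l) * x (Suc i) \<noteq> 0" using e(2) l by (auto simp: T_def S_def)
    qed
    moreover have "symmetric_integrand q s \<theta> (map x [1..<Suc k]) *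
      (\<Prod>i<k. \<Prod>l<m. (1 - (c l + x 0 * c' l) * x (Suc i)) / (1 - (b l + x 0 * b' l) * x (Suc i))) =
      symmetric_integrand q s \<theta> (map x [1..<Suc (length Us)]) *
       (\<Prod>i<k. fraction_product m (\<lambda>i. b i + x 0 * b' i) (\<lambda>i. c i + x 0 * c' i) (map x [1..<Suc (length Us)] ! i))" for x
      unfolding lU by (intro arg_cong2[of _ _ _ _ "(*)"] prod.cong refl) (subst nth, auto simp: fraction_product_def)
    ultimately show "multi_hol (\<lambda>j. if j = 0 then T else if j \<le> length Us then Us ! (j - 1) else UNIV)
       (\<lambda>x. symmetric_integrand q s \<theta> (map x [1..<Suc (length Us)]) *
       (\<Prod>i<k. fraction_product m (\<lambda>i. b i + x 0 * b' i) (\<lambda>i. c i + x 0 * c' i) (map x [1..<Suc (length Us)] ! i)))"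
      by (simp only: V_def)
    show "open T" by (simp add: T_def)
    show "length Us = length (replicate k C)" by (simp add: lU)
    show "open (Us ! i)" if "i < length Us" for i using that by (simp add: Us_def S_def)
    show "valid_path g \<and> pathfinish g = pathstart g \<and> path_image g \<subseteq> Us ! i" if i: "i < length (replicate k C)" and g: "g \<in> replicate k C ! i" for i g
      using C[of g] g i subset_thicken[OF e(1), of A] by (auto simp: Us_def S_def)
  qed
  moreover have "0 \<in> T" using subset_thicken[OF e(1), of "{0}"] by (auto simp: T_def)
  moreover have "open T" by (simp add: T_def)
  ultimately have "isCont F 0"
    using holomorphic_on_imp_continuous_on continuous_on_eq_continuous_at by blast
  then have "(F \<longlongrightarrow> F 0) (at 0)" by (simp add: isCont_def)
  then show ?thesis by (simp add: F_def)
qed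

text \<open>
  For small \<open>t\<close> the moved parameters still have no two with quotient \<open>q\<close>, and their inverses
  stay in the discs. The points of a slightly larger neighbourhood of the discs still avoid
  \<open>0\<close> and \<open>s\<close>, and none of them is \<open>q\<close> times another, so the symmetric integrand is
  holomorphic there.
\<close>
lemma symmetrized_expectation_circles:
  fixes us :: "real list"
  assumes q: "0 < q" "q < 1" and s: "-1 < s" "s < 0" and \<theta>: "\<theta> \<in> signatures k" "k \<le> length us"
    and u: "\<forall>u\<in>set us. u > 0" "\<forall>u\<in>set us. \<forall>u'\<in>set us. u \<noteq> q * u'"
    and r: "small_radii q s ((\<lambda>u. inverse (complex_of_real u)) ` set us) r"
  defines "us' \<equiv> map complex_of_real us"
  shows "has_expectation q s us' (\<lambda>\<nu>. complex_of_real (Q_obs q (map (\<lambda>t. t + 1) \<theta>) \<nu>))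
    (symmetrized_moment_formula q s \<theta> (replicate k (circles (inverse ` set us') r)) (u_product q us'))"
proof -
  let ?q = "complex_of_real q" and ?s = "complex_of_real s" and ?n = "length us"
  define P where "P = inverse ` set us'"
  define C where "C = circles P r"
  have lt: "length \<theta> = k" using \<theta> by (simp add: signatures_def)
  have P: "P = (\<lambda>u. inverse (complex_of_real u)) ` set us" by (simp add: P_def us'_def image_image)
  have r': "small_radii q s P r" using r unfolding P .
  have fP: "finite P" by (simp add: P_def)
  have rpos: "r a > 0" "?s \<notin> cball a (r a)" if "a \<in> P" for a using r' that by (auto simp: small_radii_def)
  define A where "A = (\<Union>a\<in>P. cball a (r a))"
  have cA: "compact A" unfolding A_def using fP by (intro compact_UN) auto
  have Aq: "w \<noteq> ?q * v" if wv: "w \<in> A" "v \<in> A" for w v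
  proof -
    obtain a b where "a \<in> P" "b \<in> P" "w \<in> cball a (r a)" "v \<in> cball b (r b)" using wv by (auto simp: A_def)
    then show ?thesis by (intro small_radii_disjoint[OF r' q(1)]) auto
  qed
  have A0: "0 \<notin> A" using Aq[of 0 0] by auto
  have As: "?s \<notin> A" using rpos(2) by (auto simp: A_def)
  have fC: "finite C" using fP by (simp add: C_def circles_def)
  have C: "positive_contour g" "closed_region g \<subseteq> A" if g: "g \<in> C" for g
  proof -
    obtain a where a: "a \<in> P" "g = circlepath a (r a)" using g by (auto simp: C_def circles_def)
    then show "positive_contour g" "closed_region g \<subseteq> A"
      using closed_region_circlepath[OF rpos(1)[OF a(1)], of a] by (auto simp: A_def)
  qed
  define ds where "ds = map (\<lambda>i. of_nat (Suc i) :: complex) [0..<?n]"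
  have len: "length us' = length ds" by (simp add: ds_def us'_def)
  have lus: "length us' = ?n" by (simp add: us'_def)
  have dn: "ds ! i = of_nat (Suc i)" if "i < ?n" for i using that by (simp add: ds_def)
  have upos: "1 - ?s * v \<noteq> 0 \<and> cmod (zfac ?s v) < 1" if v: "v \<in> set us'" for v
  proof -
    obtain x where "x \<in> set us" "v = of_real x" using v by (auto simp: us'_def)
    then show ?thesis using positive_parameter[OF s, of x] u(1) by blast
  qed
  have gen: "\<forall>\<^sub>F t in at 0. generic s (moved us' ds t)"
    by (rule eventually_generic[OF len]) (use upos len lus dn in \<open>auto simp del: of_nat_Suc\<close>)
  have mem: "v \<in> set (moved us' ds t) \<longleftrightarrow> (\<exists>i<?n. v = us' ! i + t * ds ! i)" for v t
    using len lus by (metis in_set_conv_nth length_moved moved_nth)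
  have unz: "us' ! i \<noteq> 0" if "i < ?n" for i using that u(1) nth_mem[of i us] by (fastforce simp: us'_def)
  have evE: "\<forall>\<^sub>F t in at 0. \<forall>i\<in>{..<?n}. inverse (us' ! i + t * ds ! i) \<in> ball (inverse (us' ! i)) (r (inverse (us' ! i)))"
  proof (intro eventually_ball_finite ballI finite_lessThan)
    fix i assume i: "i \<in> {..<?n}"
    have lim: "((\<lambda>t. inverse (us' ! i + t * ds ! i)) \<longlongrightarrow> inverse (us' ! i)) (at 0)"
      using unz i by (auto intro!: tendsto_eq_intros)
    have "inverse (us' ! i) \<in> P" using i lus by (auto simp: P_def)
    then show "\<forall>\<^sub>F t in at 0. inverse (us' ! i + t * ds ! i) \<in> ball (inverse (us' ! i)) (r (inverse (us' ! i)))"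
      by (intro topological_tendstoD[OF lim]) (use rpos in auto)
  qed
  have evq: "\<forall>\<^sub>F t in at 0. \<forall>i\<in>{..<?n}. \<forall>j\<in>{..<?n}. (us' ! i - ?q * us' ! j) + t * (ds ! i - ?q * ds ! j) \<noteq> 0"
  proof (intro eventually_ball_finite ballI finite_lessThan eventually_affine_nonzero disjI1)
    fix i j assume ij: "i \<in> {..<?n}" "j \<in> {..<?n}"
    then have "us ! i \<noteq> q * us ! j" using u(2) by simp
    then have "complex_of_real (us ! i) \<noteq> complex_of_real (q * us ! j)" by (simp only: of_real_eq_iff not_False_eq_True)
    then show "us' ! i - ?q * us' ! j \<noteq> 0" using ij by (simp add: us'_def)
  qed
  have off: "1 - v * w \<noteq> 0" if v: "inverse v \<in> ball a (r a)" "a \<in> P" and w: "w \<in> contour_support C" for v w a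
  proof
    assume "1 - v * w = 0"
    then have w': "w = inverse v" by (metis eq_iff_diff_eq_0 inverse_unique)
    obtain b where bP: "b \<in> P" and "w \<in> path_image (circlepath b (r b))"
      using w unfolding contour_support_def C_def circles_def by blast
    then have b: "b \<in> P" "w \<in> sphere b (r b)" using rpos(1)[OF bP] by auto
    have "w \<in> cball a (r a)" "w \<in> cball b (r b)" using v(1) b(2) unfolding w' by simp_all
    moreover have "a \<noteq> b \<longrightarrow> cball a (r a) \<inter> cball b (r b) = {}" using r' v(2) bP by (simp add: small_radii_def)
    ultimately have "a = b" by blast
    then show False using v(1) b w' by simp
  qed
  define \<phi> where "\<phi> = (\<lambda>t. fraction_product ?n (\<lambda>i. us' ! i + t * ds ! i) (\<lambda>i. ?q * us' ! i + t * (?q * ds ! i)))"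
  define I where "I = (\<lambda>\<psi>. iter_oint (replicate k C) (\<lambda>w. symmetric_integrand q s \<theta> w * (\<Prod>i<k. \<psi> (w ! i))))"
  have up: "u_product q us' = fraction_product ?n (\<lambda>i. us' ! i) (\<lambda>i. ?q * us' ! i)"
    using lus by (auto simp: fun_eq_iff u_product_def fraction_product_def prod.list_conv_set_nth atLeast0LessThan)
  have inP: "inverse (us' ! i) \<in> P" if "i < ?n" for i using that lus by (auto simp: P_def)
  have sub: "contour_support C \<subseteq> A" using C(2) path_image_subset_region by (fastforce simp: contour_support_def)
  have "((\<lambda>t. I (\<phi> t)) \<longlongrightarrow> I (u_product q us')) (at 0)"
    unfolding I_def \<phi>_def up lt[symmetric]
  proof (rule symmetric_integral_tendsto)
    show "compact (contour_support C)" unfolding contour_support_def using fC positive_contourD(3)[OF C(1)] by (intro compact_UN) auto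
    show "0 \<notin> contour_support C" "?s \<notin> contour_support C" using A0 As sub by auto
    show "w \<noteq> ?q * v" if "w \<in> contour_support C" "v \<in> contour_support C" for w v using that sub Aq by blast
    show "valid_path g \<and> pathfinish g = pathstart g \<and> path_image g \<subseteq> contour_support C" if "g \<in> C" for g
      using positive_contourD[OF C(1)[OF that]] that by (auto simp: contour_support_def)
    show "1 - us' ! i * w \<noteq> 0" if "i < ?n" "w \<in> contour_support C" for i w
      by (rule off[OF _ inP[OF that(1)] that(2)]) (use rpos(1)[OF inP[OF that(1)]] in simp)
  qed (use q in simp)
  define L where "L = ((- 1) ^ k * q ^ (k * (k + 1) div 2) / ((1 - q) ^ k * fact k)) * ((- ?s) ^ sum_list \<theta> * c_factor q s \<theta>) * I (u_product q us')"
  have lim: "((\<lambda>t. ((- 1) ^ k * q ^ (k * (k + 1) div 2) / ((1 - q) ^ k * fact k)) * ((- ?s) ^ sum_list \<theta> * c_factor q s \<theta>) * I (\<phi> t)) \<longlongrightarrow> L) (at 0)"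
    unfolding L_def by (intro tendsto_mult tendsto_const) fact
  obtain \<epsilon> where e: "\<epsilon> > 0" "0 \<notin> thicken \<epsilon> A" "?s \<notin> thicken \<epsilon> A" "\<forall>w\<in>thicken \<epsilon> A. \<forall>v\<in>thicken \<epsilon> A. w \<noteq> ?q * v"
  proof -
    have "\<forall>\<^sub>F \<epsilon> in at_right 0. (0 \<notin> thicken \<epsilon> A \<and> ?s \<notin> thicken \<epsilon> A \<and> (\<forall>w\<in>thicken \<epsilon> A. \<forall>v\<in>thicken \<epsilon> A. w \<noteq> ?q * v)) \<and> \<epsilon> > 0"
      by (intro eventually_conj eventually_thicken_avoid eventually_thicken_separated eventually_at_right_less) (use cA A0 As Aq q in auto)
    from eventually_happens'[OF _ this] show thesis using that by auto
  qed
  have "\<forall>\<^sub>F t in at 0. ((- 1) ^ k * q ^ (k * (k + 1) div 2) / ((1 - q) ^ k * fact k)) * ((- ?s) ^ sum_list \<theta> * c_factor q s \<theta>) * I (\<phi> t) =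
     q ^ (k * (k + 1) div 2) * c_factor q s \<theta> * bethe_s ?q ?s \<theta> (set (moved us' ds t))"
    using gen evE evq
  proof eventually_elim
    case (elim t)
    let ?U = "set (moved us' ds t)"
    have "I (\<phi> t) = I (reduced_product ?q ?U)"
      unfolding I_def
    proof (rule iter_oint_cong, rule arg_cong[of _ _ "(*) _"], rule prod.cong[OF refl])
      fix ws :: "complex list" and i
      assume ws: "\<And>i. i < length (replicate k C) \<Longrightarrow> ws ! i \<in> (\<Union>g\<in>replicate k C ! i. path_image g)" and i: "i \<in> {..<k}"
      let ?w = "ws ! i"
      have w: "?w \<in> contour_support C" using ws[of i] i by (simp add: contour_support_def)
      have dist: "distinct (moved us' ds t)" using elim by (simp add: generic_def)
      have "\<phi> t ?w = (\<Prod>i<?n. (1 - ?q * moved us' ds t ! i * ?w) / (1 - moved us' ds t ! i * ?w))"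
        unfolding fraction_product_def \<phi>_def using len lus by (intro prod.cong refl) (simp add: moved_nth algebra_simps)
      also have "\<dots> = (\<Prod>u\<in>?U. (1 - ?q * u * ?w) / (1 - u * ?w))"
        using dist len lus by (intro prod.reindex_bij_betw bij_betw_nth) auto
      also have "\<dots> = reduced_product ?q ?U ?w"
      proof (rule reduced_product_eq)
        show "\<forall>u\<in>?U. 1 - u * ?w \<noteq> 0"
        proof
          fix u assume "u \<in> ?U"
          then obtain l where l: "l < ?n" "u = us' ! l + t * ds ! l" using mem by auto
          show "1 - u * ?w \<noteq> 0" by (rule off[OF _ inP[OF l(1)] w]) (use elim(2) l in blast)
        qed
      qed (use q in auto)
      finally show "\<phi> t ?w = reduced_product ?q ?U ?w" .
    qed
    also have "\<dots> = (- (1 - ?q)) ^ k * fact k * bethe ?q ?s \<theta> ?U"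
      unfolding I_def
    proof (rule symmetric_integral_eq_bethe[OF q elim(1) \<theta>(1) fC, where S = "thicken \<epsilon> A"])
      show "positive_contour g \<and> closed_region g \<subseteq> thicken \<epsilon> A" if "g \<in> C" for g
        using C[OF that] subset_thicken[OF e(1), of A] by auto
      show "?U \<inter> (*) ?q ` ?U = {}" using elim(3) mem by (force simp: disjoint_iff algebra_simps)
      fix b assume "b \<in> ?U"
      then obtain i where i: "i < ?n" "b = us' ! i + t * ds ! i" using mem by auto
      let ?a = "inverse (us' ! i)"
      have ba: "inverse b \<in> ball ?a (r ?a)" using elim(2) i by blast
      show "\<exists>g\<in>C. inverse b \<in> inside (path_image g) \<and> (\<forall>h\<in>C - {g}. inverse b \<notin> closed_region h)"
      proof (intro bexI conjI ballI)
        show "circlepath ?a (r ?a) \<in> C" using inP[OF i(1)] by (simp add: C_def circles_def)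
        show "inverse b \<in> inside (path_image (circlepath ?a (r ?a)))"
          using closed_region_circlepath(1)[OF rpos(1)[OF inP[OF i(1)]], of ?a] ba by simp
        fix h assume "h \<in> C - {circlepath ?a (r ?a)}"
        then obtain a' where a': "a' \<in> P" "h = circlepath a' (r a')" "a' \<noteq> ?a" by (auto simp: C_def circles_def)
        have "cball ?a (r ?a) \<inter> cball a' (r a') = {}" using r' inP[OF i(1)] a' by (simp add: small_radii_def)
        moreover have "inverse b \<in> cball ?a (r ?a)" using ba by simp
        ultimately show "inverse b \<notin> closed_region h"
          using closed_region_circlepath(2)[OF rpos(1)[OF a'(1)], of a'] a' by blast
      qed
    qed (use e in auto)
    finally have I: "I (\<phi> t) = (- (1 - ?q)) ^ k * fact k * bethe ?q ?s \<theta> ?U" .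
    have q1: "(1 - ?q) ^ k \<noteq> 0" using q by simp
    have "(- (1 - ?q)) ^ k = (- 1) ^ k * (1 - ?q) ^ k" by (rule power_minus)
    moreover have "(- 1) ^ k * ((- 1) ^ k * x) = x" for x :: complex by (simp add: power_mult_distrib[symmetric] mult.assoc[symmetric])
    ultimately show ?case unfolding I bethe_s_def using q1 q by (simp add: field_simps)
  qed
  then have L: "((\<lambda>t. q ^ (k * (k + 1) div 2) * c_factor q s \<theta> * bethe_s ?q ?s \<theta> (set (moved us' ds t))) \<longlongrightarrow> L) (at 0)"
    by (rule Lim_transform_eventually[OF lim])
  have "has_expectation q s us' (\<lambda>\<nu>. complex_of_real (Q_obs q (map (\<lambda>t. t + 1) \<theta>) \<nu>)) L"
    by (rule expectation_limit[OF q s(1) _ len upos gen \<theta>(1) _ L]) (use s \<theta> lus in auto)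
  then show ?thesis unfolding symmetrized_moment_formula_eq lt L_def I_def C_def P_def by simp
qed

section \<open>The moment formulas\<close>

theorem theorem8p12:
  fixes q s :: real and n k :: nat and \<theta> :: "nat list"
  assumes "0 < q" and "q < 1" and "-1 < s" and "s < 0" and "k \<le> n"
    and "\<theta> \<in> signatures k"
  shows
    "(\<forall>(us :: complex list) \<gamma>.
       length us = n \<and>
       (\<forall>u\<in>set us. 1 - s * u \<noteq> 0 \<and> cmod (s * ((u - s) / (1 - s * u))) < 1) \<and>
       length \<gamma> = k \<and> nested_contours q s {inverse (complex_of_real s)} \<gamma> \<and>
       (\<forall>g\<in>set \<gamma>. \<forall>u\<in>set us. u \<noteq> 0 \<and> inverse u \<in> inside (path_image g))
       \<longrightarrow>
       has_expectation q s us (\<lambda>\<nu>. complex_of_real (Q_obs q (map (\<lambda>t. t + 1) \<theta>) \<nu>))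
         (moment_formula q s \<theta> (map (\<lambda>g. {g}) \<gamma>) (u_product q us))) \<and>
    (\<forall>(us :: real list) r.
       length us = n \<and>
       (\<forall>u\<in>set us. u > 0) \<and> (\<forall>u\<in>set us. \<forall>u'\<in>set us. u \<noteq> q * u') \<and>
       small_radii q s ((\<lambda>u. inverse (complex_of_real u)) ` set us) r
       \<longrightarrow>
       (let us' = map complex_of_real us;
            Cs = replicate k (circles (inverse ` set us') r) in
        has_expectation q s us' (\<lambda>\<nu>. complex_of_real (Q_obs q (map (\<lambda>t. t + 1) \<theta>) \<nu>))
          (moment_formula q s \<theta> Cs (u_product q us')) \<and>
        has_expectation q s us' (\<lambda>\<nu>. complex_of_real (Q_obs q (map (\<lambda>t. t + 1) \<theta>) \<nu>))
          (symmetrized_moment_formula q s \<theta> Cs (u_product q us')))) \<and>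
    (\<forall>J n' (vs :: real list) \<gamma>.
       1 \<le> J \<and> n = J * n' \<and> length vs = n' \<and>
       (\<forall>u\<in>set vs. u > 0) \<and> (\<forall>u\<in>set vs. \<forall>u'\<in>set vs. q * u < u') \<and>
       length \<gamma> = k \<and>
       nested_contours q s ((\<lambda>u. inverse (complex_of_real u)) ` set vs) \<gamma>
       \<longrightarrow>
       (let us' = concat (map (\<lambda>u. map (\<lambda>i. complex_of_real (q ^ i * u)) [0..<J]) vs);
            \<phi> = (\<lambda>w. \<Prod>u\<leftarrow>vs. (1 - q ^ J * u * w) / (1 - u * w)) in
        has_expectation q s us' (\<lambda>\<nu>. complex_of_real (Q_obs q (map (\<lambda>t. t + 1) \<theta>) \<nu>))
          (moment_formula q s \<theta> (map (\<lambda>g. {g}) \<gamma>) (u_product q us')) \<and>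
        (\<forall>w. (\<forall>u\<in>set us'. 1 - u * w \<noteq> 0) \<longrightarrow> u_product q us' w = \<phi> w) \<and>
        has_expectation q s us' (\<lambda>\<nu>. complex_of_real (Q_obs q (map (\<lambda>t. t + 1) \<theta>) \<nu>))
          (moment_formula q s \<theta> (map (\<lambda>g. {g}) \<gamma>) \<phi>)))"
proof (intro conjI allI impI)
  note q = assms(1,2) and s = assms(3,4) and \<theta> = assms(6,5)
  fix us :: "complex list" and \<gamma>
  assume a: "length us = n \<and>
       (\<forall>u\<in>set us. 1 - s * u \<noteq> 0 \<and> cmod (s * ((u - s) / (1 - s * u))) < 1) \<and>
       length \<gamma> = k \<and> nested_contours q s {inverse (complex_of_real s)} \<gamma> \<and>
       (\<forall>g\<in>set \<gamma>. \<forall>u\<in>set us. u \<noteq> 0 \<and> inverse u \<in> inside (path_image g))"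
  show "has_expectation q s us (\<lambda>\<nu>. complex_of_real (Q_obs q (map (\<lambda>t. t + 1) \<theta>) \<nu>))
         (moment_formula q s \<theta> (map (\<lambda>g. {g}) \<gamma>) (u_product q us))"
    by (rule moment_expectation_nested[OF q s(1) _ \<theta>(1)]) (use a s \<theta> in auto)
next
  note q = assms(1,2) and s = assms(3,4) and \<theta> = assms(6,5)
  fix us :: "real list" and r
  assume a: "length us = n \<and>
       (\<forall>u\<in>set us. u > 0) \<and> (\<forall>u\<in>set us. \<forall>u'\<in>set us. u \<noteq> q * u') \<and>
       small_radii q s ((\<lambda>u. inverse (complex_of_real u)) ` set us) r"
  show "let us' = map complex_of_real us;
            Cs = replicate k (circles (inverse ` set us') r) in
        has_expectation q s us' (\<lambda>\<nu>. complex_of_real (Q_obs q (map (\<lambda>t. t + 1) \<theta>) \<nu>))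
          (moment_formula q s \<theta> Cs (u_product q us')) \<and>
        has_expectation q s us' (\<lambda>\<nu>. complex_of_real (Q_obs q (map (\<lambda>t. t + 1) \<theta>) \<nu>))
          (symmetrized_moment_formula q s \<theta> Cs (u_product q us'))"
    unfolding Let_def
  proof
    have "k \<le> length us" using a \<theta> by simp
    note th = \<theta>(1) this
    show "has_expectation q s (map complex_of_real us) (\<lambda>\<nu>. complex_of_real (Q_obs q (map (\<lambda>t. t + 1) \<theta>) \<nu>))
          (moment_formula q s \<theta> (replicate k (circles (inverse ` set (map complex_of_real us)) r)) (u_product q (map complex_of_real us)))"
      by (rule moment_expectation_circles[OF q s th]) (use a in blast)+
    show "has_expectation q s (map complex_of_real us) (\<lambda>\<nu>. complex_of_real (Q_obs q (map (\<lambda>t. t + 1) \<theta>) \<nu>))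
          (symmetrized_moment_formula q s \<theta> (replicate k (circles (inverse ` set (map complex_of_real us)) r)) (u_product q (map complex_of_real us)))"
      by (rule symmetrized_expectation_circles[OF q s th]) (use a in blast)+
  qed
next
  note q = assms(1,2) and s = assms(3,4) and \<theta> = assms(6,5)
  fix J n' :: nat and vs :: "real list" and \<gamma>
  assume a: "1 \<le> J \<and> n = J * n' \<and> length vs = n' \<and>
       (\<forall>u\<in>set vs. u > 0) \<and> (\<forall>u\<in>set vs. \<forall>u'\<in>set vs. q * u < u') \<and>
       length \<gamma> = k \<and>
       nested_contours q s ((\<lambda>u. inverse (complex_of_real u)) ` set vs) \<gamma>"
  define us' where "us' = concat (map (\<lambda>u. map (\<lambda>i. complex_of_real (q ^ i * u)) [0..<J]) vs)"
  define \<phi> where "\<phi> = (\<lambda>w :: complex. \<Prod>u\<leftarrow>vs. (1 - q ^ J * u * w) / (1 - u * w))"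
  have J: "1 \<le> J" and th: "\<theta> \<in> signatures k" "k \<le> J * length vs" and l\<gamma>: "length \<gamma> = k" using a \<theta> by auto
  have main: "has_expectation q s us' (\<lambda>\<nu>. complex_of_real (Q_obs q (map (\<lambda>t. t + 1) \<theta>) \<nu>))
          (moment_formula q s \<theta> (map (\<lambda>g. {g}) \<gamma>) \<phi>)"
    unfolding us'_def \<phi>_def by (rule moment_expectation_strings[OF q s th J _ _ l\<gamma>]) (use a in blast)+
  have prod_eq: "u_product q us' w = \<phi> w" if "\<forall>u\<in>set us'. 1 - u * w \<noteq> 0" for w
    unfolding us'_def \<phi>_def by (rule u_product_strings[OF J]) (use that in \<open>simp only: us'_def\<close>)
  \<comment> \<open>For \<open>i > 0\<close> the points \<open>1 / (q\<^sup>i u)\<close> may lie on the contours.\<close>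
  have "moment_formula q s \<theta> (map (\<lambda>g. {g}) \<gamma>) (u_product q us') = moment_formula q s \<theta> (map (\<lambda>g. {g}) \<gamma>) \<phi>"
  proof (rule moment_formula_spike)
    show "\<forall>g\<in>set \<gamma>. positive_contour g" using a by (simp add: nested_contours_def)
    show "finite (inverse ` set us')" by simp
    show "length \<gamma> = length \<theta>" using l\<gamma> th by (simp add: signatures_def)
    fix w assume w: "w \<notin> inverse ` set us'"
    show "u_product q us' w = \<phi> w"
    proof (rule prod_eq, rule ballI)
      fix u assume "u \<in> set us'"
      then have "w \<noteq> inverse u" using w by blast
      then show "1 - u * w \<noteq> 0" by (metis eq_iff_diff_eq_0 inverse_unique)
    qed
  qed
  then have "has_expectation q s us' (\<lambda>\<nu>. complex_of_real (Q_obs q (map (\<lambda>t. t + 1) \<theta>) \<nu>))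
          (moment_formula q s \<theta> (map (\<lambda>g. {g}) \<gamma>) (u_product q us'))" using main by simp
  then show "let us' = concat (map (\<lambda>u. map (\<lambda>i. complex_of_real (q ^ i * u)) [0..<J]) vs);
            \<phi> = (\<lambda>w. \<Prod>u\<leftarrow>vs. (1 - q ^ J * u * w) / (1 - u * w)) in
        has_expectation q s us' (\<lambda>\<nu>. complex_of_real (Q_obs q (map (\<lambda>t. t + 1) \<theta>) \<nu>))
          (moment_formula q s \<theta> (map (\<lambda>g. {g}) \<gamma>) (u_product q us')) \<and>
        (\<forall>w. (\<forall>u\<in>set us'. 1 - u * w \<noteq> 0) \<longrightarrow> u_product q us' w = \<phi> w) \<and>
        has_expectation q s us' (\<lambda>\<nu>. complex_of_real (Q_obs q (map (\<lambda>t. t + 1) \<theta>) \<nu>))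
          (moment_formula q s \<theta> (map (\<lambda>g. {g}) \<gamma>) \<phi>)"
    unfolding Let_def us'_def[symmetric] \<phi>_def[symmetric] using main prod_eq by blast
qed

end
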